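(* Let $N$ be a positive integer, $0=Q_0<Q_1<\cdots<Q_{N-1}<Q_N=\infty$, and $K_1,\ldots,K_N\ge0$ with $K_n\ne K_{n+1}$ for $n=1,\ldots,N-1$, and let the setup cost be the step function $$K(\xi)=\sum_{n=1}^N K_n 1_{(Q_{n-1},Q_n)}(\xi)+\sum_{n=1}^{N-1}(K_n\wedge K_{n+1})1_{\{Q_n\}}(\xi),\qquad \xi\ge0.$$ Let $h:\mathbb{R}\to\mathbb{R}$ be convex with $h(0)=0$, continuously differentiable on $\mathbb{R}\setminus\{0\}$, with $h'(z)>0$ for $z>0$ and $h'(z)<0$ for $z<0$, and polynomially bounded, i.e. there exist a positive integer $a$ and $b_0,b_1>0$ with $h(z)\le b_0+b_1|z|^a$ for all $z$. Let $\nu^\star=\inf\{\operatorname{AC}(x,Y):x\in\mathbb{R},\,Y\in\mathcal{U}\}$. (a) If $K_1=0$, the base stock policy $U(z^\star,z^\star)$ is an optimal ordering policy that minimizes the long-run average cost, i.e. $\nu^\star=\gamma(z^\star,z^\star)=k\mu+h(z^\star)$. (b) If $K_1>0$, then with $(s^\star,S^\star)$ uniquely determined by the selection procedure given in the context, $U(s^\star,S^\star)$ is an optimal ordering policy that minimizes the long-run average cost, i.e. $\nu^\star=\gamma(s^\star,S^\star)$.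
   Context: Model. Fix $\mu>0$, $\sigma>0$, $k\ge 0$, $\lambda=2\mu/\sigma^2$. Let $B$ be a standard Brownian motion on a filtered probability space $(\Omega,\mathcal{F},\mathbb{F},\mathbb{P})$ (an $\mathbb{F}$-Brownian motion), and $X(t)=x-\mu t+\sigma B(t)$, $x\in\mathbb{R}$ the initial level. An admissible policy is an $\mathbb{F}$-adapted process $Y=\{Y(t):t\ge0\}$ whose sample paths are all nondecreasing, nonnegative, right-continuous on $[0,\infty)$ with left limits on $(0,\infty)$; $\mathcal{U}$ is the set of these. Conventions: $Y(0-)=0$, $Z(0-)=x$, $\Delta Y(t)=Y(t)-Y(t-)$. $Z=X+Y$ is the inventory process and $Y^c(t)=Y(t)-\sum_{0\le u\le t}\Delta Y(u)$. Put $\ell=\liminf_{\xi\downarrow0}K(\xi)/\xi\in[0,\infty]$, with $0\cdot\infty=0$, and $$\operatorname{AC}(x,Y)=\limsup_{t\to\infty}\frac1t\,\mathbb{E}_x\Big[\int_0^t h(Z(u))\,du+\sum_{0\le u\le t}K(\Delta Y(u))+kY(t)+\ell Y^c(t)\Big].$$ $(s,S)$ policies. For $s<S$, $U(s,S)$ places an order of size $\xi_j$ at time $\tau_j$, where $\tau_0=0$, $\xi_0=S-x$ if $x\le s$ and $\xi_0=0$ if $x>s$, and for $j\ge1$, $\tau_j=\inf\{t>\tau_{j-1}:Z(t-)\le s\}$, $\xi_j=S-s$. $U(s,s)$ is the base stock policy $Y(t)=\sup_{0\le u\le t}(s-X(u))^+$. A policy $U(s,S)$ is optimal if $\operatorname{AC}(x,U(s,S))=\nu^\star$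 for every $x$. $$\gamma(s,S)=\begin{cases}k\mu+\dfrac{K(S-s)\mu}{S-s}+\dfrac{\lambda}{S-s}\displaystyle\int_s^S\int_0^\infty h(u+y)e^{-\lambda u}\,du\,dy & s<S,\\[2mm](k+\ell)\mu+\lambda\displaystyle\int_0^\infty h(u+s)e^{-\lambda u}\,du&s=S.\end{cases}$$ $g_0(z)=\frac{\lambda}{\mu}\int_0^\infty h(y+z)e^{-\lambda y}\,dy$; $z^\star$ is the unique real solution of $\lambda\int_0^\infty h(u+z^\star)e^{-\lambda u}\,du=h(z^\star)$; it is the unique minimizer of $g_0$. Selection procedure (for $K_1>0$). 1. Let $\Lambda(y)=\int_{-\infty}^\infty 1_{(-\infty,y]}(g_0(u))\,du$. For $n=1,\ldots,N$ let $\hat\nu_n\ge k\mu+h(z^\star)$ be the unique solution of $\int_{h(z^\star)/\mu}^{-k+\hat\nu_n/\mu}\Lambda(u)\,du=K_n$, let $\hat s_n\le z^\star\le\hat S_n$ be the unique solution of $g_0(\hat s_n)=g_0(\hat S_n)=-k+\hat\nu_n/\mu$, and put $\hat\xi_n=\hat S_n-\hat s_n$. 2. Let $\mathcal{N}_<=\{n:\hat\xi_n\le Q_{n-1}\}$, $\mathcal{N}_==\{n:Q_{n-1}<\hat\xi_n<Q_n\}$, $\mathcal{N}_>=\{n:\hat\xi_n\ge Q_n\}$ (indices $n\in\{1,\dots,N\}$). Put $\xi_n^\star=Q_{n-1}$ if $n\in\mathcal{N}_<$, $\xi_n^\star=\hat\xi_n$ if $n\in\mathcal{N}_=$, $\xi_n^\star=Q_n$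 if $n\in\mathcal{N}_>$. Let $\mathcal{N}=\{n\in\{1,\ldots,N\}:K(\xi_n^\star)=K_n\}$. 3. For $n\in\mathcal{N}_=$ put $s_n=\hat s_n$, $S_n=\hat S_n$, $\nu_n=\hat\nu_n$. For $n\in\mathcal{N}\setminus\mathcal{N}_=$ let $(s_n,S_n)$ be the unique solution of $S_n-s_n=\xi_n^\star$, $g_0(s_n)=g_0(S_n)$, and put $\nu_n=k\mu+\frac{K(\xi_n^\star)\mu}{\xi_n^\star}+\frac{\mu}{\xi_n^\star}\int_{s_n}^{S_n}g_0(u)\,du$. 4. Let $n^\star=\min\{n\in\mathcal{N}:\nu_n\le\nu_i\text{ for all }i\in\mathcal{N}\}$ and set $s^\star=s_{n^\star}$, $S^\star=S_{n^\star}$. *)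

theory Defs
  imports "HOL-Probability.Probability"
begin

section \<open>Brownian motion relative to a filtration\<close>

text \<open>
  Time is \<^typ>\<open>real\<close>; only the indices \<open>t \<ge> 0\<close> matter. The library locale
  \<^locale>\<open>filtration\<close> also ranges over negative indices, which is no restriction: a filtration on
  \<open>[0, \<infinity>)\<close> extends by \<open>F t = F 0\<close> for \<open>t < 0\<close>. The usual conditions are not assumed.
\<close>

definition filtered_prob_space :: "'a measure \<Rightarrow> (real \<Rightarrow> 'a measure) \<Rightarrow> bool" where
  "filtered_prob_space M F \<longleftrightarrow>
     prob_space M \<and> filtration (space M) F \<and> (\<forall>t. subalgebra M (F t))"

text \<open>
  All paths are continuous and start at \<open>0\<close>, so that the policies below are defined and adapted
  without completing the filtration.
\<close>

definition brownian_motion ::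
  "'a measure \<Rightarrow> (real \<Rightarrow> 'a measure) \<Rightarrow> (real \<Rightarrow> 'a \<Rightarrow> real) \<Rightarrow> bool" where
  "brownian_motion M F B \<longleftrightarrow>
     (\<forall>\<omega>\<in>space M. B 0 \<omega> = 0 \<and> continuous_on {0..} (\<lambda>t. B t \<omega>)) \<and>
     (\<forall>t\<ge>0. B t \<in> borel_measurable (F t)) \<and>
     (\<forall>s t. 0 \<le> s \<and> s < t \<longrightarrow>
        distributed M lborel (\<lambda>\<omega>. B t \<omega> - B s \<omega>) (normal_density 0 (sqrt (t - s))) \<and>
        prob_space.indep_set M (sets (F s))
          (sets (vimage_algebra (space M) (\<lambda>\<omega>. B t \<omega> - B s \<omega>) borel)))"

section \<open>Policies and long-run average cost\<close>

definition admissible ::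
  "'a measure \<Rightarrow> (real \<Rightarrow> 'a measure) \<Rightarrow> (real \<Rightarrow> 'a \<Rightarrow> real) \<Rightarrow> bool" where
  "admissible M F Y \<longleftrightarrow>
     (\<forall>t\<ge>0. Y t \<in> borel_measurable (F t)) \<and>
     (\<forall>\<omega>\<in>space M.
        mono_on {0..} (\<lambda>t. Y t \<omega>) \<and>
        (\<forall>t\<ge>0. 0 \<le> Y t \<omega>) \<and>
        (\<forall>t\<ge>0. continuous (at_right t) (\<lambda>u. Y u \<omega>)) \<and>
        (\<forall>t>0. \<exists>l. ((\<lambda>u. Y u \<omega>) \<longlongrightarrow> l) (at_left t)))"

definition netput :: "real \<Rightarrow> real \<Rightarrow> (real \<Rightarrow> 'a \<Rightarrow> real) \<Rightarrow> real \<Rightarrow> real \<Rightarrow> 'a \<Rightarrow> real" where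
  "netput \<mu> \<sigma> B x t \<omega> = x - \<mu> * t + \<sigma> * B t \<omega>"

text \<open>Jump at time \<open>t\<close> of a path \<open>y\<close> on \<open>[0, \<infinity>)\<close>, with the convention \<open>y (0-) = 0\<close>.\<close>

definition jump :: "(real \<Rightarrow> real) \<Rightarrow> real \<Rightarrow> real" where
  "jump y t = y t - (if t = 0 then 0 else Lim (at_left t) y)"

definition cont_part :: "(real \<Rightarrow> real) \<Rightarrow> real \<Rightarrow> real" where
  "cont_part y t = y t - (\<Sum>\<^sub>\<infinity>u\<in>{0..t}. jump y u)"

definition ell :: "(real \<Rightarrow> real) \<Rightarrow> ennreal" where
  "ell K = Liminf (at_right 0) (\<lambda>\<xi>. ennreal (K \<xi> / \<xi>))"

text \<open>
  All costs are nonnegative, so they are evaluated in \<^typ>\<open>ennreal\<close>, where \<open>0 * \<infinity> = 0\<close>. The sum of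
  \<open>K\<close> over the jumps in \<open>[0, t]\<close> is an integral over the counting measure, as \<open>K 0 = 0\<close>.
\<close>

definition total_cost ::
  "(real \<Rightarrow> real) \<Rightarrow> (real \<Rightarrow> real) \<Rightarrow> real \<Rightarrow> (real \<Rightarrow> real) \<Rightarrow> (real \<Rightarrow> real) \<Rightarrow> real \<Rightarrow> ennreal" where
  "total_cost h K k z y t =
     (\<integral>\<^sup>+u\<in>{0..t}. ennreal (h (z u)) \<partial>lborel) +
     (\<integral>\<^sup>+u. ennreal (K (jump y u)) \<partial>count_space {0..t}) +
     ennreal (k * y t) + ell K * ennreal (cont_part y t)"

definition AC ::
  "'a measure \<Rightarrow> (real \<Rightarrow> 'a \<Rightarrow> real) \<Rightarrow> real \<Rightarrow> real \<Rightarrow> real \<Rightarrow> (real \<Rightarrow> real) \<Rightarrow> (real \<Rightarrow> real) \<Rightarrow>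
   real \<Rightarrow> (real \<Rightarrow> 'a \<Rightarrow> real) \<Rightarrow> ennreal" where
  "AC M B \<mu> \<sigma> k h K x Y =
     Limsup at_top (\<lambda>t::real.
       (\<integral>\<^sup>+\<omega>. total_cost h K k (\<lambda>u. netput \<mu> \<sigma> B x u \<omega> + Y u \<omega>) (\<lambda>u. Y u \<omega>) t \<partial>M) / ennreal t)"

definition nu_star ::
  "'a measure \<Rightarrow> (real \<Rightarrow> 'a measure) \<Rightarrow> (real \<Rightarrow> 'a \<Rightarrow> real) \<Rightarrow> real \<Rightarrow> real \<Rightarrow> real \<Rightarrow>
   (real \<Rightarrow> real) \<Rightarrow> (real \<Rightarrow> real) \<Rightarrow> ennreal" where
  "nu_star M F B \<mu> \<sigma> k h K = Inf {AC M B \<mu> \<sigma> k h K x Y | x Y. admissible M F Y}"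

section \<open>\<open>(s, S)\<close> and base stock policies\<close>

definition order_size :: "real \<Rightarrow> real \<Rightarrow> real \<Rightarrow> nat \<Rightarrow> real" where
  "order_size x s S j = (if j = 0 then (if x \<le> s then S - x else 0) else S - s)"

text \<open>
  \<open>X\<close> is a sample path of the uncontrolled process started at \<open>x\<close>. Up to and including time
  \<open>\<tau>\<^sub>j\<^sub>+\<^sub>1\<close>, and after \<open>\<tau>\<^sub>j\<close>, the inventory just before \<open>t\<close> is \<open>X t\<close> plus the orders \<open>0, \<dots>, j\<close>,
  because \<open>X\<close> is continuous; see the lemma \<open>order_time_Suc_left_limit\<close>. Order times that do not
  occur are \<open>\<infinity>\<close>.
\<close>

primrec order_time :: "(real \<Rightarrow> real) \<Rightarrow> real \<Rightarrow> real \<Rightarrow> real \<Rightarrow> nat \<Rightarrow> ereal" where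
  "order_time X x s S 0 = 0"
| "order_time X x s S (Suc j) =
     Inf (ereal ` {t. order_time X x s S j < ereal t \<and> X t + (\<Sum>i\<le>j. order_size x s S i) \<le> s})"

definition sS_path :: "(real \<Rightarrow> real) \<Rightarrow> real \<Rightarrow> real \<Rightarrow> real \<Rightarrow> real \<Rightarrow> real" where
  "sS_path X x s S t =
     (if s < S then \<Sum>j | order_time X x s S j \<le> ereal t. order_size x s S j
      else SUP u\<in>{0..t}. max 0 (s - X u))"

definition sS_policy ::
  "(real \<Rightarrow> 'a \<Rightarrow> real) \<Rightarrow> real \<Rightarrow> real \<Rightarrow> real \<Rightarrow> real \<Rightarrow> real \<Rightarrow> real \<Rightarrow> 'a \<Rightarrow> real" where
  "sS_policy B \<mu> \<sigma> s S x t \<omega> = sS_path (\<lambda>u. netput \<mu> \<sigma> B x u \<omega>) x s S t"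

definition sS_optimal ::
  "'a measure \<Rightarrow> (real \<Rightarrow> 'a measure) \<Rightarrow> (real \<Rightarrow> 'a \<Rightarrow> real) \<Rightarrow> real \<Rightarrow> real \<Rightarrow> real \<Rightarrow>
   (real \<Rightarrow> real) \<Rightarrow> (real \<Rightarrow> real) \<Rightarrow> real \<Rightarrow> real \<Rightarrow> bool" where
  "sS_optimal M F B \<mu> \<sigma> k h K s S \<longleftrightarrow>
     (\<forall>x. admissible M F (sS_policy B \<mu> \<sigma> s S x) \<and>
          AC M B \<mu> \<sigma> k h K x (sS_policy B \<mu> \<sigma> s S x) = nu_star M F B \<mu> \<sigma> k h K)"

lemma order_time_le_Suc: "order_time X x s S j \<le> order_time X x s S (Suc j)"
  by (auto intro!: Inf_greatest)

lemma order_time_mono: "i \<le> j \<Longrightarrow> order_time X x s S i \<le> order_time X x s S j"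
  by (rule lift_Suc_mono_le[of "order_time X x s S", OF order_time_le_Suc])

lemma order_time_nonneg: "0 \<le> order_time X x s S j"
  using order_time_mono[of 0 j X x s S] by simp

lemma sS_path_left_limit:
  assumes "s < S" and X: "continuous_on {0..} X"
    and t: "order_time X x s S j < ereal t" "ereal t \<le> order_time X x s S (Suc j)"
  shows "Lim (at_left t) (\<lambda>u. X u + sS_path X x s S u) = X t + (\<Sum>i\<le>j. order_size x s S i)"
proof -
  obtain a where a: "order_time X x s S j = ereal a"
    using order_time_nonneg[of X x s S j] t(1) by (cases "order_time X x s S j") auto
  have at: "a < t" "0 \<le> a" using t(1) a order_time_nonneg[of X x s S j] by auto
  have path: "sS_path X x s S u = (\<Sum>i\<le>j. order_size x s S i)" if u: "a < u" "u < t" for u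
  proof -
    have "order_time X x s S i \<le> ereal u \<longleftrightarrow> i \<le> j" for i
    proof
      assume "i \<le> j"
      then have "order_time X x s S i \<le> ereal a" using order_time_mono a by metis
      also have "\<dots> \<le> ereal u" using u by simp
      finally show "order_time X x s S i \<le> ereal u" .
    next
      assume le: "order_time X x s S i \<le> ereal u"
      show "i \<le> j"
      proof (rule ccontr)
        assume "\<not> i \<le> j"
        then have "order_time X x s S (Suc j) \<le> order_time X x s S i"
          by (intro order_time_mono) simp
        then have "ereal t \<le> ereal u" 
            by (rule order_trans[OF order_trans[OF t(2)] le])
        then show False using u by simp
      qed
    qed
    then have "{i. order_time X x s S i \<le> ereal u} = {..j}" by auto
    then show ?thesis using assms(1) by (simp add: sS_path_def)
  qed
  have "continuous_on {0<..} X" using X by (rule continuous_on_subset) auto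
  then have "isCont X t"
    by (rule continuous_on_interior) (use at in \<open>auto simp: interior_open\<close>)
  then have "(X \<longlongrightarrow> X t) (at_left t)"
    unfolding isCont_def by (rule tendsto_within_subset) simp
  then have "((\<lambda>u. X u + (\<Sum>i\<le>j. order_size x s S i)) \<longlongrightarrow>
               X t + (\<Sum>i\<le>j. order_size x s S i)) (at_left t)"
    by (intro tendsto_intros)
  moreover have "\<forall>\<^sub>F u in at_left t. X u + (\<Sum>i\<le>j. order_size x s S i) = X u + sS_path X x s S u"
    using eventually_at_left_real[OF at(1)] by eventually_elim (simp add: path)
  ultimately have "((\<lambda>u. X u + sS_path X x s S u) \<longlongrightarrow>
               X t + (\<Sum>i\<le>j. order_size x s S i)) (at_left t)"
    by (rule Lim_transform_eventually)
  then show ?thesis by (intro tendsto_Lim) auto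
qed

lemma order_time_Suc_attained:
  assumes X: "continuous_on {0..} X" and a: "order_time X x s S j = ereal a" "0 \<le> a"
    and gt: "s < X a + (\<Sum>i\<le>j. order_size x s S i)"
    and fin: "order_time X x s S (Suc j) \<noteq> \<infinity>"
  obtains b where "order_time X x s S (Suc j) = ereal b" "a < b"
    "X b + (\<Sum>i\<le>j. order_size x s S i) \<le> s"
    "\<And>t. a < t \<Longrightarrow> t < b \<Longrightarrow> s < X t + (\<Sum>i\<le>j. order_size x s S i)"
proof -
  define C where "C = (\<Sum>i\<le>j. order_size x s S i)"
  define A where "A = {t. a < t \<and> X t + C \<le> s}"
  have \<tau>: "order_time X x s S (Suc j) = Inf (ereal ` A)"
    by (simp add: a A_def C_def)
  then have ne: "A \<noteq> {}" using fin by (auto simp: top_ereal_def)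
  have "continuous_on {a..} (\<lambda>t. X t + C)"
    by (intro continuous_intros continuous_on_subset[OF X]) (use a in auto)
  then have "closed ({a..} \<inter> (\<lambda>t. X t + C) -` {..s})"
    by (intro continuous_closed_preimage) auto
  also have "{a..} \<inter> (\<lambda>t. X t + C) -` {..s} = A"
    using gt by (auto simp: A_def C_def less_le)
  finally have cl: "closed A" .
  have bdd: "bdd_below A" by (intro bdd_belowI[of _ a]) (auto simp: A_def)
  define b where "b = Inf A"
  have bA: "b \<in> A" unfolding b_def by (rule closed_contains_Inf[OF ne bdd cl])
  have low: "b \<le> t" if "t \<in> A" for t
    unfolding b_def by (rule cInf_lower[OF that bdd])
  have "Inf (ereal ` A) = ereal b"
    by (intro antisym Inf_lower Inf_greatest) (use bA low in auto)
  then show thesis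
    using bA low \<tau>
    by (intro that[of b])
      (auto simp: A_def C_def not_le[symmetric] simp del: order_time.simps)
qed

lemma order_time_above:
  assumes "s < S" and X: "continuous_on {0..} X" "X 0 = x"
    and "order_time X x s S j = ereal a"
  shows "s < X a + (\<Sum>i\<le>j. order_size x s S i)"
  using assms(4)
proof (induction j arbitrary: a)
  case 0
  then show ?case using assms by (auto simp: order_size_def)
next
  case (Suc j b)
  define C where "C = (\<Sum>i\<le>j. order_size x s S i)"
  have "order_time X x s S j \<le> ereal b"
    using order_time_le_Suc[of X x s S j] Suc.prems by metis
  then obtain a where a: "order_time X x s S j = ereal a"
    using order_time_nonneg[of X x s S j] by (cases "order_time X x s S j") auto
  have a0: "0 \<le> a" using order_time_nonneg[of X x s S j] a by simp
  have fin: "order_time X x s S (Suc j) \<noteq> \<infinity>" using Suc.prems by (simp del: order_time.simps)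
  obtain b' where b': "order_time X x s S (Suc j) = ereal b'" "a < b'"
    "\<And>t. a < t \<Longrightarrow> t < b' \<Longrightarrow> s < X t + C"
    using order_time_Suc_attained[OF X(1) a a0 Suc.IH[OF a] fin] unfolding C_def by metis
  have [simp]: "b' = b" using b'(1) Suc.prems by (simp del: order_time.simps)
  have "continuous_on {0<..} X" using X(1) by (rule continuous_on_subset) auto
  then have "isCont X b"
    by (rule continuous_on_interior) (use b'(2) a0 in \<open>auto simp: interior_open\<close>)
  then have "(X \<longlongrightarrow> X b) (at_left b)"
    unfolding isCont_def by (rule tendsto_within_subset) simp
  then have "((\<lambda>t. X t + C) \<longlongrightarrow> X b + C) (at_left b)"
    by (intro tendsto_intros)
  moreover have "\<forall>\<^sub>F t in at_left b. s \<le> X t + C"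
    using eventually_at_left_real[of a b] b'(2,3)
    by (auto elim!: eventually_mono intro: less_imp_le)
  ultimately have "s \<le> X b + C"
    by (intro tendsto_lowerbound[of "\<lambda>t. X t + C" _ "at_left b"]) auto
  then show ?case using assms(1) by (simp add: order_size_def C_def)
qed

lemma order_time_Suc_left_limit:
  assumes "s < S" and X: "continuous_on {0..} X" "X 0 = x"
  shows "order_time X x s S (Suc j) =
    Inf (ereal ` {t. order_time X x s S j < ereal t \<and>
                     Lim (at_left t) (\<lambda>u. X u + sS_path X x s S u) \<le> s})"
    (is "?\<tau> = Inf (ereal ` ?A)")
proof (cases "order_time X x s S j")
  case (real a)
  have a0: "0 \<le> a" using order_time_nonneg[of X x s S j] real by simp
  note L = sS_path_left_limit[OF assms(1) X(1), of x j]
  show ?thesis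
  proof (cases "?\<tau> = \<infinity>")
    case True
    then have "?A = {t. order_time X x s S j < ereal t \<and>
                        X t + (\<Sum>i\<le>j. order_size x s S i) \<le> s}"
      using True by (intro Collect_cong conj_cong refl) (simp add: L del: order_time.simps)
    then show ?thesis by simp
  next
    case False
    obtain b where b: "?\<tau> = ereal b" "a < b" "X b + (\<Sum>i\<le>j. order_size x s S i) \<le> s"
      "\<And>t. a < t \<Longrightarrow> t < b \<Longrightarrow> s < X t + (\<Sum>i\<le>j. order_size x s S i)"
      using order_time_Suc_attained[OF X(1) real a0 order_time_above[OF assms real] False] by metis
    have bA: "b \<in> ?A" using L[of b] b(1-3) real by (simp del: order_time.simps)
    have low: "b \<le> t" if "t \<in> ?A" for t
    proof (rule ccontr)
      assume "\<not> b \<le> t"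
      then show False
        using L[of t] b(1) b(4)[of t] that real by (simp del: order_time.simps)
    qed
    have "Inf (ereal ` ?A) = ereal b"
      by (intro antisym Inf_lower Inf_greatest imageI bA) (use low in \<open>auto simp del: order_time.simps\<close>)
    then show ?thesis using b(1) by (simp del: order_time.simps)
  qed
qed (use order_time_nonneg[of X x s S j] in auto)

section \<open>The function \<open>\<gamma>\<close> and the selection procedure\<close>

definition lam :: "real \<Rightarrow> real \<Rightarrow> real" where
  "lam \<mu> \<sigma> = 2 * \<mu> / \<sigma>\<^sup>2"

definition gamma_cost ::
  "real \<Rightarrow> real \<Rightarrow> real \<Rightarrow> (real \<Rightarrow> real) \<Rightarrow> (real \<Rightarrow> real) \<Rightarrow> real \<Rightarrow> real \<Rightarrow> ennreal" where
  "gamma_cost \<mu> \<sigma> k h K s S =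
     (if s < S then
        ennreal (k * \<mu> + K (S - s) * \<mu> / (S - s) +
          lam \<mu> \<sigma> / (S - s) *
            (LBINT y:{s..S}. (LBINT u:{0..}. h (u + y) * exp (- lam \<mu> \<sigma> * u))))
      else
        (ennreal k + ell K) * ennreal \<mu> +
        ennreal (lam \<mu> \<sigma> * (LBINT u:{0..}. h (u + s) * exp (- lam \<mu> \<sigma> * u))))"

definition step_cost :: "nat \<Rightarrow> (nat \<Rightarrow> ereal) \<Rightarrow> (nat \<Rightarrow> real) \<Rightarrow> real \<Rightarrow> real" where
  "step_cost N Q c \<xi> =
     (\<Sum>n=1..N. c n * indicator {Q (n - 1)<..<Q n} (ereal \<xi>)) +
     (\<Sum>n=1..N - 1. min (c n) (c (n + 1)) * indicator {Q n} (ereal \<xi>))"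

context
  fixes \<mu> \<sigma> k :: real and h :: "real \<Rightarrow> real"
    and N :: nat and Q :: "nat \<Rightarrow> ereal" and c :: "nat \<Rightarrow> real"
begin

definition g0 :: "real \<Rightarrow> real" where
  "g0 z = lam \<mu> \<sigma> / \<mu> * (LBINT y:{0..}. h (y + z) * exp (- lam \<mu> \<sigma> * y))"

definition is_z_star :: "real \<Rightarrow> bool" where
  "is_z_star z \<longleftrightarrow> lam \<mu> \<sigma> * (LBINT u:{0..}. h (u + z) * exp (- lam \<mu> \<sigma> * u)) = h z"

definition z_star :: real where
  "z_star = (THE z. is_z_star z)"

definition Lam :: "real \<Rightarrow> real" where
  "Lam y = (LBINT u. indicator {..y} (g0 u))"

definition is_nu_hat :: "nat \<Rightarrow> real \<Rightarrow> bool" where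
  "is_nu_hat n \<nu> \<longleftrightarrow>
     k * \<mu> + h z_star \<le> \<nu> \<and> (LBINT u:{h z_star / \<mu>..- k + \<nu> / \<mu>}. Lam u) = c n"

definition nu_hat :: "nat \<Rightarrow> real" where
  "nu_hat n = (THE \<nu>. is_nu_hat n \<nu>)"

definition is_hat_levels :: "nat \<Rightarrow> real \<times> real \<Rightarrow> bool" where
  "is_hat_levels n p \<longleftrightarrow>
     fst p \<le> z_star \<and> z_star \<le> snd p \<and>
     g0 (fst p) = g0 (snd p) \<and> g0 (snd p) = - k + nu_hat n / \<mu>"

definition hat_levels :: "nat \<Rightarrow> real \<times> real" where
  "hat_levels n = (THE p. is_hat_levels n p)"

definition xi_hat :: "nat \<Rightarrow> real" where
  "xi_hat n = snd (hat_levels n) - fst (hat_levels n)"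

definition N_less :: "nat set" where
  "N_less = {n\<in>{1..N}. ereal (xi_hat n) \<le> Q (n - 1)}"

definition N_eq :: "nat set" where
  "N_eq = {n\<in>{1..N}. Q (n - 1) < ereal (xi_hat n) \<and> ereal (xi_hat n) < Q n}"

definition N_greater :: "nat set" where
  "N_greater = {n\<in>{1..N}. Q n \<le> ereal (xi_hat n)}"

text \<open>
  \<open>Q n\<close> is finite whenever \<open>n\<close> belongs to \<^term>\<open>N_greater\<close>, so no infinite value is truncated.
\<close>

definition xi_star :: "nat \<Rightarrow> real" where
  "xi_star n =
     (if n \<in> N_less then real_of_ereal (Q (n - 1))
      else if n \<in> N_greater then real_of_ereal (Q n)
      else xi_hat n)"

definition N_sel :: "nat set" where
  "N_sel = {n\<in>{1..N}. step_cost N Q c (xi_star n) = c n}"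

definition is_constrained_levels :: "nat \<Rightarrow> real \<times> real \<Rightarrow> bool" where
  "is_constrained_levels n p \<longleftrightarrow> snd p - fst p = xi_star n \<and> g0 (fst p) = g0 (snd p)"

definition levels :: "nat \<Rightarrow> real \<times> real" where
  "levels n = (if n \<in> N_eq then hat_levels n else (THE p. is_constrained_levels n p))"

definition nu_sel :: "nat \<Rightarrow> real" where
  "nu_sel n =
     (if n \<in> N_eq then nu_hat n
      else k * \<mu> + step_cost N Q c (xi_star n) * \<mu> / xi_star n +
        \<mu> / xi_star n * (LBINT u:{fst (levels n)..snd (levels n)}. g0 u))"

definition n_star :: nat where
  "n_star = Min {n\<in>N_sel. \<forall>i\<in>N_sel. nu_sel n \<le> nu_sel i}"

definition s_star :: real where
  "s_star = fst (levels n_star)"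

definition S_star :: real where
  "S_star = snd (levels n_star)"

text \<open>Every equation solved in the procedure has a unique solution, and there is a candidate.\<close>

definition selection_well_defined :: bool where
  "selection_well_defined \<longleftrightarrow>
     (\<exists>!z. is_z_star z) \<and>
     (\<forall>n\<in>{1..N}. (\<exists>!\<nu>. is_nu_hat n \<nu>) \<and> (\<exists>!p. is_hat_levels n p)) \<and>
     (\<forall>n\<in>N_sel - N_eq. \<exists>!p. is_constrained_levels n p) \<and>
     N_sel \<noteq> {}"

end

end

theory Submission
  imports Defs
begin

text \<open>
  For \<open>\<nu> = inf \<gamma>(s, S)\<close>, the function \<open>f\<close> with \<open>f' = g\<^sub>0 - \<nu> / \<mu>\<close> satisfies
  \<open>\<sigma>\<^sup>2 / 2 f'' - \<mu> f' = \<nu> - h\<close> and \<open>f (z + \<xi>) - f z + k \<xi> + K \<xi> \<ge> 0\<close>, with equality at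
  \<open>z = s\<^sup>*\<close>, \<open>\<xi> = S\<^sup>* - s\<^sup>*\<close>. Stochastic calculus is avoided: along a time grid,
  \<open>f (Z\<^sub>T) - f (Z\<^sub>0)\<close> is the sum of the increments caused by the Brownian increments, whose
  expectations follow from a Taylor expansion and independence, and of those caused by the control,
  which are bounded path by path by the ordering cost. To have \<open>f\<close> Lipschitz, \<open>h\<close> is replaced by
  \<open>h\<close> frozen outside a compact interval.

  Minimising \<open>\<gamma>(s, S)\<close> over \<open>s\<close> for fixed \<open>\<xi> = S - s\<close> gives the sublevel interval of \<open>g\<^sub>0\<close> of
  length \<open>\<xi>\<close>; its integral is the convex conjugate of \<open>v \<mapsto> \<integral> (v - g\<^sub>0)\<^sup>+ = \<integral>\<^bsup>v\<^esup> \<Lambda>\<close>, which reduces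
  the minimisation over \<open>\<xi>\<close> in one tier of \<open>K\<close> to clamping \<open>\<xi>\<close> to the tier. A candidate at which \<open>K\<close>
  is smaller than \<open>K\<^sub>n\<close> is dominated by the candidate of a neighbouring tier.
\<close>

section \<open>Exponential averages\<close>

text \<open>The inequality \<open>f (z + \<xi>) - f z + k * \<xi> + K \<xi> \<ge> 0\<close> holds at
  every \<open>z\<close>. In the lower bound the orders of a grid cell may therefore be moved behind
  its Brownian increment, which keeps that increment independent of its starting point. Equality is
  available only for the jump from \<open>s\<close> to \<open>S\<close>; in the upper bound the
  moved jump starts off by at most the oscillation of \<open>X\<close> over the cell, so for
  Lipschitz \<open>f\<close> the total error vanishes with the mesh. Truncation enters the two
  bounds differently. In the lower bound it lowers \<open>f'\<close>, and reducing
  \<open>\<nu>\<close> by \<open>\<epsilon>\<close> compensates on a large interval. In the upper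
  bound the fixed policy has an exact rate for each truncated cost, and monotone convergence removes
  the truncation. The boundary term \<open>E f (Z T)\<close> is the other obstacle: an arbitrary
  policy gives no bound on it at a given \<open>T\<close>. A limit superior below
  \<open>\<nu>\<close> need only be refuted at arbitrarily late times, and a finite average holding
  cost supplies such times with bounded mean absolute stock. For the two policies
  \<open>Z \<ge> s\<close> bounds the term from the required side.\<close>

definition expo :: "real \<Rightarrow> real measure" where
  "expo l = density lborel (\<lambda>x. ennreal (exponential_density l x))"

text \<open>For \<open>l = lam \<mu> \<sigma>\<close> and \<open>\<phi> = h\<close> this is
  \<open>\<mu>\<close> times \<open>g0\<close>, read as the mean of \<open>h\<close> at
  \<open>z\<close> plus an exponential variable. As integrals over a probability space, these means
  are easy to compare for \<open>h\<close> and its truncations.\<close>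

definition expmean :: "real \<Rightarrow> (real \<Rightarrow> real) \<Rightarrow> real \<Rightarrow> real" where
  "expmean l \<phi> z = (LINT y|expo l. \<phi> (y + z))"

text \<open>The growth rate \<open>l / 2\<close>, strictly below \<open>l\<close>, makes all shifts
  of \<open>\<phi>\<close> integrable for the exponential law and still admits polynomial
  growth.\<close>

definition tempered :: "real \<Rightarrow> (real \<Rightarrow> real) \<Rightarrow> bool" where
  "tempered l \<phi> \<longleftrightarrow>
     continuous_on UNIV \<phi> \<and> (\<exists>D. \<forall>z. \<bar>\<phi> z\<bar> \<le> D * exp (l / 2 * \<bar>z\<bar>))"

lemma prob_space_expo: "0 < l \<Longrightarrow> prob_space (expo l)"
  unfolding expo_def by (rule prob_space_exponential_density)

lemma sets_expo [simp, measurable_cong]: "sets (expo l) = sets borel"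
  by (simp add: expo_def)

lemma AE_expo_nonneg: "0 < l \<Longrightarrow> AE y in expo l. 0 \<le> y"
  unfolding expo_def
  by (subst AE_density) (auto simp: exponential_density_def split: if_splits)

lemma tempered_measurable: "tempered l \<phi> \<Longrightarrow> \<phi> \<in> borel_measurable borel"
  by (auto simp: tempered_def intro: borel_measurable_continuous_onI)

lemma integrable_exponential_density:
  assumes "0 < l" shows "integrable lborel (exponential_density l)"
proof (rule integrableI_nonneg)
  interpret prob_space "expo l" using assms by (rule prob_space_expo)
  have "(\<integral>\<^sup>+x. ennreal (exponential_density l x) \<partial>lborel) = 1"
    using emeasure_space_1 by (simp add: expo_def emeasure_density)
  then show "(\<integral>\<^sup>+x. ennreal (exponential_density l x) \<partial>lborel) < \<infinity>" by simp
qed (use assms in \<open>auto simp: exponential_density_def\<close>)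

text \<open>Multiplying the density of rate \<open>l\<close> by \<open>exp (l / 2 * y)\<close> gives
  twice the density of rate \<open>l / 2\<close>.\<close>

lemma expo_integrable_exp:
  assumes "0 < l" shows "integrable (expo l) (\<lambda>y. exp (l / 2 * y))"
proof -
  have "integrable lborel (\<lambda>y. 2 * exponential_density (l / 2) y)"
    using integrable_exponential_density[of "l/2"] assms by simp
  also have "(\<lambda>y. 2 * exponential_density (l / 2) y) =
      (\<lambda>y. exponential_density l y *\<^sub>R exp (l / 2 * y))"
    by (auto simp: exponential_density_def exp_add[symmetric] field_simps)
  finally show ?thesis
    unfolding expo_def using assms
    by (subst integrable_density) (auto simp: exponential_density_def)
qed

lemma tempered_shift_bound:
  fixes \<phi> :: "real \<Rightarrow> real"
  assumes "0 < l" "\<forall>z. \<bar>\<phi> z\<bar> \<le> D * exp (l / 2 * \<bar>z\<bar>)" "0 \<le> y"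
  shows "\<bar>\<phi> (y + z)\<bar> \<le> D * exp (l / 2 * \<bar>z\<bar>) * exp (l / 2 * y)"
proof -
  have "0 \<le> D * exp (l / 2 * \<bar>0\<bar>)" 
    using order_trans[OF abs_ge_zero assms(2)[rule_format, of 0]] .
  then have D: "0 \<le> D" by simp
  have "l / 2 * \<bar>y + z\<bar> \<le> l / 2 * \<bar>z\<bar> + l / 2 * y"
    using assms(1,3) by (simp add: distrib_left[symmetric])
  then have "exp (l / 2 * \<bar>y + z\<bar>) \<le> exp (l / 2 * \<bar>z\<bar>) * exp (l / 2 * y)"
    by (simp add: exp_add[symmetric])
  then have "D * exp (l / 2 * \<bar>y + z\<bar>) \<le> D * (exp (l / 2 * \<bar>z\<bar>) * exp (l / 2 * y))"
    using D by (rule mult_left_mono)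
  then show ?thesis using order_trans[OF assms(2)[rule_format]] by (simp add: mult.assoc)
qed

lemma tempered_integrable:
  assumes "0 < l" "tempered l \<phi>"
  shows "integrable (expo l) (\<lambda>y. \<phi> (y + z))"
proof -
  obtain D where D: "\<forall>z. \<bar>\<phi> z\<bar> \<le> D * exp (l / 2 * \<bar>z\<bar>)"
    using assms(2) by (auto simp: tempered_def)
  have [measurable]: "\<phi> \<in> borel_measurable borel" using assms(2) by (rule tempered_measurable)
  show ?thesis
  proof (rule Bochner_Integration.integrable_bound)
    show "integrable (expo l) (\<lambda>y. D * exp (l / 2 * \<bar>z\<bar>) * exp (l / 2 * y))"
      using expo_integrable_exp[OF assms(1)] by simp
    show "AE y in expo l. norm (\<phi> (y + z)) \<le> norm (D * exp (l / 2 * \<bar>z\<bar>) * exp (l / 2 * y))"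
      using AE_expo_nonneg[OF assms(1)]
    proof eventually_elim
      case (elim y)
      show ?case
        using tempered_shift_bound[OF assms(1) D elim, of z] abs_ge_self order_trans
        unfolding real_norm_def by blast
    qed
  qed measurable
qed

lemma expmean_eq_LBINT:
  assumes [measurable]: "\<phi> \<in> borel_measurable borel" and "0 < l"
  shows "l * (LBINT y:{0..}. \<phi> (y + z) * exp (- l * y)) = expmean l \<phi> z"
proof -
  have "expmean l \<phi> z = (LINT y|lborel. exponential_density l y *\<^sub>R \<phi> (y + z))"
    unfolding expmean_def expo_def using assms(2)
    by (subst integral_density) (auto simp: exponential_density_def)
  also have "\<dots> = (LINT y|lborel. l * (indicator {0..} y *\<^sub>R (\<phi> (y + z) * exp (- l * y))))"
    by (intro Bochner_Integration.integral_cong refl)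
       (auto simp: exponential_density_def indicator_def mult_ac)
  finally show ?thesis by (simp add: set_lebesgue_integral_def)
qed

lemma expmean_const: "0 < l \<Longrightarrow> expmean l (\<lambda>_. c) z = c"
  unfolding expmean_def
  using prob_space.prob_space[OF prob_space_expo] by simp

lemma expmean_mono:
  assumes "0 < l" "tempered l \<phi>" "tempered l \<psi>" "\<And>y. 0 \<le> y \<Longrightarrow> \<phi> (y + z) \<le> \<psi> (y + w)"
  shows "expmean l \<phi> z \<le> expmean l \<psi> w"
  unfolding expmean_def
  by (intro integral_mono_AE tempered_integrable assms)
     (use AE_expo_nonneg[OF assms(1)] assms(4) in auto)

text \<open>After the substitution \<open>u = y + z\<close> the mean is
  \<open>l * exp (l * z)\<close> times the integral of \<open>\<phi> u * exp (- l * u)\<close> over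
  \<open>[z, \<infinity>)\<close>, and the product rule applies. For \<open>\<phi> = h\<close> this
  is the source of the second-order equation for \<open>f\<close>.\<close>

lemma expmean_deriv:
  assumes l: "0 < l" and t: "tempered l \<phi>"
  shows "(expmean l \<phi> has_real_derivative l * (expmean l \<phi> z - \<phi> z)) (at z)"
proof -
  have [measurable]: "\<phi> \<in> borel_measurable borel" using t by (rule tempered_measurable)
  have cont: "continuous_on A \<phi>" for A
    using t by (auto simp: tempered_def intro: continuous_on_subset)
  define \<psi> where "\<psi> u = \<phi> u * exp (- l * u)" for u
  have c\<psi>: "continuous_on A \<psi>" for A unfolding \<psi>_def by (intro continuous_intros cont)
  then have [measurable]: "\<psi> \<in> borel_measurable borel" by (rule borel_measurable_continuous_onI)
  \<comment> \<open>Writing \<open>x + 1 * y\<close> makes the terms literal instances of the affine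
    substitution rules; hence \<open>mult_1\<close> is removed from the simplifier below.\<close>
  have aff: "(\<lambda>y. exponential_density l y *\<^sub>R \<phi> (y + x)) =
    (\<lambda>y. l * exp (l * x) * (indicator {x..} (x + 1 * y) *\<^sub>R \<psi> (x + 1 * y)))" for x
    by (auto simp: exponential_density_def indicator_def \<psi>_def exp_add[symmetric] algebra_simps)
  have "integrable lborel (\<lambda>y. exponential_density l y *\<^sub>R \<phi> (y + x))" for x
    using tempered_integrable[OF l t, of x] l unfolding expo_def
    by (subst (asm) integrable_density) (auto simp: exponential_density_def)
  then have "integrable lborel (\<lambda>y. indicator {x..} (x + 1 * y) *\<^sub>R \<psi> (x + 1 * y))" for x
    unfolding aff using l by (simp del: mult_1)
  then have int: "set_integrable lborel {x..} \<psi>" for x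
    using lborel_integrable_real_affine_iff[of 1 "\<lambda>u. indicator {x..} u *\<^sub>R \<psi> u" x]
    unfolding set_integrable_def by simp
  define I where "I x = (LBINT u:{x..}. \<psi> u)" for x
  have em: "expmean l \<phi> x = l * exp (l * x) * I x" for x
  proof -
    have "expmean l \<phi> x = (LINT y|lborel. exponential_density l y *\<^sub>R \<phi> (y + x))"
      unfolding expmean_def expo_def using l
      by (subst integral_density) (auto simp: exponential_density_def)
    also have "\<dots> = l * exp (l * x) * (LINT y|lborel. indicator {x..} (x + 1 * y) *\<^sub>R \<psi> (x + 1 * y))"
      unfolding aff by (simp del: mult_1)
    also have "\<dots> = l * exp (l * x) * I x"
      using lborel_integral_real_affine[of 1 "\<lambda>u. indicator {x..} u *\<^sub>R \<psi> u" x]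
      by (simp add: I_def set_lebesgue_integral_def)
    finally show ?thesis .
  qed
  \<comment> \<open>A base point to the left of \<open>z\<close> turns the tail integral into a
    constant minus an ordinary integral, which is differentiable from both sides at
    \<open>z\<close>.\<close>
  define a where "a = z - 1"
  have split: "I x = I a - integral {a..x} \<psi>" if "a \<le> x" for x
  proof -
    have u: "{a..} = {a..<x} \<union> {x..}" using that by auto
    have i1: "set_integrable lborel {a..<x} \<psi>" and i2: "set_integrable lborel {a..x} \<psi>"
      by (rule set_integrable_subset[OF int[of a]]; auto)+
    have "I a = (LBINT u:{a..<x}. \<psi> u) + I x"
      unfolding I_def u by (rule set_integral_Un) (use i1 int in auto)
    also have "(LBINT u:{a..<x}. \<psi> u) = (LBINT u:{a..x}. \<psi> u)"
      unfolding set_lebesgue_integral_def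
      by (intro integral_cong_AE) (use AE_lborel_singleton[of x] in
        \<open>auto simp: indicator_def less_le\<close>)
    also have "\<dots> = integral {a..x} \<psi>" using set_borel_integral_eq_integral(2)[OF i2] .
    finally show ?thesis by simp
  qed
  have "((\<lambda>x. integral {a..x} \<psi>) has_real_derivative \<psi> z) (at z within {a..z+1})"
    by (rule integral_has_real_derivative) (use c\<psi> in \<open>auto simp: a_def\<close>)
  then have d: "((\<lambda>x. integral {a..x} \<psi>) has_real_derivative \<psi> z) (at z)"
    by (subst (asm) at_within_interior) (auto simp: a_def)
  have e: "((\<lambda>x. l * exp (l * x)) has_real_derivative l * (l * exp (l * z))) (at z)"
    by (auto intro!: derivative_eq_intros)
  have "((\<lambda>x. l * exp (l * x) * (I a - integral {a..x} \<psi>)) has_real_derivative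
       (l * (l * exp (l * z)) * (I a - integral {a..z} \<psi>) - \<psi> z * (l * exp (l * z)))) (at z)"
    using DERIV_mult[OF e DERIV_diff[OF DERIV_const[of "I a"] d]] by simp
  then have "(expmean l \<phi> has_real_derivative
       (l * (l * exp (l * z)) * (I a - integral {a..z} \<psi>) - \<psi> z * (l * exp (l * z)))) (at z)"
  proof (rule has_field_derivative_transform_within_open[where S="{a<..}"])
    fix x assume "x \<in> {a<..}"
    then show "l * exp (l * x) * (I a - integral {a..x} \<psi>) = expmean l \<phi> x"
      using split[of x] em[of x] by auto
  qed (auto simp: a_def)
  also have "l * (l * exp (l * z)) * (I a - integral {a..z} \<psi>) - \<psi> z * (l * exp (l * z))
      = l * (expmean l \<phi> z - \<phi> z)"
  proof -
    have "I a - integral {a..z} \<psi> = I z" using split[of z] by (simp add: a_def)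
    moreover have "\<psi> z * (l * exp (l * z)) = l * \<phi> z"
      by (simp add: \<psi>_def exp_minus)
    ultimately show ?thesis by (auto simp: em algebra_simps)
  qed
  finally show ?thesis .
qed

text \<open>The density is positive on a unit interval inside \<open>{a..}\<close>, and that
  interval is not a Lebesgue null set.\<close>

lemma emeasure_expo_Ici:
  assumes "0 < l" shows "emeasure (expo l) {a..} \<noteq> 0"
proof
  assume "emeasure (expo l) {a..} = 0"
  then have "{a..} \<in> null_sets (expo l)" by auto
  then have "AE y in lborel. y \<in> {a..} \<longrightarrow> ennreal (exponential_density l y) = 0"
    unfolding expo_def by (subst (asm) null_sets_density_iff) auto
  then have "AE y in lborel. y \<notin> {max 0 a..max 0 a + 1}"
    by eventually_elim (use assms in \<open>auto simp: exponential_density_def ennreal_eq_0_iff mult_le_0_iff not_le\<close>)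
  then have "emeasure lborel {max 0 a..max 0 a + 1} = 0"
    by (subst (asm) AE_iff_null_sets[symmetric]) auto
  then show False by simp
qed

lemma expo_integral_strict:
  fixes f g :: "real \<Rightarrow> real"
  assumes l: "0 < l" and int: "integrable (expo l) f" "integrable (expo l) g"
    and le: "\<And>y. 0 \<le> y \<Longrightarrow> f y \<le> g y" and less: "\<And>y. a < y \<Longrightarrow> f y < g y"
  shows "(LINT y|expo l. f y) < (LINT y|expo l. g y)"
proof (rule finite_measure.integral_less_AE[OF prob_space.finite_measure[OF prob_space_expo[OF l]] int, of "{a+1..}"])
  show "AE x in expo l. x \<in> {a+1..} \<longrightarrow> f x \<noteq> g x"
  proof (intro AE_I2 impI)
    fix x assume "x \<in> {a + 1..}"
    then have "f x < g x" by (intro less) auto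
    then show "f x \<noteq> g x" by simp
  qed
  show "AE x in expo l. f x \<le> g x" using AE_expo_nonneg[OF l] by eventually_elim (rule le)
qed (use emeasure_expo_Ici[OF l] in auto)

lemma tempered_bounded:
  assumes "0 < l" "continuous_on UNIV \<phi>" "\<And>z. \<bar>\<phi> z\<bar> \<le> C"
  shows "tempered l \<phi>"
  unfolding tempered_def
proof (intro conjI exI[of _ C] allI assms(2))
  fix z
  have "0 \<le> C" using assms(3)[of 0] by (auto intro: order_trans[OF abs_ge_zero])
  moreover have "1 \<le> exp (l / 2 * \<bar>z\<bar>)" using assms(1) by simp
  ultimately have "C * 1 \<le> C * exp (l / 2 * \<bar>z\<bar>)" by (intro mult_left_mono)
  then show "\<bar>\<phi> z\<bar> \<le> C * exp (l / 2 * \<bar>z\<bar>)" using assms(3)[of z] by simp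
qed

lemma power_le_exp:
  fixes x :: real assumes "0 \<le> x" shows "x ^ n \<le> fact n * exp x"
proof -
  have "(\<Sum>k\<in>{n}. x ^ k /\<^sub>R fact k) \<le> (\<Sum>k. x ^ k /\<^sub>R fact k)"
    by (rule sum_le_suminf[OF summable_exp_generic]) (use assms in auto)
  then have "x ^ n / fact n \<le> exp x" by (simp add: exp_def divide_inverse mult.commute)
  then show ?thesis by (simp add: field_simps)
qed

lemma polynomially_bounded_tempered:
  assumes l: "0 < l" and c: "continuous_on UNIV \<phi>" and "0 \<le> b0" "0 \<le> b1"
    and b: "\<And>z. \<bar>\<phi> z\<bar> \<le> b0 + b1 * \<bar>z\<bar> ^ n"
  shows "tempered l \<phi>"
  unfolding tempered_def
proof (intro conjI exI allI c)
  fix z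
  have "(l / 2 * \<bar>z\<bar>) ^ n \<le> fact n * exp (l / 2 * \<bar>z\<bar>)" using l by (intro power_le_exp) simp
  then have "\<bar>z\<bar> ^ n \<le> (fact n / (l / 2) ^ n) * exp (l / 2 * \<bar>z\<bar>)"
    using l by (simp add: power_mult_distrib field_simps power_divide)
  then have "b1 * \<bar>z\<bar> ^ n \<le> b1 * (fact n / (l / 2) ^ n * exp (l / 2 * \<bar>z\<bar>))"
    using assms(4) by (rule mult_left_mono)
  moreover have "b0 * 1 \<le> b0 * exp (l / 2 * \<bar>z\<bar>)" using assms(3) l by (intro mult_left_mono) auto
  ultimately show "\<bar>\<phi> z\<bar> \<le> (b0 + b1 * (fact n / (l / 2) ^ n)) * exp (l / 2 * \<bar>z\<bar>)"
    using b[of z] by (simp add: algebra_simps)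
qed

text \<open>The points \<open>y + z\<close> and \<open>w\<close> are convex combinations of
  \<open>z\<close> and \<open>y + w\<close> with exchanged weights; the two convexity inequalities
  add up to the claim.\<close>

lemma convex_increment_mono:
  fixes h :: "real \<Rightarrow> real"
  assumes "convex_on UNIV h" "z \<le> w" "0 \<le> y"
  shows "h (y + z) - h z \<le> h (y + w) - h w"
proof (cases "y = 0 \<or> z = w")
  case False
  define t where "t = y / (y + w - z)"
  have p: "y + w - z > 0" using False assms by auto
  have t: "0 \<le> t" "t \<le> 1" using assms p by (auto simp: t_def)
  have ty: "t * (y + w - z) = y" using p by (simp add: t_def)
  have "h ((1 - t) *\<^sub>R z + t *\<^sub>R (y + w)) \<le> (1 - t) * h z + t * h (y + w)"
    using convex_onD[OF assms(1) t(1,2)] by simp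
  moreover have "(1 - t) *\<^sub>R z + t *\<^sub>R (y + w) = y + z" using ty by (simp add: algebra_simps)
  moreover have "h ((1 - t) *\<^sub>R (y + w) + t *\<^sub>R z) \<le> (1 - t) * h (y + w) + t * h z"
    using convex_onD[OF assms(1) t(1,2)] by simp
  moreover have "(1 - t) *\<^sub>R (y + w) + t *\<^sub>R z = w" using ty by (simp add: algebra_simps)
  ultimately show ?thesis by (simp add: algebra_simps)
qed (use assms in auto)

section \<open>Convex holding costs and their exponential means\<close>

locale holding_cost =
  fixes l :: real and h :: "real \<Rightarrow> real"
  assumes l_pos: "0 < l" and convex: "convex_on UNIV h" and h_0: "h 0 = 0"
    and h_inc: "\<And>x y. 0 \<le> x \<Longrightarrow> x < y \<Longrightarrow> h x < h y"
    and h_dec: "\<And>x y. x < y \<Longrightarrow> y \<le> 0 \<Longrightarrow> h y < h x"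
    and temp: "tempered l h"
begin

lemma h_cont: "continuous_on A h"
  using temp by (auto simp: tempered_def intro: continuous_on_subset)

lemma h_meas [measurable]: "h \<in> borel_measurable borel"
  using temp by (rule tempered_measurable)

lemma h_nonneg: "0 \<le> h z"
  using h_inc[of 0 z] h_dec[of z 0] h_0 by (cases z "0::real" rule: linorder_cases) auto

lemma h_pos: "z \<noteq> 0 \<Longrightarrow> 0 < h z"
  using h_inc[of 0 z] h_dec[of z 0] h_0 by (cases z "0::real" rule: linorder_cases) auto

lemma h_mono: "0 \<le> x \<Longrightarrow> x \<le> y \<Longrightarrow> h x \<le> h y"
  using h_inc[of x y] by (cases "x = y") auto

lemma h_antimono: "x \<le> y \<Longrightarrow> y \<le> 0 \<Longrightarrow> h y \<le> h x"
  using h_dec[of x y] by (cases "x = y") auto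

text \<open>Convexity on the segment from \<open>0\<close> to \<open>z\<close> at weight
  \<open>1 / \<bar>z\<bar>\<close> compares \<open>h z\<close> with \<open>h 1\<close> or
  \<open>h (-1)\<close>, both positive. The \<open>- 1\<close> makes the bound trivial for
  \<open>\<bar>z\<bar> \<le> 1\<close>.\<close>

lemma h_linear_lower:
  obtains \<alpha> where "0 < \<alpha>" "\<And>z. \<alpha> * (\<bar>z\<bar> - 1) \<le> h z"
proof
  define \<alpha> where "\<alpha> = min (h 1) (h (-1))"
  show a: "0 < \<alpha>" using h_pos by (simp add: \<alpha>_def)
  fix z :: real
  show "\<alpha> * (\<bar>z\<bar> - 1) \<le> h z"
  proof (cases "\<bar>z\<bar> \<le> 1")
    case True
    then have "\<alpha> * (\<bar>z\<bar> - 1) \<le> 0" using a by (simp add: mult_le_0_iff)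
    then show ?thesis using h_nonneg[of z] by simp
  next
    case False
    define t where "t = 1 / \<bar>z\<bar>"
    have t: "0 \<le> t" "t \<le> 1" using False by (auto simp: t_def)
    have "h ((1 - t) *\<^sub>R 0 + t *\<^sub>R z) \<le> (1 - t) * h 0 + t * h z"
      using convex_onD[OF convex t(1,2), of 0 z] by simp
    then have 1: "h (t * z) \<le> t * h z" by (simp add: h_0)
    have "t * z = 1 \<or> t * z = -1" using False by (auto simp: t_def abs_if field_simps)
    then have "\<alpha> \<le> h (t * z)" by (auto simp: \<alpha>_def)
    with 1 have "\<alpha> \<le> t * h z" by simp
    then have "\<alpha> * \<bar>z\<bar> \<le> h z" using False by (simp add: t_def field_simps)
    then show ?thesis using a by (simp add: algebra_simps)
  qed
qed

abbreviation "m \<equiv> expmean l h"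

lemma m_deriv: "(m has_real_derivative l * (m z - h z)) (at z)"
  by (rule expmean_deriv[OF l_pos temp])

lemma m_cont: "continuous_on A m"
  by (intro DERIV_continuous_on[where D="\<lambda>z. l * (m z - h z)"] DERIV_subset[OF m_deriv]) auto

lemma m_nonneg: "0 \<le> m z"
  unfolding expmean_def by (intro integral_nonneg_AE) (simp add: h_nonneg)

lemma int_h: "integrable (expo l) (\<lambda>y. h (y + z))"
  by (rule tempered_integrable[OF l_pos temp])

lemma m_minus_h: "m z - h z = (LINT y|expo l. h (y + z) - h z)"
proof -
  interpret prob_space "expo l" by (rule prob_space_expo[OF l_pos])
  show ?thesis unfolding expmean_def using int_h[of z] by (simp add: prob_space)
qed

lemma int_h_diff: "integrable (expo l) (\<lambda>y. h (y + z) - h z)"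
proof -
  interpret prob_space "expo l" by (rule prob_space_expo[OF l_pos])
  show ?thesis using int_h[of z] by simp
qed

lemma m_gt_h: assumes "0 \<le> z" shows "h z < m z"
proof -
  have "(LINT y|expo l. 0) < (LINT y|expo l. h (y + z) - h z)"
    by (rule expo_integral_strict[OF l_pos _ int_h_diff, where a = 0])
       (use h_mono[of z] h_inc[of z] assms in auto)
  then show ?thesis by (simp flip: m_minus_h)
qed

text \<open>\<open>m - h\<close> averages increments of \<open>h\<close>, which convexity makes
  nondecreasing in the starting point. For \<open>y > - z\<close> both shifted points are positive,
  so \<open>h (y + z) < h (y + w)\<close> while \<open>h w < h z\<close>. Uniqueness of
  \<open>z_star\<close> rests on this.\<close>

lemma m_minus_h_strict:
  assumes "z < w" "w \<le> 0" shows "m z - h z < m w - h w"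
  unfolding m_minus_h
proof (rule expo_integral_strict[OF l_pos int_h_diff int_h_diff, where a = "- z"])
  show "h (y + z) - h z \<le> h (y + w) - h w" if "0 \<le> y" for y
    using convex_increment_mono[OF convex, of z w y] assms that by simp
  show "h (y + z) - h z < h (y + w) - h w" if "- z < y" for y
    using h_inc[of "y + z" "y + w"] h_dec[of z w] assms that by simp
qed

section \<open>Holding costs frozen outside \<open>[- A, A]\<close>\<close>

definition hc :: "real \<Rightarrow> real \<Rightarrow> real" where "hc A z = h (max (- A) (min A z))"

abbreviation "mc A \<equiv> expmean l (hc A)"

lemma hc_cont: "continuous_on S (hc A)"
  unfolding hc_def by (intro continuous_on_compose2[OF h_cont[of UNIV]] continuous_intros) auto

lemma hc_meas [measurable]: "hc A \<in> borel_measurable borel"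
  by (rule borel_measurable_continuous_onI[OF hc_cont])

lemma hc_nonneg: "0 \<le> hc A z"
  by (simp add: hc_def h_nonneg)

lemma hc_eq: "\<bar>z\<bar> \<le> A \<Longrightarrow> hc A z = h z"
  by (auto simp: hc_def max_def min_def intro!: arg_cong[of _ _ h])

lemma hc_mono: assumes "0 \<le> A" "A \<le> B" shows "hc A z \<le> hc B z"
proof (cases "0 \<le> z")
  case True
  then show ?thesis using assms unfolding hc_def by (intro h_mono) auto
next
  case False
  then show ?thesis using assms unfolding hc_def by (intro h_antimono) auto
qed

lemma hc_le: assumes "0 \<le> A" shows "hc A z \<le> h z"
  using hc_mono[OF assms, of "max A \<bar>z\<bar>" z] hc_eq[of z "max A \<bar>z\<bar>"] by simp

lemma hc_bound: assumes "0 \<le> A" shows "hc A z \<le> h A + h (- A)"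
proof (cases "0 \<le> z")
  case True
  then have "hc A z \<le> h A" unfolding hc_def using assms by (intro h_mono) auto
  then show ?thesis using h_nonneg[of "- A"] by simp
next
  case False
  then have "hc A z \<le> h (- A)" unfolding hc_def using assms by (intro h_antimono) auto
  then show ?thesis using h_nonneg[of A] by simp
qed

lemma hc_abs_bound: "0 \<le> A \<Longrightarrow> \<bar>hc A z\<bar> \<le> h A + h (- A)"
  using hc_bound[of A z] hc_nonneg[of A z] by simp

lemma hc_tempered: "0 \<le> A \<Longrightarrow> tempered l (hc A)"
  by (rule tempered_bounded[OF l_pos hc_cont hc_abs_bound])

text \<open>Slopes of chords inside \<open>[- A, A]\<close> lie between those over
  \<open>[- A - 1, - A]\<close> and \<open>[A, A + 1]\<close>, and \<open>h \<ge> 0\<close> bounds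
  these two in absolute value by the constant.\<close>

lemma hc_lipschitz:
  assumes "0 \<le> A"
  shows "\<bar>hc A x - hc A y\<bar> \<le> (h (A + 1) + h (- A - 1)) * \<bar>x - y\<bar>"
proof -
  define L where "L = h (A + 1) + h (- A - 1)"
  have inner: "\<bar>h x - h y\<bar> \<le> L * (y - x)" if xy: "x < y" "- A \<le> x" "y \<le> A" for x y
  proof -
    have "(h x - h y) / (x - y) \<le> (h x - h (A + 1)) / (x - (A + 1))"
      using xy by (intro convex_on_slope_le(1)[OF convex]) auto
    also have "\<dots> \<le> (h A - h (A + 1)) / (A - (A + 1))"
      using xy by (intro convex_on_slope_le(2)[OF convex]) auto
    also have "\<dots> \<le> L" using h_nonneg[of A] h_nonneg[of "- A - 1"] by (simp add: L_def)
    finally have 1: "h y - h x \<le> L * (y - x)" using xy by (simp add: field_simps)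
    have "- L \<le> (h (- A - 1) - h (- A)) / (- A - 1 - - A)"
      using h_nonneg[of "- A"] h_nonneg[of "A + 1"] by (simp add: L_def)
    also have "\<dots> \<le> (h (- A - 1) - h y) / (- A - 1 - y)"
      using xy by (intro convex_on_slope_le(1)[OF convex]) auto
    also have "\<dots> \<le> (h x - h y) / (x - y)"
      using xy by (intro convex_on_slope_le(2)[OF convex]) auto
    finally have 2: "h x - h y \<le> L * (y - x)" using xy by (simp add: field_simps)
    from 1 2 show ?thesis by (simp add: abs_le_iff)
  qed
  have L0: "0 \<le> L" by (simp add: L_def h_nonneg)
  have le: "\<bar>hc A x - hc A y\<bar> \<le> L * \<bar>x - y\<bar>" if "x \<le> y" for x y
  proof -
    define x' where "x' = max (- A) (min A x)"
    define y' where "y' = max (- A) (min A y)"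
    have *: "x' \<le> y'" "y' - x' \<le> y - x" "- A \<le> x'" "y' \<le> A"
      using that assms by (auto simp: x'_def y'_def)
    have "\<bar>h x' - h y'\<bar> \<le> L * (y' - x')" using inner[of x' y'] * by (cases "x' = y'") auto
    also have "\<dots> \<le> L * (y - x)" using *(2) L0 by (rule mult_left_mono)
    finally show ?thesis using that by (simp add: hc_def x'_def y'_def)
  qed
  show ?thesis
    using le[of x y] le[of y x] unfolding L_def by (cases "x \<le> y") (auto simp: abs_minus_commute)
qed

lemma mc_deriv: "0 \<le> A \<Longrightarrow> (mc A has_real_derivative l * (mc A z - hc A z)) (at z)"
  by (rule expmean_deriv[OF l_pos hc_tempered])

lemma mc_cont: "0 \<le> A \<Longrightarrow> continuous_on S (mc A)"
  by (intro DERIV_continuous_on[where D="\<lambda>z. l * (mc A z - hc A z)"] DERIV_subset[OF mc_deriv]) auto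

lemma mc_nonneg: "0 \<le> mc A z"
  unfolding expmean_def by (intro integral_nonneg_AE) (simp add: hc_nonneg)

lemma mc_le: "0 \<le> A \<Longrightarrow> mc A z \<le> m z"
  by (rule expmean_mono[OF l_pos hc_tempered temp]) (auto intro: hc_le)

lemma mc_bound: assumes "0 \<le> A" shows "mc A z \<le> h A + h (- A)"
proof -
  have "tempered l (\<lambda>_. h A + h (- A))"
    by (rule tempered_bounded[OF l_pos, where C = "h A + h (- A)"]) (auto simp: h_nonneg)
  then have "mc A z \<le> expmean l (\<lambda>_. h A + h (- A)) z"
    by (rule expmean_mono[OF l_pos hc_tempered[OF assms]]) (rule hc_bound[OF assms])
  then show ?thesis by (simp only: expmean_const[OF l_pos])
qed

text \<open>An exponential shift \<open>y\<close> brings a point closer to \<open>0\<close> by at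
  most \<open>y\<close>, which costs only the mean of \<open>y\<close>. The same
  \<open>\<alpha>\<close> and \<open>C\<close> serve every \<open>A\<close>, so later thresholds can
  be fixed before \<open>A\<close> is chosen.\<close>

lemma mc_linear_lower:
  obtains \<alpha> C where "0 < \<alpha>" "\<And>A z. 0 \<le> A \<Longrightarrow> \<alpha> * min A \<bar>z\<bar> - C \<le> mc A z"
    "\<And>z. \<alpha> * \<bar>z\<bar> - C \<le> m z"
proof -
  obtain \<alpha> where a: "0 < \<alpha>" "\<And>z. \<alpha> * (\<bar>z\<bar> - 1) \<le> h z" by (rule h_linear_lower) (auto intro: that)
  interpret prob_space "expo l" by (rule prob_space_expo[OF l_pos])
  have "tempered l (\<lambda>y. y)"
    by (rule polynomially_bounded_tempered[OF l_pos, of _ 0 1 1]) auto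
  from tempered_integrable[OF l_pos this, of 0] have i: "integrable (expo l) (\<lambda>y. y)" by simp
  \<comment> \<open>The mean of the exponential variable accounts for the shift, the
    \<open>1\<close> for the \<open>- 1\<close> in the linear bound of \<open>h\<close>.\<close>
  define C where "C = \<alpha> * ((LINT y|expo l. y) + 1)"
  have c: "\<alpha> * min A \<bar>z\<bar> - C \<le> mc A z" if A: "0 \<le> A" for A z
  proof -
    have "(LINT y|expo l. \<alpha> * (min A \<bar>z\<bar> - y - 1)) \<le> mc A z"
      unfolding expmean_def
    proof (rule integral_mono_AE)
      show "AE y in expo l. \<alpha> * (min A \<bar>z\<bar> - y - 1) \<le> hc A (y + z)"
        using AE_expo_nonneg[OF l_pos]
      proof eventually_elim
        case (elim y)
        have "\<alpha> * (min A \<bar>z\<bar> - y - 1) \<le> \<alpha> * (\<bar>max (- A) (min A (y + z))\<bar> - 1)"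
          using a(1) elim A by (intro mult_left_mono) auto
        then show ?case using a(2)[of "max (- A) (min A (y + z))"] unfolding hc_def by linarith
      qed
    qed (use i tempered_integrable[OF l_pos hc_tempered[OF A]] in auto)
    also have "(LINT y|expo l. \<alpha> * (min A \<bar>z\<bar> - y - 1)) = \<alpha> * min A \<bar>z\<bar> - C"
      using i by (simp add: prob_space algebra_simps C_def)
    finally show ?thesis .
  qed
  have "\<alpha> * \<bar>z\<bar> - C \<le> m z" for z
    using c[of "\<bar>z\<bar>" z] mc_le[of "\<bar>z\<bar>" z] by simp
  with a(1) c show thesis by (rule that)
qed

lemma mc_tendsto: "(\<lambda>n. mc (real n) z) \<longlonglongrightarrow> m z"
  unfolding expmean_def
proof (rule integral_dominated_convergence[where w = "\<lambda>y. h (y + z)"])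
  show "integrable (expo l) (\<lambda>y. h (y + z))" by (rule int_h)
  have "(\<lambda>n. hc (real n) y) \<longlonglongrightarrow> h y" for y
  proof (rule tendsto_eventually)
    show "\<forall>\<^sub>F n in sequentially. hc (real n) y = h y"
      using eventually_ge_at_top[of "nat \<lceil>\<bar>y\<bar>\<rceil>"]
      by eventually_elim (rule hc_eq, linarith)
  qed
  then show "AE y in expo l. (\<lambda>n. hc (real n) (y + z)) \<longlonglongrightarrow> h (y + z)" by simp
  show "AE y in expo l. norm (hc (real n) (y + z)) \<le> h (y + z)" for n
    by (simp add: hc_nonneg hc_le)
qed auto

text \<open>Exponential shifts go to the right, so from \<open>u \<ge> - A\<close> only the part of
  \<open>h\<close> beyond \<open>A\<close> is lost, and the loss grows with the point reached. One
  estimate at \<open>b\<close> thus controls all of \<open>[- b, b]\<close>.\<close>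

lemma m_minus_mc_mono:
  assumes "\<bar>u\<bar> \<le> b" "b \<le> A" shows "m u - mc A u \<le> m b - mc A b"
proof -
  have A: "0 \<le> A" using assms by linarith
  have i: "integrable (expo l) (\<lambda>y. h (y + u) - hc A (y + u))" for u
    using int_h tempered_integrable[OF l_pos hc_tempered[OF A]] by simp
  have "m u - mc A u = (LINT y|expo l. h (y + u) - hc A (y + u))" for u
    unfolding expmean_def using int_h tempered_integrable[OF l_pos hc_tempered[OF A]] by simp
  moreover have "(LINT y|expo l. h (y + u) - hc A (y + u)) \<le> (LINT y|expo l. h (y + b) - hc A (y + b))"
  proof (rule integral_mono_AE[OF i i])
    show "AE y in expo l. h (y + u) - hc A (y + u) \<le> h (y + b) - hc A (y + b)"
      using AE_expo_nonneg[OF l_pos]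
    proof eventually_elim
      case (elim y)
      show ?case
      proof (cases "y + u \<le> A")
        case True
        then have "hc A (y + u) = h (y + u)" using elim assms by (intro hc_eq) auto
        then show ?thesis using hc_le[OF A, of "y + b"] by simp
      next
        case False
        then have "hc A (y + u) = h A" "hc A (y + b) = h A"
          using assms A by (auto simp: hc_def intro!: arg_cong[of _ _ h])
        moreover have "h (y + u) \<le> h (y + b)" using False assms A by (intro h_mono) auto
        ultimately show ?thesis by simp
      qed
    qed
  qed
  ultimately show ?thesis by simp
qed

lemma m_large:
  obtains A where "0 \<le> A" "\<And>z. A \<le> \<bar>z\<bar> \<Longrightarrow> C \<le> m z"
proof -
  obtain \<alpha> D where a: "0 < \<alpha>" "\<And>z. \<alpha> * \<bar>z\<bar> - D \<le> m z" by (rule mc_linear_lower) (auto intro: that)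
  have "C \<le> m z" if "max 0 ((C + D) / \<alpha>) \<le> \<bar>z\<bar>" for z
  proof -
    have "C + D \<le> \<alpha> * \<bar>z\<bar>" using that a(1) by (simp add: field_simps)
    then show ?thesis using a(2)[of z] by linarith
  qed
  then show thesis by (intro that[of "max 0 ((C + D) / \<alpha>)"]) auto
qed

text \<open>If \<open>h \<le> m\<close> held at all negative points, then
  \<open>m' = l * (m - h) \<ge> 0\<close> there, against the growth of \<open>m\<close> at
  \<open>-\<infinity>\<close>; so \<open>m - h\<close> takes a negative value, and it is positive at
  \<open>0\<close>. All zeros are negative, where \<open>m - h\<close> is strictly
  increasing.\<close>

lemma crossing: "\<exists>!z. m z = h z" and crossing_neg: "m z = h z \<Longrightarrow> z < 0"
proof -
  show neg: "z < 0" if "m z = h z" for z using m_gt_h[of z] that by (cases "z < 0") auto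
  have "\<exists>w<0. m w - h w < 0"
  proof (rule ccontr)
    assume "\<not> (\<exists>w<0. m w - h w < 0)"
    then have d: "0 \<le> m w - h w" if "w < 0" for w using that by force
    obtain A where A: "0 \<le> A" "\<And>z. A \<le> \<bar>z\<bar> \<Longrightarrow> m 0 + 1 \<le> m z" by (rule m_large) (auto intro: that)
    have "m (- A - 1) \<le> m 0"
    proof (rule DERIV_nonneg_imp_nondecreasing[of "- A - 1" 0 m])
      fix x :: real assume "x \<le> 0"
      then have "0 \<le> m x - h x" using d[of x] m_gt_h[of 0] by (cases "x = 0") auto
      then show "\<exists>y. DERIV m x :> y \<and> 0 \<le> y" using m_deriv[of x] l_pos by force
    qed (use A in auto)
    then show False using A(1) A(2)[of "- A - 1"] by auto
  qed
  then obtain w where w: "w < 0" "m w - h w < 0" by auto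
  have "\<exists>z\<ge>w. z \<le> 0 \<and> m z - h z = 0"
    by (rule IVT') (use w m_gt_h[of 0] in \<open>auto intro!: continuous_intros m_cont h_cont\<close>)
  then obtain z where z: "m z = h z" by auto
  moreover have "z1 = z2" if "m z1 = h z1" "m z2 = h z2" for z1 z2
    using m_minus_h_strict[of z1 z2] m_minus_h_strict[of z2 z1] neg[of z1] neg[of z2] that
    by (cases z1 z2 rule: linorder_cases) auto
  ultimately show "\<exists>!z. m z = h z" by blast
qed

text \<open>Since \<open>m' = l * (m - h)\<close>, this is the sign of the derivative of
  \<open>m\<close> and makes \<open>zs\<close> its unique minimizer.\<close>

lemma m_sign:
  assumes "m zs = h zs"
  shows "z < zs \<Longrightarrow> m z < h z" "zs < z \<Longrightarrow> h z < m z"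
  using m_minus_h_strict[of z zs] m_minus_h_strict[of zs z] m_gt_h[of z] crossing_neg[OF assms] assms
  by (auto, cases "z \<le> 0", auto)

lemma m_inc:
  assumes "m zs = h zs" "zs \<le> x" "x < y" shows "m x < m y"
  by (rule DERIV_pos_imp_increasing_open[OF assms(3) _ m_cont])
     (use m_deriv m_sign(2)[OF assms(1)] l_pos assms(2) in \<open>metis diff_gt_0_iff_gt mult_pos_pos order_le_less_trans\<close>)

lemma m_dec:
  assumes "m zs = h zs" "y \<le> zs" "x < y" shows "m y < m x"
  by (rule DERIV_neg_imp_decreasing_open[OF assms(3) _ m_cont])
     (use m_deriv m_sign(1)[OF assms(1)] l_pos assms(2) in
       \<open>metis diff_less_0_iff_less mult_pos_neg order_less_le_trans\<close>)

end

section \<open>Intervals of given length with minimal integral\<close>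

locale valley =
  fixes g :: "real \<Rightarrow> real" and zs :: real
  assumes dec: "\<And>x y. x < y \<Longrightarrow> y \<le> zs \<Longrightarrow> g y < g x"
    and inc: "\<And>x y. zs \<le> x \<Longrightarrow> x < y \<Longrightarrow> g x < g y"
    and cont: "continuous_on UNIV g"
    and left_unbounded: "\<And>C. \<exists>z\<le>zs. C \<le> g z"
    and right_unbounded: "\<And>C. \<exists>z\<ge>zs. C \<le> g z"
begin

lemma g_meas [measurable]: "g \<in> borel_measurable borel"
  by (rule borel_measurable_continuous_onI[OF cont])

lemma g_integrable: "set_integrable lborel {a..b} g"
  by (rule borel_integrable_atLeastAtMost') (rule continuous_on_subset[OF cont], simp)

lemma g_min: "g zs \<le> g z"
  using dec[of z zs] inc[of zs z] by (cases z zs rule: linorder_cases) auto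

lemma ex1_lo: assumes "g zs \<le> v" shows "\<exists>!a. a \<le> zs \<and> g a = v"
proof -
  obtain z where z: "z \<le> zs" "v \<le> g z" using left_unbounded by blast
  have "\<exists>a\<ge>z. a \<le> zs \<and> g a = v"
    by (rule IVT2') (use z assms in \<open>auto intro: continuous_on_subset[OF cont]\<close>)
  moreover have "a = a'" if "a \<le> zs" "a' \<le> zs" "g a = g a'" for a a'
    using dec[of a a'] dec[of a' a] that by (cases a a' rule: linorder_cases) auto
  ultimately show ?thesis by blast
qed

lemma ex1_hi: assumes "g zs \<le> v" shows "\<exists>!b. zs \<le> b \<and> g b = v"
proof -
  obtain z where z: "zs \<le> z" "v \<le> g z" using right_unbounded by blast
  have "\<exists>b\<ge>zs. b \<le> z \<and> g b = v"
    by (rule IVT') (use z assms in \<open>auto intro: continuous_on_subset[OF cont]\<close>)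
  moreover have "a = a'" if "zs \<le> a" "zs \<le> a'" "g a = g a'" for a a'
    using inc[of a a'] inc[of a' a] that by (cases a a' rule: linorder_cases) auto
  ultimately show ?thesis by blast
qed

definition lo :: "real \<Rightarrow> real" where "lo v = (THE a. a \<le> zs \<and> g a = v)"
definition hi :: "real \<Rightarrow> real" where "hi v = (THE b. zs \<le> b \<and> g b = v)"

lemma lo: assumes "g zs \<le> v" shows "lo v \<le> zs" "g (lo v) = v"
  using theI'[OF ex1_lo[OF assms]] by (auto simp: lo_def)

lemma hi: assumes "g zs \<le> v" shows "zs \<le> hi v" "g (hi v) = v"
  using theI'[OF ex1_hi[OF assms]] by (auto simp: hi_def)

lemma lo_eqI: "a \<le> zs \<Longrightarrow> lo (g a) = a"
  using ex1_lo[OF g_min[of a]] lo[OF g_min[of a]] by blast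

lemma hi_eqI: "zs \<le> b \<Longrightarrow> hi (g b) = b"
  using ex1_hi[OF g_min[of b]] hi[OF g_min[of b]] by blast

lemma sublevel: assumes "g zs \<le> v" shows "g x \<le> v \<longleftrightarrow> lo v \<le> x \<and> x \<le> hi v"
proof -
  note L = lo[OF assms] note H = hi[OF assms]
  show ?thesis
  proof (cases "x \<le> zs")
    case True
    then show ?thesis
      using dec[of x "lo v"] dec[of "lo v" x] L H by (cases x "lo v" rule: linorder_cases) auto
  next
    case False
    then show ?thesis
      using inc[of x "hi v"] inc[of "hi v" x] L H by (cases x "hi v" rule: linorder_cases) auto
  qed
qed

definition width :: "real \<Rightarrow> real" where
  "width y = (LBINT u. indicator {..y} (g u))"

lemma width_eq: assumes "g zs \<le> v" shows "width v = hi v - lo v"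
proof -
  have "(\<lambda>u. indicator {..v} (g u) :: real) = indicator {lo v..hi v}"
    using sublevel[OF assms] by (auto simp: indicator_def)
  then show ?thesis using lo(1)[OF assms] hi(1)[OF assms] by (simp add: width_def)
qed

lemma width_below: assumes "v < g zs" shows "width v = 0"
proof -
  have "\<not> g u \<le> v" for u using g_min[of u] assms by simp
  then have "(\<lambda>u. indicator {..v} (g u) :: real) = (\<lambda>u. 0)" by (simp add: indicator_def)
  then show ?thesis by (simp add: width_def)
qed

lemma lo_hi_mono:
  assumes "g zs \<le> v" "v \<le> w" shows "lo w \<le> lo v" "hi v \<le> hi w"
  using sublevel[of w "lo v"] sublevel[of w "hi v"] lo[of v] hi[of v] assms by auto

lemma width_nonneg: "0 \<le> width v"
  using width_eq[of v] width_below[of v] lo[of v] hi[of v] by (cases "g zs \<le> v") auto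

lemma width_mono: "mono width"
proof
  fix v w :: real assume "v \<le> w"
  then show "width v \<le> width w"
    using width_below[of v] width_nonneg[of w] width_eq[of v] width_eq[of w] lo_hi_mono[of v w]
    by (cases "g zs \<le> v") auto
qed

lemma width_pos: assumes "g zs < v" shows "0 < width v"
  using width_eq[of v] lo[of v] hi[of v] assms by (cases "lo v = zs") auto

lemma width_meas [measurable]: "width \<in> borel_measurable borel"
  by (rule borel_measurable_mono[OF width_mono])

lemma width_integrable: "set_integrable lborel {a..b} width"
  unfolding set_integrable_def
proof (rule Bochner_Integration.integrable_bound[of _ "\<lambda>x. width b * indicator {a..b} x"])
  show "integrable lborel (\<lambda>x. width b * indicat_real {a..b} x)"
    by (intro integrable_mult_right integrable_real_indicator) (auto simp: emeasure_lborel_Icc_eq)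
  show "AE x in lborel. norm (indicat_real {a..b} x *\<^sub>R width x) \<le> norm (width b * indicat_real {a..b} x)"
    using width_nonneg monoD[OF width_mono, of _ b] by (intro AE_I2) (auto simp: indicator_def)
qed auto

section \<open>The integrated width of sublevel sets and its conjugate\<close>

definition excess :: "real \<Rightarrow> real" where "excess v = (LBINT u:{g zs..v}. width u)"

lemma excess_min: "excess (g zs) = 0"
  unfolding excess_def by (simp add: set_integral_at_point)

lemma excess_diff:
  assumes "g zs \<le> v" "v \<le> w"
  shows "(w - v) * width v \<le> excess w - excess v" "excess w - excess v \<le> (w - v) * width w"
proof -
  have u: "{g zs..w} = {g zs..v} \<union> {v<..w}" using assms by auto
  have i: "set_integrable lborel {v<..w} width"
    by (rule set_integrable_subset[OF width_integrable[of v w]]) auto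
  have "excess w = excess v + (LBINT u:{v<..w}. width u)"
    unfolding excess_def u by (rule set_integral_Un) (use i width_integrable in auto)
  then have d: "excess w - excess v = (LBINT u:{v<..w}. width u)" by simp
  have c: "(LBINT u:{v<..w}. (c::real)) = (w - v) * c" for c
    using assms by (subst set_integral_const) auto
  have ci: "set_integrable lborel {v<..w} (\<lambda>_. c::real)" for c
    unfolding set_integrable_def using assms by simp
  have "(LBINT u:{v<..w}. width v) \<le> (LBINT u:{v<..w}. width u)"
    by (rule set_integral_mono[OF ci i]) (use width_mono in \<open>auto simp: mono_def\<close>)
  then show "(w - v) * width v \<le> excess w - excess v" by (simp only: c d)
  have "(LBINT u:{v<..w}. width u) \<le> (LBINT u:{v<..w}. width w)"
    by (rule set_integral_mono[OF i ci]) (use width_mono in \<open>auto simp: mono_def\<close>)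
  then show "excess w - excess v \<le> (w - v) * width w" by (simp only: c d)
qed

lemma excess_strict_mono:
  assumes "g zs \<le> v" "v < w" shows "excess v < excess w"
proof -
  \<comment> \<open>\<open>width\<close> vanishes at \<open>v = g zs\<close>, but it is positive at
    the midpoint.\<close>
  define u where "u = (v + w) / 2"
  have "0 \<le> (u - v) * width v" using assms width_nonneg by (auto simp: u_def)
  moreover have "0 < (w - u) * width u" using assms width_pos[of u] by (auto simp: u_def)
  ultimately show ?thesis
    using excess_diff(1)[of v u] excess_diff(1)[of u w] assms by (auto simp: u_def)
qed

lemma excess_mono: "g zs \<le> v \<Longrightarrow> v \<le> w \<Longrightarrow> excess v \<le> excess w"
  using excess_strict_mono[of v w] by (cases "v = w") auto

lemma excess_cont: "continuous_on {g zs..w} excess"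
proof -
  have le: "\<bar>excess x - excess y\<bar> \<le> width w * \<bar>x - y\<bar>" if "x \<in> {g zs..w}" "y \<in> {g zs..w}" "x \<le> y" for x y
  proof -
    have 1: "(y - x) * width y \<le> (y - x) * width w"
      using that by (intro mult_left_mono monoD[OF width_mono]) auto
    have 2: "0 \<le> (y - x) * width x" using that width_nonneg by simp
    have "0 \<le> excess y - excess x" "excess y - excess x \<le> width w * (y - x)"
      using excess_diff[of x y] that 1 2 by (auto simp: mult.commute)
    then show ?thesis using that(3) by (simp add: abs_le_iff)
  qed
  then have "\<bar>excess x - excess y\<bar> \<le> width w * \<bar>x - y\<bar>" if "x \<in> {g zs..w}" "y \<in> {g zs..w}" for x y
    using that(1,2) le[of x y] le[of y x] by (cases "x \<le> y") (simp_all add: abs_minus_commute)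
  then have "(width w)-lipschitz_on {g zs..w} excess"
    using width_nonneg by (intro lipschitz_onI) (auto simp: dist_real_def)
  then show ?thesis by (rule lipschitz_on_continuous_on)
qed

lemma excess_ex1: assumes "0 \<le> c" shows "\<exists>!v. g zs \<le> v \<and> excess v = c"
proof -
  \<comment> \<open>From \<open>g zs + 1\<close> on, \<open>excess\<close> grows with slope at least
    \<open>width (g zs + 1) > 0\<close>, so it has reached \<open>c\<close> at
    \<open>w\<close>.\<close>
  define w where "w = g zs + 1 + c / width (g zs + 1)"
  have wp: "0 < width (g zs + 1)" by (rule width_pos) simp
  have "0 \<le> excess (g zs + 1)" using excess_mono[of "g zs" "g zs + 1"] excess_min by simp
  moreover have "(w - (g zs + 1)) * width (g zs + 1) = c" using wp by (simp add: w_def)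
  ultimately have "c \<le> excess w"
    using excess_diff(1)[of "g zs + 1" w] wp assms by (simp add: w_def)
  then have "\<exists>v\<ge>g zs. v \<le> w \<and> excess v = c"
    by (intro IVT'[OF _ _ _ excess_cont]) (use assms wp in \<open>auto simp: excess_min w_def\<close>)
  moreover have "u = v" if "g zs \<le> u" "g zs \<le> v" "excess u = excess v" for u v
    using excess_strict_mono[of u v] excess_strict_mono[of v u] that by (cases u v rule: linorder_cases) auto
  ultimately show ?thesis by blast
qed

text \<open>Fubini on the region \<open>g x \<le> u \<le> v\<close>: its sections at fixed
  \<open>u\<close> have length \<open>width u\<close>, those at fixed \<open>x\<close> have length
  \<open>v - g x\<close>.\<close>

lemma excess_eq:
  assumes "g zs \<le> v" shows "excess v = (LBINT x:{lo v..hi v}. v - g x)"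
proof -
  define f :: "real \<Rightarrow> real \<Rightarrow> real" where
    "f u x = (if g zs \<le> u \<and> u \<le> v \<and> g x \<le> u then 1 else 0)" for u x
  have int: "integrable (lborel \<Otimes>\<^sub>M lborel) (case_prod f)"
  proof (rule Bochner_Integration.integrable_bound)
    show "integrable (lborel \<Otimes>\<^sub>M lborel) (indicat_real ({g zs..v} \<times> {lo v..hi v}))"
      by (intro integrable_real_indicator)
         (auto simp: lborel.emeasure_pair_measure_Times ennreal_mult_less_top emeasure_lborel_Icc_eq)
    show "case_prod f \<in> borel_measurable (lborel \<Otimes>\<^sub>M lborel)"
      unfolding f_def by measurable
    have "\<bar>f u x\<bar> \<le> indicat_real ({g zs..v} \<times> {lo v..hi v}) (u, x)" for u x
      using sublevel[OF assms, of x] by (auto simp: f_def indicator_def)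
    then show "AE p in lborel \<Otimes>\<^sub>M lborel. norm (case_prod f p) \<le> norm (indicat_real ({g zs..v} \<times> {lo v..hi v}) p)"
      by (intro AE_I2) (auto simp: split_beta)
  qed
  have "excess v = (LBINT u. LBINT x. f u x)"
    unfolding excess_def set_lebesgue_integral_def width_def
    by (intro Bochner_Integration.integral_cong refl)
       (auto simp: f_def indicator_def if_distrib intro!: Bochner_Integration.integral_cong)
  also have "\<dots> = (LBINT x. LBINT u. f u x)"
    by (rule lborel_pair.Fubini_integral[OF int, symmetric])
  also have "(\<lambda>x. LBINT u. f u x) = (\<lambda>x. indicator {lo v..hi v} x *\<^sub>R (v - g x))"
  proof
    fix x
    have "(\<lambda>u. f u x) = indicator {g x..v}"
      using g_min[of x] by (intro ext) (auto simp: f_def indicator_def)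
    then have "(LBINT u. f u x) = (if g x \<le> v then v - g x else 0)" by simp
    then show "(LBINT u. f u x) = indicator {lo v..hi v} x *\<^sub>R (v - g x)"
      using sublevel[OF assms, of x] by (auto simp: indicator_def)
  qed
  finally show ?thesis by (simp add: set_lebesgue_integral_def)
qed

lemma integral_const_diff:
  "a \<le> b \<Longrightarrow> (LBINT x:{a..b}. v - g x) = v * (b - a) - (LBINT x:{a..b}. g x)"
proof -
  assume "a \<le> b"
  then have "(LBINT x:{a..b}. v) = v * (b - a)" by (subst set_integral_const) auto
  moreover have "set_integrable lborel {a..b} (\<lambda>_. v)"
    by (intro borel_integrable_atLeastAtMost') simp
  ultimately show ?thesis using g_integrable[of a b] by (subst set_integral_diff) auto
qed

text \<open>\<open>excess\<close> is the convex conjugate of the least integral of \<open>g\<close> over an interval of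
  given length; equality holds for the sublevel intervals.\<close>

lemma fenchel_young:
  assumes "g zs \<le> v" "a \<le> b" shows "v * (b - a) - excess v \<le> (LBINT x:{a..b}. g x)"
proof -
  have i: "set_integrable lborel {a..b} (\<lambda>x. v - g x)" for a b
    by (rule borel_integrable_atLeastAtMost') (auto intro!: continuous_intros continuous_on_subset[OF cont])
  have "(LBINT x:{a..b}. v - g x) \<le> (LBINT x:{lo v..hi v}. v - g x)"
    unfolding set_lebesgue_integral_def
  proof (rule integral_mono[OF i[unfolded set_integrable_def] i[unfolded set_integrable_def]])
    fix x
    \<comment> \<open>The integrand \<open>v - g x\<close> is nonnegative exactly on the sublevel
      interval, so no other interval gives a larger integral.\<close>
    have "lo v \<le> x \<and> x \<le> hi v \<longleftrightarrow> g x \<le> v" using sublevel[OF assms(1)] by blast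
    then show "indicat_real {a..b} x *\<^sub>R (v - g x) \<le> indicat_real {lo v..hi v} x *\<^sub>R (v - g x)"
      by (auto simp: indicator_def)
  qed
  then show ?thesis using excess_eq[OF assms(1)] integral_const_diff[OF assms(2)] by simp
qed

lemma fenchel_eq:
  assumes "g zs \<le> v" shows "(LBINT x:{lo v..hi v}. g x) = v * (hi v - lo v) - excess v"
  using excess_eq[OF assms] integral_const_diff[of "lo v" "hi v" v] lo[OF assms] hi[OF assms] by simp

lemma equal_ends:
  assumes "a < b" "g a = g b" shows "a < zs" "zs < b"
  using inc[of a b] dec[of a b] assms by (cases "zs \<le> a"; cases "b \<le> zs"; auto)+

text \<open>The difference \<open>g (s + q) - g s\<close> changes sign between \<open>zs - q\<close>
  and \<open>zs\<close>. Of two solutions, the one further right would have a lower value at its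
  left end and a higher one at its right end.\<close>

lemma interval_ex1:
  assumes "0 < q" shows "\<exists>!p. snd p - fst p = q \<and> g (fst p) = g (snd p)"
proof -
  have "\<exists>s\<ge>zs - q. s \<le> zs \<and> g (s + q) - g s = 0"
  proof (rule IVT')
    show "g (zs - q + q) - g (zs - q) \<le> 0" "0 \<le> g (zs + q) - g zs" using g_min by auto
    show "continuous_on {zs - q..zs} (\<lambda>s. g (s + q) - g s)"
      by (intro continuous_intros continuous_on_compose2[OF cont] continuous_on_subset[OF cont]) auto
  qed (use assms in auto)
  then obtain s where s: "g (s + q) = g s" by auto
  have uniq: False if "a < b" "g a = g (a + q)" "g b = g (b + q)" for a b
    using equal_ends[of a "a + q"] equal_ends[of b "b + q"] dec[of a b] inc[of "a + q" "b + q"]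
      that assms by auto
  show ?thesis
  proof (rule ex1I[of _ "(s, s + q)"])
    show "snd (s, s + q) - fst (s, s + q) = q \<and> g (fst (s, s + q)) = g (snd (s, s + q))"
      using s by simp
    fix p assume p: "snd p - fst p = q \<and> g (fst p) = g (snd p)"
    then have "snd p = fst p + q" by auto
    then show "p = (s, s + q)"
      using uniq[of s "fst p"] uniq[of "fst p" s] p s
      by (cases s "fst p" rule: linorder_cases) (auto simp: prod_eq_iff)
  qed
qed

lemma equal_ends_lo_hi:
  assumes "a < b" "g a = g b" shows "lo (g a) = a" "hi (g a) = b"
  using equal_ends[OF assms] lo_eqI[of a] hi_eqI[of b] assms(2) by auto

lemma width_less_imp: "width v < width w \<Longrightarrow> v < w"
  using monoD[OF width_mono, of w v] by linarith

end

section \<open>Optimality of the selected levels\<close>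

locale tiers =
  fixes N :: nat and Q :: "nat \<Rightarrow> ereal" and c :: "nat \<Rightarrow> real"
  assumes N_pos: "1 \<le> N" and Q_0: "Q 0 = 0" and Q_N: "Q N = \<infinity>"
    and Q_Suc: "\<And>n. n < N \<Longrightarrow> Q n < Q (Suc n)"
    and c_nonneg: "\<And>n. n \<in> {1..N} \<Longrightarrow> 0 \<le> c n"
begin

abbreviation "K \<equiv> step_cost N Q c"

lemma Q_strict: assumes "i < j" "j \<le> N" shows "Q i < Q j"
  using assms
proof (induction j)
  case (Suc j)
  then show ?case using Q_Suc[of j] by (cases "i = j") auto
qed simp

lemma Q_mono: "i \<le> j \<Longrightarrow> j \<le> N \<Longrightarrow> Q i \<le> Q j"
  using Q_strict[of i j] by (cases "i = j") auto

lemma Q_less_cancel: "i \<le> N \<Longrightarrow> j \<le> N \<Longrightarrow> Q i < Q j \<Longrightarrow> i < j"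
  using Q_mono[of j i] by (cases "i < j") auto

lemma Q_inj: "i \<le> N \<Longrightarrow> j \<le> N \<Longrightarrow> Q i = Q j \<Longrightarrow> i = j"
  using Q_strict[of i j] Q_strict[of j i] by (cases i j rule: linorder_cases) auto

lemma Q_real:
  assumes "1 \<le> n" "n < N" shows "ereal (real_of_ereal (Q n)) = Q n" "0 < real_of_ereal (Q n)"
proof -
  have "0 < Q n" "Q n < \<infinity>" using Q_strict[of 0 n] Q_strict[of n N] assms Q_0 Q_N by auto
  then show "ereal (real_of_ereal (Q n)) = Q n" "0 < real_of_ereal (Q n)" by (cases "Q n"; auto)+
qed

lemma K_interior:
  assumes n: "n \<in> {1..N}" and "Q (n - 1) < ereal \<xi>" "ereal \<xi> < Q n"
  shows "K \<xi> = c n"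
proof -
  have 1: "indicat_real {Q (i - 1)<..<Q i} (ereal \<xi>) = (if i = n then 1 else 0)" if "i \<in> {1..N}" for i
  proof -
    have "i = n" if "Q (i - 1) < ereal \<xi>" "ereal \<xi> < Q i"
    proof -
      have "Q (i - 1) < Q n" "Q (n - 1) < Q i" using that assms by (auto intro: less_trans)
      then show ?thesis
        using Q_less_cancel[of "i - 1" n] Q_less_cancel[of "n - 1" i] \<open>i \<in> {1..N}\<close> n by force
    qed
    then show ?thesis using assms(2,3) by (cases "i = n") (simp_all add: indicator_def, blast)
  qed
  have 2: "indicat_real {Q i} (ereal \<xi>) = 0" if "i \<in> {1..N - 1}" for i
  proof -
    have "Q i \<noteq> ereal \<xi>"
    proof
      assume "Q i = ereal \<xi>"
      then have "Q (n - 1) < Q i" "Q i < Q n" using assms by auto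
      then show False using Q_less_cancel[of "n - 1" i] Q_less_cancel[of i n] that n by force
    qed
    then show ?thesis by (auto simp: indicator_def)
  qed
  have "(\<Sum>i=1..N. c i * indicator {Q (i - 1)<..<Q i} (ereal \<xi>)) = (\<Sum>i=1..N. if i = n then c i else 0)"
  proof (intro sum.cong refl)
    fix i assume "i \<in> {1..N}"
    from 1[OF this] show "c i * indicator {Q (i - 1)<..<Q i} (ereal \<xi>) = (if i = n then c i else 0)"
      by (simp only:) simp
  qed
  also have "\<dots> = c n" using n by simp
  finally show ?thesis unfolding step_cost_def using 2 by simp
qed

lemma K_boundary:
  assumes j: "j \<in> {1..N - 1}" and \<xi>: "ereal \<xi> = Q j"
  shows "K \<xi> = min (c j) (c (j + 1))"
proof -
  have 1: "indicat_real {Q (i - 1)<..<Q i} (ereal \<xi>) = 0" if "i \<in> {1..N}" for i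
    using Q_less_cancel[of "i - 1" j] Q_less_cancel[of j i] that j by (force simp: indicator_def \<xi>)
  have 2: "indicat_real {Q i} (ereal \<xi>) = (if i = j then 1 else 0)" if "i \<in> {1..N - 1}" for i
  proof -
    have "i \<le> N" "j \<le> N" using that j by auto
    then show ?thesis using Q_inj[of i j] by (auto simp: indicator_def \<xi>)
  qed
  have "(\<Sum>i=1..N - 1. min (c i) (c (i + 1)) * indicator {Q i} (ereal \<xi>))
      = (\<Sum>i=1..N - 1. if i = j then min (c i) (c (i + 1)) else 0)"
    by (intro sum.cong refl) (simp add: 2)
  also have "\<dots> = min (c j) (c (j + 1))" using j by simp
  finally show ?thesis unfolding step_cost_def using 1 by simp
qed

text \<open>At a boundary \<open>Q n\<close> the cost is the smaller of the two neighbouring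
  constants, hence the constant of one of the two closed tiers that meet there.\<close>

lemma K_cases:
  assumes "0 < \<xi>"
  obtains n where "n \<in> {1..N}" "Q (n - 1) \<le> ereal \<xi>" "ereal \<xi> \<le> Q n" "K \<xi> = c n"
proof -
  define n where "n = (LEAST n. ereal \<xi> \<le> Q n)"
  have n: "ereal \<xi> \<le> Q n" unfolding n_def by (rule LeastI[of _ N]) (simp add: Q_N)
  have nN: "n \<le> N" unfolding n_def by (rule Least_le) (simp add: Q_N)
  have n1: "1 \<le> n" using n assms Q_0 by (cases n) (auto simp: zero_ereal_def)
  have below: "Q (n - 1) < ereal \<xi>"
    using not_less_Least[of "n - 1" "\<lambda>n. ereal \<xi> \<le> Q n"] n1 by (auto simp: n_def[symmetric])
  show thesis
  proof (cases "ereal \<xi> < Q n")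
    case True
    then show ?thesis using K_interior[of n \<xi>] below n n1 nN by (intro that[of n]) auto
  next
    case False
    then have eq: "ereal \<xi> = Q n" using n by simp
    then have lt: "n < N" using nN Q_N by (cases "n = N") auto
    then have K: "K \<xi> = min (c n) (c (n + 1))" using K_boundary[of n \<xi>] eq n1 by auto
    show ?thesis
    proof (cases "c n \<le> c (n + 1)")
      case True
      then show ?thesis using K below n n1 nN by (intro that[of n]) auto
    next
      case False
      then show ?thesis using K eq lt Q_mono[of n "n + 1"] by (intro that[of "n + 1"]) auto
    qed
  qed
qed

lemma K_nonneg: "0 \<le> K \<xi>"
  unfolding step_cost_def using c_nonneg
  by (intro add_nonneg_nonneg sum_nonneg mult_nonneg_nonneg) (auto simp: min_def)

lemma K_small:
  obtains r where "0 < r" "\<And>\<xi>. 0 < \<xi> \<Longrightarrow> \<xi> < r \<Longrightarrow> K \<xi> = c 1"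
proof -
  have "0 < Q 1" using Q_strict[of 0 1] N_pos Q_0 by simp
  then obtain r where r: "0 < r" "ereal r < Q 1"
    using ereal_dense2[of 0 "Q 1"] by auto
  show thesis
  proof (rule that[OF r(1)])
    fix \<xi> :: real assume "0 < \<xi>" "\<xi> < r"
    then have "ereal \<xi> < Q 1" using r(2) by (metis less_ereal.simps(1) less_trans)
    then show "K \<xi> = c 1" using K_interior[of 1 \<xi>] \<open>0 < \<xi>\<close> N_pos Q_0 by auto
  qed
qed

lemma K_0: "K 0 = 0"
proof -
  have "\<not> (Q (n - 1) < 0 \<and> 0 < Q n)" if "n \<in> {1..N}" for n
  proof -
    have "n - 1 \<le> N" using that by auto
    then show ?thesis using Q_mono[of 0 "n - 1"] Q_0 by auto
  qed
  moreover have "Q n \<noteq> 0" if "n \<in> {1..N - 1}" for n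
  proof -
    have "0 < n" "n \<le> N" using that by auto
    then show ?thesis using Q_strict[of 0 n] Q_0 by auto
  qed
  ultimately show ?thesis unfolding step_cost_def by (auto simp: indicator_def zero_ereal_def[symmetric] intro!: sum.neutral)
qed

end

section \<open>The selection procedure and its minimality\<close>

locale inventory = holding_cost "lam \<mu> \<sigma>" h + tiers N Q c
  for \<mu> \<sigma> :: real and h :: "real \<Rightarrow> real" and N :: nat and Q :: "nat \<Rightarrow> ereal" and c :: "nat \<Rightarrow> real" +
  fixes k :: real
  assumes mu_pos: "0 < \<mu>" and sigma_pos: "0 < \<sigma>" and k_nonneg: "0 \<le> k"
begin

abbreviation "g \<equiv> g0 \<mu> \<sigma> h"
abbreviation "zs \<equiv> z_star \<mu> \<sigma> h"

lemma g_eq: "g z = m z / \<mu>"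
  using expmean_eq_LBINT[OF h_meas l_pos, of z] by (simp add: g0_def)

lemma is_z_star_iff: "is_z_star \<mu> \<sigma> h z \<longleftrightarrow> m z = h z"
  using expmean_eq_LBINT[OF h_meas l_pos, of z] by (simp add: is_z_star_def)

lemma z_star_ex1: "\<exists>!z. is_z_star \<mu> \<sigma> h z"
  unfolding is_z_star_iff by (rule crossing)

lemma m_zs: "m zs = h zs"
proof -
  have "is_z_star \<mu> \<sigma> h zs" unfolding z_star_def by (rule theI'[OF z_star_ex1])
  then show ?thesis by (simp only: is_z_star_iff)
qed

sublocale valley g zs
proof
  show "g y < g x" if "x < y" "y \<le> zs" for x y
    using m_dec[OF m_zs that(2,1)] mu_pos by (simp add: g_eq divide_strict_right_mono)
  show "g x < g y" if "zs \<le> x" "x < y" for x y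
    using m_inc[OF m_zs that] mu_pos by (simp add: g_eq divide_strict_right_mono)
  show "continuous_on UNIV g"
    unfolding g_eq using mu_pos by (intro continuous_intros m_cont) auto
  show "\<exists>z\<le>zs. C \<le> g z" "\<exists>z\<ge>zs. C \<le> g z" for C
  proof -
    obtain A where A: "0 \<le> A" "\<And>z. A \<le> \<bar>z\<bar> \<Longrightarrow> C * \<mu> \<le> m z" by (rule m_large) (auto intro: that)
    show "\<exists>z\<le>zs. C \<le> g z"
      using A mu_pos by (intro exI[of _ "min zs (- A)"]) (auto simp: g_eq field_simps)
    show "\<exists>z\<ge>zs. C \<le> g z"
      using A mu_pos by (intro exI[of _ "max zs A"]) (auto simp: g_eq field_simps)
  qed
qed

lemma Lam_eq: "Lam \<mu> \<sigma> h = width"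
  by (rule ext) (simp add: Lam_def width_def)

lemma g_zs: "g zs = h zs / \<mu>"
  by (simp add: g_eq m_zs)

lemma is_nu_hat_iff:
  "is_nu_hat \<mu> \<sigma> k h c n \<nu> \<longleftrightarrow> g zs \<le> - k + \<nu> / \<mu> \<and> excess (- k + \<nu> / \<mu>) = c n"
  unfolding is_nu_hat_def excess_def Lam_eq using mu_pos by (auto simp: g_zs field_simps)

lemma nu_hat_ex1: assumes "n \<in> {1..N}" shows "\<exists>!\<nu>. is_nu_hat \<mu> \<sigma> k h c n \<nu>"
proof -
  obtain v where v: "g zs \<le> v" "excess v = c n" and u: "\<And>w. g zs \<le> w \<and> excess w = c n \<Longrightarrow> w = v"
    using excess_ex1[OF c_nonneg[OF assms]] by blast
  show ?thesis
    unfolding is_nu_hat_iff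
  proof (rule ex1I[of _ "\<mu> * (v + k)"])
    show "g zs \<le> - k + \<mu> * (v + k) / \<mu> \<and> excess (- k + \<mu> * (v + k) / \<mu>) = c n"
      using v mu_pos by simp
    fix \<nu> assume "g zs \<le> - k + \<nu> / \<mu> \<and> excess (- k + \<nu> / \<mu>) = c n"
    from u[OF this] show "\<nu> = \<mu> * (v + k)" using mu_pos by (auto simp: field_simps)
  qed
qed

text \<open>Average costs are measured as levels of \<open>g\<close>: the rate \<open>\<nu>\<close>
  corresponds to the level \<open>\<nu> / \<mu> - k\<close>, and \<open>nu_hat\<close> of tier
  \<open>n\<close> to the level at which \<open>excess\<close> equals \<open>c n\<close>.\<close>

definition v_hat :: "nat \<Rightarrow> real" where "v_hat n = - k + nu_hat \<mu> \<sigma> k h c n / \<mu>"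

lemma nu_hat_eq: "nu_hat \<mu> \<sigma> k h c n = k * \<mu> + \<mu> * v_hat n"
  using mu_pos by (simp add: v_hat_def field_simps)

lemma v_hat: assumes "n \<in> {1..N}" shows "g zs \<le> v_hat n" "excess (v_hat n) = c n"
proof -
  have "is_nu_hat \<mu> \<sigma> k h c n (nu_hat \<mu> \<sigma> k h c n)"
    unfolding nu_hat_def by (rule theI'[OF nu_hat_ex1[OF assms]])
  then show "g zs \<le> v_hat n" "excess (v_hat n) = c n" by (auto simp: is_nu_hat_iff v_hat_def)
qed

lemma is_hat_levels_iff:
  assumes "n \<in> {1..N}"
  shows "is_hat_levels \<mu> \<sigma> k h c n p \<longleftrightarrow> p = (lo (v_hat n), hi (v_hat n))"
proof
  assume "is_hat_levels \<mu> \<sigma> k h c n p"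
  then have "fst p \<le> zs" "zs \<le> snd p" "g (fst p) = v_hat n" "g (snd p) = v_hat n"
    unfolding is_hat_levels_def v_hat_def by auto
  then show "p = (lo (v_hat n), hi (v_hat n))"
    using lo_eqI[of "fst p"] hi_eqI[of "snd p"] by (simp add: prod_eq_iff)
qed (use lo[OF v_hat(1)[OF assms]] hi[OF v_hat(1)[OF assms]] in \<open>auto simp: is_hat_levels_def v_hat_def\<close>)

lemma hat_levels_eq: "n \<in> {1..N} \<Longrightarrow> hat_levels \<mu> \<sigma> k h c n = (lo (v_hat n), hi (v_hat n))"
  unfolding hat_levels_def by (intro the_equality) (simp_all only: is_hat_levels_iff)

abbreviation "xihat \<equiv> xi_hat \<mu> \<sigma> k h c"
abbreviation "xistar \<equiv> xi_star \<mu> \<sigma> k h N Q c"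
abbreviation "Nless \<equiv> N_less \<mu> \<sigma> k h N Q c"
abbreviation "Neq \<equiv> N_eq \<mu> \<sigma> k h N Q c"
abbreviation "Ngreater \<equiv> N_greater \<mu> \<sigma> k h N Q c"
abbreviation "Nsel \<equiv> N_sel \<mu> \<sigma> k h N Q c"
abbreviation "lev \<equiv> levels \<mu> \<sigma> k h N Q c"
abbreviation "nusel \<equiv> nu_sel \<mu> \<sigma> k h N Q c"
abbreviation "nstar \<equiv> n_star \<mu> \<sigma> k h N Q c"

lemma xi_hat_eq: "n \<in> {1..N} \<Longrightarrow> xihat n = width (v_hat n)"
  using width_eq[OF v_hat(1)] by (simp add: xi_hat_def hat_levels_eq)

lemma tier_cases:
  assumes "n \<in> {1..N}"
  obtains (less) "n \<in> Nless" "n \<notin> Neq" "n \<notin> Ngreater" "ereal (xihat n) \<le> Q (n - 1)"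
      "xistar n = real_of_ereal (Q (n - 1))"
    | (greater) "n \<in> Ngreater" "n \<notin> Neq" "n \<notin> Nless" "Q n \<le> ereal (xihat n)"
      "xistar n = real_of_ereal (Q n)" "n < N"
    | (eq) "n \<in> Neq" "n \<notin> Nless" "n \<notin> Ngreater" "Q (n - 1) < ereal (xihat n)" "ereal (xihat n) < Q n"
      "xistar n = xihat n"
proof -
  have lt: "Q (n - 1) < Q n" using Q_strict[of "n - 1" n] assms by simp
  consider "ereal (xihat n) \<le> Q (n - 1)" | "Q n \<le> ereal (xihat n)"
    | "Q (n - 1) < ereal (xihat n)" "ereal (xihat n) < Q n" by force
  then show thesis
  proof cases
    case 1
    then have "ereal (xihat n) < Q n" using lt by simp
    then show ?thesis using 1 assms
      by (intro less) (auto simp: N_less_def N_eq_def N_greater_def xi_star_def not_le not_less)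
  next
    case 2
    then have "Q (n - 1) < ereal (xihat n)" using lt by simp
    moreover have "n < N" using 2 Q_N assms by (cases "n = N") auto
    ultimately show ?thesis using 2 assms
      by (intro greater) (auto simp: N_less_def N_eq_def N_greater_def xi_star_def not_le not_less)
  next
    case 3
    then show ?thesis using assms
      by (intro eq) (auto simp: N_less_def N_eq_def N_greater_def xi_star_def not_le not_less)
  qed
qed

text \<open>The rate of tier \<open>n\<close> with its constant extended to all order sizes; it
  differs from \<open>rate\<close> only where \<open>K (S - s) \<noteq> c n\<close>.\<close>

definition cl :: "nat \<Rightarrow> real \<Rightarrow> real \<Rightarrow> real" where
  "cl n s S = k * \<mu> + c n * \<mu> / (S - s) + \<mu> / (S - s) * (LBINT u:{s..S}. g u)"

definition rate :: "real \<Rightarrow> real \<Rightarrow> real" where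
  "rate s S = k * \<mu> + K (S - s) * \<mu> / (S - s) + \<mu> / (S - s) * (LBINT u:{s..S}. g u)"

lemma gamma_cost_eq: "s < S \<Longrightarrow> gamma_cost \<mu> \<sigma> k h K s S = ennreal (rate s S)"
proof -
  have "(LBINT u:{s..S}. g u) = lam \<mu> \<sigma> / \<mu> * (LBINT y:{s..S}. (LBINT u:{0..}. h (u + y) * exp (- lam \<mu> \<sigma> * u)))"
    unfolding g0_def by (subst set_integral_mult_right) simp
  then show "s < S \<Longrightarrow> ?thesis" using mu_pos by (simp add: gamma_cost_def rate_def)
qed

context
  assumes c1: "0 < c 1"
begin

text \<open>A zero size could arise only by clamping to the lower end of the first tier, but
  \<open>c 1 > 0\<close> puts \<open>v_hat 1\<close> above the minimum of \<open>g\<close> and so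
  makes \<open>xihat 1\<close> positive.\<close>

lemma xi_star_pos: assumes "n \<in> {1..N}" shows "0 < xistar n"
  using assms
proof (cases rule: tier_cases)
  case less
  have "n \<noteq> 1"
  proof
    assume [simp]: "n = 1"
    have "g zs \<noteq> v_hat 1" using v_hat[OF assms] excess_min c1 by auto
    then have "0 < width (v_hat 1)" using v_hat[OF assms] by (intro width_pos) auto
    then show False using less(4) xi_hat_eq[OF assms] Q_0 by (simp add: zero_ereal_def)
  qed
  then show ?thesis using less(5) Q_real(2)[of "n - 1"] assms by auto
next
  case greater
  then show ?thesis using Q_real(2)[of n] assms by auto
next
  case eq
  have "0 \<le> Q (n - 1)" using Q_mono[of 0 "n - 1"] Q_0 assms by auto
  then have "0 < ereal (xihat n)" using eq(4) by (rule le_less_trans)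
  then show ?thesis using eq(6) by simp
qed

lemma is_constrained_iff:
  "is_constrained_levels \<mu> \<sigma> k h N Q c n p \<longleftrightarrow> snd p - fst p = xistar n \<and> g (fst p) = g (snd p)"
  by (simp add: is_constrained_levels_def)

lemma lev_props:
  assumes n: "n \<in> {1..N}"
  shows "snd (lev n) - fst (lev n) = xistar n" "g (fst (lev n)) = g (snd (lev n))"
    "fst (lev n) < snd (lev n)"
proof -
  have "snd (lev n) - fst (lev n) = xistar n \<and> g (fst (lev n)) = g (snd (lev n))"
  proof (cases "n \<in> Neq")
    case True
    have "xistar n = xihat n" using n by (cases rule: tier_cases) (use True in auto)
    then show ?thesis
      using True lo(2)[OF v_hat(1)[OF n]] hi(2)[OF v_hat(1)[OF n]] hat_levels_eq[OF n]
      by (auto simp: levels_def xi_hat_def)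
  next
    case False
    then show ?thesis
      using theI'[OF interval_ex1[OF xi_star_pos[OF n]]]
      by (simp add: levels_def is_constrained_iff[abs_def])
  qed
  then show "snd (lev n) - fst (lev n) = xistar n" "g (fst (lev n)) = g (snd (lev n))"
    "fst (lev n) < snd (lev n)"
    using xi_star_pos[OF n] by auto
qed

text \<open>On its tier, the candidate of tier \<open>n\<close> minimises the cost with constant setup cost \<open>c n\<close>:
  by Fenchel--Young, it suffices to compare \<open>(c n - excess w) / \<xi>\<close> for the level
  \<open>w\<close> of the candidate, and the sign of \<open>c n - excess w\<close> is determined by the side on which
  \<open>xihat n\<close> was clamped.\<close>

lemma cl_minimal:
  assumes n: "n \<in> {1..N}" and \<xi>: "0 < \<xi>" "Q (n - 1) \<le> ereal \<xi>" "ereal \<xi> \<le> Q n"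
  shows "cl n (fst (lev n)) (snd (lev n)) \<le> cl n z (z + \<xi>)"
proof -
  define s where "s = fst (lev n)"
  define S where "S = snd (lev n)"
  define w where "w = g s"
  define q where "q = xistar n"
  note P = lev_props[OF n, folded s_def S_def q_def]
  have q: "0 < q" using P by simp
  have w: "g zs \<le> w" unfolding w_def by (rule g_min)
  have sS: "lo w = s" "hi w = S" using equal_ends_lo_hi[OF P(3,2)] by (auto simp: w_def)
  have width_w: "width w = q" using width_eq[OF w] sS P(1) by simp
  \<comment> \<open>The candidate size is \<open>xihat n\<close> projected onto the closed tier, so
    it lies between \<open>xihat n\<close> and every \<open>\<xi>\<close> of the tier.\<close>
  have qv: "q = xihat n \<or> (q \<le> xihat n \<and> \<xi> \<le> q) \<or> (xihat n \<le> q \<and> q \<le> \<xi>)"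
    using n
  proof (cases rule: tier_cases)
    case less
    have "n \<noteq> 1" using less(5) q Q_0 by (auto simp: q_def)
    then have "ereal q = Q (n - 1)" using Q_real(1)[of "n - 1"] less(5) n by (auto simp: q_def)
    then show ?thesis using less(4) \<xi>(2) by (metis ereal_less_eq(3))
  next
    case greater
    then have "ereal q = Q n" using Q_real(1)[of n] n by (auto simp: q_def)
    then show ?thesis using greater(4) \<xi>(3) by (metis ereal_less_eq(3))
  next
    case eq then show ?thesis by (simp add: q_def)
  qed
  note vh = v_hat[OF n] note xh = xi_hat_eq[OF n]
  have hilo: "(c n - excess w) / q \<le> (c n - excess w) / \<xi>"
  proof -
    have w_v: "w = v_hat n" if "width w = width (v_hat n)"
    proof (rule ccontr)
      assume "w \<noteq> v_hat n"
      then consider "w < v_hat n" | "v_hat n < w" by linarith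
      then show False
      proof cases
        case 1
        then have "lo (v_hat n) \<noteq> lo w" using lo(2)[OF w] lo(2)[OF vh(1)] by auto
        then show False
          using lo_hi_mono[OF w, of "v_hat n"] 1 width_eq[OF w] width_eq[OF vh(1)] that by auto
      next
        case 2
        then have "lo (v_hat n) \<noteq> lo w" using lo(2)[OF w] lo(2)[OF vh(1)] by auto
        then show False
          using lo_hi_mono[OF vh(1), of w] 2 width_eq[OF w] width_eq[OF vh(1)] that by auto
      qed
    qed
    have le: "excess w \<le> c n" if "q \<le> xihat n"
    proof (cases "q = xihat n")
      case True then show ?thesis using w_v width_w xh vh(2) by simp
    next
      case False
      then have "width w < width (v_hat n)" using that width_w xh by linarith
      then have "w \<le> v_hat n" by (intro less_imp_le[OF width_less_imp])
      from excess_mono[OF w this] show ?thesis using vh(2) by linarith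
    qed
    have ge: "c n \<le> excess w" if "xihat n \<le> q"
    proof (cases "q = xihat n")
      case True then show ?thesis using w_v width_w xh vh(2) by simp
    next
      case False
      then have "width (v_hat n) < width w" using that width_w xh by linarith
      then have "v_hat n \<le> w" by (intro less_imp_le[OF width_less_imp])
      from excess_mono[OF vh(1) this] show ?thesis using vh(2) by linarith
    qed
    from qv show ?thesis
    proof (elim disjE conjE)
      assume "q = xihat n"
      then have "c n = excess w" using le ge by linarith
      then show ?thesis by simp
    next
      assume "q \<le> xihat n" "\<xi> \<le> q"
      moreover have "0 \<le> c n - excess w" using le \<open>q \<le> xihat n\<close> by linarith
      ultimately show ?thesis using \<xi>(1) q by (intro divide_left_mono mult_pos_pos)
    next
      assume "xihat n \<le> q" "q \<le> \<xi>"
      moreover have "c n - excess w \<le> 0" using ge \<open>xihat n \<le> q\<close> by linarith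
      ultimately show ?thesis using \<xi>(1) q by (intro divide_left_mono_neg mult_pos_pos)
    qed
  qed
  \<comment> \<open>The candidate is the sublevel interval of \<open>w\<close>, so Fenchel--Young is
    an equality for it; for the competitor the inequality is used below at the same
    \<open>w\<close>.\<close>
  have "(LBINT u:{s..S}. g u) = w * q - excess w"
    using fenchel_eq[OF w] sS P(1) by simp
  then have "cl n s S = k * \<mu> + c n * \<mu> / q + \<mu> / q * (w * q - excess w)"
    by (simp only: cl_def P(1))
  also have "\<dots> = k * \<mu> + \<mu> * ((c n - excess w) / q + w)"
    using q by (simp add: field_simps)
  also have "\<dots> \<le> k * \<mu> + \<mu> * ((c n - excess w) / \<xi> + w)"
    using hilo mu_pos by simp
  also have "\<dots> = k * \<mu> + \<mu> * (c n + (w * \<xi> - excess w)) / \<xi>"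
    using \<xi>(1) by (simp add: field_simps)
  also have "\<dots> \<le> k * \<mu> + \<mu> * (c n + (LBINT u:{z..z + \<xi>}. g u)) / \<xi>"
    using fenchel_young[OF w, of z "z + \<xi>"] \<xi>(1) mu_pos
    by (intro add_left_mono divide_right_mono mult_left_mono) auto
  also have "\<dots> = cl n z (z + \<xi>)" using \<xi>(1) by (simp add: cl_def field_simps)
  finally show ?thesis unfolding s_def S_def .
qed

lemma xi_star_range: assumes n: "n \<in> {1..N}"
  shows "Q (n - 1) \<le> ereal (xistar n)" "ereal (xistar n) \<le> Q n"
proof -
  have lt: "Q (n - 1) < Q n" using Q_strict[of "n - 1" n] n by simp
  have "Q (n - 1) \<le> ereal (xistar n) \<and> ereal (xistar n) \<le> Q n"
    using n
  proof (cases rule: tier_cases)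
    case less
    have "n \<noteq> 1" using less(5) xi_star_pos[OF n] Q_0 by auto
    then show ?thesis using less(5) lt Q_real(1)[of "n - 1"] n by auto
  next
    case greater
    then show ?thesis using lt Q_real(1)[of n] n by auto
  qed auto
  then show "Q (n - 1) \<le> ereal (xistar n)" "ereal (xistar n) \<le> Q n" by auto
qed

text \<open>A candidate on a tier boundary is charged the smaller of two constants; if that is not
  \<open>c n\<close>, it belongs to a cheaper tier whose closure contains the size.\<close>

lemma K_xi_star:
  assumes n: "n \<in> {1..N}"
  obtains "K (xistar n) = c n"
    | n' where "n' \<in> {1..N}" "K (xistar n) = c n'" "c n' < c n"
      "Q (n' - 1) \<le> ereal (xistar n)" "ereal (xistar n) \<le> Q n'"
proof -
  obtain n' where n': "n' \<in> {1..N}" "Q (n' - 1) \<le> ereal (xistar n)" "ereal (xistar n) \<le> Q n'"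
      "K (xistar n) = c n'" by (rule K_cases[OF xi_star_pos[OF n]]) (auto intro: that)
  have "K (xistar n) \<le> c n"
  proof (cases "Q (n - 1) < ereal (xistar n) \<and> ereal (xistar n) < Q n")
    case True then show ?thesis using K_interior[OF n] by auto
  next
    case False
    then consider "ereal (xistar n) = Q (n - 1)" | "ereal (xistar n) = Q n"
      using xi_star_range[OF n] by force
    then show ?thesis
    proof cases
      case 1
      have "n \<noteq> 1" using 1 xi_star_pos[OF n] Q_0 by (auto simp: zero_ereal_def)
      then have "n - 1 \<in> {1..N - 1}" "n - 1 + 1 = n" using n by auto
      then show ?thesis using K_boundary[of "n - 1" "xistar n"] 1 by simp
    next
      case 2
      then have "n \<noteq> N" using Q_N by auto
      then have "n \<in> {1..N - 1}" using n by auto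
      then show ?thesis using K_boundary[of n "xistar n"] 2 by simp
    qed
  qed
  then show thesis using n' that by (cases "c n' = c n") auto
qed

text \<open>If the constant of tier \<open>n\<close> overcharges its candidate, a cheaper tier
  \<open>n'\<close> contains the same size, and the candidate of \<open>n'\<close> is at least as
  good. The number of tiers with a smaller constant drops, so the chain ends in
  \<open>Nsel\<close>.\<close>

lemma cl_dominated:
  assumes "n \<in> {1..N}"
  shows "\<exists>i\<in>Nsel. cl i (fst (lev i)) (snd (lev i)) \<le> cl n (fst (lev n)) (snd (lev n))"
  using assms
proof (induction "card {i \<in> {1..N}. c i < c n}" arbitrary: n rule: less_induct)
  case less
  note n = less.prems
  from n show ?case
  proof (cases rule: K_xi_star)
    case 1
    then show ?thesis using n by (auto simp: N_sel_def)
  next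
    case (2 n')
    have "{i \<in> {1..N}. c i < c n'} \<subset> {i \<in> {1..N}. c i < c n}" using 2 by auto
    then have "card {i \<in> {1..N}. c i < c n'} < card {i \<in> {1..N}. c i < c n}"
      by (intro psubset_card_mono) auto
    from less.hyps[OF this 2(1)] obtain i where
      i: "i \<in> Nsel" "cl i (fst (lev i)) (snd (lev i)) \<le> cl n' (fst (lev n')) (snd (lev n'))" by blast
    note i(2)
    also have "\<dots> \<le> cl n' (fst (lev n)) (fst (lev n) + xistar n)"
      by (rule cl_minimal[OF 2(1) xi_star_pos[OF n] 2(4,5)])
    also have "\<dots> = cl n' (fst (lev n)) (snd (lev n))"
      using lev_props(1)[OF n] by (simp add: algebra_simps)
    also have "\<dots> \<le> cl n (fst (lev n)) (snd (lev n))"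
      using 2(3) mu_pos lev_props(3)[OF n] unfolding cl_def
      by (intro add_right_mono add_left_mono divide_right_mono mult_right_mono) auto
    finally show ?thesis using i(1) by blast
  qed
qed

text \<open>For \<open>n \<in> Neq\<close> the interval has level \<open>v_hat n\<close> with
  \<open>excess (v_hat n) = c n\<close>, so setup cost and excess cancel in the Fenchel--Young
  equality and the rate is \<open>k * \<mu> + \<mu> * v_hat n\<close>.\<close>

lemma Nsel_props:
  assumes "n \<in> Nsel"
  shows "n \<in> {1..N}" "nusel n = cl n (fst (lev n)) (snd (lev n))"
    "rate (fst (lev n)) (snd (lev n)) = cl n (fst (lev n)) (snd (lev n))"
proof -
  show n: "n \<in> {1..N}" using assms by (simp add: N_sel_def)
  have K: "K (xistar n) = c n" using assms by (simp add: N_sel_def)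
  show "rate (fst (lev n)) (snd (lev n)) = cl n (fst (lev n)) (snd (lev n))"
    using lev_props(1)[OF n] K by (simp add: rate_def cl_def)
  show "nusel n = cl n (fst (lev n)) (snd (lev n))"
  proof (cases "n \<in> Neq")
    case True
    have pos: "0 < hi (v_hat n) - lo (v_hat n)"
      using lev_props(3)[OF n] True by (simp add: levels_def hat_levels_eq[OF n])
    define D where "D = hi (v_hat n) - lo (v_hat n)"
    have "cl n (lo (v_hat n)) (hi (v_hat n)) = k * \<mu> + c n * \<mu> / D + \<mu> / D * (v_hat n * D - c n)"
      using fenchel_eq[OF v_hat(1)[OF n]] v_hat(2)[OF n] by (simp add: cl_def D_def)
    also have "\<dots> = k * \<mu> + \<mu> * v_hat n" using pos by (simp add: D_def[symmetric] field_simps)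
    finally have "cl n (lo (v_hat n)) (hi (v_hat n)) = k * \<mu> + \<mu> * v_hat n" .
    then show ?thesis
      using True by (simp add: nu_sel_def levels_def hat_levels_eq[OF n] nu_hat_eq)
  next
    case False
    then show ?thesis using lev_props(1)[OF n] K by (simp add: nu_sel_def cl_def)
  qed
qed

lemma Nsel_nonempty: "Nsel \<noteq> {}"
  using cl_dominated[of 1] N_pos by auto

lemma n_star: "nstar \<in> Nsel" "i \<in> Nsel \<Longrightarrow> nusel nstar \<le> nusel i"
proof -
  have fin: "finite Nsel" by (simp add: N_sel_def)
  define A where "A = {n \<in> Nsel. \<forall>i\<in>Nsel. nusel n \<le> nusel i}"
  obtain n where "n \<in> Nsel" "\<forall>i\<in>Nsel. nusel n \<le> nusel i"
    using ex_min_if_finite[of "nusel ` Nsel"] fin Nsel_nonempty by (force simp: not_less)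
  then have "A \<noteq> {}" by (auto simp: A_def)
  then have "Min A \<in> A" using fin by (intro Min_in) (auto simp: A_def)
  then show "nstar \<in> Nsel" "i \<in> Nsel \<Longrightarrow> nusel nstar \<le> nusel i"
    by (auto simp: n_star_def A_def)
qed

lemma s_less_S: "s_star \<mu> \<sigma> k h N Q c < S_star \<mu> \<sigma> k h N Q c"
  unfolding s_star_def S_star_def using lev_props(3) Nsel_props(1) n_star(1) by blast

text \<open>\<open>K_cases\<close> places \<open>\<xi>\<close> in a closed tier that charges exactly
  \<open>K \<xi>\<close>, where \<open>cl\<close> and \<open>rate\<close> agree; minimality within
  the tier, domination by \<open>Nsel\<close> and the choice of \<open>nstar\<close> then chain
  up.\<close>

lemma selection_optimal:
  assumes "0 < \<xi>"
  shows "rate (s_star \<mu> \<sigma> k h N Q c) (S_star \<mu> \<sigma> k h N Q c) \<le> rate z (z + \<xi>)"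
proof -
  obtain n where n: "n \<in> {1..N}" "Q (n - 1) \<le> ereal \<xi>" "ereal \<xi> \<le> Q n" "K \<xi> = c n"
    by (rule K_cases[OF assms]) (auto intro: that)
  obtain i where i: "i \<in> Nsel" "cl i (fst (lev i)) (snd (lev i)) \<le> cl n (fst (lev n)) (snd (lev n))"
    using cl_dominated[OF n(1)] by blast
  have "rate (s_star \<mu> \<sigma> k h N Q c) (S_star \<mu> \<sigma> k h N Q c) = nusel nstar"
    using Nsel_props(2,3)[OF n_star(1)] by (simp add: s_star_def S_star_def)
  also have "\<dots> \<le> nusel i" by (rule n_star(2)[OF i(1)])
  also have "\<dots> \<le> cl n (fst (lev n)) (snd (lev n))" using Nsel_props(2)[OF i(1)] i(2) by simp
  also have "\<dots> \<le> cl n z (z + \<xi>)" by (rule cl_minimal[OF n(1) assms n(2,3)])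
  also have "\<dots> = rate z (z + \<xi>)" using n(4) by (simp add: cl_def rate_def)
  finally show ?thesis .
qed

lemma well_defined: "selection_well_defined \<mu> \<sigma> k h N Q c"
  unfolding selection_well_defined_def
proof (intro conjI ballI)
  show "\<exists>!z. is_z_star \<mu> \<sigma> h z" by (rule z_star_ex1)
  show "Nsel \<noteq> {}" by (rule Nsel_nonempty)
  fix n
  show "\<exists>!\<nu>. is_nu_hat \<mu> \<sigma> k h c n \<nu>" "\<exists>!p. is_hat_levels \<mu> \<sigma> k h c n p" if "n \<in> {1..N}"
    using nu_hat_ex1[OF that] is_hat_levels_iff[OF that] by auto
  show "\<exists>!p. is_constrained_levels \<mu> \<sigma> k h N Q c n p" if "n \<in> Nsel - Neq"
    unfolding is_constrained_iff by (rule interval_ex1[OF xi_star_pos]) (use that Nsel_props(1) in auto)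
qed

end

end

section \<open>Truncated test functions\<close>

lemma ex_antiderivative:
  fixes p :: "real \<Rightarrow> real"
  assumes "continuous_on UNIV p"
  obtains f where "\<And>x. (f has_real_derivative p x) (at x)"
proof
  fix x :: real
  have "((\<lambda>u. LBINT y=ereal 0..ereal u. p y) has_vector_derivative p x) (at x within {min 0 x - 1..max 0 x + 1})"
    by (rule interval_integral_FTC2) (use assms in \<open>auto intro: continuous_on_subset\<close>)
  moreover have "at x within {min 0 x - 1..max 0 x + 1} = at x"
    by (rule at_within_interior) auto
  ultimately show "((\<lambda>z. LBINT y=ereal 0..ereal z. p y) has_real_derivative p x) (at x)"
    by (simp only: has_real_derivative_iff_has_vector_derivative)
qed

lemma LBINT_FTC:
  fixes p f :: "real \<Rightarrow> real"
  assumes "continuous_on UNIV p" "\<And>x. (f has_real_derivative p x) (at x)" "a \<le> b"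
  shows "(LBINT u:{a..b}. p u) = f b - f a"
proof -
  have "(LBINT u. p u * indicator {a..b} u) = f b - f a"
    by (rule integral_FTC_Icc_real[OF assms(3,2)])
       (use assms(1) in \<open>auto simp: continuous_on_eq_continuous_at\<close>)
  then show ?thesis by (simp add: set_lebesgue_integral_def mult.commute)
qed

lemma deriv_lower_bound:
  fixes f p :: "real \<Rightarrow> real"
  assumes d: "\<And>x. (f has_real_derivative p x) (at x)" and "a \<le> b"
    and "\<And>x. a \<le> x \<Longrightarrow> x \<le> b \<Longrightarrow> C \<le> p x"
  shows "C * (b - a) \<le> f b - f a"
proof (cases "a = b")
  case False
  then obtain z where z: "a < z" "z < b" "f b - f a = (b - a) * p z"
    using MVT2[where f=f and f'=p and a=a and b=b] d assms(2) by auto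
  then show ?thesis using assms(2) assms(3)[of z] by (simp add: mult.commute[of C] mult_left_mono)
qed simp

lemma deriv_upper_bound:
  fixes f p :: "real \<Rightarrow> real"
  assumes d: "\<And>x. (f has_real_derivative p x) (at x)" and "a \<le> b"
    and "\<And>x. a \<le> x \<Longrightarrow> x \<le> b \<Longrightarrow> p x \<le> C"
  shows "f b - f a \<le> C * (b - a)"
proof -
  have "((\<lambda>x. - f x) has_real_derivative - p x) (at x)" for x by (intro DERIV_minus d)
  then show ?thesis
    using deriv_lower_bound[of "\<lambda>x. - f x" "\<lambda>x. - p x" a b "- C"] assms(2,3) by auto
qed

lemma deriv_lipschitz:
  fixes f p :: "real \<Rightarrow> real"
  assumes d: "\<And>x. (f has_real_derivative p x) (at x)" and b: "\<And>x. \<bar>p x\<bar> \<le> C"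
  shows "\<bar>f x - f y\<bar> \<le> C * \<bar>x - y\<bar>"
proof -
  have p: "- C \<le> p x" "p x \<le> C" for x using b[of x] by auto
  have "\<bar>f x - f y\<bar> \<le> C * \<bar>x - y\<bar>" if "x \<le> y" for x y
    using deriv_lower_bound[OF d that, of "- C"] deriv_upper_bound[OF d that, of C] p that
    by (auto simp: abs_le_iff)
  from this[of x y] this[of y x] show ?thesis by (cases "x \<le> y") (auto simp: abs_minus_commute)
qed

text \<open>Regularity that suffices for a second-order expansion of \<open>E f (z + X\<^sub>t)\<close> at \<open>t = 0\<close>,
  uniformly in \<open>z\<close>.\<close>

locale test_function =
  fixes f p q :: "real \<Rightarrow> real" and P R L :: real
  assumes f_deriv: "\<And>x. (f has_real_derivative p x) (at x)"
    and p_deriv: "\<And>x. (p has_real_derivative q x) (at x)"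
    and p_bound: "\<And>x. \<bar>p x\<bar> \<le> P" and q_bound: "\<And>x. \<bar>q x\<bar> \<le> R"
    and q_lipschitz: "\<And>x y. \<bar>q x - q y\<bar> \<le> L * \<bar>x - y\<bar>"
begin

lemma f_lipschitz: "\<bar>f x - f y\<bar> \<le> P * \<bar>x - y\<bar>"
  by (rule deriv_lipschitz[OF f_deriv p_bound])

lemma p_lipschitz: "\<bar>p x - p y\<bar> \<le> R * \<bar>x - y\<bar>"
  by (rule deriv_lipschitz[OF p_deriv q_bound])

lemma bounds_nonneg: "0 \<le> P" "0 \<le> R" "0 \<le> L"
  using p_bound[of 0] q_bound[of 0] q_lipschitz[of 0 1] by auto

lemma f_meas [measurable]: "f \<in> borel_measurable borel"
  and p_meas [measurable]: "p \<in> borel_measurable borel"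
  by (intro borel_measurable_continuous_onI DERIV_continuous_on[of _ f p] DERIV_continuous_on[of _ p q]
      DERIV_subset[OF f_deriv] DERIV_subset[OF p_deriv]; simp)+

lemma q_meas [measurable]: "q \<in> borel_measurable borel"
proof (rule borel_measurable_continuous_onI)
  have "L-lipschitz_on UNIV q"
    using q_lipschitz bounds_nonneg by (intro lipschitz_onI) (auto simp: dist_real_def)
  then show "continuous_on UNIV q" by (rule lipschitz_on_continuous_on)
qed

text \<open>The Lagrange remainder of order two evaluates \<open>q\<close> within
  \<open>\<bar>d\<bar>\<close> of \<open>x\<close>; the Lipschitz condition on \<open>q\<close>
  stands in for a third derivative.\<close>

lemma taylor: "\<bar>f (x + d) - f x - p x * d - q x * d\<^sup>2 / 2\<bar> \<le> L * \<bar>d\<bar> ^ 3"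
proof (cases "d = 0")
  case False
  define D where "D m = (if m = 0 then f else if m = 1 then p else q)" for m :: nat
  have "\<exists>t. (if x + d < x then x + d < t \<and> t < x else x < t \<and> t < x + d) \<and>
      f (x + d) = (\<Sum>m<2. D m x / fact m * (x + d - x) ^ m) + D 2 t / fact 2 * (x + d - x) ^ 2"
    by (rule Taylor[of 2 D f "min x (x + d)" "max x (x + d)"])
       (use False f_deriv p_deriv in \<open>auto simp: less_2_cases_iff D_def\<close>)
  then obtain t where t: "if x + d < x then x + d < t \<and> t < x else x < t \<and> t < x + d"
    and eq: "f (x + d) = (\<Sum>m<2. D m x / fact m * (x + d - x) ^ m) + D 2 t / fact 2 * (x + d - x) ^ 2"
    by blast
  have t: "\<bar>x - t\<bar> \<le> \<bar>d\<bar>" "f (x + d) = f x + p x * d + q t * d\<^sup>2 / 2"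
    using t eq by (auto simp: numeral_2_eq_2 D_def split: if_splits)
  have "\<bar>f (x + d) - f x - p x * d - q x * d\<^sup>2 / 2\<bar> = \<bar>q t - q x\<bar> * d\<^sup>2 / 2"
    by (simp add: t(2) left_diff_distrib[symmetric] diff_divide_distrib[symmetric] abs_mult)
  also have "\<dots> \<le> (L * \<bar>d\<bar>) * d\<^sup>2"
  proof -
    have "\<bar>q t - q x\<bar> \<le> L * \<bar>t - x\<bar>" by (rule q_lipschitz)
    also have "\<dots> \<le> L * \<bar>d\<bar>" using t(1) bounds_nonneg by (intro mult_left_mono) auto
    finally have "\<bar>q t - q x\<bar> * d\<^sup>2 \<le> (L * \<bar>d\<bar>) * d\<^sup>2" by (rule mult_right_mono) simp
    moreover have "0 \<le> \<bar>q t - q x\<bar> * d\<^sup>2" by simp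
    ultimately show ?thesis by linarith
  qed
  also have "\<dots> = L * \<bar>d\<bar> ^ 3"
  proof -
    have "\<bar>d\<bar> ^ 3 = \<bar>d\<bar> * d\<^sup>2" by (simp add: power3_eq_cube power2_eq_square mult.assoc)
    then show ?thesis by (simp only: mult.assoc)
  qed
  finally show ?thesis .
qed simp

end

context inventory
begin

lemma truncated_test_function:
  assumes A: "0 \<le> A" and f: "\<And>x. (f has_real_derivative mc A x / \<mu> - C) (at x)"
  shows "\<exists>P R L. test_function f (\<lambda>x. mc A x / \<mu> - C) (\<lambda>x. lam \<mu> \<sigma> / \<mu> * (mc A x - hc A x)) P R L"
proof (intro exI, unfold_locales)
  let ?l = "lam \<mu> \<sigma>"
  define D where "D = h A + h (- A)"
  have b: "0 \<le> mc A x" "mc A x \<le> D" "0 \<le> hc A x" "hc A x \<le> D" for x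
    using mc_nonneg mc_bound[OF A] hc_nonneg hc_bound[OF A] by (auto simp: D_def)
  have d: "\<bar>mc A x - hc A x\<bar> \<le> D" for x using b[of x] by auto
  show "((\<lambda>x. mc A x / \<mu> - C) has_real_derivative ?l / \<mu> * (mc A x - hc A x)) (at x)" for x
    using mu_pos by (auto intro!: derivative_eq_intros mc_deriv[OF A])
  show "\<bar>mc A x / \<mu> - C\<bar> \<le> D / \<mu> + \<bar>C\<bar>" for x
  proof -
    have "0 \<le> mc A x / \<mu>" "mc A x / \<mu> \<le> D / \<mu>" using b mu_pos by (auto intro: divide_right_mono)
    then show ?thesis by linarith
  qed
  show "\<bar>?l / \<mu> * (mc A x - hc A x)\<bar> \<le> ?l / \<mu> * D" for x
    using mu_pos l_pos d[of x] by (simp add: abs_mult mult_left_mono divide_right_mono)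
  fix x y
  have "\<bar>mc A x - mc A y\<bar> \<le> ?l * D * \<bar>x - y\<bar>"
    by (rule deriv_lipschitz[OF mc_deriv[OF A]]) (use d l_pos in \<open>simp add: abs_mult\<close>)
  moreover have "\<bar>hc A x - hc A y\<bar> \<le> (h (A + 1) + h (- A - 1)) * \<bar>x - y\<bar>"
    by (rule hc_lipschitz[OF A])
  ultimately have "\<bar>(mc A x - hc A x) - (mc A y - hc A y)\<bar>
      \<le> (?l * D + (h (A + 1) + h (- A - 1))) * \<bar>x - y\<bar>"
    by (simp add: distrib_right)
  then have "?l / \<mu> * \<bar>(mc A x - hc A x) - (mc A y - hc A y)\<bar>
      \<le> ?l / \<mu> * ((?l * D + (h (A + 1) + h (- A - 1))) * \<bar>x - y\<bar>)"
    using mu_pos l_pos by (intro mult_left_mono) auto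
  moreover have "\<bar>?l / \<mu> * (mc A x - hc A x) - ?l / \<mu> * (mc A y - hc A y)\<bar>
      = ?l / \<mu> * \<bar>(mc A x - hc A x) - (mc A y - hc A y)\<bar>"
  proof -
    have "?l / \<mu> * (mc A x - hc A x) - ?l / \<mu> * (mc A y - hc A y)
      = ?l / \<mu> * ((mc A x - hc A x) - (mc A y - hc A y))" by (simp only: right_diff_distrib)
    then show ?thesis using mu_pos l_pos by (simp only: abs_mult) simp
  qed
  ultimately show "\<bar>?l / \<mu> * (mc A x - hc A x) - ?l / \<mu> * (mc A y - hc A y)\<bar>
      \<le> (?l / \<mu> * (?l * D + (h (A + 1) + h (- A - 1)))) * \<bar>x - y\<bar>"
    by (simp only: mult.assoc)
qed (rule f)

text \<open>Truncating \<open>h\<close> costs an arbitrarily small \<open>\<epsilon>\<close>: outside a large interval the derivative of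
  the test function plus \<open>k\<close> is at least \<open>1\<close>, so an increment that leaves this interval is
  nonnegative without the help of \<open>Kf\<close>.\<close>

lemma truncation:
  assumes Kf: "\<And>\<xi>. 0 \<le> Kf \<xi>"
    and base: "\<And>z \<xi>. 0 < \<xi> \<Longrightarrow> 0 \<le> (LBINT u:{z..z + \<xi>}. g u) + (k - \<nu> / \<mu>) * \<xi> + Kf \<xi>"
    and eps: "0 < \<epsilon>"
  obtains A where "0 \<le> A"
    "\<And>f z \<xi>. (\<And>u. (f has_real_derivative mc A u / \<mu> - (\<nu> - \<epsilon>) / \<mu>) (at u)) \<Longrightarrow> 0 < \<xi> \<Longrightarrow>
       0 \<le> f (z + \<xi>) - f z + k * \<xi> + Kf \<xi>"
proof -
  obtain \<alpha> C where a: "0 < \<alpha>" "\<And>A z. 0 \<le> A \<Longrightarrow> \<alpha> * min A \<bar>z\<bar> - C \<le> mc A z"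
    "\<And>z. \<alpha> * \<bar>z\<bar> - C \<le> m z"
    by (rule mc_linear_lower) (auto intro: that)
  \<comment> \<open>The derivative of the untruncated potential plus \<open>k * z\<close>;
    \<open>base\<close> says that its antiderivative drops by at most \<open>Kf \<xi>\<close> over a
    length \<open>\<xi>\<close>.\<close>
  define W where "W u = g u + k - \<nu> / \<mu>" for u
  have W_cont: "continuous_on UNIV W" unfolding W_def by (intro continuous_intros cont)
  obtain w where w: "\<And>x. (w has_real_derivative W x) (at x)" using ex_antiderivative[OF W_cont] by blast
  \<comment> \<open>Beyond \<open>a\<close> the truncated derivative is at least \<open>1\<close>
    for every \<open>A \<ge> a\<close>, by the lower bound that is uniform in
    \<open>A\<close>.\<close>
  define a where "a = max 0 ((\<mu> * (1 + \<nu> / \<mu> - k) + C) / \<alpha>)"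
  have a0: "0 \<le> a" by (simp add: a_def)
  have "(\<mu> * (1 + \<nu> / \<mu> - k) + C) / \<alpha> \<le> a" by (simp add: a_def)
  then have aC: "\<mu> * (1 + \<nu> / \<mu> - k) \<le> \<alpha> * a - C" using a(1) by (simp add: field_simps)
  have "compact (W ` {- a..a})"
    by (intro compact_continuous_image continuous_intros continuous_on_subset[OF W_cont]) auto
  then obtain D' where D': "\<And>y. y \<in> W ` {- a..a} \<Longrightarrow> norm y \<le> D'"
    using compact_imp_bounded bounded_iff by metis
  have D': "\<bar>W u\<bar> \<le> D'" if "\<bar>u\<bar> \<le> a" for u
    using D'[of "W u"] that by (auto simp: abs_le_iff)
  define D where "D = max 0 D'"
  have D: "\<bar>W u\<bar> \<le> D" if "\<bar>u\<bar> \<le> a" for u using D'[OF that] by (simp add: D_def)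
  have D0: "0 \<le> D" by (simp add: D_def)
  \<comment> \<open>On \<open>[- a, a]\<close> the truncated potential falls by at most
    \<open>2 * a * D\<close>; a stretch of length \<open>b - a\<close> with slope at least
    \<open>1\<close> makes up for this.\<close>
  define b where "b = a + 2 * a * D"
  have ab: "a \<le> b" using a0 D0 by (simp add: b_def)
  have "\<forall>\<^sub>F n in sequentially. m b - \<epsilon> < mc (real n) b"
    using mc_tendsto[of b] eps by (intro order_tendstoD) auto
  then have "\<forall>\<^sub>F n in sequentially. m b - \<epsilon> < mc (real n) b \<and> b \<le> real n"
    using eventually_ge_at_top[of "nat \<lceil>b\<rceil>"] by eventually_elim linarith
  \<comment> \<open>The truncation error on \<open>[- b, b]\<close> is largest at \<open>b\<close>;
    once it is below \<open>\<epsilon>\<close> there, lowering \<open>\<nu>\<close> by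
    \<open>\<epsilon>\<close> offsets it on the whole interval.\<close>
  then obtain n where n: "m b - \<epsilon> < mc (real n) b" "b \<le> real n"
    by (auto simp: eventually_sequentially)
  define A where "A = real n"
  have A: "0 \<le> A" "a \<le> A" using n ab a0 by (auto simp: A_def)
  define Pk where "Pk u = mc A u / \<mu> - (\<nu> - \<epsilon>) / \<mu> + k" for u
  have P1: "1 \<le> Pk u" if "a \<le> \<bar>u\<bar>" for u
  proof -
    have "\<alpha> * a \<le> \<alpha> * min A \<bar>u\<bar>" using that A a(1) by (intro mult_left_mono) auto
    then have "\<mu> * (1 + \<nu> / \<mu> - k) \<le> mc A u" using a(2)[OF A(1), of u] aC by linarith
    then have "1 + \<nu> / \<mu> - k \<le> mc A u / \<mu>" using mu_pos by (simp add: field_simps)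
    moreover have "0 \<le> \<epsilon> / \<mu>" using eps mu_pos by simp
    ultimately show ?thesis by (simp add: Pk_def diff_divide_distrib)
  qed
  have PW: "W u \<le> Pk u" if "\<bar>u\<bar> \<le> b" for u
  proof -
    have "m u - mc A u \<le> m b - mc A b"
      by (rule m_minus_mc_mono[OF that]) (use n in \<open>simp add: A_def\<close>)
    then have "m u - mc A u \<le> \<epsilon>" using n(1) by (simp add: A_def)
    then have "(m u - mc A u) / \<mu> \<le> \<epsilon> / \<mu>" using mu_pos by (intro divide_right_mono) auto
    then show ?thesis by (simp add: W_def Pk_def g_eq diff_divide_distrib)
  qed
  have PD: "- D \<le> Pk u" if "\<bar>u\<bar> \<le> a" for u
    using PW[of u] D[OF that] that ab by linarith
  show thesis
  proof (rule that[OF A(1)])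
    fix f z \<xi> assume f: "\<And>u. (f has_real_derivative mc A u / \<mu> - (\<nu> - \<epsilon>) / \<mu>) (at u)"
      and \<xi>: "0 < (\<xi>::real)"
    define F where "F u = f u + k * u" for u
    have F: "(F has_real_derivative Pk u) (at u)" for u
      unfolding F_def Pk_def by (auto intro!: derivative_eq_intros f)
    have out: "y - x \<le> F y - F x" if "x \<le> y" "y \<le> - a \<or> a \<le> x" for x y
      using deriv_lower_bound[OF F that(1), of 1] P1 that a0 by force
    have low: "- (2 * a * D) \<le> F y - F x" if "x \<le> y" for x y
    proof -
      define c1 where "c1 = max x (min y (- a))"
      define c2 where "c2 = max c1 (min y a)"
      have c: "x \<le> c1" "c1 \<le> c2" "c2 \<le> y" using that by (auto simp: c1_def c2_def)
      have 1: "0 \<le> F c1 - F x"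
      proof (cases "c1 = x")
        case False
        then have "c1 \<le> - a" by (auto simp: c1_def)
        then show ?thesis using out[OF c(1)] c by auto
      qed simp
      have 3: "0 \<le> F y - F c2"
      proof (cases "c2 = y")
        case False
        then have "a \<le> c2" using c by (auto simp: c2_def)
        then show ?thesis using out[OF c(3)] c by auto
      qed simp
      have 2: "- (2 * a * D) \<le> F c2 - F c1"
      proof (cases "c1 = c2")
        case False
        then have c2: "c2 \<le> a" "- a \<le> c1" using that a0 by (auto simp: c1_def c2_def)
        then have "- D * (c2 - c1) \<le> F c2 - F c1"
          using c PD by (intro deriv_lower_bound[OF F]) auto
        moreover have "D * (c2 - c1) \<le> D * (2 * a)" using D0 c2 by (intro mult_left_mono) auto
        ultimately show ?thesis by (simp add: algebra_simps)
      qed (use a0 D0 in simp)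
      show ?thesis using 1 2 3 by linarith
    qed
    have "0 \<le> F (z + \<xi>) - F z + Kf \<xi>"
    proof (cases "- b \<le> z \<and> z + \<xi> \<le> b")
      case True
      have "(LBINT u:{z..z + \<xi>}. g u) + (k - \<nu> / \<mu>) * \<xi> = w (z + \<xi>) - w z"
      proof -
        have w': "((\<lambda>u. w u - (k - \<nu> / \<mu>) * u) has_real_derivative g u) (at u)" for u
          by (auto intro!: derivative_eq_intros w simp: W_def)
        have "(k - \<nu> / \<mu>) * (z + \<xi>) = (k - \<nu> / \<mu>) * z + (k - \<nu> / \<mu>) * \<xi>"
          by (rule distrib_left)
        then show ?thesis using LBINT_FTC[OF cont w', of z "z + \<xi>"] \<xi> by linarith
      qed
      moreover have "0 * (z + \<xi> - z) \<le> (F (z + \<xi>) - w (z + \<xi>)) - (F z - w z)"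
        by (rule deriv_lower_bound[where p="\<lambda>u. Pk u - W u"])
           (use PW True \<xi> in \<open>auto intro!: derivative_intros F w\<close>)
      ultimately show ?thesis using base[OF \<xi>, of z] by linarith
    next
      case False
      then have "0 \<le> F (z + \<xi>) - F z"
      proof (cases "z < - b")
        case True
        show ?thesis
        proof (cases "z + \<xi> \<le> - a")
          case True then show ?thesis using out[of z "z + \<xi>"] \<xi> by auto
        next
          case False
          then show ?thesis using out[of z "- a"] low[of "- a" "z + \<xi>"] True ab by (simp add: b_def)
        qed
      next
        case zb: False
        then have zb: "b < z + \<xi>" using False by auto
        show ?thesis
        proof (cases "a \<le> z")
          case True then show ?thesis using out[of z "z + \<xi>"] \<xi> by auto
        next
          case False
          then show ?thesis using out[of a "z + \<xi>"] low[of z a] zb ab by (simp add: b_def)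
        qed
      qed
      then show ?thesis using Kf[of \<xi>] by simp
    qed
    then show "0 \<le> f (z + \<xi>) - f z + k * \<xi> + Kf \<xi>" by (simp add: F_def algebra_simps)
  qed
qed

end

section \<open>Expansion along Brownian increments\<close>

text \<open>The difference of the two sides factors as
  \<open>3 * (a + b) * (a - b)\<^sup>2\<close>.\<close>

lemma cube_add_le:
  fixes a b :: real assumes "0 \<le> a" "0 \<le> b" shows "(a + b) ^ 3 \<le> 4 * (a ^ 3 + b ^ 3)"
proof -
  have "0 \<le> 3 * (a + b) * (a - b)\<^sup>2" using assms by simp
  then show ?thesis by (simp add: power2_eq_square power3_eq_cube algebra_simps)
qed

section \<open>Brownian increments: moments and independence\<close>

locale brownian =
  fixes M :: "'a measure" and F :: "real \<Rightarrow> 'a measure" and B :: "real \<Rightarrow> 'a \<Rightarrow> real" and \<mu> \<sigma> :: real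
  assumes fps: "filtered_prob_space M F" and bm: "brownian_motion M F B"
    and mu_pos: "0 < \<mu>" and sigma_pos: "0 < \<sigma>"
begin

sublocale prob_space M using fps by (simp add: filtered_prob_space_def)

lemma subalg: "subalgebra M (F t)"
  using fps by (simp add: filtered_prob_space_def)

lemma space_F: "space (F t) = space M"
  using subalg[of t] by (simp add: subalgebra_def)

lemma F_mono: "s \<le> t \<Longrightarrow> sets (F s) \<subseteq> sets (F t)"
  using fps by (simp add: filtered_prob_space_def filtration_def)

lemma measurable_mono: "s \<le> t \<Longrightarrow> V \<in> borel_measurable (F s) \<Longrightarrow> V \<in> borel_measurable (F t)"
  by (rule measurable_from_subalg[of _ "F s"]) (auto simp: subalgebra_def space_F F_mono)

lemma measurable_M: "V \<in> borel_measurable (F s) \<Longrightarrow> V \<in> borel_measurable M"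
  by (rule measurable_from_subalg[OF subalg])

lemma B_F: "0 \<le> s \<Longrightarrow> s \<le> t \<Longrightarrow> B s \<in> borel_measurable (F t)"
  using bm measurable_mono[of s t "B s"] by (auto simp: brownian_motion_def)

lemma B_M [measurable (raw)]: "0 \<le> s \<Longrightarrow> B s \<in> borel_measurable M"
  using measurable_M[OF B_F[of s s]] by simp

lemma B_0: "\<omega> \<in> space M \<Longrightarrow> B 0 \<omega> = 0"
  using bm by (simp add: brownian_motion_def)

lemma B_cont: "\<omega> \<in> space M \<Longrightarrow> continuous_on {0..} (\<lambda>t. B t \<omega>)"
  using bm by (simp add: brownian_motion_def)

lemma B_distr:
  "0 \<le> s \<Longrightarrow> s < t \<Longrightarrow>
    distributed M lborel (\<lambda>\<omega>. B t \<omega> - B s \<omega>) (normal_density 0 (sqrt (t - s)))"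
  using bm by (simp add: brownian_motion_def)

lemma moments:
  assumes "0 \<le> s" "s < t"
  shows "integrable M (\<lambda>\<omega>. B t \<omega> - B s \<omega>)" "(\<integral>\<omega>. B t \<omega> - B s \<omega> \<partial>M) = 0"
    "integrable M (\<lambda>\<omega>. (B t \<omega> - B s \<omega>)\<^sup>2)" "(\<integral>\<omega>. (B t \<omega> - B s \<omega>)\<^sup>2 \<partial>M) = t - s"
    "integrable M (\<lambda>\<omega>. \<bar>B t \<omega> - B s \<omega>\<bar> ^ 3)"
    "(\<integral>\<omega>. \<bar>B t \<omega> - B s \<omega>\<bar> ^ 3 \<partial>M) = 2 * ((t - s) * sqrt (t - s)) * sqrt (2 / pi)"
proof -
  let ?s = "sqrt (t - s)"
  have s: "0 < ?s" using assms by simp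
  have sq: "?s ^ 3 = (t - s) * ?s" "?s\<^sup>2 = t - s" using assms by (auto simp: power3_eq_cube)
  note d = B_distr[OF assms]
  have m1: "has_bochner_integral lborel (\<lambda>x. normal_density 0 ?s x * x) 0"
    using normal_moment_odd[OF s, of 0 0] by simp
  have m2: "has_bochner_integral lborel (\<lambda>x. normal_density 0 ?s x * x\<^sup>2) (t - s)"
    using normal_moment_even[OF s, of 0 1] sq by (simp add: numeral_2_eq_2)
  have m3: "has_bochner_integral lborel (\<lambda>x. normal_density 0 ?s x * \<bar>x\<bar> ^ 3)
      (2 * ((t - s) * ?s) * sqrt (2 / pi))"
    using normal_moment_abs_odd[OF s, of 0 1] sq by (simp add: numeral_3_eq_3 mult_ac)
  note I = distributed_integrable[OF d] distributed_integral[OF d]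
  note X = has_bochner_integral_iff[THEN iffD1]
  show "integrable M (\<lambda>\<omega>. B t \<omega> - B s \<omega>)" "(\<integral>\<omega>. B t \<omega> - B s \<omega> \<partial>M) = 0"
    using X[OF m1] I[of "\<lambda>x. x"] by auto
  show "integrable M (\<lambda>\<omega>. (B t \<omega> - B s \<omega>)\<^sup>2)" "(\<integral>\<omega>. (B t \<omega> - B s \<omega>)\<^sup>2 \<partial>M) = t - s"
    using X[OF m2] I[of "\<lambda>x. x\<^sup>2"] by auto
  show "integrable M (\<lambda>\<omega>. \<bar>B t \<omega> - B s \<omega>\<bar> ^ 3)"
    "(\<integral>\<omega>. \<bar>B t \<omega> - B s \<omega>\<bar> ^ 3 \<partial>M) = 2 * ((t - s) * sqrt (t - s)) * sqrt (2 / pi)"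
    using X[OF m3] I[of "\<lambda>x. \<bar>x\<bar> ^ 3"] by auto
qed

text \<open>The sigma-algebras generated by \<open>V\<close> and by the increment are contained in
  the two that \<open>brownian_motion\<close> declares independent.\<close>

lemma indep_increment:
  fixes V :: "'a \<Rightarrow> real"
  assumes st: "0 \<le> s" "s < t" and V: "V \<in> borel_measurable (F s)"
  shows "indep_var borel V borel (\<lambda>\<omega>. B t \<omega> - B s \<omega>)"
  unfolding indep_var_eq
proof (intro conjI)
  define D where "D = (\<lambda>\<omega>. B t \<omega> - B s \<omega>)"
  show "random_variable borel V" by (rule measurable_M[OF V])
  show "random_variable borel (\<lambda>\<omega>. B t \<omega> - B s \<omega>)"
    using st by (intro borel_measurable_diff B_M) auto
  have "indep_set (sets (F s)) (sets (vimage_algebra (space M) D borel))"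
    using bm st by (auto simp: brownian_motion_def D_def)
  then have i: "indep_sets (case_bool (sets (F s)) (sets (vimage_algebra (space M) D borel))) UNIV"
    by (simp add: indep_set_def)
  have "sigma_sets (space M) {V -` A \<inter> space M |A. A \<in> sets borel} \<subseteq> sets (F s)"
    using sets.sigma_sets_subset[of "{V -` A \<inter> space M |A. A \<in> sets borel}" "F s"]
      measurable_sets[OF V] by (auto simp: space_F)
  moreover have "sigma_sets (space M) {D -` A \<inter> space M |A. A \<in> sets borel}
      \<subseteq> sets (vimage_algebra (space M) D borel)"
    by (simp add: sets_vimage_algebra)
  ultimately have "indep_sets (case_bool
      (sigma_sets (space M) {V -` A \<inter> space M |A. A \<in> sets borel})
      (sigma_sets (space M) {D -` A \<inter> space M |A. A \<in> sets borel})) UNIV"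
    by (intro indep_sets_mono_sets[OF i]) (auto split: bool.split)
  then show "indep_set
      (sigma_sets (space M) {V -` A \<inter> space M |A. A \<in> sets borel})
      (sigma_sets (space M) {(\<lambda>\<omega>. B t \<omega> - B s \<omega>) -` A \<inter> space M |A. A \<in> sets borel})"
    by (simp add: indep_set_def D_def)
qed

lemma indep_product:
  fixes V :: "'a \<Rightarrow> real"
  assumes st: "0 \<le> s" "s < t" and V: "V \<in> borel_measurable (F s)"
    and u: "u \<in> borel_measurable borel" and w: "w \<in> borel_measurable borel"
    and int: "integrable M (\<lambda>\<omega>. u (V \<omega>) :: real)" "integrable M (\<lambda>\<omega>. w (B t \<omega> - B s \<omega>) :: real)"
  shows "integrable M (\<lambda>\<omega>. u (V \<omega>) * w (B t \<omega> - B s \<omega>))"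
    "(\<integral>\<omega>. u (V \<omega>) * w (B t \<omega> - B s \<omega>) \<partial>M) = (\<integral>\<omega>. u (V \<omega>) \<partial>M) * (\<integral>\<omega>. w (B t \<omega> - B s \<omega>) \<partial>M)"
proof -
  have i: "indep_var borel (\<lambda>\<omega>. u (V \<omega>)) borel (\<lambda>\<omega>. w (B t \<omega> - B s \<omega>))"
    using indep_var_compose[OF indep_increment[OF st V] u w] by (simp add: comp_def)
  show "integrable M (\<lambda>\<omega>. u (V \<omega>) * w (B t \<omega> - B s \<omega>))" by (rule indep_var_integrable[OF i int])
  show "(\<integral>\<omega>. u (V \<omega>) * w (B t \<omega> - B s \<omega>) \<partial>M) = (\<integral>\<omega>. u (V \<omega>) \<partial>M) * (\<integral>\<omega>. w (B t \<omega> - B s \<omega>) \<partial>M)"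
    by (rule indep_var_lebesgue_integral[OF i int])
qed

abbreviation X :: "real \<Rightarrow> real \<Rightarrow> 'a \<Rightarrow> real" where "X x \<equiv> netput \<mu> \<sigma> B x"

definition incr :: "real \<Rightarrow> real \<Rightarrow> 'a \<Rightarrow> real" where
  "incr s t \<omega> = - \<mu> * (t - s) + \<sigma> * (B t \<omega> - B s \<omega>)"

lemma X_incr: "X x t \<omega> = X x s \<omega> + incr s t \<omega>"
  by (simp add: netput_def incr_def algebra_simps)

lemma X_0: "\<omega> \<in> space M \<Longrightarrow> X x 0 \<omega> = x"
  by (simp add: netput_def B_0)

lemma X_cont: "\<omega> \<in> space M \<Longrightarrow> continuous_on {0..} (\<lambda>t. X x t \<omega>)"
  unfolding netput_def by (intro continuous_intros B_cont)

lemma X_F: "0 \<le> s \<Longrightarrow> s \<le> t \<Longrightarrow> X x s \<in> borel_measurable (F t)"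
proof -
  assume "0 \<le> s" "s \<le> t"
  then have [measurable]: "B s \<in> borel_measurable (F t)" by (rule B_F)
  show ?thesis unfolding netput_def[abs_def] by measurable
qed

lemma X_M [measurable (raw)]: "0 \<le> s \<Longrightarrow> X x s \<in> borel_measurable M"
  by (rule measurable_M[OF X_F[of s s]]) auto

lemma incr_M [measurable (raw)]: "0 \<le> s \<Longrightarrow> 0 \<le> t \<Longrightarrow> incr s t \<in> borel_measurable M"
  unfolding incr_def[abs_def] by measurable

lemma incr_moments:
  assumes "0 \<le> s" "s < t"
  shows "integrable M (incr s t)" "(\<integral>\<omega>. incr s t \<omega> \<partial>M) = - \<mu> * (t - s)"
    "integrable M (\<lambda>\<omega>. (incr s t \<omega>)\<^sup>2)"
    "(\<integral>\<omega>. (incr s t \<omega>)\<^sup>2 \<partial>M) = \<sigma>\<^sup>2 * (t - s) + \<mu>\<^sup>2 * (t - s)\<^sup>2"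
    "integrable M (\<lambda>\<omega>. \<bar>incr s t \<omega>\<bar> ^ 3)"
    "(\<integral>\<omega>. \<bar>incr s t \<omega>\<bar> ^ 3 \<partial>M) \<le> 4 * ((\<mu> * (t - s)) ^ 3 + \<sigma> ^ 3 * (2 * ((t - s) * sqrt (t - s)) * sqrt (2 / pi)))"
proof -
  note m = moments[OF assms]
  have [measurable]: "incr s t \<in> borel_measurable M" using assms by (intro incr_M) auto
  show i1: "integrable M (incr s t)" unfolding incr_def[abs_def] using m(1) by simp
  show "(\<integral>\<omega>. incr s t \<omega> \<partial>M) = - \<mu> * (t - s)"
    unfolding incr_def using m(1,2) by (subst Bochner_Integration.integral_add) (auto simp: prob_space)
  have sq: "(incr s t \<omega>)\<^sup>2 = \<mu>\<^sup>2 * (t - s)\<^sup>2 - 2 * \<mu> * (t - s) * \<sigma> * (B t \<omega> - B s \<omega>) + \<sigma>\<^sup>2 * (B t \<omega> - B s \<omega>)\<^sup>2" for \<omega>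
    unfolding incr_def by (simp add: power2_eq_square algebra_simps)
  show "integrable M (\<lambda>\<omega>. (incr s t \<omega>)\<^sup>2)" unfolding sq using m(1,3) by simp
  define D where "D \<omega> = B t \<omega> - B s \<omega>" for \<omega>
  have "(\<integral>\<omega>. (incr s t \<omega>)\<^sup>2 \<partial>M) = \<mu>\<^sup>2 * (t - s)\<^sup>2 - 2 * \<mu> * (t - s) * \<sigma> * (\<integral>\<omega>. D \<omega> \<partial>M) + \<sigma>\<^sup>2 * (\<integral>\<omega>. (D \<omega>)\<^sup>2 \<partial>M)"
    unfolding sq D_def[symmetric] using m(1,3)[folded D_def] by (simp add: prob_space)
  then have "(\<integral>\<omega>. (incr s t \<omega>)\<^sup>2 \<partial>M) = \<mu>\<^sup>2 * (t - s)\<^sup>2 - 2 * \<mu> * (t - s) * \<sigma> * (\<integral>\<omega>. B t \<omega> - B s \<omega> \<partial>M) + \<sigma>\<^sup>2 * (\<integral>\<omega>. (B t \<omega> - B s \<omega>)\<^sup>2 \<partial>M)"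
    by (simp only: D_def)
  then show "(\<integral>\<omega>. (incr s t \<omega>)\<^sup>2 \<partial>M) = \<sigma>\<^sup>2 * (t - s) + \<mu>\<^sup>2 * (t - s)\<^sup>2"
    using m(2,4) by simp
  have le: "\<bar>incr s t \<omega>\<bar> ^ 3 \<le> 4 * ((\<mu> * (t - s)) ^ 3 + \<sigma> ^ 3 * \<bar>B t \<omega> - B s \<omega>\<bar> ^ 3)" for \<omega>
  proof -
    have "\<bar>incr s t \<omega>\<bar> \<le> \<mu> * (t - s) + \<sigma> * \<bar>B t \<omega> - B s \<omega>\<bar>"
      unfolding incr_def using mu_pos sigma_pos assms
      by (intro order_trans[OF abs_triangle_ineq]) (simp add: abs_mult)
    then have "\<bar>incr s t \<omega>\<bar> ^ 3 \<le> (\<mu> * (t - s) + \<sigma> * \<bar>B t \<omega> - B s \<omega>\<bar>) ^ 3"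
      by (rule power_mono) simp
    also have "\<dots> \<le> 4 * ((\<mu> * (t - s)) ^ 3 + (\<sigma> * \<bar>B t \<omega> - B s \<omega>\<bar>) ^ 3)"
      using mu_pos sigma_pos assms by (intro cube_add_le) auto
    finally show ?thesis by (simp add: power_mult_distrib)
  qed
  have int: "integrable M (\<lambda>\<omega>. 4 * ((\<mu> * (t - s)) ^ 3 + \<sigma> ^ 3 * \<bar>B t \<omega> - B s \<omega>\<bar> ^ 3))"
    using m(5) by simp
  show i3: "integrable M (\<lambda>\<omega>. \<bar>incr s t \<omega>\<bar> ^ 3)"
  proof (rule Bochner_Integration.integrable_bound[OF int])
    show "AE \<omega> in M. norm (\<bar>incr s t \<omega>\<bar> ^ 3) \<le> norm (4 * ((\<mu> * (t - s)) ^ 3 + \<sigma> ^ 3 * \<bar>B t \<omega> - B s \<omega>\<bar> ^ 3))"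
      using le order_trans[OF le abs_ge_self] by (intro AE_I2) simp
  qed measurable
  have "(\<integral>\<omega>. \<bar>incr s t \<omega>\<bar> ^ 3 \<partial>M) \<le> (\<integral>\<omega>. 4 * ((\<mu> * (t - s)) ^ 3 + \<sigma> ^ 3 * \<bar>B t \<omega> - B s \<omega>\<bar> ^ 3) \<partial>M)"
    by (rule integral_mono[OF i3 int le])
  also have "\<dots> = 4 * ((\<mu> * (t - s)) ^ 3 + \<sigma> ^ 3 * (\<integral>\<omega>. \<bar>B t \<omega> - B s \<omega>\<bar> ^ 3 \<partial>M))"
    using m(5) by (simp add: prob_space)
  finally show "(\<integral>\<omega>. \<bar>incr s t \<omega>\<bar> ^ 3 \<partial>M) \<le> 4 * ((\<mu> * (t - s)) ^ 3 + \<sigma> ^ 3 * (2 * ((t - s) * sqrt (t - s)) * sqrt (2 / pi)))"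
    by (simp only: m(6))
qed

lemma indep_incr:
  fixes V :: "'a \<Rightarrow> real"
  assumes st: "0 \<le> s" "s < t" and V: "V \<in> borel_measurable (F s)"
    and u: "u \<in> borel_measurable borel" and w: "w \<in> borel_measurable borel"
    and int: "integrable M (\<lambda>\<omega>. u (V \<omega>) :: real)" "integrable M (\<lambda>\<omega>. w (incr s t \<omega>) :: real)"
  shows "integrable M (\<lambda>\<omega>. u (V \<omega>) * w (incr s t \<omega>))"
    "(\<integral>\<omega>. u (V \<omega>) * w (incr s t \<omega>) \<partial>M) = (\<integral>\<omega>. u (V \<omega>) \<partial>M) * (\<integral>\<omega>. w (incr s t \<omega>) \<partial>M)"
  using indep_product[OF st V u, of "\<lambda>y. w (- \<mu> * (t - s) + \<sigma> * y)"] w int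
  by (auto simp: incr_def)

end

section \<open>One-step expansion of a test function\<close>

locale brownian_test = brownian M F B \<mu> \<sigma> + test_function f p q P R L
  for M :: "'a measure" and F B \<mu> \<sigma> f p q P R L
begin

text \<open>The first part bounds the drift contribution
  \<open>\<mu>\<^sup>2 * (t - s)\<^sup>2\<close> to the second moment, the second part the Taylor
  remainder through the third absolute moment; for steps of length at most \<open>1\<close> both are
  of order \<open>(t - s) * sqrt (t - s)\<close>.\<close>

definition err :: real where
  "err = R * \<mu>\<^sup>2 / 2 + L * (4 * (\<mu> ^ 3 + \<sigma> ^ 3 * (2 * sqrt (2 / pi))))"

text \<open>Independence factors the first- and second-order Taylor terms into means, which leave
  \<open>t - s\<close> times the generator. The error has order 3/2 in the step and so still
  vanishes after summation over a fine grid.\<close>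

lemma one_step:
  assumes s: "0 \<le> s" "s < t" "t \<le> s + 1" and V: "V \<in> borel_measurable (F s)"
  shows "integrable M (\<lambda>\<omega>. f (V \<omega> + incr s t \<omega>) - f (V \<omega>))"
    "integrable M (\<lambda>\<omega>. \<sigma>\<^sup>2 / 2 * q (V \<omega>) - \<mu> * p (V \<omega>))"
    "\<bar>(\<integral>\<omega>. f (V \<omega> + incr s t \<omega>) - f (V \<omega>) \<partial>M)
       - (t - s) * (\<integral>\<omega>. \<sigma>\<^sup>2 / 2 * q (V \<omega>) - \<mu> * p (V \<omega>) \<partial>M)\<bar> \<le> err * ((t - s) * sqrt (t - s))"
proof -
  have [measurable]: "V \<in> borel_measurable M" by (rule measurable_M[OF V])
  have [measurable]: "incr s t \<in> borel_measurable M" using s by (intro incr_M) auto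
  note m = incr_moments[OF s(1,2)]
  let ?d = "incr s t"
  show int_f: "integrable M (\<lambda>\<omega>. f (V \<omega> + ?d \<omega>) - f (V \<omega>))"
  proof (rule Bochner_Integration.integrable_bound[of _ "\<lambda>\<omega>. P * ?d \<omega>"])
    show "AE \<omega> in M. norm (f (V \<omega> + ?d \<omega>) - f (V \<omega>)) \<le> norm (P * ?d \<omega>)"
      using f_lipschitz[of "V \<omega> + ?d \<omega>" "V \<omega>" for \<omega>] bounds_nonneg
      by (intro AE_I2) (simp add: abs_mult)
  qed (use m(1) in auto)
  have int_p: "integrable M (\<lambda>\<omega>. p (V \<omega>))" and int_q: "integrable M (\<lambda>\<omega>. q (V \<omega>))"
    by (rule integrable_const_bound[of _ P] integrable_const_bound[of _ R]; use p_bound q_bound in auto)+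
  show "integrable M (\<lambda>\<omega>. \<sigma>\<^sup>2 / 2 * q (V \<omega>) - \<mu> * p (V \<omega>))" using int_p int_q by simp
  have w2: "(\<lambda>y::real. y\<^sup>2 / 2) \<in> borel_measurable borel" by measurable
  have i1: "integrable M (\<lambda>\<omega>. p (V \<omega>) * ?d \<omega>)"
      "(\<integral>\<omega>. p (V \<omega>) * ?d \<omega> \<partial>M) = (\<integral>\<omega>. p (V \<omega>) \<partial>M) * (- \<mu> * (t - s))"
    using indep_incr[OF s(1,2) V p_meas, of "\<lambda>y. y"] int_p m(1,2) by auto
  have i2: "integrable M (\<lambda>\<omega>. q (V \<omega>) * (?d \<omega>)\<^sup>2 / 2)"
      "(\<integral>\<omega>. q (V \<omega>) * (?d \<omega>)\<^sup>2 / 2 \<partial>M) = (\<integral>\<omega>. q (V \<omega>) \<partial>M) * (\<sigma>\<^sup>2 * (t - s) + \<mu>\<^sup>2 * (t - s)\<^sup>2) / 2"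
    using indep_incr[OF s(1,2) V q_meas w2] int_q m(3,4) by auto
  define rem where "rem \<omega> = f (V \<omega> + ?d \<omega>) - f (V \<omega>) - p (V \<omega>) * ?d \<omega> - q (V \<omega>) * (?d \<omega>)\<^sup>2 / 2" for \<omega>
  have int_rem: "integrable M rem" unfolding rem_def[abs_def] using int_f i1(1) i2(1) by simp
  have "\<bar>\<integral>\<omega>. rem \<omega> \<partial>M\<bar> \<le> (\<integral>\<omega>. \<bar>rem \<omega>\<bar> \<partial>M)" by (rule integral_abs_bound)
  also have "\<dots> \<le> (\<integral>\<omega>. L * \<bar>?d \<omega>\<bar> ^ 3 \<partial>M)"
    using m(5) taylor by (intro integral_mono integrable_abs[OF int_rem]) (auto simp: rem_def)
  also have "\<dots> = L * (\<integral>\<omega>. \<bar>?d \<omega>\<bar> ^ 3 \<partial>M)" by simp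
  finally have rem1: "\<bar>\<integral>\<omega>. rem \<omega> \<partial>M\<bar> \<le> L * (\<integral>\<omega>. \<bar>?d \<omega>\<bar> ^ 3 \<partial>M)" .
  have eq: "(\<integral>\<omega>. f (V \<omega> + ?d \<omega>) - f (V \<omega>) \<partial>M)
      = (t - s) * (\<integral>\<omega>. \<sigma>\<^sup>2 / 2 * q (V \<omega>) - \<mu> * p (V \<omega>) \<partial>M) + (\<integral>\<omega>. q (V \<omega>) \<partial>M) * \<mu>\<^sup>2 * (t - s)\<^sup>2 / 2 + (\<integral>\<omega>. rem \<omega> \<partial>M)"
  proof -
    have "(\<integral>\<omega>. rem \<omega> \<partial>M) = (\<integral>\<omega>. f (V \<omega> + ?d \<omega>) - f (V \<omega>) \<partial>M)
        - (\<integral>\<omega>. p (V \<omega>) * ?d \<omega> \<partial>M) - (\<integral>\<omega>. q (V \<omega>) * (?d \<omega>)\<^sup>2 / 2 \<partial>M)"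
      unfolding rem_def using int_f i1(1) i2(1)
      by (subst Bochner_Integration.integral_diff[OF Bochner_Integration.integrable_diff[OF int_f i1(1)] i2(1)],
          subst Bochner_Integration.integral_diff[OF int_f i1(1)]) simp
    moreover have "(\<integral>\<omega>. \<sigma>\<^sup>2 / 2 * q (V \<omega>) - \<mu> * p (V \<omega>) \<partial>M) = \<sigma>\<^sup>2 / 2 * (\<integral>\<omega>. q (V \<omega>) \<partial>M) - \<mu> * (\<integral>\<omega>. p (V \<omega>) \<partial>M)"
      using int_p int_q by simp
    ultimately show ?thesis
      unfolding i1(2) i2(2) by (simp only:) (simp add: algebra_simps add_divide_distrib diff_divide_distrib)
  qed
  let ?e = "(t - s) * sqrt (t - s)"
  have e: "(t - s)\<^sup>2 \<le> ?e" "(t - s) ^ 3 \<le> ?e" "0 \<le> ?e"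
  proof -
    have "(t - s) * 1 \<le> sqrt (t - s)" using s by (intro real_le_rsqrt) (simp add: power2_eq_square mult_left_le)
    then have "(t - s) * (t - s) \<le> ?e" using s by (intro mult_left_mono) auto
    then show 2: "(t - s)\<^sup>2 \<le> ?e" by (simp add: power2_eq_square)
    have "(t - s)\<^sup>2 * (t - s) \<le> (t - s)\<^sup>2 * 1" using s by (intro mult_left_mono) auto
    then show "(t - s) ^ 3 \<le> ?e" using 2 by (simp add: power2_eq_square power3_eq_cube)
    show "0 \<le> ?e" using s by simp
  qed
  have "\<bar>\<integral>\<omega>. q (V \<omega>) \<partial>M\<bar> \<le> (\<integral>\<omega>. \<bar>q (V \<omega>)\<bar> \<partial>M)" by (rule integral_abs_bound)
  also have "\<dots> \<le> (\<integral>\<omega>. R \<partial>M)" using int_q q_bound by (intro integral_mono) auto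
  finally have Eq: "\<bar>\<integral>\<omega>. q (V \<omega>) \<partial>M\<bar> \<le> R" by (simp add: prob_space)
  have "\<bar>(\<integral>\<omega>. q (V \<omega>) \<partial>M) * \<mu>\<^sup>2 * (t - s)\<^sup>2 / 2\<bar> = \<bar>\<integral>\<omega>. q (V \<omega>) \<partial>M\<bar> * (\<mu>\<^sup>2 * (t - s)\<^sup>2 / 2)"
    by (simp add: abs_mult)
  also have "\<dots> \<le> R * (\<mu>\<^sup>2 * ?e / 2)"
    using Eq e bounds_nonneg by (intro mult_mono divide_right_mono mult_left_mono) auto
  finally have q2: "\<bar>(\<integral>\<omega>. q (V \<omega>) \<partial>M) * \<mu>\<^sup>2 * (t - s)\<^sup>2 / 2\<bar> \<le> R * \<mu>\<^sup>2 / 2 * ?e" by simp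
  have "(\<integral>\<omega>. \<bar>?d \<omega>\<bar> ^ 3 \<partial>M) \<le> 4 * (\<mu> ^ 3 * (t - s) ^ 3 + \<sigma> ^ 3 * (2 * ?e * sqrt (2 / pi)))"
    using m(6) by (simp only: power_mult_distrib)
  also have "\<dots> \<le> 4 * (\<mu> ^ 3 * ?e + \<sigma> ^ 3 * (2 * ?e * sqrt (2 / pi)))"
    using e(2) mu_pos by (intro mult_left_mono add_right_mono) auto
  finally have "L * (\<integral>\<omega>. \<bar>?d \<omega>\<bar> ^ 3 \<partial>M) \<le> L * (4 * (\<mu> ^ 3 * ?e + \<sigma> ^ 3 * (2 * ?e * sqrt (2 / pi))))"
    using bounds_nonneg by (intro mult_left_mono) auto
  with rem1 have r: "\<bar>\<integral>\<omega>. rem \<omega> \<partial>M\<bar> \<le> L * (4 * (\<mu> ^ 3 + \<sigma> ^ 3 * (2 * sqrt (2 / pi)))) * ?e"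
    by (simp add: algebra_simps)
  show "\<bar>(\<integral>\<omega>. f (V \<omega> + ?d \<omega>) - f (V \<omega>) \<partial>M)
       - (t - s) * (\<integral>\<omega>. \<sigma>\<^sup>2 / 2 * q (V \<omega>) - \<mu> * p (V \<omega>) \<partial>M)\<bar> \<le> err * ?e"
    using q2 r unfolding eq err_def distrib_right by linarith
qed

end

section \<open>Sums over a time grid\<close>

definition grid :: "real \<Rightarrow> nat \<Rightarrow> nat \<Rightarrow> real" where
  "grid T n i = real i * (T / real n)"

lemma grid_0 [simp]: "grid T n 0 = 0"
  by (simp add: grid_def)

lemma grid_end: "0 < n \<Longrightarrow> grid T n n = T"
  by (simp add: grid_def)

lemma grid_Suc: "grid T n (Suc i) = grid T n i + T / real n"
  by (simp add: grid_def distrib_right add_divide_distrib)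

lemma grid_nonneg: "0 \<le> T \<Longrightarrow> 0 \<le> grid T n i"
  by (simp add: grid_def)

lemma grid_less: "0 < T \<Longrightarrow> 0 < n \<Longrightarrow> i < j \<Longrightarrow> grid T n i < grid T n j"
  by (simp add: grid_def divide_strict_right_mono mult_strict_right_mono)

lemma grid_le: "0 < T \<Longrightarrow> 0 < n \<Longrightarrow> i \<le> n \<Longrightarrow> grid T n i \<le> T"
  using grid_less[of T n i n] grid_end[of n T] by (cases "i = n") auto

lemma grid_dense:
  assumes T: "0 < T" and v: "0 \<le> v" "v \<le> T"
  shows "\<exists>j. (\<forall>n. j n \<le> Suc n) \<and> (\<lambda>n. grid T (Suc n) (j n)) \<longlonglongrightarrow> v"
proof -
  define w where "w n = grid T (Suc n) (nat \<lfloor>v / (T / real (Suc n))\<rfloor>)" for n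
  have w: "\<bar>w n - v\<bar> \<le> T / real (Suc n)" "nat \<lfloor>v / (T / real (Suc n))\<rfloor> \<le> Suc n" "0 \<le> w n" for n
  proof -
    define d where "d = T / real (Suc n)"
    have d: "0 < d" using T by (simp add: d_def)
    define k where "k = nat \<lfloor>v / d\<rfloor>"
    have k: "real k \<le> v / d" "v / d < real k + 1" using v d unfolding k_def by auto
    have "real k * d \<le> v" "v \<le> real k * d + d" using k d by (auto simp: field_simps)
    moreover have w: "w n = real k * d" by (simp only: w_def grid_def k_def d_def)
    ultimately show "\<bar>w n - v\<bar> \<le> T / real (Suc n)" unfolding d_def by (simp only: abs_le_iff) linarith
    have "v * real (Suc n) \<le> T * real (Suc n)" using v(2) by (intro mult_right_mono) auto
    then have "v / d \<le> real (Suc n)" using T unfolding d_def by (simp only: divide_divide_eq_right pos_divide_le_eq mult.commute)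
    then show "nat \<lfloor>v / (T / real (Suc n))\<rfloor> \<le> Suc n" using k(1) by (simp only: k_def[unfolded d_def, symmetric] d_def[symmetric]) linarith
    show "0 \<le> w n" using w d by simp
  qed
  have "(\<lambda>n. T / real (Suc n)) \<longlonglongrightarrow> 0" using LIMSEQ_Suc[OF lim_const_over_n[of T]] by simp
  then have "(\<lambda>n. w n - v) \<longlonglongrightarrow> 0" by (rule Lim_null_comparison[rotated]) (use w in auto)
  then have "w \<longlonglongrightarrow> v" by (simp add: LIM_zero_iff)
  then have "(\<lambda>n. grid T (Suc n) (nat \<lfloor>v / (T / real (Suc n))\<rfloor>)) \<longlonglongrightarrow> v"
    by (simp only: w_def[abs_def])
  then show ?thesis
    by (intro exI[of _ "\<lambda>n. nat \<lfloor>v / (T / real (Suc n))\<rfloor>"] conjI allI w(2))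
qed

text \<open>The sum is the integral of \<open>\<phi>\<close> sampled at the left grid point, so
  dominated convergence asks for continuity only almost everywhere; this admits paths with countably
  many jumps.\<close>

lemma riemann_sum_tendsto:
  fixes \<phi> :: "real \<Rightarrow> real"
  assumes T: "0 < T" and [measurable]: "\<phi> \<in> borel_measurable borel"
    and bound: "\<And>u. \<bar>\<phi> u\<bar> \<le> C" and cont: "AE u in lborel. isCont \<phi> u"
  shows "(\<lambda>n. \<Sum>i<n. T / real n * \<phi> (grid T n i)) \<longlonglongrightarrow> (LBINT u:{0..T}. \<phi> u)"
proof -
  define s where "s n u = (\<Sum>i<n. indicator {grid T n i..<grid T n (Suc i)} u * \<phi> (grid T n i))" for n u
  define fl where "fl n u = T / real n * real_of_int \<lfloor>u / (T / real n)\<rfloor>" for n u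
  have s_eq: "s n u = indicator {0..<T} u * \<phi> (fl n u)" if n: "0 < n" for n u
  proof (cases "u \<in> {0..<T}")
    case True
    define \<delta> where "\<delta> = T / real n"
    have d: "0 < \<delta>" using T n by (simp add: \<delta>_def)
    define k where "k = nat \<lfloor>u / \<delta>\<rfloor>"
    have k: "real k = of_int \<lfloor>u / \<delta>\<rfloor>" using True d by (simp add: k_def)
    have g: "grid T n i = \<delta> * real i" for i by (simp add: grid_def \<delta>_def)
    have iff: "\<delta> * real i \<le> u \<and> u < \<delta> * real (Suc i) \<longleftrightarrow> i = k" for i
    proof -
      have "\<delta> * real i \<le> u \<and> u < \<delta> * real (Suc i) \<longleftrightarrow> real i \<le> u / \<delta> \<and> u / \<delta> < real i + 1"
        using d by (auto simp: field_simps)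
      also have "\<dots> \<longleftrightarrow> \<lfloor>u / \<delta>\<rfloor> = int i" by (simp add: floor_eq_iff)
      also have "\<dots> \<longleftrightarrow> i = k" using k by linarith
      finally show ?thesis .
    qed
    have "u / \<delta> < real n" using True T n by (simp add: \<delta>_def field_simps)
    then have kn: "k < n" using k by linarith
    have "s n u = (\<Sum>i<n. if i = k then \<phi> (grid T n i) else 0)"
      unfolding s_def
    proof (intro sum.cong refl)
      fix i
      show "indicator {grid T n i..<grid T n (Suc i)} u * \<phi> (grid T n i) = (if i = k then \<phi> (grid T n i) else 0)"
        using iff[of i] unfolding g indicator_def by auto
    qed
    also have "\<dots> = \<phi> (\<delta> * real k)" using kn by (simp add: g)
    finally show ?thesis using True k by (simp add: fl_def \<delta>_def)
  next
    case False
    have "indicator {grid T n i..<grid T n (Suc i)} u = (0::real)" if "i < n" for i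
      using False grid_nonneg[of T n i] grid_le[of T n "Suc i"] that T n by (auto simp: indicator_def)
    then show ?thesis using False by (simp add: s_def)
  qed
  have int_s: "(LBINT u. s n u) = (\<Sum>i<n. T / real n * \<phi> (grid T n i))" if n: "0 < n" for n
  proof -
    have le: "grid T n i \<le> grid T n (Suc i)" for i using T by (simp add: grid_Suc)
    have "(LBINT u. s n u) = (\<Sum>i<n. (LBINT u. indicator {grid T n i..<grid T n (Suc i)} u * \<phi> (grid T n i)))"
      unfolding s_def using le
      by (intro Bochner_Integration.integral_sum integrable_mult_left integrable_real_indicator) auto
    also have "\<dots> = (\<Sum>i<n. T / real n * \<phi> (grid T n i))"
      using le by (intro sum.cong refl) (simp add: grid_Suc)
    finally show ?thesis .
  qed
  have "(\<lambda>n. LBINT u. s (Suc n) u) \<longlonglongrightarrow> (LBINT u. indicator {0..T} u * \<phi> u)"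
  proof (rule integral_dominated_convergence[where w = "\<lambda>u. C * indicator {0..T} u"])
    show "integrable lborel (\<lambda>u. C * indicat_real {0..T} u)"
      by (intro integrable_mult_right integrable_real_indicator) (auto simp: emeasure_lborel_Icc_eq)
    show "AE u in lborel. norm (s (Suc n) u) \<le> C * indicat_real {0..T} u" for n
    proof (intro AE_I2)
      have "0 \<le> C" using bound[of 0] by linarith
      then show "norm (s (Suc n) u) \<le> C * indicat_real {0..T} u" for u
        using bound by (auto simp: s_eq indicator_def)
    qed
    have "AE u in lborel. u \<noteq> T" by (rule AE_lborel_singleton)
    with cont show "AE u in lborel. (\<lambda>n. s (Suc n) u) \<longlonglongrightarrow> indicat_real {0..T} u * \<phi> u"
    proof eventually_elim
      case (elim u)
      have fl: "\<bar>fl (Suc n) u - u\<bar> \<le> T / real (Suc n)" for n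
      proof -
        define d where "d = T / real (Suc n)"
        have d: "0 < d" using T by (simp add: d_def)
        define k where "k = real_of_int \<lfloor>u / d\<rfloor>"
        have "k \<le> u / d" "u / d < k + 1" unfolding k_def by linarith+
        then have "d * k \<le> u" "u \<le> d * k + d" using d by (auto simp: field_simps)
        moreover have "fl (Suc n) u = d * k" by (simp only: fl_def d_def k_def)
        ultimately have "fl (Suc n) u \<le> u" "u \<le> fl (Suc n) u + T / real (Suc n)"
          by (simp_all only: d_def)
        then show ?thesis by (simp add: abs_le_iff)
      qed
      have "(\<lambda>n. T / real (Suc n)) \<longlonglongrightarrow> 0"
        using LIMSEQ_Suc[OF lim_const_over_n[of T]] by simp
      then have "(\<lambda>n. fl (Suc n) u - u) \<longlonglongrightarrow> 0"
        by (rule Lim_null_comparison[rotated]) (use fl in auto)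
      then have "(\<lambda>n. fl (Suc n) u) \<longlonglongrightarrow> u" by (simp add: LIM_zero_iff)
      then have "(\<lambda>n. \<phi> (fl (Suc n) u)) \<longlonglongrightarrow> \<phi> u" by (rule isCont_tendsto_compose[OF elim(1)])
      then have "(\<lambda>n. indicator {0..<T} u * \<phi> (fl (Suc n) u)) \<longlonglongrightarrow> indicator {0..<T} u * \<phi> u"
        by (intro tendsto_intros)
      moreover have "indicat_real {0..<T} u = indicator {0..T} u" using elim(2) by (auto simp: indicator_def)
      ultimately show ?case by (simp add: s_eq)
    qed
    show "s (Suc n) \<in> borel_measurable lborel" for n unfolding s_def[abs_def] by measurable
  qed measurable
  then have "(\<lambda>n. \<Sum>i<Suc n. T / real (Suc n) * \<phi> (grid T (Suc n) i)) \<longlonglongrightarrow> (LBINT u:{0..T}. \<phi> u)"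
    by (simp only: int_s zero_less_Suc set_lebesgue_integral_def real_scaleR_def)
  then show ?thesis by (subst (asm) filterlim_sequentially_Suc)
qed

section \<open>Paths under an admissible policy\<close>

locale policy = brownian M F B \<mu> \<sigma>
  for M :: "'a measure" and F B \<mu> \<sigma> +
  fixes x :: real and Y :: "real \<Rightarrow> 'a \<Rightarrow> real"
  assumes adm: "admissible M F Y"
begin

lemma Y_F: "0 \<le> s \<Longrightarrow> s \<le> t \<Longrightarrow> Y s \<in> borel_measurable (F t)"
  using adm measurable_mono[of s t "Y s"] by (auto simp: admissible_def)

lemma Y_M [measurable (raw)]: "0 \<le> s \<Longrightarrow> Y s \<in> borel_measurable M"
  using measurable_M[OF Y_F[of s s]] by simp

lemma Y_mono: "\<omega> \<in> space M \<Longrightarrow> 0 \<le> s \<Longrightarrow> s \<le> t \<Longrightarrow> Y s \<omega> \<le> Y t \<omega>"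
  using adm by (auto simp: admissible_def mono_on_def)

lemma Y_nonneg: "\<omega> \<in> space M \<Longrightarrow> 0 \<le> t \<Longrightarrow> 0 \<le> Y t \<omega>"
  using adm by (auto simp: admissible_def)

lemma Y_right_cont: "\<omega> \<in> space M \<Longrightarrow> 0 \<le> t \<Longrightarrow> continuous (at_right t) (\<lambda>u. Y u \<omega>)"
  using adm by (auto simp: admissible_def)

definition Z :: "real \<Rightarrow> 'a \<Rightarrow> real" where "Z t \<omega> = X x t \<omega> + Y t \<omega>"

lemma Z_F: assumes "0 \<le> s" "s \<le> t" shows "Z s \<in> borel_measurable (F t)"
proof -
  have [measurable]: "X x s \<in> borel_measurable (F t)" "Y s \<in> borel_measurable (F t)"
    using assms by (auto intro: X_F Y_F)
  show ?thesis unfolding Z_def[abs_def] by measurable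
qed

lemma Z_M [measurable (raw)]: "0 \<le> s \<Longrightarrow> Z s \<in> borel_measurable M"
  using measurable_M[OF Z_F[of s s]] by simp

lemma Y_step: "Z t \<omega> = Z s \<omega> + incr s t \<omega> + (Y t \<omega> - Y s \<omega>)"
  unfolding Z_def using X_incr[of x t \<omega> s] by simp

text \<open>Paths are only controlled on \<open>[0, \<infinity>)\<close>; clipping the time index makes them measurable on \<open>\<real>\<close>.\<close>

lemma path_regular:
  assumes "\<omega> \<in> space M"
  shows "(\<lambda>u. Z (max 0 u) \<omega>) \<in> borel_measurable borel" "AE u in lborel. isCont (\<lambda>u. Z (max 0 u) \<omega>) u"
proof -
  have m: "mono (\<lambda>u. Y (max 0 u) \<omega>)" using assms by (intro monoI Y_mono) auto
  have Xc: "continuous_on UNIV (\<lambda>u. X x (max 0 u) \<omega>)"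
    by (rule continuous_on_compose2[OF X_cont[OF assms]]) (auto intro!: continuous_intros)
  have [measurable]: "(\<lambda>u. Y (max 0 u) \<omega>) \<in> borel_measurable borel" "(\<lambda>u. X x (max 0 u) \<omega>) \<in> borel_measurable borel"
    by (rule borel_measurable_mono[OF m] borel_measurable_continuous_onI[OF Xc])+
  show "(\<lambda>u. Z (max 0 u) \<omega>) \<in> borel_measurable borel" unfolding Z_def by measurable
  have "countable {u. \<not> isCont (\<lambda>u. Y (max 0 u) \<omega>) u}" by (rule mono_ctble_discont[OF m])
  then have "{u. \<not> isCont (\<lambda>u. Y (max 0 u) \<omega>) u} \<in> null_sets lborel" by (rule countable_imp_null_set_lborel)
  then have "AE u in lborel. isCont (\<lambda>u. Y (max 0 u) \<omega>) u" using AE_not_in by fastforce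
  then show "AE u in lborel. isCont (\<lambda>u. Z (max 0 u) \<omega>) u"
  proof eventually_elim
    case (elim u)
    have "isCont (\<lambda>u. X x (max 0 u) \<omega>) u" using Xc by (simp add: continuous_on_eq_continuous_at)
    with elim show ?case unfolding Z_def by (intro continuous_intros)
  qed
qed

text \<open>Time is replaced by a slightly later one from a countable set, where joint measurability
  is clear; right continuity of the paths gives the pointwise limit.\<close>

lemma Z_jointly_measurable:
  "(\<lambda>(\<omega>, u). Z (max 0 u) \<omega>) \<in> borel_measurable (M \<Otimes>\<^sub>M borel)"
proof (rule borel_measurable_LIMSEQ_real)
  \<comment> \<open>The \<open>+ 1\<close> makes \<open>s n u\<close> strictly larger than the time
    it approximates, as needed for a limit from the right.\<close>
  define s where "s n u = real (nat (\<lfloor>real (Suc n) * max 0 u\<rfloor> + 1)) / real (Suc n)" for n and u :: real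
  fix p :: "'a \<times> real" assume p: "p \<in> space (M \<Otimes>\<^sub>M borel)"
  obtain \<omega> u where [simp]: "p = (\<omega>, u)" by (cases p)
  have \<omega>: "\<omega> \<in> space M" using p by (simp add: space_pair_measure)
  define t where "t = max 0 u"
  have t0: "0 \<le> t" by (simp add: t_def)
  have s: "t < s n u" "s n u \<le> t + 1 / real (Suc n)" for n
  proof -
    have f: "\<lfloor>real (Suc n) * t\<rfloor> \<le> real (Suc n) * t" "real (Suc n) * t < \<lfloor>real (Suc n) * t\<rfloor> + 1" by linarith+
    have "0 \<le> real (Suc n) * t" using t0 by simp
    then have "0 \<le> \<lfloor>real (Suc n) * t\<rfloor>" by linarith
    then have sn: "s n u = (real_of_int \<lfloor>real (Suc n) * t\<rfloor> + 1) / real (Suc n)" by (simp add: s_def t_def)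
    show "t < s n u" "s n u \<le> t + 1 / real (Suc n)"
      using f unfolding sn by (auto simp: field_simps simp del: of_nat_Suc)
  qed
  have lim: "(\<lambda>n. s n u) \<longlonglongrightarrow> t"
  proof (rule tendsto_sandwich[of "\<lambda>_. t" _ _ "\<lambda>n. t + 1 / real (Suc n)"])
    show "(\<lambda>n. t + 1 / real (Suc n)) \<longlonglongrightarrow> t"
      using tendsto_add[OF tendsto_const[of t] LIMSEQ_Suc[OF lim_const_over_n[of 1]]] by simp
  qed (use s in \<open>auto intro!: always_eventually less_imp_le\<close>)
  have "filterlim (\<lambda>n. s n u) (at_right t) sequentially"
    by (rule tendsto_imp_filterlim_at_right[OF lim]) (use s in auto)
  moreover have "((\<lambda>u. Z u \<omega>) \<longlongrightarrow> Z t \<omega>) (at_right t)"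
  proof -
    have "((\<lambda>u. Y u \<omega>) \<longlongrightarrow> Y t \<omega>) (at_right t)"
      using Y_right_cont[OF \<omega> t0] by (simp add: continuous_within)
    moreover have "((\<lambda>u. X x u \<omega>) \<longlongrightarrow> X x t \<omega>) (at_right t)"
    proof -
      have "((\<lambda>u. X x u \<omega>) \<longlongrightarrow> X x t \<omega>) (at t within {0..})"
        using X_cont[OF \<omega>, of x] t0 by (simp add: continuous_on_def)
      then show ?thesis by (rule tendsto_within_subset) (use t0 in auto)
    qed
    ultimately show ?thesis unfolding Z_def by (intro tendsto_intros)
  qed
  ultimately have "(\<lambda>n. Z (s n u) \<omega>) \<longlonglongrightarrow> Z t \<omega>" by (rule filterlim_compose[rotated])
  then show "(\<lambda>n. (\<lambda>(\<omega>, u). Z (real (nat (\<lfloor>real (Suc n) * max 0 u\<rfloor> + 1)) / real (Suc n)) \<omega>) p)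
      \<longlonglongrightarrow> (\<lambda>(\<omega>, u). Z (max 0 u) \<omega>) p" by (simp add: s_def t_def)
next
  fix n
  have "(\<lambda>p. Z (real (nat (\<lfloor>real (Suc n) * max 0 (snd p)\<rfloor> + 1)) / real (Suc n)) (fst p)) \<in> borel_measurable (M \<Otimes>\<^sub>M borel)"
  proof (rule measurable_compose_countable[where f = "\<lambda>i p. Z (real i / real (Suc n)) (fst p)"])
    show "(\<lambda>p. Z (real i / real (Suc n)) (fst p)) \<in> borel_measurable (M \<Otimes>\<^sub>M borel)" for i
    proof -
      have [measurable]: "Z (real i / real (Suc n)) \<in> borel_measurable M" by (rule Z_M) simp
      show ?thesis by measurable
    qed
  qed measurable
  then show "(\<lambda>(\<omega>, u). Z (real (nat (\<lfloor>real (Suc n) * max 0 u\<rfloor> + 1)) / real (Suc n)) \<omega>) \<in> borel_measurable (M \<Otimes>\<^sub>M borel)"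
    by (simp add: split_beta')
qed

lemma holding_integral_cong:
  "(LBINT u:{0..T}. H (Z u \<omega>)) = (LBINT u:{0..T}. H (Z (max 0 u) \<omega>))"
  unfolding set_lebesgue_integral_def
  by (intro Bochner_Integration.integral_cong refl) (auto simp: indicator_def max_def)

lemma holding_sum_tendsto:
  assumes "\<omega> \<in> space M" "0 < T" "continuous_on UNIV H" "\<And>z. \<bar>H z\<bar> \<le> C"
  shows "(\<lambda>n. \<Sum>i<n. T / real n * H (Z (grid T n i) \<omega>)) \<longlonglongrightarrow> (LBINT u:{0..T}. H (Z u \<omega>))"
proof -
  have H: "isCont H z" for z using assms(3) by (simp add: continuous_on_eq_continuous_at)
  note m = path_regular[OF assms(1)]
  have [measurable]: "H \<in> borel_measurable borel" by (rule borel_measurable_continuous_onI[OF assms(3)])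
  have [measurable]: "(\<lambda>u. Z (max 0 u) \<omega>) \<in> borel_measurable borel" by (rule m)
  have "(\<lambda>n. \<Sum>i<n. T / real n * H (Z (max 0 (grid T n i)) \<omega>)) \<longlonglongrightarrow> (LBINT u:{0..T}. H (Z (max 0 u) \<omega>))"
  proof (rule riemann_sum_tendsto[OF assms(2) _ assms(4)])
    show "AE u in lborel. isCont (\<lambda>u. H (Z (max 0 u) \<omega>)) u"
      using m(2) by eventually_elim (intro isCont_o2[OF _ H])
  qed measurable
  then show ?thesis using assms(2) by (simp add: holding_integral_cong max_absorb2 grid_nonneg)
qed

end

text \<open>\<open>gen\<close> is the Poisson equation for the running cost \<open>H\<close>: the
  generator of \<open>X\<close> applied to \<open>f\<close> gives \<open>a - H\<close>, where
  \<open>a\<close> plays the part of the average cost.\<close>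

locale policy_test = policy M F B \<mu> \<sigma> x Y + brownian_test M F B \<mu> \<sigma> f p q P R L
  for M :: "'a measure" and F B \<mu> \<sigma> x Y f p q P R L +
  fixes a :: real and H :: "real \<Rightarrow> real" and C :: real
  assumes gen: "\<And>z. \<sigma>\<^sup>2 / 2 * q z - \<mu> * p z = a - H z"
    and H_cont: "continuous_on UNIV H" and H_bound: "\<And>z. \<bar>H z\<bar> \<le> C"
begin

text \<open>Within a cell the Brownian increment comes first and starts at \<open>Z\<close> of the
  left grid point, which is known at that time; the rest of the step is due to the control and goes
  to \<open>control_sum\<close>.\<close>

definition diffusion_sum :: "real \<Rightarrow> nat \<Rightarrow> 'a \<Rightarrow> real" where
  "diffusion_sum T n \<omega> =
     (\<Sum>i<n. f (Z (grid T n i) \<omega> + incr (grid T n i) (grid T n (Suc i)) \<omega>) - f (Z (grid T n i) \<omega>))"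

definition control_sum :: "real \<Rightarrow> nat \<Rightarrow> 'a \<Rightarrow> real" where
  "control_sum T n \<omega> =
     (\<Sum>i<n. f (Z (grid T n (Suc i)) \<omega>) - f (Z (grid T n i) \<omega> + incr (grid T n i) (grid T n (Suc i)) \<omega>))"

lemma telescope:
  assumes "0 < n" shows "f (Z T \<omega>) - f (Z 0 \<omega>) = diffusion_sum T n \<omega> + control_sum T n \<omega>"
proof -
  have "diffusion_sum T n \<omega> + control_sum T n \<omega> = (\<Sum>i<n. f (Z (grid T n (Suc i)) \<omega>) - f (Z (grid T n i) \<omega>))"
    unfolding diffusion_sum_def control_sum_def sum.distrib[symmetric] by (intro sum.cong) auto
  also have "\<dots> = f (Z (grid T n n) \<omega>) - f (Z (grid T n 0) \<omega>)" by (rule sum_lessThan_telescope)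
  finally show ?thesis using assms by (simp add: grid_end)
qed

lemma H_meas [measurable]: "H \<in> borel_measurable borel"
  by (rule borel_measurable_continuous_onI[OF H_cont])

lemma H_Z_integrable: "0 \<le> s \<Longrightarrow> integrable M (\<lambda>\<omega>. H (Z s \<omega>))"
proof -
  assume "0 \<le> s"
  then have [measurable]: "Z s \<in> borel_measurable M" by (rule Z_M)
  show ?thesis by (rule integrable_const_bound[of _ C]) (use H_bound in auto)
qed

text \<open>The \<open>n\<close> one-step errors \<open>err * \<delta> * sqrt \<delta>\<close> with
  \<open>\<delta> = T / n\<close> add up to \<open>err * T * sqrt \<delta>\<close>;
  \<open>T \<le> n\<close> keeps the steps at most \<open>1\<close>.\<close>

lemma diffusion_sum_bound:
  assumes T: "0 < T" and n: "T \<le> real n"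
  shows "integrable M (diffusion_sum T n)"
    "\<bar>(\<integral>\<omega>. diffusion_sum T n \<omega> \<partial>M) - (a * T - (\<integral>\<omega>. (\<Sum>i<n. T / real n * H (Z (grid T n i) \<omega>)) \<partial>M))\<bar>
       \<le> err * T * sqrt (T / real n)"
proof -
  have n0: "0 < n" using T n by (cases n) auto
  let ?\<delta> = "T / real n"
  have d: "0 < ?\<delta>" "?\<delta> \<le> 1" using T n n0 by auto
  have step: "integrable M (\<lambda>\<omega>. f (Z (grid T n i) \<omega> + incr (grid T n i) (grid T n (Suc i)) \<omega>) - f (Z (grid T n i) \<omega>))"
    "\<bar>(\<integral>\<omega>. f (Z (grid T n i) \<omega> + incr (grid T n i) (grid T n (Suc i)) \<omega>) - f (Z (grid T n i) \<omega>) \<partial>M)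
       - (a * ?\<delta> - (\<integral>\<omega>. ?\<delta> * H (Z (grid T n i) \<omega>) \<partial>M))\<bar> \<le> err * (?\<delta> * sqrt ?\<delta>)" for i
  proof -
    have g: "0 \<le> grid T n i" "grid T n i < grid T n (Suc i)" "grid T n (Suc i) \<le> grid T n i + 1"
      using d T by (auto simp: grid_Suc grid_nonneg)
    have Zm: "Z (grid T n i) \<in> borel_measurable (F (grid T n i))" using g by (intro Z_F) auto
    show "integrable M (\<lambda>\<omega>. f (Z (grid T n i) \<omega> + incr (grid T n i) (grid T n (Suc i)) \<omega>) - f (Z (grid T n i) \<omega>))"
      by (rule one_step(1)[OF g Zm])
    have "(\<integral>\<omega>. \<sigma>\<^sup>2 / 2 * q (Z (grid T n i) \<omega>) - \<mu> * p (Z (grid T n i) \<omega>) \<partial>M) = a - (\<integral>\<omega>. H (Z (grid T n i) \<omega>) \<partial>M)"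
      unfolding gen using H_Z_integrable[OF g(1)] by (simp add: prob_space)
    then have "?\<delta> * (\<integral>\<omega>. \<sigma>\<^sup>2 / 2 * q (Z (grid T n i) \<omega>) - \<mu> * p (Z (grid T n i) \<omega>) \<partial>M)
        = a * ?\<delta> - (\<integral>\<omega>. ?\<delta> * H (Z (grid T n i) \<omega>) \<partial>M)"
      by (simp only: integral_mult_right_zero right_diff_distrib mult.commute)
    then show "\<bar>(\<integral>\<omega>. f (Z (grid T n i) \<omega> + incr (grid T n i) (grid T n (Suc i)) \<omega>) - f (Z (grid T n i) \<omega>) \<partial>M)
       - (a * ?\<delta> - (\<integral>\<omega>. ?\<delta> * H (Z (grid T n i) \<omega>) \<partial>M))\<bar> \<le> err * (?\<delta> * sqrt ?\<delta>)"
      using one_step(3)[OF g Zm] by (simp add: grid_Suc)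
  qed
  show "integrable M (diffusion_sum T n)"
    unfolding diffusion_sum_def[abs_def] by (intro Bochner_Integration.integrable_sum step)
  let ?D = "\<lambda>i. (\<integral>\<omega>. f (Z (grid T n i) \<omega> + incr (grid T n i) (grid T n (Suc i)) \<omega>) - f (Z (grid T n i) \<omega>) \<partial>M)"
  have "(\<integral>\<omega>. diffusion_sum T n \<omega> \<partial>M) = (\<Sum>i<n. ?D i)"
    unfolding diffusion_sum_def by (intro Bochner_Integration.integral_sum step)
  moreover have "(\<integral>\<omega>. (\<Sum>i<n. ?\<delta> * H (Z (grid T n i) \<omega>)) \<partial>M) = (\<Sum>i<n. (\<integral>\<omega>. ?\<delta> * H (Z (grid T n i) \<omega>) \<partial>M))"
    using T by (intro Bochner_Integration.integral_sum integrable_mult_right H_Z_integrable grid_nonneg) auto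
  moreover have "a * T = (\<Sum>i<n. a * ?\<delta>)" using n0 by simp
  ultimately have "\<bar>(\<integral>\<omega>. diffusion_sum T n \<omega> \<partial>M) - (a * T - (\<integral>\<omega>. (\<Sum>i<n. ?\<delta> * H (Z (grid T n i) \<omega>)) \<partial>M))\<bar>
      = \<bar>\<Sum>i<n. ?D i - (a * ?\<delta> - (\<integral>\<omega>. ?\<delta> * H (Z (grid T n i) \<omega>) \<partial>M))\<bar>"
    by (simp only: sum_subtractf)
  also have "\<dots> \<le> (\<Sum>i<n. err * (?\<delta> * sqrt ?\<delta>))"
    by (intro order_trans[OF sum_abs] sum_mono step)
  also have "\<dots> = err * T * sqrt ?\<delta>" using n0 by simp
  finally show "\<bar>(\<integral>\<omega>. diffusion_sum T n \<omega> \<partial>M) - (a * T - (\<integral>\<omega>. (\<Sum>i<n. T / real n * H (Z (grid T n i) \<omega>)) \<partial>M))\<bar>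
       \<le> err * T * sqrt (T / real n)" .
qed

lemma holding_integral_props:
  assumes T: "0 < T"
  shows "(\<lambda>\<omega>. LBINT u:{0..T}. H (Z u \<omega>)) \<in> borel_measurable M"
    "integrable M (\<lambda>\<omega>. LBINT u:{0..T}. H (Z u \<omega>))"
    "(\<lambda>n. \<integral>\<omega>. (\<Sum>i<n. T / real n * H (Z (grid T n i) \<omega>)) \<partial>M) \<longlonglongrightarrow> (\<integral>\<omega>. (LBINT u:{0..T}. H (Z u \<omega>)) \<partial>M)"
proof -
  have s_meas: "(\<lambda>\<omega>. \<Sum>i<n. T / real n * H (Z (grid T n i) \<omega>)) \<in> borel_measurable M" for n
  proof -
    have [measurable]: "Z (grid T n i) \<in> borel_measurable M" for i using T by (intro Z_M grid_nonneg) auto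
    show ?thesis by measurable
  qed
  have lim: "(\<lambda>n. \<Sum>i<n. T / real n * H (Z (grid T n i) \<omega>)) \<longlonglongrightarrow> (LBINT u:{0..T}. H (Z u \<omega>))"
    if "\<omega> \<in> space M" for \<omega> by (rule holding_sum_tendsto[OF that T H_cont H_bound])
  show meas: "(\<lambda>\<omega>. LBINT u:{0..T}. H (Z u \<omega>)) \<in> borel_measurable M"
    by (rule borel_measurable_LIMSEQ_real[OF lim s_meas])
  have bound: "\<bar>\<Sum>i<n. T / real n * H (Z (grid T n i) \<omega>)\<bar> \<le> T * C" for n \<omega>
  proof -
    have "\<bar>\<Sum>i<n. T / real n * H (Z (grid T n i) \<omega>)\<bar> \<le> (\<Sum>i<n. T / real n * C)"
      using T H_bound by (intro order_trans[OF sum_abs] sum_mono) (simp add: abs_mult mult_left_mono divide_right_mono)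
    also have "\<dots> \<le> T * C" using T H_bound[of 0] by (cases "n = 0") auto
    finally show ?thesis .
  qed
  show "(\<lambda>n. \<integral>\<omega>. (\<Sum>i<n. T / real n * H (Z (grid T n i) \<omega>)) \<partial>M) \<longlonglongrightarrow> (\<integral>\<omega>. (LBINT u:{0..T}. H (Z u \<omega>)) \<partial>M)"
    by (rule integral_dominated_convergence[where w = "\<lambda>_. T * C", OF meas s_meas])
       (use lim bound in auto)
  have "\<bar>LBINT u:{0..T}. H (Z u \<omega>)\<bar> \<le> T * C" if "\<omega> \<in> space M" for \<omega>
    by (rule LIMSEQ_le_const2[OF tendsto_rabs[OF lim[OF that]]]) (use bound in auto)
  then show "integrable M (\<lambda>\<omega>. LBINT u:{0..T}. H (Z u \<omega>))"
    by (intro integrable_const_bound[of _ "T * C"] meas AE_I2) auto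
qed

lemma diffusion_sum_tendsto:
  assumes T: "0 < T"
  shows "(\<lambda>n. \<integral>\<omega>. diffusion_sum T n \<omega> \<partial>M) \<longlonglongrightarrow> a * T - (\<integral>\<omega>. (LBINT u:{0..T}. H (Z u \<omega>)) \<partial>M)"
proof -
  let ?E = "\<lambda>n. a * T - (\<integral>\<omega>. (\<Sum>i<n. T / real n * H (Z (grid T n i) \<omega>)) \<partial>M)"
  have 1: "?E \<longlonglongrightarrow> a * T - (\<integral>\<omega>. (LBINT u:{0..T}. H (Z u \<omega>)) \<partial>M)"
    by (intro tendsto_intros holding_integral_props T)
  have e: "(\<lambda>n. err * T * sqrt (T / real n)) \<longlonglongrightarrow> err * T * sqrt 0"
    by (intro tendsto_intros lim_const_over_n)
  have 2: "(\<lambda>n. (\<integral>\<omega>. diffusion_sum T n \<omega> \<partial>M) - ?E n) \<longlonglongrightarrow> 0"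
  proof (rule Lim_null_comparison)
    show "\<forall>\<^sub>F n in sequentially. norm ((\<integral>\<omega>. diffusion_sum T n \<omega> \<partial>M) - ?E n) \<le> err * T * sqrt (T / real n)"
      using eventually_ge_at_top[of "nat \<lceil>T\<rceil>"]
    proof eventually_elim
      case (elim n)
      then have "T \<le> real n" by linarith
      from diffusion_sum_bound(2)[OF T this] show ?case by simp
    qed
  qed (use e in simp)
  show ?thesis using tendsto_add[OF 2 1] by simp
qed

end

section \<open>Lower bound for the average cost\<close>

locale increasing_path =
  fixes y :: "real \<Rightarrow> real"
  assumes y_mono: "\<And>s t. 0 \<le> s \<Longrightarrow> s \<le> t \<Longrightarrow> y s \<le> y t"
    and y_nonneg: "0 \<le> y 0"
    and y_left_limit: "\<And>t. 0 < t \<Longrightarrow> \<exists>l. (y \<longlongrightarrow> l) (at_left t)"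
begin

lemma left_limit_bounds:
  assumes "0 < t"
  shows "0 \<le> s \<Longrightarrow> s < t \<Longrightarrow> y s \<le> Lim (at_left t) y" "Lim (at_left t) y \<le> y t"
proof -
  obtain l where l: "(y \<longlongrightarrow> l) (at_left t)" using y_left_limit[OF assms] by blast
  then have L: "Lim (at_left t) y = l" by (intro tendsto_Lim) auto
  show "y s \<le> Lim (at_left t) y" if "0 \<le> s" "s < t"
    unfolding L
  proof (rule tendsto_lowerbound[OF l])
    show "\<forall>\<^sub>F u in at_left t. y s \<le> y u"
      using eventually_at_left_real[OF that(2)] by eventually_elim (use that in \<open>auto intro: y_mono\<close>)
  qed simp
  show "Lim (at_left t) y \<le> y t"
    unfolding L
  proof (rule tendsto_upperbound[OF l])
    show "\<forall>\<^sub>F u in at_left t. y u \<le> y t"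
      using eventually_at_left_real[OF assms] by eventually_elim (auto intro: y_mono)
  qed simp
qed

lemma jump_nonneg: "0 \<le> t \<Longrightarrow> 0 \<le> jump y t"
  using left_limit_bounds(2)[of t] y_nonneg by (auto simp: jump_def)

text \<open>Jump times are added in increasing order: the value at the last earlier jump is at most
  the left limit at the new one, so the jumps use disjoint parts of the increase.\<close>

lemma sum_jumps_le:
  assumes "finite A" "0 \<le> s" "s \<le> t" "A \<subseteq> {s<..t}"
  shows "(\<Sum>u\<in>A. jump y u) \<le> y t - y s"
proof -
  have "\<forall>t. s \<le> t \<and> A \<subseteq> {s<..t} \<longrightarrow> (\<Sum>u\<in>A. jump y u) \<le> y t - y s"
    using assms(1)
  proof (induction A rule: finite_linorder_max_induct)
    case empty
    then show ?case using y_mono[OF assms(2)] by auto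
  next
    case (insert b A)
    show ?case
    proof (intro allI impI, elim conjE)
      fix t assume t: "s \<le> t" "insert b A \<subseteq> {s<..t}"
      then have b: "s < b" "b \<le> t" by auto
      define v where "v = (if A = {} then s else Max A)"
      have v: "s \<le> v" "v < b" "A \<subseteq> {s<..v}"
      proof -
        have M: "s < Max A \<and> Max A < b" if "A \<noteq> {}"
        proof -
          have "Max A \<in> A" using insert.hyps(1) that by simp
          then show ?thesis using insert.hyps(2) t(2) by auto
        qed
        then show "s \<le> v" "v < b" using b by (auto simp: v_def less_imp_le)
        show "A \<subseteq> {s<..v}" using insert.hyps(1) t by (auto simp: v_def)
      qed
      have "(\<Sum>u\<in>A. jump y u) \<le> y v - y s" using insert.IH v by blast
      also have "\<dots> \<le> Lim (at_left b) y - y s"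
        using left_limit_bounds(1)[of b v] v b assms(2) by simp
      finally have "(\<Sum>u\<in>A. jump y u) + jump y b \<le> y b - y s"
        using b assms(2) by (simp add: jump_def)
      moreover have "y b \<le> y t" using b assms(2) by (intro y_mono) auto
      moreover have "b \<notin> A" using insert.hyps by auto
      ultimately show "(\<Sum>u\<in>insert b A. jump y u) \<le> y t - y s"
        using insert.hyps(1) by simp
    qed
  qed
  with assms(3,4) show ?thesis by blast
qed

end

section \<open>Paths of finite ordering cost for positive \<open>c 1\<close>\<close>

locale tiers_path = tiers N Q c + increasing_path y for N Q c y +
  fixes T :: real
  assumes c1: "0 < c 1" and T: "0 < T"
    and fin: "(\<integral>\<^sup>+u. ennreal (K (jump y u)) \<partial>count_space {0..T}) + ell K * ennreal (cont_part y T) < \<infinity>"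
begin

definition J :: "real set" where "J = {u \<in> {0..T}. jump y u \<noteq> 0}"

text \<open>Each small jump costs \<open>c 1 > 0\<close> out of a finite total, and each large jump
  uses at least \<open>r\<close> of the increase \<open>y T - y 0\<close>. Time \<open>0\<close> is
  kept apart because its jump \<open>y 0\<close> is outside that increase.\<close>

lemma finite_J: "finite J"
proof -
  obtain r where r: "0 < r" "\<And>\<xi>. 0 < \<xi> \<Longrightarrow> \<xi> < r \<Longrightarrow> K \<xi> = c 1" by (rule K_small) (auto intro: that)
  let ?I = "\<integral>\<^sup>+u. ennreal (K (jump y u)) \<partial>count_space {0..T}"
  have I: "?I < \<infinity>" by (rule le_less_trans[OF _ fin]) simp
  define D where "D = enn2real ?I"
  have ID: "?I = ennreal D" using I by (simp add: D_def less_top)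
  have D0: "0 \<le> D" by (simp add: D_def)
  have "finite {u \<in> {0..T}. jump y u \<noteq> 0 \<and> jump y u < r}" (is "finite ?S")
  proof (rule ccontr)
    assume "infinite ?S"
    then obtain A where A: "A \<subseteq> ?S" "finite A" "card A = nat \<lceil>D / c 1\<rceil> + 1"
      using infinite_arbitrarily_large by blast
    have "ennreal (c 1 * card A) = (\<integral>\<^sup>+u. ennreal (c 1) * indicator A u \<partial>count_space {0..T})"
    proof -
      have "A \<in> sets (count_space {0..T})" using A(1) by auto
      then have "(\<integral>\<^sup>+u. ennreal (c 1) * indicator A u \<partial>count_space {0..T}) = ennreal (c 1) * emeasure (count_space {0..T}) A"
        by (rule nn_integral_cmult_indicator)
      also have "emeasure (count_space {0..T}) A = of_nat (card A)"
        using A by (intro emeasure_count_space_finite) auto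
      finally show ?thesis using c1 by (simp add: ennreal_mult ennreal_of_nat_eq_real_of_nat)
    qed
    also have "\<dots> \<le> ?I"
    proof (rule nn_integral_mono)
      fix u assume "u \<in> space (count_space {0..T})"
      show "ennreal (c 1) * indicator A u \<le> ennreal (K (jump y u))"
        using A(1) r(2)[of "jump y u"] jump_nonneg[of u] by (auto simp: indicator_def)
    qed
    also have "?I = ennreal D" by (rule ID)
    finally have "c 1 * card A \<le> D" using D0 by simp
    then have "real (card A) \<le> D / c 1" using c1 by (simp add: field_simps)
    then show False using A(3) by linarith
  qed
  moreover have "finite {u \<in> {0<..T}. r \<le> jump y u}" (is "finite ?L")
  proof (rule ccontr)
    assume "infinite ?L"
    then obtain A where A: "A \<subseteq> ?L" "finite A" "card A = nat \<lceil>(y T - y 0) / r\<rceil> + 1"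
      using infinite_arbitrarily_large by blast
    have "r * card A = (\<Sum>u\<in>A. r)" by simp
    also have "\<dots> \<le> (\<Sum>u\<in>A. jump y u)" using A(1) by (intro sum_mono) auto
    also have "\<dots> \<le> y T - y 0" using A T by (intro sum_jumps_le) auto
    finally have "real (card A) \<le> (y T - y 0) / r" using r(1) by (simp add: field_simps)
    then show False using A(3) by linarith
  qed
  moreover have "J \<subseteq> ?S \<union> ?L \<union> {0}" by (auto simp: J_def not_less less_le)
  ultimately show ?thesis by (meson finite.emptyI finite_UnI finite_insert finite_subset)
qed

text \<open>Near \<open>0\<close> the setup cost is the positive constant \<open>c 1\<close>, so
  \<open>K \<xi> / \<xi>\<close> tends to infinity; a finite cost then rules out continuous
  control.\<close>

lemma ell_top: "ell K = \<infinity>"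
proof -
  obtain r where r: "0 < r" "\<And>\<xi>. 0 < \<xi> \<Longrightarrow> \<xi> < r \<Longrightarrow> K \<xi> = c 1" by (rule K_small) (auto intro: that)
  have "ennreal C \<le> ell K" if C: "0 < C" for C
    unfolding ell_def
  proof (rule Liminf_bounded)
    have "0 < min r (c 1 / C)" using r c1 C by simp
    from eventually_at_right_real[OF this] show "\<forall>\<^sub>F \<xi> in at_right 0. ennreal C \<le> ennreal (K \<xi> / \<xi>)"
    proof eventually_elim
      case (elim \<xi>)
      then show ?case using r(2)[of \<xi>] C by (intro ennreal_leI) (auto simp: field_simps)
    qed
  qed
  note * = this
  have le: "of_nat n \<le> ell K" for n
  proof -
    have "of_nat n \<le> ennreal (real n + 1)" by (simp only: ennreal_of_nat_eq_real_of_nat) (rule ennreal_leI, simp)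
    also have "\<dots> \<le> ell K" by (rule *) linarith
    finally show ?thesis .
  qed
  show ?thesis
  proof (rule ccontr)
    assume "ell K \<noteq> \<infinity>"
    then have "ell K < \<infinity>" by (simp add: less_top)
    then obtain n where "ell K < of_nat n" using ennreal_Ex_less_of_nat[of "ell K"] by auto
    with le[of n] show False by simp
  qed
qed

text \<open>A finite cost with \<open>ell K = \<infinity>\<close> forces
  \<open>ennreal (cont_part y T) = 0\<close>. As \<open>ennreal\<close> clips negative numbers, this
  yields an inequality; the opposite one comes from \<open>sum_jumps_le\<close>.\<close>

lemma jumps_exhaust: "y T \<le> (\<Sum>u\<in>J. jump y u)"
proof -
  have "ell K * ennreal (cont_part y T) \<noteq> \<infinity>" using fin by auto
  then have "ennreal (cont_part y T) = 0" unfolding ell_top by (metis ennreal_top_mult infinity_ennreal_def)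
  then have "cont_part y T \<le> 0" by (simp add: ennreal_eq_0_iff)
  moreover have "(\<Sum>\<^sub>\<infinity>u\<in>{0..T}. jump y u) = (\<Sum>\<^sub>\<infinity>u\<in>J. jump y u)"
    by (rule infsum_cong_neutral) (auto simp: J_def)
  ultimately show ?thesis using finite_J by (simp add: cont_part_def)
qed

text \<open>On each of the pieces \<open>{0}\<close>, \<open>(0, s]\<close>, \<open>(s, t]\<close>,
  \<open>(t, T]\<close> the jumps sum to at most the increase; since together they exhaust
  \<open>y T\<close>, none of these bounds can be strict.\<close>

lemma increment_eq:
  assumes "0 \<le> s" "s \<le> t" "t \<le> T"
  shows "(\<Sum>u\<in>J \<inter> {s<..t}. jump y u) = y t - y s"
proof -
  have le: "(\<Sum>u\<in>J \<inter> {a<..b}. jump y u) \<le> y b - y a" if "0 \<le> a" "a \<le> b" for a b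
    using finite_J that by (intro sum_jumps_le) auto
  have split: "(\<Sum>u\<in>J \<inter> {a<..d}. jump y u) = (\<Sum>u\<in>J \<inter> {a<..b}. jump y u) + (\<Sum>u\<in>J \<inter> {b<..d}. jump y u)"
    if "a \<le> b" "b \<le> d" for a b d
  proof -
    have "J \<inter> {a<..d} = J \<inter> {a<..b} \<union> J \<inter> {b<..d}" using that by auto
    moreover have "(J \<inter> {a<..b}) \<inter> (J \<inter> {b<..d}) = {}" by auto
    ultimately show ?thesis using finite_J by (simp only: sum.union_disjoint finite_Int disjI1)
  qed
  have "J = J \<inter> {0} \<union> J \<inter> {0<..T}" by (auto simp: J_def)
  then have "(\<Sum>u\<in>J. jump y u) = (\<Sum>u\<in>J \<inter> {0} \<union> J \<inter> {0<..T}. jump y u)" by simp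
  also have "\<dots> = (\<Sum>u\<in>J \<inter> {0}. jump y u) + (\<Sum>u\<in>J \<inter> {0<..T}. jump y u)"
    using finite_J by (intro sum.union_disjoint) auto
  also have "(\<Sum>u\<in>J \<inter> {0}. jump y u) \<le> y 0"
    using y_nonneg by (cases "0 \<in> J") (auto simp: jump_def)
  finally have "y T \<le> y 0 + (\<Sum>u\<in>J \<inter> {0<..T}. jump y u)" using jumps_exhaust by simp
  then show ?thesis
    using split[of 0 s T] split[of s t T] le[of 0 s] le[of s t] le[of t T] assms by linarith
qed

text \<open>Jumps are applied one after another from an arbitrary point; \<open>G\<close> obeys the
  inequality everywhere, so neither their order nor their true positions matter.\<close>

lemma potential_increment:
  assumes G: "\<And>z \<xi>. 0 < \<xi> \<Longrightarrow> 0 \<le> G (z + \<xi>) - G z + K \<xi>"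
    and "finite A" "A \<subseteq> J"
  shows "- (\<Sum>u\<in>A. K (jump y u)) \<le> G (z + (\<Sum>u\<in>A. jump y u)) - G z"
  using assms(2,3)
proof (induction A arbitrary: z)
  case (insert u A)
  have "0 < jump y u" using insert.prems jump_nonneg[of u] by (auto simp: J_def less_le)
  then have "0 \<le> G (z + jump y u) - G z + K (jump y u)" by (rule G)
  moreover have "- (\<Sum>u\<in>A. K (jump y u)) \<le> G (z + jump y u + (\<Sum>u\<in>A. jump y u)) - G (z + jump y u)"
    using insert by auto
  ultimately show ?case using insert.hyps by (simp add: add.assoc)
qed simp

text \<open>\<open>j\<close> is the total setup cost of the jumps. The base points
  \<open>zz i\<close> are arbitrary because the inequality for \<open>G\<close> holds everywhere,
  which allows the jumps of a cell to be performed at its end; one \<open>j\<close> serves every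
  grid and every \<open>G\<close>.\<close>

lemma path_cost_lower:
  obtains j where "0 \<le> j"
    "ennreal j \<le> (\<integral>\<^sup>+u. ennreal (K (jump y u)) \<partial>count_space {0..T}) + ell K * ennreal (cont_part y T)"
    "\<And>G z0 zz n. (\<And>z \<xi>. 0 < \<xi> \<Longrightarrow> 0 \<le> G (z + \<xi>) - G z + K \<xi>) \<Longrightarrow> 0 < n \<Longrightarrow>
       - j \<le> G (z0 + y 0) - G z0 +
         (\<Sum>i<n. G (zz i + (y (grid T n (Suc i)) - y (grid T n i))) - G (zz i))"
proof
  define j where "j = (\<Sum>u\<in>J. K (jump y u))"
  show "0 \<le> j" unfolding j_def by (intro sum_nonneg K_nonneg)
  have "(\<integral>\<^sup>+u. ennreal (K (jump y u)) \<partial>count_space {0..T}) = (\<Sum>u\<in>J. ennreal (K (jump y u)))"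
    by (rule nn_integral_count_space') (use finite_J in \<open>auto simp: J_def K_0\<close>)
  also have "\<dots> = ennreal j" unfolding j_def by (intro sum_ennreal K_nonneg)
  finally show "ennreal j \<le> (\<integral>\<^sup>+u. ennreal (K (jump y u)) \<partial>count_space {0..T}) + ell K * ennreal (cont_part y T)"
    by simp
  fix G :: "real \<Rightarrow> real" and z0 zz and n :: nat
  assume G: "\<And>z \<xi>. 0 < \<xi> \<Longrightarrow> 0 \<le> G (z + \<xi>) - G z + K \<xi>" and n: "0 < n"
  let ?Kj = "\<lambda>A. \<Sum>u\<in>A. K (jump y u)"
  have sums: "- ?Kj (J \<inter> {0<..grid T n k}) \<le> (\<Sum>i<k. G (zz i + (y (grid T n (Suc i)) - y (grid T n i))) - G (zz i))"
    if "k \<le> n" for k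
    using that
  proof (induction k)
    case (Suc k)
    let ?A = "J \<inter> {grid T n k<..grid T n (Suc k)}"
    have g: "0 \<le> grid T n k" "grid T n k \<le> grid T n (Suc k)" "grid T n (Suc k) \<le> T"
      using grid_nonneg[of T n k] grid_less[OF T n, of k "Suc k"] grid_le[OF T n Suc.prems] T by auto
    have "J \<inter> {0<..grid T n (Suc k)} = J \<inter> {0<..grid T n k} \<union> ?A" using g by auto
    then have "?Kj (J \<inter> {0<..grid T n (Suc k)}) = ?Kj (J \<inter> {0<..grid T n k}) + ?Kj ?A"
      using finite_J by (simp only:) (subst sum.union_disjoint; force)
    moreover have "- ?Kj ?A \<le> G (zz k + (\<Sum>u\<in>?A. jump y u)) - G (zz k)"
      using finite_J by (intro potential_increment G) auto
    ultimately show ?case using Suc increment_eq[OF g] by simp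
  qed simp
  have first: "- ?Kj (J \<inter> {0}) \<le> G (z0 + y 0) - G z0"
  proof (cases "0 \<in> J")
    case True
    then have "0 < y 0" using y_nonneg by (auto simp: J_def jump_def)
    then show ?thesis using G[of "y 0" z0] True by (simp add: jump_def)
  next
    case False
    then have "y 0 = 0" using T by (auto simp: J_def jump_def)
    then show ?thesis using False by simp
  qed
  have "J = J \<inter> {0} \<union> J \<inter> {0<..grid T n n}" using T n by (auto simp: J_def grid_end)
  then have "j = ?Kj (J \<inter> {0} \<union> J \<inter> {0<..grid T n n})" unfolding j_def by simp
  also have "\<dots> = ?Kj (J \<inter> {0}) + ?Kj (J \<inter> {0<..grid T n n})"
    using finite_J by (intro sum.union_disjoint) auto
  finally show "- j \<le> G (z0 + y 0) - G z0 + (\<Sum>i<n. G (zz i + (y (grid T n (Suc i)) - y (grid T n i))) - G (zz i))"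
    using sums[of n] first by linarith
qed

end

lemma ennreal_integral_le:
  fixes G :: "'a \<Rightarrow> real"
  assumes "integrable M G" shows "ennreal (\<integral>\<omega>. G \<omega> \<partial>M) \<le> (\<integral>\<^sup>+\<omega>. ennreal (G \<omega>) \<partial>M)"
proof -
  have i: "integrable M (\<lambda>\<omega>. max 0 (G \<omega>))" using assms by simp
  have "ennreal (\<integral>\<omega>. G \<omega> \<partial>M) \<le> ennreal (\<integral>\<omega>. max 0 (G \<omega>) \<partial>M)"
    by (intro ennreal_leI integral_mono assms i) auto
  also have "\<dots> = (\<integral>\<^sup>+\<omega>. ennreal (max 0 (G \<omega>)) \<partial>M)"
    by (rule nn_integral_eq_integral[OF i, symmetric]) simp
  also have "\<dots> = (\<integral>\<^sup>+\<omega>. ennreal (G \<omega>) \<partial>M)"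
    by (intro nn_integral_cong) (simp add: max_def ennreal_neg)
  finally show ?thesis .
qed

context policy
begin

lemma increasing: "\<omega> \<in> space M \<Longrightarrow> increasing_path (\<lambda>u. Y u \<omega>)"
  using Y_mono[of \<omega>] Y_nonneg[of \<omega> 0] adm by unfold_locales (auto simp: admissible_def)

lemma holding_nn_integral:
  assumes "\<omega> \<in> space M" "continuous_on UNIV H" "\<And>z. 0 \<le> H z" "\<And>z. H z \<le> C"
  shows "(\<integral>\<^sup>+u\<in>{0..T}. ennreal (H (Z u \<omega>)) \<partial>lborel) = ennreal (LBINT u:{0..T}. H (Z u \<omega>))"
proof -
  have [measurable]: "H \<in> borel_measurable borel" by (rule borel_measurable_continuous_onI[OF assms(2)])
  have [measurable]: "(\<lambda>u. Z (max 0 u) \<omega>) \<in> borel_measurable borel" by (rule path_regular[OF assms(1)])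
  have C: "0 \<le> C" using assms(3,4)[of 0] by linarith
  have i: "integrable lborel (\<lambda>u. indicator {0..T} u * H (Z (max 0 u) \<omega>))"
  proof (rule Bochner_Integration.integrable_bound[where f = "\<lambda>u. C * indicat_real {0..T} u"])
    show "integrable lborel (\<lambda>u. C * indicat_real {0..T} u)"
      by (intro integrable_mult_right integrable_real_indicator) (auto simp: emeasure_lborel_Icc_eq)
    show "AE u in lborel. norm (indicat_real {0..T} u * H (Z (max 0 u) \<omega>)) \<le> norm (C * indicat_real {0..T} u)"
      using assms(3,4) C by (intro AE_I2) (auto simp: indicator_def)
  qed measurable
  have "(\<integral>\<^sup>+u\<in>{0..T}. ennreal (H (Z u \<omega>)) \<partial>lborel) = (\<integral>\<^sup>+u. ennreal (indicator {0..T} u * H (Z (max 0 u) \<omega>)) \<partial>lborel)"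
    by (intro nn_integral_cong) (auto simp: indicator_def max_def)
  also have "\<dots> = ennreal (LBINT u. indicator {0..T} u * H (Z (max 0 u) \<omega>))"
    by (rule nn_integral_eq_integral[OF i]) (use assms(3) in auto)
  also have "(LBINT u. indicator {0..T} u * H (Z (max 0 u) \<omega>)) = (LBINT u:{0..T}. H (Z u \<omega>))"
    using holding_integral_cong[of T H \<omega>] by (simp add: set_lebesgue_integral_def)
  finally show ?thesis .
qed

end

section \<open>The cost of an arbitrary policy\<close>

locale controlled = inventory \<mu> \<sigma> h N Q c k + policy M F B \<mu> \<sigma> x Y
  for \<mu> \<sigma> :: real and h :: "real \<Rightarrow> real" and N :: nat and Q :: "nat \<Rightarrow> ereal" and c :: "nat \<Rightarrow> real"
    and k :: real and M :: "'a measure" and F B x Y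
begin

definition cost :: "real \<Rightarrow> 'a \<Rightarrow> ennreal" where
  "cost T \<omega> = total_cost h K k (\<lambda>u. Z u \<omega>) (\<lambda>u. Y u \<omega>) T"

lemma AC_eq: "AC M B \<mu> \<sigma> k h K x Y = Limsup at_top (\<lambda>T::real. (\<integral>\<^sup>+\<omega>. cost T \<omega> \<partial>M) / ennreal T)"
  by (simp add: AC_def cost_def Z_def)

text \<open>By the choice of \<open>lam\<close>,
  \<open>\<sigma>\<^sup>2 / 2 * (lam \<mu> \<sigma> / \<mu>) = 1\<close>, so the terms in
  \<open>mc A z\<close> cancel.\<close>

lemma generator:
  "\<sigma>\<^sup>2 / 2 * (lam \<mu> \<sigma> / \<mu> * (mc A z - hc A z)) - \<mu> * (mc A z / \<mu> - a / \<mu>) = a - hc A z"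
  using mu_pos sigma_pos by (simp add: lam_def field_simps)

lemma policy_testI:
  assumes A: "0 \<le> A" and f: "\<And>x. (f has_real_derivative mc A x / \<mu> - a / \<mu>) (at x)"
  shows "\<exists>P R L. policy_test M F B \<mu> \<sigma> Y f (\<lambda>x. mc A x / \<mu> - a / \<mu>)
    (\<lambda>x. lam \<mu> \<sigma> / \<mu> * (mc A x - hc A x)) P R L a (hc A) (h A + h (- A))"
proof -
  from truncated_test_function[OF A f] obtain P R L where
    tf: "test_function f (\<lambda>x. mc A x / \<mu> - a / \<mu>) (\<lambda>x. lam \<mu> \<sigma> / \<mu> * (mc A x - hc A x)) P R L" by blast
  then show ?thesis
    using generator hc_cont hc_abs_bound[OF A] policy_axioms
    by (intro exI[of _ P] exI[of _ R] exI[of _ L] policy_test.intro brownian_test.intro policy_test_axioms.intro brownian_axioms)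
qed

text \<open>Telescoping \<open>f\<close> along the grid leaves the control increments, which the
  ordering cost bounds. With \<open>Kf = (\<lambda>_. 0)\<close> the function
  \<open>f z + k * z\<close> is nondecreasing, so control of any kind is covered by its proportional
  cost; this alternative serves the base stock policy.\<close>

lemma cost_lower_path:
  assumes A: "0 \<le> A" and pt: "policy_test M F B \<mu> \<sigma> Y f p q P R L a (hc A) C"
    and Kf: "Kf = K \<and> 0 < c 1 \<or> Kf = (\<lambda>_. 0)"
    and G: "\<And>z \<xi>. 0 < \<xi> \<Longrightarrow> 0 \<le> f (z + \<xi>) - f z + k * \<xi> + Kf \<xi>"
    and \<omega>: "\<omega> \<in> space M" and T: "0 < T" and n: "0 < n"
  shows "ennreal ((LBINT u:{0..T}. hc A (Z u \<omega>)) + f x - f (Z T \<omega>) + policy_test.diffusion_sum B \<mu> \<sigma> x Y f T n \<omega>)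
    \<le> cost T \<omega>"
proof (cases "cost T \<omega> = \<infinity>")
  case False
  interpret policy_test M F B \<mu> \<sigma> x Y f p q P R L a "hc A" C by (rule pt)
  interpret y: increasing_path "\<lambda>u. Y u \<omega>" by (rule increasing[OF \<omega>])
  let ?y = "\<lambda>u. Y u \<omega>"
  let ?jc = "(\<integral>\<^sup>+u. ennreal (K (jump ?y u)) \<partial>count_space {0..T}) + ell K * ennreal (cont_part ?y T)"
  have cost: "cost T \<omega> = (\<integral>\<^sup>+u\<in>{0..T}. ennreal (h (Z u \<omega>)) \<partial>lborel) + ?jc + ennreal (k * Y T \<omega>)"
    unfolding cost_def total_cost_def by (simp add: ac_simps)
  have jc: "?jc < \<infinity>" using False unfolding cost by (auto simp: less_top)
  define G where "G z = f z + k * z" for z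
  define I where "I i = Z (grid T n i) \<omega> + incr (grid T n i) (grid T n (Suc i)) \<omega>" for i
  define S where "S = G (x + Y 0 \<omega>) - G x + (\<Sum>i<n. G (I i + (Y (grid T n (Suc i)) \<omega> - Y (grid T n i) \<omega>)) - G (I i))"
  have G': "0 \<le> G (z + \<xi>) - G z + Kf \<xi>" if "0 < \<xi>" for z \<xi>
    using assms(4)[OF that, of z] by (simp add: G_def algebra_simps)
  have "\<exists>j\<ge>0. ennreal j \<le> ?jc \<and> - j \<le> S"
    using Kf
  proof
    assume K: "Kf = K \<and> 0 < c 1"
    interpret tiers_path N Q c ?y T
      using K T jc by unfold_locales auto
    show ?thesis
    proof (rule path_cost_lower)
      fix j assume j: "0 \<le> j" "ennreal j \<le> ?jc"
        "\<And>G z0 zz n. (\<And>z \<xi>. 0 < \<xi> \<Longrightarrow> 0 \<le> G (z + \<xi>) - G z + K \<xi>) \<Longrightarrow> 0 < n \<Longrightarrow>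
         - j \<le> G (z0 + Y 0 \<omega>) - G z0 +
           (\<Sum>i<n. G (zz i + (Y (grid T n (Suc i)) \<omega> - Y (grid T n i) \<omega>)) - G (zz i))"
      have "- j \<le> S" unfolding S_def by (rule j(3)[OF _ n]) (use G' K in auto)
      with j(1,2) show ?thesis by blast
    qed
  next
    assume K: "Kf = (\<lambda>_. 0)"
    have mono: "G z \<le> G (z + d)" if "0 \<le> d" for z d
      using G'[of d z] that K by (cases "d = 0") auto
    have "0 \<le> Y (grid T n (Suc i)) \<omega> - Y (grid T n i) \<omega>" for i
      using y.y_mono[of "grid T n i" "grid T n (Suc i)"] grid_nonneg[of T n i] T n by (simp add: grid_Suc)
    then have "0 \<le> (\<Sum>i<n. G (I i + (Y (grid T n (Suc i)) \<omega> - Y (grid T n i) \<omega>)) - G (I i))"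
      using mono by (intro sum_nonneg) auto
    then have "0 \<le> S" using mono[of "Y 0 \<omega>" x] y.y_nonneg unfolding S_def by simp
    then show ?thesis by (intro exI[of _ 0]) auto
  qed
  then obtain j where j: "0 \<le> j" "ennreal j \<le> ?jc" "- j \<le> S" by blast
  have S: "S = control_sum T n \<omega> + f (Z 0 \<omega>) - f x + k * Y T \<omega>"
  proof -
    have "I i + (Y (grid T n (Suc i)) \<omega> - Y (grid T n i) \<omega>) = Z (grid T n (Suc i)) \<omega>" for i
      unfolding I_def using Y_step[of "grid T n (Suc i)" \<omega> "grid T n i"] by simp
    then have "(\<Sum>i<n. G (I i + (Y (grid T n (Suc i)) \<omega> - Y (grid T n i) \<omega>)) - G (I i))
        = (\<Sum>i<n. (f (Z (grid T n (Suc i)) \<omega>) - f (I i)) + (k * Y (grid T n (Suc i)) \<omega> - k * Y (grid T n i) \<omega>))"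
      by (intro sum.cong refl) (simp add: G_def algebra_simps flip: \<open>\<And>i. _ = Z (grid T n (Suc i)) \<omega>\<close>)
    also have "\<dots> = control_sum T n \<omega> + (k * Y T \<omega> - k * Y 0 \<omega>)"
      unfolding sum.distrib control_sum_def I_def sum_lessThan_telescope[of "\<lambda>i. k * Y (grid T n i) \<omega>"]
      using n by (simp add: grid_end)
    finally show ?thesis using \<omega> by (simp add: S_def G_def Z_def X_0 algebra_simps)
  qed
  have "ennreal ((LBINT u:{0..T}. hc A (Z u \<omega>)) + f x - f (Z T \<omega>) + diffusion_sum T n \<omega>)
      \<le> ennreal ((LBINT u:{0..T}. hc A (Z u \<omega>)) + j + k * Y T \<omega>)"
    using j(3) telescope[OF n, of T \<omega>] unfolding S by (intro ennreal_leI) linarith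
  also have "\<dots> = ennreal (LBINT u:{0..T}. hc A (Z u \<omega>)) + ennreal j + ennreal (k * Y T \<omega>)"
  proof -
    have "0 \<le> (LBINT u:{0..T}. hc A (Z u \<omega>))"
      unfolding set_lebesgue_integral_def by (intro integral_nonneg_AE) (simp add: hc_nonneg)
    moreover have "0 \<le> k * Y T \<omega>" using k_nonneg Y_nonneg[OF \<omega>, of T] T by simp
    ultimately show ?thesis using j(1) by (simp add: ennreal_plus)
  qed
  also have "\<dots> \<le> cost T \<omega>"
    unfolding cost
  proof (intro add_mono j(2) order_refl)
    have "ennreal (LBINT u:{0..T}. hc A (Z u \<omega>)) = (\<integral>\<^sup>+u\<in>{0..T}. ennreal (hc A (Z u \<omega>)) \<partial>lborel)"
      by (rule holding_nn_integral[OF \<omega> hc_cont hc_nonneg hc_bound[OF A], symmetric])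
    also have "\<dots> \<le> (\<integral>\<^sup>+u\<in>{0..T}. ennreal (h (Z u \<omega>)) \<partial>lborel)"
      by (intro nn_integral_mono mult_right_mono ennreal_leI hc_le A) auto
    finally show "ennreal (LBINT u:{0..T}. hc A (Z u \<omega>)) \<le> (\<integral>\<^sup>+u\<in>{0..T}. ennreal (h (Z u \<omega>)) \<partial>lborel)" .
  qed
  finally show ?thesis .
qed simp

text \<open>As the mesh tends to \<open>0\<close>, the mean holding integral cancels against the one
  produced by the generator, leaving \<open>(\<nu> - \<epsilon>) * T\<close> and boundary terms. It
  matters later that \<open>f\<close> and its Lipschitz constant do not depend on
  \<open>T\<close>.\<close>

lemma cost_lower_expectation:
  assumes Kf: "Kf = K \<and> 0 < c 1 \<or> Kf = (\<lambda>_. 0)"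
    and base: "\<And>z \<xi>. 0 < \<xi> \<Longrightarrow> 0 \<le> (LBINT u:{z..z + \<xi>}. g u) + (k - \<nu> / \<mu>) * \<xi> + Kf \<xi>"
    and eps: "0 < \<epsilon>"
  obtains f P where "f \<in> borel_measurable borel" "0 \<le> P" "\<And>y z. \<bar>f y - f z\<bar> \<le> P * \<bar>y - z\<bar>"
    "\<And>T. 0 < T \<Longrightarrow> integrable M (Z T) \<Longrightarrow>
       ennreal ((\<nu> - \<epsilon>) * T + f x - (\<integral>\<omega>. f (Z T \<omega>) \<partial>M)) \<le> (\<integral>\<^sup>+\<omega>. cost T \<omega> \<partial>M)"
proof -
  have Kf0: "0 \<le> Kf \<xi>" for \<xi> using Kf K_nonneg by auto
  obtain A where A: "0 \<le> A" and G: "\<And>f z \<xi>. (\<And>u. (f has_real_derivative mc A u / \<mu> - (\<nu> - \<epsilon>) / \<mu>) (at u)) \<Longrightarrow> 0 < \<xi> \<Longrightarrow>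
       0 \<le> f (z + \<xi>) - f z + k * \<xi> + Kf \<xi>"
    using truncation[OF Kf0 base eps] by blast
  have "continuous_on UNIV (\<lambda>u. mc A u / \<mu> - (\<nu> - \<epsilon>) / \<mu>)"
    using mu_pos by (intro continuous_intros mc_cont[OF A]) auto
  from ex_antiderivative[OF this] obtain f
    where f: "\<And>u. (f has_real_derivative mc A u / \<mu> - (\<nu> - \<epsilon>) / \<mu>) (at u)" by blast
  obtain P R L where pt: "policy_test M F B \<mu> \<sigma> Y f (\<lambda>x. mc A x / \<mu> - (\<nu> - \<epsilon>) / \<mu>)
    (\<lambda>x. lam \<mu> \<sigma> / \<mu> * (mc A x - hc A x)) P R L (\<nu> - \<epsilon>) (hc A) (h A + h (- A))"
    using policy_testI[OF A f] by blast
  interpret policy_test M F B \<mu> \<sigma> x Y f "\<lambda>x. mc A x / \<mu> - (\<nu> - \<epsilon>) / \<mu>"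
    "\<lambda>x. lam \<mu> \<sigma> / \<mu> * (mc A x - hc A x)" P R L "\<nu> - \<epsilon>" "hc A" "h A + h (- A)" by (rule pt)
  have main: "ennreal ((\<nu> - \<epsilon>) * T + f x - (\<integral>\<omega>. f (Z T \<omega>) \<partial>M)) \<le> (\<integral>\<^sup>+\<omega>. cost T \<omega> \<partial>M)"
    if T: "0 < T" and int: "integrable M (Z T)" for T
  proof -
    have [measurable]: "Z T \<in> borel_measurable M" using T by (intro Z_M) auto
    have int_f: "integrable M (\<lambda>\<omega>. f (Z T \<omega>))"
    proof (rule Bochner_Integration.integrable_bound)
      show "integrable M (\<lambda>\<omega>. P * \<bar>Z T \<omega>\<bar> + \<bar>f 0\<bar>)" using int by simp
      show "AE \<omega> in M. norm (f (Z T \<omega>)) \<le> norm (P * \<bar>Z T \<omega>\<bar> + \<bar>f 0\<bar>)"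
        using f_lipschitz[of "Z T \<omega>" 0 for \<omega>] by (intro AE_I2) (smt (verit) real_norm_def)
    qed measurable
    let ?I = "\<lambda>\<omega>. LBINT u:{0..T}. hc A (Z u \<omega>)"
    let ?G = "\<lambda>n \<omega>. ?I \<omega> + f x - f (Z T \<omega>) + diffusion_sum T n \<omega>"
    have "(\<lambda>n. (\<integral>\<omega>. ?I \<omega> \<partial>M) + f x - (\<integral>\<omega>. f (Z T \<omega>) \<partial>M) + (\<integral>\<omega>. diffusion_sum T n \<omega> \<partial>M))
      \<longlonglongrightarrow> (\<integral>\<omega>. ?I \<omega> \<partial>M) + f x - (\<integral>\<omega>. f (Z T \<omega>) \<partial>M) + ((\<nu> - \<epsilon>) * T - (\<integral>\<omega>. ?I \<omega> \<partial>M))"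
      by (intro tendsto_intros diffusion_sum_tendsto T)
    then have lim: "(\<lambda>n. ennreal ((\<integral>\<omega>. ?I \<omega> \<partial>M) + f x - (\<integral>\<omega>. f (Z T \<omega>) \<partial>M) + (\<integral>\<omega>. diffusion_sum T n \<omega> \<partial>M)))
      \<longlonglongrightarrow> ennreal ((\<nu> - \<epsilon>) * T + f x - (\<integral>\<omega>. f (Z T \<omega>) \<partial>M))"
      by (intro tendsto_ennrealI) (simp add: algebra_simps)
    show ?thesis
    proof (rule LIMSEQ_le_const2[OF lim], intro exI allI impI)
      fix n assume "nat \<lceil>T\<rceil> \<le> n"
      then have n: "T \<le> real n" by linarith
      then have n0: "0 < n" using T by (cases n) auto
      note dint = diffusion_sum_bound(1)[OF T n] note Iint = holding_integral_props(2)[OF T]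
      have Gint: "integrable M (?G n)" using dint Iint int_f by simp
      have "(\<integral>\<omega>. ?I \<omega> \<partial>M) + f x - (\<integral>\<omega>. f (Z T \<omega>) \<partial>M) + (\<integral>\<omega>. diffusion_sum T n \<omega> \<partial>M) = (\<integral>\<omega>. ?G n \<omega> \<partial>M)"
        using dint Iint int_f by (simp add: prob_space)
      then have "ennreal ((\<integral>\<omega>. ?I \<omega> \<partial>M) + f x - (\<integral>\<omega>. f (Z T \<omega>) \<partial>M) + (\<integral>\<omega>. diffusion_sum T n \<omega> \<partial>M))
          = ennreal (\<integral>\<omega>. ?G n \<omega> \<partial>M)" by simp
      also have "\<dots> \<le> (\<integral>\<^sup>+\<omega>. ennreal (?G n \<omega>) \<partial>M)" by (rule ennreal_integral_le[OF Gint])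
      also have "\<dots> \<le> (\<integral>\<^sup>+\<omega>. cost T \<omega> \<partial>M)"
        by (intro nn_integral_mono cost_lower_path[OF A pt Kf _ _ T n0] G f)
      finally show "ennreal ((\<integral>\<omega>. ?I \<omega> \<partial>M) + f x - (\<integral>\<omega>. f (Z T \<omega>) \<partial>M) + (\<integral>\<omega>. diffusion_sum T n \<omega> \<partial>M))
          \<le> (\<integral>\<^sup>+\<omega>. cost T \<omega> \<partial>M)" .
    qed
  qed
  show thesis by (rule that[OF f_meas bounds_nonneg(1) f_lipschitz main])
qed

text \<open>Linear growth of \<open>h\<close> bounds the time average of \<open>E \<bar>Z u\<bar>\<close> by the cost, so there are arbitrarily
  late times at which the boundary term \<open>E (f (Z T))\<close> is negligible.\<close>

lemma moderate_time:
  assumes \<alpha>: "0 < \<alpha>" "\<And>z. \<alpha> * (\<bar>z\<bar> - 1) \<le> h z" and T: "0 < T"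
    and cost: "(\<integral>\<^sup>+\<omega>. cost (2 * T) \<omega> \<partial>M) \<le> ennreal (D * (2 * T))" and D: "0 \<le> D"
  obtains u where "T \<le> u" "u \<le> 2 * T" "integrable M (Z u)" "(\<integral>\<omega>. \<bar>Z u \<omega>\<bar> \<partial>M) \<le> 2 * (D / \<alpha> + 1) + 1"
proof -
  interpret pair_sigma_finite M lborel ..
  \<comment> \<open>The integral of the mean of \<open>\<bar>Z u\<bar>\<close> over
    \<open>[0, 2 * T]\<close> is at most \<open>2 * (D / \<alpha> + 1) * T\<close>; means of at
    least \<open>?C\<close> on all of \<open>[T, 2 * T]\<close> would exceed this by at least
    \<open>T\<close>.\<close>
  let ?C = "2 * (D / \<alpha> + 1) + 1"
  have "0 \<le> D / \<alpha>" using \<alpha>(1) D by simp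
  then have C: "0 < ?C" by (intro add_nonneg_pos mult_nonneg_nonneg add_nonneg_nonneg) auto
  have [measurable]: "(\<lambda>p. Z (max 0 (snd p)) (fst p)) \<in> borel_measurable (M \<Otimes>\<^sub>M lborel)"
    using Z_jointly_measurable
    by (simp add: split_beta' measurable_cong_sets[OF sets_pair_measure_cong[OF refl sets_lborel] refl])
  define \<phi> where "\<phi> p = ennreal \<bar>Z (max 0 (snd p)) (fst p)\<bar> * indicator {0..2 * T} (snd p)" for p
  have [measurable]: "\<phi> \<in> borel_measurable (M \<Otimes>\<^sub>M lborel)" unfolding \<phi>_def by measurable
  define \<psi> where "\<psi> \<omega> = (\<integral>\<^sup>+u. ennreal (h (Z (max 0 u) \<omega>)) * indicator {0..2 * T} u \<partial>lborel)" for \<omega>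
  have [measurable]: "\<psi> \<in> borel_measurable M"
  proof -
    have "(\<lambda>(\<omega>, u). ennreal (h (Z (max 0 u) \<omega>)) * indicator {0..2 * T} u) \<in> borel_measurable (M \<Otimes>\<^sub>M lborel)"
      unfolding split_beta' by measurable
    then show ?thesis unfolding \<psi>_def[abs_def] by (rule lborel.borel_measurable_nn_integral)
  qed
  have path: "(\<integral>\<^sup>+u. \<phi> (\<omega>, u) \<partial>lborel) \<le> ennreal (1 / \<alpha>) * \<psi> \<omega> + ennreal (2 * T)" if \<omega>: "\<omega> \<in> space M" for \<omega>
  proof -
    have [measurable]: "(\<lambda>u. Z (max 0 u) \<omega>) \<in> borel_measurable borel" by (rule path_regular[OF \<omega>])
    have "(\<integral>\<^sup>+u. \<phi> (\<omega>, u) \<partial>lborel) \<le> (\<integral>\<^sup>+u. ennreal (1 / \<alpha>) * (ennreal (h (Z (max 0 u) \<omega>)) * indicator {0..2 * T} u) + indicator {0..2 * T} u \<partial>lborel)"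
    proof (rule nn_integral_mono)
      fix u
      have "\<bar>Z (max 0 u) \<omega>\<bar> \<le> 1 / \<alpha> * h (Z (max 0 u) \<omega>) + 1"
        using \<alpha>(1) \<alpha>(2)[of "Z (max 0 u) \<omega>"] by (simp add: field_simps)
      then have "ennreal \<bar>Z (max 0 u) \<omega>\<bar> \<le> ennreal (1 / \<alpha> * h (Z (max 0 u) \<omega>) + 1)" by (rule ennreal_leI)
      also have "\<dots> = ennreal (1 / \<alpha> * h (Z (max 0 u) \<omega>)) + ennreal 1"
        using \<alpha>(1) h_nonneg by (intro ennreal_plus) auto
      also have "ennreal (1 / \<alpha> * h (Z (max 0 u) \<omega>)) = ennreal (1 / \<alpha>) * ennreal (h (Z (max 0 u) \<omega>))"
        using \<alpha>(1) h_nonneg by (intro ennreal_mult) auto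
      finally have "ennreal \<bar>Z (max 0 u) \<omega>\<bar> \<le> ennreal (1 / \<alpha>) * ennreal (h (Z (max 0 u) \<omega>)) + 1" by simp
      then show "\<phi> (\<omega>, u) \<le> ennreal (1 / \<alpha>) * (ennreal (h (Z (max 0 u) \<omega>)) * indicator {0..2 * T} u) + indicator {0..2 * T} u"
        by (auto simp: \<phi>_def indicator_def)
    qed
    also have "\<dots> = ennreal (1 / \<alpha>) * (\<integral>\<^sup>+u. ennreal (h (Z (max 0 u) \<omega>)) * indicator {0..2 * T} u \<partial>lborel) + (\<integral>\<^sup>+u. indicator {0..2 * T} u \<partial>lborel)"
      by (subst nn_integral_add, measurable, subst nn_integral_cmult) auto
    also have "(\<integral>\<^sup>+u. indicator {0..2 * T} u \<partial>lborel) = ennreal (2 * T)" using T by simp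
    finally show ?thesis by (simp only: \<psi>_def)
  qed
  have "(\<integral>\<^sup>+u. (\<integral>\<^sup>+\<omega>. \<phi> (\<omega>, u) \<partial>M) \<partial>lborel) = (\<integral>\<^sup>+\<omega>. (\<integral>\<^sup>+u. \<phi> (\<omega>, u) \<partial>lborel) \<partial>M)"
    by (rule Fubini) measurable
  also have "\<dots> \<le> ennreal (2 * (D / \<alpha> + 1) * T)"
  proof -
    have "(\<integral>\<^sup>+\<omega>. (\<integral>\<^sup>+u. \<phi> (\<omega>, u) \<partial>lborel) \<partial>M) \<le> (\<integral>\<^sup>+\<omega>. ennreal (1 / \<alpha>) * \<psi> \<omega> + ennreal (2 * T) \<partial>M)"
      by (rule nn_integral_mono) (rule path)
    also have "\<dots> = ennreal (1 / \<alpha>) * (\<integral>\<^sup>+\<omega>. \<psi> \<omega> \<partial>M) + ennreal (2 * T)"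
      by (simp add: nn_integral_add nn_integral_cmult emeasure_space_1)
    also have "\<dots> \<le> ennreal (1 / \<alpha>) * ennreal (D * (2 * T)) + ennreal (2 * T)"
    proof (intro add_right_mono mult_left_mono order_trans[OF _ cost] nn_integral_mono)
      fix \<omega> assume "\<omega> \<in> space M"
      have "\<psi> \<omega> = (\<integral>\<^sup>+u\<in>{0..2 * T}. ennreal (h (Z u \<omega>)) \<partial>lborel)"
        unfolding \<psi>_def by (intro nn_integral_cong) (auto simp: indicator_def max_def)
      also have "\<dots> \<le> cost (2 * T) \<omega>" unfolding cost_def total_cost_def by (simp add: add.assoc)
      finally show "\<psi> \<omega> \<le> cost (2 * T) \<omega>" .
    qed simp
    also have "\<dots> = ennreal (1 / \<alpha> * (D * (2 * T)) + 2 * T)"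
      using \<alpha>(1) D T by (subst ennreal_mult[symmetric]) (auto simp: ennreal_plus)
    also have "1 / \<alpha> * (D * (2 * T)) + 2 * T = 2 * (D / \<alpha> + 1) * T" by (simp add: field_simps)
    finally show ?thesis .
  qed
  finally have small: "(\<integral>\<^sup>+u. (\<integral>\<^sup>+\<omega>. \<phi> (\<omega>, u) \<partial>M) \<partial>lborel) \<le> ennreal (2 * (D / \<alpha> + 1) * T)" .
  have "\<exists>u\<in>{T..2 * T}. (\<integral>\<^sup>+\<omega>. ennreal \<bar>Z u \<omega>\<bar> \<partial>M) \<le> ennreal ?C"
  proof (rule ccontr)
    assume "\<not> ?thesis"
    then have big: "ennreal ?C \<le> (\<integral>\<^sup>+\<omega>. ennreal \<bar>Z u \<omega>\<bar> \<partial>M)" if "u \<in> {T..2 * T}" for u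
      using that by (metis nle_le)
    have "ennreal (?C * T) = (\<integral>\<^sup>+u. ennreal ?C * indicator {T..2 * T} u \<partial>lborel)"
      using T C by (simp add: nn_integral_cmult_indicator ennreal_mult)
    also have "\<dots> \<le> (\<integral>\<^sup>+u. (\<integral>\<^sup>+\<omega>. \<phi> (\<omega>, u) \<partial>M) \<partial>lborel)"
    proof (rule nn_integral_mono)
      fix u
      show "ennreal ?C * indicator {T..2 * T} u \<le> (\<integral>\<^sup>+\<omega>. \<phi> (\<omega>, u) \<partial>M)"
        using big[of u] T by (auto simp: \<phi>_def indicator_def max_def)
    qed
    also note small
    finally have "?C * T \<le> 2 * (D / \<alpha> + 1) * T" using \<alpha>(1) D T by (simp add: ennreal_le_iff)
    then show False using T by simp
  qed
  then obtain u where u: "T \<le> u" "u \<le> 2 * T" "(\<integral>\<^sup>+\<omega>. ennreal \<bar>Z u \<omega>\<bar> \<partial>M) \<le> ennreal ?C" by auto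
  have [measurable]: "Z u \<in> borel_measurable M" using u T by (intro Z_M) auto
  have int: "integrable M (Z u)"
    unfolding integrable_iff_bounded using le_less_trans[OF u(3) ennreal_less_top] by simp
  have "ennreal (\<integral>\<omega>. \<bar>Z u \<omega>\<bar> \<partial>M) \<le> ennreal ?C"
    using u(3) int by (subst nn_integral_eq_integral[symmetric]) auto
  then have "(\<integral>\<omega>. \<bar>Z u \<omega>\<bar> \<partial>M) \<le> ?C" using C by (simp add: ennreal_le_iff)
  then show thesis using u int by (intro that[of u]) auto
qed

text \<open>If the limit superior were below some \<open>r < \<nu>\<close>, the cost at a late time
  \<open>u\<close> would be at most \<open>r * u\<close>, while the potential gives
  \<open>(\<nu> - \<epsilon>) * u\<close> up to a bounded boundary term. With
  \<open>\<epsilon>\<close> half the gap, the difference \<open>\<epsilon> * u\<close> outgrows that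
  term.\<close>

theorem AC_lower:
  assumes Kf: "Kf = K \<and> 0 < c 1 \<or> Kf = (\<lambda>_. 0)"
    and base: "\<And>z \<xi>. 0 < \<xi> \<Longrightarrow> 0 \<le> (LBINT u:{z..z + \<xi>}. g u) + (k - \<nu> / \<mu>) * \<xi> + Kf \<xi>"
  shows "ennreal \<nu> \<le> AC M B \<mu> \<sigma> k h K x Y"
proof (rule ccontr)
  assume "\<not> ?thesis"
  then have less: "AC M B \<mu> \<sigma> k h K x Y < ennreal \<nu>" by simp
  then obtain r where r: "AC M B \<mu> \<sigma> k h K x Y < ennreal r" "0 \<le> r" "r < \<nu>"
  proof -
    obtain e where e: "AC M B \<mu> \<sigma> k h K x Y < e" "e < ennreal \<nu>" using dense[OF less] by blast
    show ?thesis
    proof (cases e)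
      case (real r)
      then show ?thesis using e by (intro that[of r]) (auto simp: ennreal_less_iff)
    qed (use e in auto)
  qed
  define \<epsilon> where "\<epsilon> = (\<nu> - r) / 2"
  have eps: "0 < \<epsilon>" using r by (simp add: \<epsilon>_def)
  obtain \<alpha> where \<alpha>: "0 < \<alpha>" "\<And>z. \<alpha> * (\<bar>z\<bar> - 1) \<le> h z" by (rule h_linear_lower) (auto intro: that)
  obtain f P where fP: "f \<in> borel_measurable borel" "0 \<le> P" "\<And>y z. \<bar>f y - f z\<bar> \<le> P * \<bar>y - z\<bar>"
    and lower: "\<And>T. 0 < T \<Longrightarrow> integrable M (Z T) \<Longrightarrow>
       ennreal ((\<nu> - \<epsilon>) * T + f x - (\<integral>\<omega>. f (Z T \<omega>) \<partial>M)) \<le> (\<integral>\<^sup>+\<omega>. cost T \<omega> \<partial>M)"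
    by (rule cost_lower_expectation[OF Kf base eps]) (auto intro: that)
  have "\<forall>\<^sub>F T in at_top. (\<integral>\<^sup>+\<omega>. cost T \<omega> \<partial>M) / ennreal T < ennreal r"
    using r(1) unfolding AC_eq by (rule Limsup_lessD)
  then obtain T0 where T0: "\<And>T. T0 \<le> T \<Longrightarrow> (\<integral>\<^sup>+\<omega>. cost T \<omega> \<partial>M) / ennreal T < ennreal r"
    by (auto simp: eventually_at_top_linorder)
  have up: "(\<integral>\<^sup>+\<omega>. cost T \<omega> \<partial>M) \<le> ennreal (r * T)" if "T0 \<le> T" "0 < T" for T
  proof -
    have "(\<integral>\<^sup>+\<omega>. cost T \<omega> \<partial>M) = (\<integral>\<^sup>+\<omega>. cost T \<omega> \<partial>M) / ennreal T * ennreal T"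
    proof -
      have "(\<integral>\<^sup>+\<omega>. cost T \<omega> \<partial>M) / ennreal T * ennreal T = (\<integral>\<^sup>+\<omega>. cost T \<omega> \<partial>M) * ennreal T / ennreal T"
        by (subst (1 2) mult.commute) (rule ennreal_times_divide)
      also have "\<dots> = (\<integral>\<^sup>+\<omega>. cost T \<omega> \<partial>M)" using that by (intro ennreal_mult_divide_eq) auto
      finally show ?thesis by (rule sym)
    qed
    also have "\<dots> \<le> ennreal r * ennreal T" by (rule mult_right_mono[OF less_imp_le[OF T0[OF that(1)]]]) simp
    finally show ?thesis using that r by (simp add: ennreal_mult)
  qed
  define C where "C = 2 * (r / \<alpha> + 1) + 1"
  \<comment> \<open>The last entry makes \<open>\<epsilon> * T\<close> exceed the boundary term
    \<open>P * (C + \<bar>x\<bar>)\<close>.\<close>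
  define T where "T = max 1 (max T0 (P * (C + \<bar>x\<bar>) / \<epsilon> + 1))"
  have T: "0 < T" "T0 \<le> T" "P * (C + \<bar>x\<bar>) / \<epsilon> < T" by (auto simp: T_def)
  obtain u where u: "T \<le> u" "u \<le> 2 * T" "integrable M (Z u)" "(\<integral>\<omega>. \<bar>Z u \<omega>\<bar> \<partial>M) \<le> C"
    unfolding C_def using T r by (elim moderate_time[OF \<alpha> T(1) up r(2), rotated 2]) auto
  have u0: "0 < u" "T0 \<le> u" using u T by auto
  have [measurable]: "Z u \<in> borel_measurable M" "f \<in> borel_measurable borel" using u0 fP by (auto intro: Z_M)
  have int_b: "integrable M (\<lambda>\<omega>. f x + P * (\<bar>Z u \<omega>\<bar> + \<bar>x\<bar>))" using u(3) by simp
  have le: "f (Z u \<omega>) \<le> f x + P * (\<bar>Z u \<omega>\<bar> + \<bar>x\<bar>)" for \<omega>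
  proof -
    have "P * \<bar>Z u \<omega> - x\<bar> \<le> P * (\<bar>Z u \<omega>\<bar> + \<bar>x\<bar>)" using fP(2) by (intro mult_left_mono) auto
    then show ?thesis using fP(3)[of "Z u \<omega>" x] by linarith
  qed
  have int_f: "integrable M (\<lambda>\<omega>. f (Z u \<omega>))"
  proof (rule Bochner_Integration.integrable_bound)
    show "integrable M (\<lambda>\<omega>. P * \<bar>Z u \<omega>\<bar> + \<bar>f 0\<bar>)" using u(3) by simp
    show "AE \<omega> in M. norm (f (Z u \<omega>)) \<le> norm (P * \<bar>Z u \<omega>\<bar> + \<bar>f 0\<bar>)"
      using fP(3)[of "Z u \<omega>" 0 for \<omega>] by (intro AE_I2) (smt (verit) real_norm_def)
  qed measurable
  have "(\<integral>\<omega>. f (Z u \<omega>) \<partial>M) \<le> (\<integral>\<omega>. f x + P * (\<bar>Z u \<omega>\<bar> + \<bar>x\<bar>) \<partial>M)"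
    by (rule integral_mono[OF int_f int_b le])
  also have "\<dots> = f x + P * ((\<integral>\<omega>. \<bar>Z u \<omega>\<bar> \<partial>M) + \<bar>x\<bar>)"
    using u(3) by (simp add: prob_space)
  also have "\<dots> \<le> f x + P * (C + \<bar>x\<bar>)" using u(4) fP(2) by (intro add_left_mono mult_left_mono) auto
  finally have Ef: "(\<integral>\<omega>. f (Z u \<omega>) \<partial>M) \<le> f x + P * (C + \<bar>x\<bar>)" .
  have "ennreal ((\<nu> - \<epsilon>) * u + f x - (\<integral>\<omega>. f (Z u \<omega>) \<partial>M)) \<le> ennreal (r * u)"
    using lower[OF u0(1) u(3)] up[OF u0(2,1)] by (rule order_trans)
  then have "(\<nu> - \<epsilon>) * u + f x - (\<integral>\<omega>. f (Z u \<omega>) \<partial>M) \<le> r * u"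
    using r u0 by (simp add: ennreal_le_iff)
  with Ef have "(\<nu> - \<epsilon>) * u - r * u \<le> P * (C + \<bar>x\<bar>)" by linarith
  moreover have "(\<nu> - \<epsilon>) * u - r * u = \<epsilon> * u" by (simp add: \<epsilon>_def field_simps)
  moreover have "P * (C + \<bar>x\<bar>) < \<epsilon> * u"
  proof -
    have "P * (C + \<bar>x\<bar>) / \<epsilon> < u" using T(3) u(1) by linarith
    then show ?thesis using eps by (simp add: pos_divide_less_eq mult.commute)
  qed
  ultimately show False by linarith
qed

end

section \<open>Upper bound for the average cost\<close>

context brownian
begin

text \<open>The random walk on the grid reflected at \<open>0\<close> dominates the drawdown of \<open>X\<close>; its second
  moment is bounded uniformly in the mesh because reflection does not increase squares.\<close>

primrec drawdown :: "real \<Rightarrow> nat \<Rightarrow> nat \<Rightarrow> 'a \<Rightarrow> real" where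
  "drawdown T n 0 \<omega> = 0"
| "drawdown T n (Suc i) \<omega> = max 0 (drawdown T n i \<omega> + incr (grid T n i) (grid T n (Suc i)) \<omega>)"

lemma drawdown_nonneg: "0 \<le> drawdown T n i \<omega>"
  by (cases i) auto

text \<open>Reflection only raises the walk, so it stays above the plain increment of
  \<open>X\<close> since any earlier grid point.\<close>

lemma drawdown_ge: "j \<le> i \<Longrightarrow> X x (grid T n i) \<omega> - X x (grid T n j) \<omega> \<le> drawdown T n i \<omega>"
proof (induction i)
  case (Suc i)
  show ?case
  proof (cases "j = Suc i")
    case False
    then have "X x (grid T n i) \<omega> - X x (grid T n j) \<omega> \<le> drawdown T n i \<omega>" using Suc by auto
    then show ?thesis using X_incr[of x "grid T n (Suc i)" \<omega> "grid T n i"] by simp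
  qed (simp add: drawdown_nonneg)
qed simp

text \<open>By independence the cross term is twice the mean of the walk times the negative mean
  increment, hence at most \<open>0\<close>; each step adds only the second moment of its own
  increment.\<close>

lemma drawdown_moment:
  assumes T: "0 < T" and n: "0 < n"
  shows "drawdown T n i \<in> borel_measurable (F (grid T n i))"
    "integrable M (\<lambda>\<omega>. (drawdown T n i \<omega>)\<^sup>2)"
    "(\<integral>\<omega>. (drawdown T n i \<omega>)\<^sup>2 \<partial>M) \<le> real i * (\<sigma>\<^sup>2 * (T / real n) + \<mu>\<^sup>2 * (T / real n)\<^sup>2)"
proof (induction i)
  case (Suc i)
  let ?s = "grid T n i" let ?t = "grid T n (Suc i)" let ?R = "drawdown T n i" let ?d = "incr ?s ?t"
  have st: "0 \<le> ?s" "?s < ?t" "?t - ?s = T / real n" using T n by (auto simp: grid_nonneg grid_Suc)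
  have [measurable]: "?R \<in> borel_measurable (F ?t)" by (rule measurable_mono[OF _ Suc(1)]) (use st in simp)
  have [measurable]: "B ?s \<in> borel_measurable (F ?t)" "B ?t \<in> borel_measurable (F ?t)" using st by (auto intro: B_F)
  show m: "drawdown T n (Suc i) \<in> borel_measurable (F ?t)"
    unfolding drawdown.simps(2)[abs_def] incr_def by measurable
  have [measurable]: "drawdown T n (Suc i) \<in> borel_measurable M" by (rule measurable_M[OF m])
  have [measurable]: "?R \<in> borel_measurable M" by (rule measurable_M[OF Suc(1)])
  note d = incr_moments[OF st(1,2)]
  have intR: "integrable M ?R"
    by (rule square_integrable_imp_integrable[OF _ Suc(2)]) measurable
  have c: "integrable M (\<lambda>\<omega>. ?R \<omega> * ?d \<omega>)" "(\<integral>\<omega>. ?R \<omega> * ?d \<omega> \<partial>M) = (\<integral>\<omega>. ?R \<omega> \<partial>M) * (\<integral>\<omega>. ?d \<omega> \<partial>M)"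
    using indep_incr[OF st(1,2) Suc(1), of "\<lambda>y. y" "\<lambda>y. y"] intR d(1) by auto
  have int: "integrable M (\<lambda>\<omega>. (?R \<omega>)\<^sup>2 + 2 * (?R \<omega> * ?d \<omega>) + (?d \<omega>)\<^sup>2)"
    using Suc(2) c(1) d(3) by simp
  have le: "(drawdown T n (Suc i) \<omega>)\<^sup>2 \<le> (?R \<omega>)\<^sup>2 + 2 * (?R \<omega> * ?d \<omega>) + (?d \<omega>)\<^sup>2" for \<omega>
  proof -
    have "(max 0 y)\<^sup>2 \<le> y\<^sup>2" for y :: real by (simp add: max_def)
    from this[of "?R \<omega> + ?d \<omega>"] show ?thesis by (simp add: power2_sum)
  qed
  show i2: "integrable M (\<lambda>\<omega>. (drawdown T n (Suc i) \<omega>)\<^sup>2)"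
  proof (rule Bochner_Integration.integrable_bound[OF int])
    show "AE \<omega> in M. norm ((drawdown T n (Suc i) \<omega>)\<^sup>2) \<le> norm ((?R \<omega>)\<^sup>2 + 2 * (?R \<omega> * ?d \<omega>) + (?d \<omega>)\<^sup>2)"
      using le order_trans[OF le abs_ge_self] by (intro AE_I2) simp
  qed measurable
  have "(\<integral>\<omega>. (drawdown T n (Suc i) \<omega>)\<^sup>2 \<partial>M) \<le> (\<integral>\<omega>. (?R \<omega>)\<^sup>2 + 2 * (?R \<omega> * ?d \<omega>) + (?d \<omega>)\<^sup>2 \<partial>M)"
    by (rule integral_mono[OF i2 int le])
  also have "\<dots> = (\<integral>\<omega>. (?R \<omega>)\<^sup>2 \<partial>M) + 2 * ((\<integral>\<omega>. ?R \<omega> \<partial>M) * (- \<mu> * (T / real n))) + (\<sigma>\<^sup>2 * (T / real n) + \<mu>\<^sup>2 * (T / real n)\<^sup>2)"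
    using Suc(2) c(1) d(3) by (simp add: c(2) d(2,4) st(3))
  also have "\<dots> \<le> (\<integral>\<omega>. (?R \<omega>)\<^sup>2 \<partial>M) + (\<sigma>\<^sup>2 * (T / real n) + \<mu>\<^sup>2 * (T / real n)\<^sup>2)"
  proof -
    have "0 \<le> (\<integral>\<omega>. ?R \<omega> \<partial>M)" by (intro integral_nonneg_AE) (simp add: drawdown_nonneg)
    then have "0 \<le> (\<integral>\<omega>. ?R \<omega> \<partial>M) * (\<mu> * (T / real n))" using mu_pos T by (intro mult_nonneg_nonneg) auto
    then show ?thesis by simp
  qed
  also have "\<dots> \<le> real (Suc i) * (\<sigma>\<^sup>2 * (T / real n) + \<mu>\<^sup>2 * (T / real n)\<^sup>2)"
    using Suc(3) by (simp only: of_nat_Suc distrib_right mult_1_left)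
  finally show "(\<integral>\<omega>. (drawdown T n (Suc i) \<omega>)\<^sup>2 \<partial>M) \<le> real (Suc i) * (\<sigma>\<^sup>2 * (T / real n) + \<mu>\<^sup>2 * (T / real n)\<^sup>2)" .
next
  case 0
  have "drawdown T n 0 = (\<lambda>_. 0)" by (simp add: fun_eq_iff)
  then show "drawdown T n 0 \<in> borel_measurable (F (grid T n 0))" by simp
qed auto

text \<open>The second moment controls the mean through \<open>r \<le> 1 + r\<^sup>2\<close>, and
  the mesh enters only through \<open>T / n \<le> 1\<close>.\<close>

lemma drawdown_mean:
  assumes T: "0 < T" and n: "T \<le> real n"
  shows "(\<integral>\<^sup>+\<omega>. ennreal (drawdown T n n \<omega>) \<partial>M) \<le> ennreal (1 + T * (\<sigma>\<^sup>2 + \<mu>\<^sup>2))"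
proof -
  have n0: "0 < n" using T n by (cases n) auto
  note m = drawdown_moment[OF T n0, of n]
  have "(\<integral>\<^sup>+\<omega>. ennreal (drawdown T n n \<omega>) \<partial>M) \<le> (\<integral>\<^sup>+\<omega>. ennreal (1 + (drawdown T n n \<omega>)\<^sup>2) \<partial>M)"
  proof (intro nn_integral_mono ennreal_leI)
    fix \<omega>
    have "0 \<le> (drawdown T n n \<omega> - 1 / 2)\<^sup>2" by simp
    then show "drawdown T n n \<omega> \<le> 1 + (drawdown T n n \<omega>)\<^sup>2" by (simp add: power2_eq_square algebra_simps)
  qed
  also have "\<dots> = ennreal (\<integral>\<omega>. 1 + (drawdown T n n \<omega>)\<^sup>2 \<partial>M)"
    using m(2) by (intro nn_integral_eq_integral) auto
  also have "\<dots> \<le> ennreal (1 + T * (\<sigma>\<^sup>2 + \<mu>\<^sup>2))"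
  proof (rule ennreal_leI)
    have "T / real n \<le> 1" using n n0 by simp
    then have "T * (T / real n) \<le> T * 1" using T by (intro mult_left_mono) auto
    then have "\<mu>\<^sup>2 * (T * (T / real n)) \<le> \<mu>\<^sup>2 * (T * 1)" by (rule mult_left_mono) simp
    moreover have "real n * (\<sigma>\<^sup>2 * (T / real n) + \<mu>\<^sup>2 * (T / real n)\<^sup>2) = \<sigma>\<^sup>2 * T + \<mu>\<^sup>2 * (T * (T / real n))"
      using n0 by (simp add: power2_eq_square field_simps)
    ultimately show "(\<integral>\<omega>. 1 + (drawdown T n n \<omega>)\<^sup>2 \<partial>M) \<le> 1 + T * (\<sigma>\<^sup>2 + \<mu>\<^sup>2)"
      using m(2,3) by (simp add: prob_space algebra_simps)
  qed
  finally show ?thesis .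
qed

text \<open>Grid points approximate the time \<open>v\<close>, and the path is continuous. The limit
  inferior is the form that Fatou's lemma accepts.\<close>

lemma drawdown_liminf:
  assumes \<omega>: "\<omega> \<in> space M" and T: "0 < T" and v: "0 \<le> v" "v \<le> T"
  shows "ennreal (X x T \<omega> - X x v \<omega>) \<le> liminf (\<lambda>n. ennreal (drawdown T n n \<omega>))"
proof -
  obtain j where j: "\<And>n. j n \<le> Suc n" "(\<lambda>n. grid T (Suc n) (j n)) \<longlonglongrightarrow> v"
    using grid_dense[OF T v] by blast
  define w where "w n = grid T (Suc n) (j n)" for n
  have w0: "0 \<le> w n" for n using T by (simp add: w_def grid_nonneg)
  have "w \<longlonglongrightarrow> v" using j(2) by (simp add: w_def[abs_def])
  then have "(\<lambda>n. X x (w n) \<omega>) \<longlonglongrightarrow> X x v \<omega>"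
    using continuous_on_tendsto_compose[OF X_cont[OF \<omega>, of x], of w v sequentially] v w0 by auto
  then have "(\<lambda>n. ennreal (X x T \<omega> - X x (w n) \<omega>)) \<longlonglongrightarrow> ennreal (X x T \<omega> - X x v \<omega>)"
    by (intro tendsto_ennrealI tendsto_intros)
  then have "ennreal (X x T \<omega> - X x v \<omega>) = liminf (\<lambda>n. ennreal (X x T \<omega> - X x (w n) \<omega>))"
    using lim_imp_Liminf[of sequentially] by fastforce
  also have "\<dots> \<le> liminf (\<lambda>n. ennreal (drawdown T (Suc n) (Suc n) \<omega>))"
  proof (intro Liminf_mono always_eventually allI ennreal_leI)
    fix n
    show "X x T \<omega> - X x (w n) \<omega> \<le> drawdown T (Suc n) (Suc n) \<omega>"
      using drawdown_ge[OF j(1)[of n], of x T "Suc n" \<omega>] by (simp add: w_def grid_end)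
  qed
  also have "\<dots> = liminf (\<lambda>n. ennreal (drawdown T n n \<omega>))"
    using liminf_shift[of "\<lambda>n. ennreal (drawdown T n n \<omega>)"] by simp
  finally show ?thesis .
qed

end

text \<open>The common features of \<open>(s, S)\<close> and base stock policies: orders follow the
  running minimum of \<open>X\<close>, stock never falls below \<open>s\<close>, and apart from
  \<open>K0\<close> for the initial order \<open>y0\<close> the setup costs amount to at most
  \<open>\<kappa>\<close> per unit ordered.\<close>

locale dominated_policy = controlled \<mu> \<sigma> h N Q c k M F B x Y
  for \<mu> \<sigma> h N Q c k M F B x Y +
  fixes s y0 K0 \<kappa> C0 :: real
  assumes growth: "\<And>\<omega> T. \<omega> \<in> space M \<Longrightarrow> 0 \<le> T \<Longrightarrow> \<exists>v\<in>{0..T}. Y T \<omega> \<le> C0 - X x v \<omega>"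
    and Y_0: "\<And>\<omega>. \<omega> \<in> space M \<Longrightarrow> Y 0 \<omega> = y0" and y0: "0 \<le> y0"
    and Z_ge: "\<And>\<omega> t. \<omega> \<in> space M \<Longrightarrow> 0 \<le> t \<Longrightarrow> s \<le> Z t \<omega>"
    and K0: "0 \<le> K0" and kappa: "0 \<le> \<kappa>"
    and order_cost: "\<And>\<omega> T. \<omega> \<in> space M \<Longrightarrow> 0 < T \<Longrightarrow>
      (\<integral>\<^sup>+u. ennreal (K (jump (\<lambda>u. Y u \<omega>) u)) \<partial>count_space {0..T}) + ell K * ennreal (cont_part (\<lambda>u. Y u \<omega>) T)
        \<le> ennreal (K0 + \<kappa> * (Y T \<omega> - y0))"
begin

text \<open>By \<open>growth\<close>, \<open>Y T\<close> is at most
  \<open>\<bar>C0\<bar> + \<bar>X x T\<bar>\<close> plus a drawdown from some time \<open>v\<close>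
  to \<open>T\<close>; Fatou's lemma transfers the grid bound on the mean drawdown.\<close>

lemma Y_integrable: assumes T: "0 < T" shows "integrable M (Y T)"
proof (rule integrableI_nonneg)
  show [measurable]: "Y T \<in> borel_measurable M" using T by (intro Y_M) auto
  show "AE \<omega> in M. 0 \<le> Y T \<omega>" using Y_nonneg T by auto
  have [measurable]: "drawdown T n n \<in> borel_measurable M" for n
  proof (cases "n = 0")
    case False
    then show ?thesis by (intro measurable_M[OF drawdown_moment(1)[OF T]]) auto
  next
    case True
    have "drawdown T 0 0 = (\<lambda>_. 0)" by (simp add: fun_eq_iff)
    then show ?thesis using True by simp
  qed
  have [measurable]: "X x T \<in> borel_measurable M" using T by (intro X_M) auto
  have intX: "integrable M (X x T)"
  proof -
    have "integrable M (\<lambda>\<omega>. x + incr 0 T \<omega>)" using incr_moments(1)[of 0 T] T by simp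
    then show ?thesis by (rule Bochner_Integration.integrable_cong[THEN iffD1, rotated -1]) (auto simp: X_0 X_incr[of x T _ 0])
  qed
  have "(\<integral>\<^sup>+\<omega>. ennreal (Y T \<omega>) \<partial>M) \<le> (\<integral>\<^sup>+\<omega>. ennreal (\<bar>C0\<bar> + \<bar>X x T \<omega>\<bar>) + liminf (\<lambda>n. ennreal (drawdown T n n \<omega>)) \<partial>M)"
  proof (rule nn_integral_mono)
    fix \<omega> assume \<omega>: "\<omega> \<in> space M"
    obtain v where v: "v \<in> {0..T}" "Y T \<omega> \<le> C0 - X x v \<omega>" using growth[OF \<omega>, of T] T by auto
    have "ennreal (Y T \<omega>) \<le> ennreal ((\<bar>C0\<bar> + \<bar>X x T \<omega>\<bar>) + max 0 (X x T \<omega> - X x v \<omega>))"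
      using v(2) by (intro ennreal_leI) linarith
    also have "\<dots> = ennreal (\<bar>C0\<bar> + \<bar>X x T \<omega>\<bar>) + ennreal (max 0 (X x T \<omega> - X x v \<omega>))"
      by (intro ennreal_plus) auto
    also have "ennreal (max 0 (X x T \<omega> - X x v \<omega>)) = ennreal (X x T \<omega> - X x v \<omega>)"
      by (simp add: max_def ennreal_neg)
    also have "\<dots> \<le> liminf (\<lambda>n. ennreal (drawdown T n n \<omega>))"
      using drawdown_liminf[OF \<omega> T] v by auto
    finally show "ennreal (Y T \<omega>) \<le> ennreal (\<bar>C0\<bar> + \<bar>X x T \<omega>\<bar>) + liminf (\<lambda>n. ennreal (drawdown T n n \<omega>))"
      by (simp add: add_left_mono)
  qed
  also have "\<dots> = (\<integral>\<^sup>+\<omega>. ennreal (\<bar>C0\<bar> + \<bar>X x T \<omega>\<bar>) \<partial>M) + (\<integral>\<^sup>+\<omega>. liminf (\<lambda>n. ennreal (drawdown T n n \<omega>)) \<partial>M)"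
    by (rule nn_integral_add) measurable
  also have "(\<integral>\<^sup>+\<omega>. ennreal (\<bar>C0\<bar> + \<bar>X x T \<omega>\<bar>) \<partial>M) = ennreal (\<integral>\<omega>. \<bar>C0\<bar> + \<bar>X x T \<omega>\<bar> \<partial>M)"
    using intX by (intro nn_integral_eq_integral) auto
  also have "(\<integral>\<^sup>+\<omega>. liminf (\<lambda>n. ennreal (drawdown T n n \<omega>)) \<partial>M) \<le> liminf (\<lambda>n. \<integral>\<^sup>+\<omega>. ennreal (drawdown T n n \<omega>) \<partial>M)"
    by (rule nn_integral_liminf) measurable
  also have "\<dots> \<le> liminf (\<lambda>n. ennreal (1 + T * (\<sigma>\<^sup>2 + \<mu>\<^sup>2)))"
  proof (rule Liminf_mono)
    show "\<forall>\<^sub>F n in sequentially. (\<integral>\<^sup>+\<omega>. ennreal (drawdown T n n \<omega>) \<partial>M) \<le> ennreal (1 + T * (\<sigma>\<^sup>2 + \<mu>\<^sup>2))"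
      using eventually_ge_at_top[of "nat \<lceil>T\<rceil>"]
      by eventually_elim (intro drawdown_mean T, linarith)
  qed
  also have "\<dots> = ennreal (1 + T * (\<sigma>\<^sup>2 + \<mu>\<^sup>2))" by (rule Liminf_const) simp
  finally show "(\<integral>\<^sup>+\<omega>. ennreal (Y T \<omega>) \<partial>M) < \<infinity>"
    by (rule le_less_trans[OF _ ]) (auto simp: add_left_mono)
qed

lemma Z_integrable: assumes T: "0 < T" shows "integrable M (Z T)"
proof -
  have "integrable M (\<lambda>\<omega>. x + incr 0 T \<omega> + Y T \<omega>)" using incr_moments(1)[of 0 T] Y_integrable[OF T] T by simp
  then show ?thesis
    by (rule Bochner_Integration.integrable_cong[THEN iffD1, rotated -1]) (auto simp: Z_def X_0 X_incr[of x T _ 0])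
qed

text \<open>\<open>control\<close> says that in the limit each unit ordered changes
  \<open>f z + k * z\<close> by \<open>- \<kappa>\<close>. The control sums are dominated by
  \<open>P * (Y T - y0)\<close>, so the limit passes to expectations and the inequality of the lower
  bound becomes an identity.\<close>

lemma balance:
  assumes A: "0 \<le> A" and f: "\<And>x. (f has_real_derivative mc A x / \<mu> - a / \<mu>) (at x)" and T: "0 < T"
    and control: "\<And>\<omega>. \<omega> \<in> space M \<Longrightarrow>
      (\<lambda>n. \<Sum>i<n. (f (Z (grid T n (Suc i)) \<omega>) + k * Z (grid T n (Suc i)) \<omega>)
        - (f (Z (grid T n i) \<omega> + incr (grid T n i) (grid T n (Suc i)) \<omega>)
            + k * (Z (grid T n i) \<omega> + incr (grid T n i) (grid T n (Suc i)) \<omega>)))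
      \<longlonglongrightarrow> - \<kappa> * (Y T \<omega> - y0)"
  shows "integrable M (\<lambda>\<omega>. f (Z T \<omega>))" "integrable M (\<lambda>\<omega>. LBINT u:{0..T}. hc A (Z u \<omega>))"
    "(\<integral>\<omega>. (LBINT u:{0..T}. hc A (Z u \<omega>)) \<partial>M) + (\<kappa> + k) * ((\<integral>\<omega>. Y T \<omega> \<partial>M) - y0)
      = a * T + f (x + y0) - (\<integral>\<omega>. f (Z T \<omega>) \<partial>M)"
proof -
  obtain P R L where pt: "policy_test M F B \<mu> \<sigma> Y f (\<lambda>x. mc A x / \<mu> - a / \<mu>)
    (\<lambda>x. lam \<mu> \<sigma> / \<mu> * (mc A x - hc A x)) P R L a (hc A) (h A + h (- A))"
    using policy_testI[OF A f] by blast
  interpret policy_test M F B \<mu> \<sigma> x Y f "\<lambda>x. mc A x / \<mu> - a / \<mu>"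
    "\<lambda>x. lam \<mu> \<sigma> / \<mu> * (mc A x - hc A x)" P R L a "hc A" "h A + h (- A)" by (rule pt)
  have [measurable]: "Z t \<in> borel_measurable M" if "0 \<le> t" for t using that by (rule Z_M)
  have [measurable]: "Z T \<in> borel_measurable M" "Y T \<in> borel_measurable M" using T by (auto intro: Z_M Y_M)
  have Y0m: "integrable M (\<lambda>\<omega>. Y T \<omega> - y0)" using Y_integrable[OF T] by simp
  show int_f: "integrable M (\<lambda>\<omega>. f (Z T \<omega>))"
  proof (rule Bochner_Integration.integrable_bound)
    show "integrable M (\<lambda>\<omega>. P * \<bar>Z T \<omega>\<bar> + \<bar>f 0\<bar>)" using Z_integrable[OF T] by simp
    show "AE \<omega> in M. norm (f (Z T \<omega>)) \<le> norm (P * \<bar>Z T \<omega>\<bar> + \<bar>f 0\<bar>)"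
      using f_lipschitz[of "Z T \<omega>" 0 for \<omega>] by (intro AE_I2) (smt (verit) real_norm_def)
  qed measurable
  show "integrable M (\<lambda>\<omega>. LBINT u:{0..T}. hc A (Z u \<omega>))" by (rule holding_integral_props(2)[OF T])
  have step: "Z (grid T n (Suc i)) \<omega> = Z (grid T n i) \<omega> + incr (grid T n i) (grid T n (Suc i)) \<omega> + (Y (grid T n (Suc i)) \<omega> - Y (grid T n i) \<omega>)" for n i \<omega>
    by (rule Y_step)
  have mono: "0 \<le> Y (grid T n (Suc i)) \<omega> - Y (grid T n i) \<omega>" if "\<omega> \<in> space M" for n i \<omega>
    using Y_mono[OF that, of "grid T n i" "grid T n (Suc i)"] grid_nonneg[of T n i] T by (simp add: grid_Suc)
  have tele: "(\<Sum>i<n. Y (grid T n (Suc i)) \<omega> - Y (grid T n i) \<omega>) = Y T \<omega> - y0" if "\<omega> \<in> space M" "0 < n" for n \<omega>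
    using sum_lessThan_telescope[of "\<lambda>i. Y (grid T n i) \<omega>" n] that by (simp add: grid_end Y_0)
  have bound: "\<bar>control_sum T n \<omega>\<bar> \<le> P * (Y T \<omega> - y0)" if "\<omega> \<in> space M" "0 < n" for n \<omega>
  proof -
    have "\<bar>control_sum T n \<omega>\<bar> \<le> (\<Sum>i<n. P * (Y (grid T n (Suc i)) \<omega> - Y (grid T n i) \<omega>))"
      unfolding control_sum_def
    proof (intro order_trans[OF sum_abs] sum_mono)
      fix i
      show "\<bar>f (Z (grid T n (Suc i)) \<omega>) - f (Z (grid T n i) \<omega> + incr (grid T n i) (grid T n (Suc i)) \<omega>)\<bar>
          \<le> P * (Y (grid T n (Suc i)) \<omega> - Y (grid T n i) \<omega>)"
        using f_lipschitz[of "Z (grid T n (Suc i)) \<omega>" "Z (grid T n i) \<omega> + incr (grid T n i) (grid T n (Suc i)) \<omega>"]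
          step[of n i \<omega>] mono[OF that(1), of n i] by simp
    qed
    also have "\<dots> = P * (Y T \<omega> - y0)" by (simp only: sum_distrib_left[symmetric] tele[OF that])
    finally show ?thesis .
  qed
  have lim: "(\<lambda>n. control_sum T (Suc n) \<omega>) \<longlonglongrightarrow> - (\<kappa> + k) * (Y T \<omega> - y0)" if \<omega>: "\<omega> \<in> space M" for \<omega>
  proof -
    have "(\<lambda>n. control_sum T (Suc n) \<omega> + k * (Y T \<omega> - y0)) \<longlonglongrightarrow> - \<kappa> * (Y T \<omega> - y0)"
    proof (rule Lim_transform_eventually[OF LIMSEQ_Suc[OF control[OF \<omega>]]], rule always_eventually, rule allI)
      fix n
      show "(\<Sum>i<Suc n. (f (Z (grid T (Suc n) (Suc i)) \<omega>) + k * Z (grid T (Suc n) (Suc i)) \<omega>)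
        - (f (Z (grid T (Suc n) i) \<omega> + incr (grid T (Suc n) i) (grid T (Suc n) (Suc i)) \<omega>)
            + k * (Z (grid T (Suc n) i) \<omega> + incr (grid T (Suc n) i) (grid T (Suc n) (Suc i)) \<omega>)))
        = control_sum T (Suc n) \<omega> + k * (Y T \<omega> - y0)"
        unfolding control_sum_def tele[OF \<omega> zero_less_Suc[of n], symmetric] sum_distrib_left sum.distrib[symmetric]
        by (intro sum.cong refl) (simp add: step[of "Suc n" _ \<omega>] algebra_simps)
    qed
    from tendsto_diff[OF this tendsto_const[of "k * (Y T \<omega> - y0)"]] show ?thesis
      by (simp add: algebra_simps)
  qed
  have cm: "control_sum T n \<in> borel_measurable M" for n
  proof -
    have [measurable]: "Z (grid T n i) \<in> borel_measurable M" "incr (grid T n i) (grid T n (Suc i)) \<in> borel_measurable M" for i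
      using T by (auto intro!: Z_M incr_M grid_nonneg)
    show ?thesis unfolding control_sum_def[abs_def] by measurable
  qed
  have 1: "(\<lambda>n. \<integral>\<omega>. control_sum T (Suc n) \<omega> \<partial>M) \<longlonglongrightarrow> (\<integral>\<omega>. - (\<kappa> + k) * (Y T \<omega> - y0) \<partial>M)"
    by (rule integral_dominated_convergence[where w = "\<lambda>\<omega>. P * (Y T \<omega> - y0)"])
       (use cm lim bound Y0m in auto)
  have 2: "(\<lambda>n. \<integral>\<omega>. diffusion_sum T (Suc n) \<omega> \<partial>M) \<longlonglongrightarrow> a * T - (\<integral>\<omega>. (LBINT u:{0..T}. hc A (Z u \<omega>)) \<partial>M)"
    by (rule LIMSEQ_Suc[OF diffusion_sum_tendsto[OF T]])
  have 3: "\<forall>\<^sub>F n in sequentially. (\<integral>\<omega>. control_sum T (Suc n) \<omega> \<partial>M) + (\<integral>\<omega>. diffusion_sum T (Suc n) \<omega> \<partial>M)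
      = (\<integral>\<omega>. f (Z T \<omega>) \<partial>M) - f (x + y0)"
    using eventually_ge_at_top[of "nat \<lceil>T\<rceil>"]
  proof eventually_elim
    case (elim n)
    then have n: "T \<le> real (Suc n)" by linarith
    have ci: "integrable M (control_sum T (Suc n))"
      by (rule Bochner_Integration.integrable_bound[of _ "\<lambda>\<omega>. P * (Y T \<omega> - y0)"])
         (use Y0m cm bound[OF _ zero_less_Suc[of n]] order_trans[OF _ abs_ge_self] in \<open>auto intro!: AE_I2\<close>)
    have "(\<integral>\<omega>. control_sum T (Suc n) \<omega> \<partial>M) + (\<integral>\<omega>. diffusion_sum T (Suc n) \<omega> \<partial>M)
        = (\<integral>\<omega>. diffusion_sum T (Suc n) \<omega> + control_sum T (Suc n) \<omega> \<partial>M)"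
      using ci diffusion_sum_bound(1)[OF T n] by simp
    also have "\<dots> = (\<integral>\<omega>. f (Z T \<omega>) - f (x + y0) \<partial>M)"
      by (intro Bochner_Integration.integral_cong refl)
         (simp add: telescope[OF zero_less_Suc, symmetric] Z_def[of 0] X_0 Y_0)
    also have "\<dots> = (\<integral>\<omega>. f (Z T \<omega>) \<partial>M) - f (x + y0)" using int_f by (simp add: prob_space)
    finally show ?case .
  qed
  have "(\<lambda>n. (\<integral>\<omega>. f (Z T \<omega>) \<partial>M) - f (x + y0)) \<longlonglongrightarrow>
      (\<integral>\<omega>. - (\<kappa> + k) * (Y T \<omega> - y0) \<partial>M) + (a * T - (\<integral>\<omega>. (LBINT u:{0..T}. hc A (Z u \<omega>)) \<partial>M))"
    by (rule Lim_transform_eventually[OF tendsto_add[OF 1 2] 3])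
  then have "(\<integral>\<omega>. f (Z T \<omega>) \<partial>M) - f (x + y0) =
      (\<integral>\<omega>. - (\<kappa> + k) * (Y T \<omega> - y0) \<partial>M) + (a * T - (\<integral>\<omega>. (LBINT u:{0..T}. hc A (Z u \<omega>)) \<partial>M))"
    by (simp only: LIMSEQ_const_iff)
  moreover have "(\<integral>\<omega>. - (\<kappa> + k) * (Y T \<omega> - y0) \<partial>M) = - (\<kappa> + k) * ((\<integral>\<omega>. Y T \<omega> \<partial>M) - y0)"
    using Y_integrable[OF T] by (simp add: prob_space)
  ultimately show "(\<integral>\<omega>. (LBINT u:{0..T}. hc A (Z u \<omega>)) \<partial>M) + (\<kappa> + k) * ((\<integral>\<omega>. Y T \<omega> \<partial>M) - y0)
      = a * T + f (x + y0) - (\<integral>\<omega>. f (Z T \<omega>) \<partial>M)"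
    by (simp only: mult_minus_left)
qed

text \<open>The boundary terms are bounded uniformly in the truncation \<open>A\<close> because \<open>Z \<ge> s\<close> and the test
  functions increase beyond a level independent of \<open>A\<close>.\<close>

theorem AC_upper:
  assumes nu: "0 \<le> \<nu>" and a: "\<And>A. 0 \<le> A \<Longrightarrow> 0 \<le> a A" "\<And>A. 0 \<le> A \<Longrightarrow> a A \<le> \<nu>"
    and control: "\<And>A f T \<omega>. 0 \<le> A \<Longrightarrow> (\<And>x. (f has_real_derivative mc A x / \<mu> - a A / \<mu>) (at x)) \<Longrightarrow> 0 < T \<Longrightarrow> \<omega> \<in> space M \<Longrightarrow>
      (\<lambda>n. \<Sum>i<n. (f (Z (grid T n (Suc i)) \<omega>) + k * Z (grid T n (Suc i)) \<omega>)
        - (f (Z (grid T n i) \<omega> + incr (grid T n i) (grid T n (Suc i)) \<omega>)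
            + k * (Z (grid T n i) \<omega> + incr (grid T n i) (grid T n (Suc i)) \<omega>)))
      \<longlonglongrightarrow> - \<kappa> * (Y T \<omega> - y0)"
  shows "AC M B \<mu> \<sigma> k h K x Y \<le> ennreal \<nu>"
proof -
  obtain \<alpha> D where al: "0 < \<alpha>" "\<And>A z. 0 \<le> A \<Longrightarrow> \<alpha> * min A \<bar>z\<bar> - D \<le> mc A z"
    "\<And>z. \<alpha> * \<bar>z\<bar> - D \<le> m z"
    by (rule mc_linear_lower) (auto intro: that)
  \<comment> \<open>Beyond \<open>b\<close> every \<open>mc A\<close> with \<open>A \<ge> b\<close>
    is at least \<open>\<nu> \<ge> a A\<close>, so the test function no longer decreases.\<close>
  define b where "b = max (max 0 s) ((\<nu> + D) / \<alpha>)"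
  have b: "0 \<le> b" "s \<le> b" "\<nu> + D \<le> \<alpha> * b"
  proof -
    have "(\<nu> + D) / \<alpha> \<le> b" by (simp add: b_def)
    then show "\<nu> + D \<le> \<alpha> * b" using al(1) by (simp add: field_simps)
  qed (auto simp: b_def)
  have sx: "\<omega> \<in> space M \<Longrightarrow> s \<le> x + y0" for \<omega> using Z_ge[of \<omega> 0] by (simp add: Z_def X_0 Y_0)
  then have sx: "s \<le> x + y0" using not_empty by auto
  have "compact (g ` {s..x + y0})" by (intro compact_continuous_image continuous_on_subset[OF cont]) auto
  then obtain Cg where Cg: "\<And>y. y \<in> g ` {s..x + y0} \<Longrightarrow> norm y \<le> Cg"
    using compact_imp_bounded bounded_iff by metis
  \<comment> \<open>The rise from \<open>s\<close> to the initial stock has slope at most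
    \<open>Cg\<close>; the fall between \<open>s\<close> and \<open>b\<close> has slope at most
    \<open>\<nu> / \<mu>\<close>. Neither depends on the truncation.\<close>
  define C1 where "C1 = Cg * (x + y0 - s) + \<nu> / \<mu> * (b - s)"
  have boundary: "f (x + y0) - f z \<le> C1"
    if A: "b \<le> A" and f: "\<And>x. (f has_real_derivative mc A x / \<mu> - a A / \<mu>) (at x)" and z: "s \<le> z" for A f z
  proof -
    have A0: "0 \<le> A" using A b by linarith
    have "f (x + y0) - f s \<le> Cg * (x + y0 - s)"
    proof (rule deriv_upper_bound[OF f sx])
      fix u assume u: "s \<le> u" "u \<le> x + y0"
      have "mc A u / \<mu> \<le> g u" using mc_le[OF A0, of u] mu_pos by (simp add: g_eq divide_right_mono)
      moreover have "0 \<le> a A / \<mu>" using a(1)[OF A0] mu_pos by simp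
      moreover have "g u \<le> Cg" using Cg[of "g u"] u by (auto simp: abs_le_iff)
      ultimately show "mc A u / \<mu> - a A / \<mu> \<le> Cg" by linarith
    qed
    moreover have "- (\<nu> / \<mu>) * (min z b - s) \<le> f (min z b) - f s"
    proof (rule deriv_lower_bound[OF f])
      fix u
      have "a A / \<mu> \<le> \<nu> / \<mu>" using a(2)[OF A0] mu_pos by (simp add: divide_right_mono)
      moreover have "0 \<le> mc A u / \<mu>" using mc_nonneg mu_pos by simp
      ultimately show "- (\<nu> / \<mu>) \<le> mc A u / \<mu> - a A / \<mu>" by linarith
    qed (use z b in auto)
    moreover have "\<nu> / \<mu> * (min z b - s) \<le> \<nu> / \<mu> * (b - s)" using nu mu_pos by (intro mult_left_mono) auto
    moreover have "0 * (z - min z b) \<le> f z - f (min z b)"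
    proof (cases "z \<le> b")
      case False
      then have mb: "min z b = b" by simp
      show ?thesis
        unfolding mb
      proof (rule deriv_lower_bound[OF f])
        fix u assume u: "b \<le> u"
        have "\<alpha> * b \<le> \<alpha> * min A \<bar>u\<bar>" using al(1) A u b by (intro mult_left_mono) auto
        then have "a A \<le> mc A u" using al(2)[OF A0, of u] b(3) a(2)[OF A0] by linarith
        then show "0 \<le> mc A u / \<mu> - a A / \<mu>" using mu_pos by (simp add: divide_right_mono)
      qed (use False in simp)
    qed simp
    ultimately show ?thesis unfolding C1_def by simp
  qed
  \<comment> \<open>The terms \<open>(\<kappa> + k) * e\<close> of holding and ordering costs
    cancel; this is what remains besides \<open>\<nu> * T\<close>.\<close>
  define C2 where "C2 = C1 + K0 + k * y0"
  have main: "(\<integral>\<^sup>+\<omega>. cost T \<omega> \<partial>M) \<le> ennreal (\<nu> * T + C2)" if T: "0 < T" for T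
  proof -
    have [measurable]: "Y T \<in> borel_measurable M" using T by (intro Y_M) auto
    define e where "e = (\<integral>\<omega>. Y T \<omega> \<partial>M) - y0"
    have e0: "0 \<le> e"
    proof -
      have "(\<integral>\<omega>. y0 \<partial>M) \<le> (\<integral>\<omega>. Y T \<omega> \<partial>M)"
        using Y_integrable[OF T] Y_mono[of _ 0 T] T Y_0 by (intro integral_mono) force+
      then show ?thesis by (simp add: e_def prob_space)
    qed
    define \<psi> where "\<psi> H \<omega> = (\<integral>\<^sup>+u. ennreal (H (Z (max 0 u) \<omega>)) * indicator {0..T} u \<partial>lborel)" for H :: "real \<Rightarrow> real" and \<omega>
    have Zj[measurable]: "(\<lambda>p. Z (max 0 (snd p)) (fst p)) \<in> borel_measurable (M \<Otimes>\<^sub>M lborel)"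
      using Z_jointly_measurable
      by (simp add: split_beta' measurable_cong_sets[OF sets_pair_measure_cong[OF refl sets_lborel] refl])
    have psi_meas: "\<psi> H \<in> borel_measurable M" if [measurable]: "H \<in> borel_measurable borel" for H
    proof -
      have "(\<lambda>(\<omega>, u). ennreal (H (Z (max 0 u) \<omega>)) * indicator {0..T} u) \<in> borel_measurable (M \<Otimes>\<^sub>M lborel)"
        unfolding split_beta' by measurable
      then show ?thesis unfolding \<psi>_def[abs_def] by (rule lborel.borel_measurable_nn_integral)
    qed
    have psi_eq: "\<psi> H \<omega> = (\<integral>\<^sup>+u\<in>{0..T}. ennreal (H (Z u \<omega>)) \<partial>lborel)" for H \<omega>
      unfolding \<psi>_def by (intro nn_integral_cong) (auto simp: indicator_def max_def)
    have upper: "(\<integral>\<^sup>+\<omega>. \<psi> (hc (real n)) \<omega> \<partial>M) \<le> ennreal (\<nu> * T + C1 - (\<kappa> + k) * e)"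
        "0 \<le> \<nu> * T + C1 - (\<kappa> + k) * e" if n: "b \<le> real n" for n
    proof -
      have A: "0 \<le> real n" by simp
      have "continuous_on UNIV (\<lambda>u. mc (real n) u / \<mu> - a (real n) / \<mu>)"
        using mu_pos by (intro continuous_intros mc_cont[OF A]) auto
      from ex_antiderivative[OF this] obtain f
        where f: "\<And>u. (f has_real_derivative mc (real n) u / \<mu> - a (real n) / \<mu>) (at u)" by blast
      note bal = balance[OF A f T control[OF A f T]]
      have "(\<integral>\<omega>. f (x + y0) - f (Z T \<omega>) \<partial>M) \<le> (\<integral>\<omega>. C1 \<partial>M)"
        using bal(1) boundary[OF n f Z_ge] T by (intro integral_mono) auto
      then have "f (x + y0) - (\<integral>\<omega>. f (Z T \<omega>) \<partial>M) \<le> C1" using bal(1) by (simp add: prob_space)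
      moreover have "a (real n) * T \<le> \<nu> * T" using a(2)[OF A] T by (intro mult_right_mono) auto
      ultimately have le: "(\<integral>\<omega>. (LBINT u:{0..T}. hc (real n) (Z u \<omega>)) \<partial>M) \<le> \<nu> * T + C1 - (\<kappa> + k) * e"
        using bal(3) by (simp add: e_def)
      have nn: "0 \<le> (LBINT u:{0..T}. hc (real n) (Z u \<omega>))" for \<omega>
        unfolding set_lebesgue_integral_def by (intro integral_nonneg_AE) (simp add: hc_nonneg)
      then have "0 \<le> (\<integral>\<omega>. (LBINT u:{0..T}. hc (real n) (Z u \<omega>)) \<partial>M)" by (intro integral_nonneg_AE) simp
      with le show "0 \<le> \<nu> * T + C1 - (\<kappa> + k) * e" by linarith
      have "(\<integral>\<^sup>+\<omega>. \<psi> (hc (real n)) \<omega> \<partial>M) = (\<integral>\<^sup>+\<omega>. ennreal (LBINT u:{0..T}. hc (real n) (Z u \<omega>)) \<partial>M)"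
        unfolding psi_eq
        by (intro nn_integral_cong holding_nn_integral[where C = "h (real n) + h (- real n)"] hc_cont hc_nonneg hc_bound[OF A])
      also have "\<dots> = ennreal (\<integral>\<omega>. (LBINT u:{0..T}. hc (real n) (Z u \<omega>)) \<partial>M)"
        using nn by (intro nn_integral_eq_integral bal(2)) auto
      also have "\<dots> \<le> ennreal (\<nu> * T + C1 - (\<kappa> + k) * e)" by (rule ennreal_leI[OF le])
      finally show "(\<integral>\<^sup>+\<omega>. \<psi> (hc (real n)) \<omega> \<partial>M) \<le> ennreal (\<nu> * T + C1 - (\<kappa> + k) * e)" .
    qed
    have hc_lim: "(\<lambda>n. hc (real n) z) \<longlonglongrightarrow> h z" for z
    proof (rule tendsto_eventually)
      show "\<forall>\<^sub>F n in sequentially. hc (real n) z = h z"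
        using eventually_ge_at_top[of "nat \<lceil>\<bar>z\<bar>\<rceil>"] by eventually_elim (rule hc_eq, linarith)
    qed
    have psi_lim: "(\<lambda>n. \<psi> (hc (real n)) \<omega>) \<longlonglongrightarrow> \<psi> h \<omega>" if \<omega>: "\<omega> \<in> space M" for \<omega>
      unfolding \<psi>_def
    proof (rule nn_integral_LIMSEQ)
      have [measurable]: "(\<lambda>u. Z (max 0 u) \<omega>) \<in> borel_measurable borel" by (rule path_regular[OF \<omega>])
      show "(\<lambda>u. ennreal (hc (real n) (Z (max 0 u) \<omega>)) * indicator {0..T} u) \<in> borel_measurable lborel" for n by measurable
      show "incseq (\<lambda>n u. ennreal (hc (real n) (Z (max 0 u) \<omega>)) * indicator {0..T} u)"
        by (auto intro!: incseq_SucI le_funI mult_right_mono ennreal_leI hc_mono)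
      show "(\<lambda>n. ennreal (hc (real n) (Z (max 0 u) \<omega>)) * indicator {0..T} u) \<longlonglongrightarrow> ennreal (h (Z (max 0 u) \<omega>)) * indicator {0..T} u" for u
        by (cases "u \<in> {0..T}") (auto intro!: tendsto_ennrealI hc_lim)
    qed
    have lim: "(\<lambda>n. \<integral>\<^sup>+\<omega>. \<psi> (hc (real n)) \<omega> \<partial>M) \<longlonglongrightarrow> (\<integral>\<^sup>+\<omega>. \<psi> h \<omega> \<partial>M)"
    proof -
      \<comment> \<open>The factor \<open>indicator (space M) \<omega>\<close> makes the convergence
        hold at every \<open>\<omega>\<close>, as the monotone limit rule requires.\<close>
      have "(\<lambda>n. \<integral>\<^sup>+\<omega>. \<psi> (hc (real n)) \<omega> * indicator (space M) \<omega> \<partial>M) \<longlonglongrightarrow> (\<integral>\<^sup>+\<omega>. \<psi> h \<omega> * indicator (space M) \<omega> \<partial>M)"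
      proof (rule nn_integral_LIMSEQ)
        show "(\<lambda>\<omega>. \<psi> (hc (real n)) \<omega> * indicator (space M) \<omega>) \<in> borel_measurable M" for n
          using psi_meas[OF hc_meas] by measurable
        show "incseq (\<lambda>n \<omega>. \<psi> (hc (real n)) \<omega> * indicator (space M) \<omega>)"
          unfolding \<psi>_def by (auto intro!: incseq_SucI le_funI mult_right_mono nn_integral_mono ennreal_leI hc_mono)
        show "(\<lambda>n. \<psi> (hc (real n)) \<omega> * indicator (space M) \<omega>) \<longlonglongrightarrow> \<psi> h \<omega> * indicator (space M) \<omega>" for \<omega>
          using psi_lim by (cases "\<omega> \<in> space M") auto
      qed
      then show ?thesis by simp
    qed
    have H: "(\<integral>\<^sup>+\<omega>. \<psi> h \<omega> \<partial>M) \<le> ennreal (\<nu> * T + C1 - (\<kappa> + k) * e)"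
      by (rule LIMSEQ_le_const2[OF lim]) (use upper(1) in \<open>auto intro!: exI[of _ "nat \<lceil>b\<rceil>"], linarith?\<close>)
    have pos: "0 \<le> \<nu> * T + C1 - (\<kappa> + k) * e" by (rule upper(2)[of "nat \<lceil>b\<rceil>"]) linarith
    have io: "integrable M (\<lambda>\<omega>. K0 + \<kappa> * (Y T \<omega> - y0) + k * Y T \<omega>)" using Y_integrable[OF T] by simp
    have nn: "0 \<le> K0 + \<kappa> * (Y T \<omega> - y0)" "0 \<le> k * Y T \<omega>" if "\<omega> \<in> space M" for \<omega>
      using Y_mono[OF that, of 0 T] Y_0[OF that] y0 T K0 kappa k_nonneg by auto
    have "(\<integral>\<^sup>+\<omega>. cost T \<omega> \<partial>M) \<le> (\<integral>\<^sup>+\<omega>. \<psi> h \<omega> + ennreal (K0 + \<kappa> * (Y T \<omega> - y0) + k * Y T \<omega>) \<partial>M)"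
    proof (rule nn_integral_mono)
      fix \<omega> assume \<omega>: "\<omega> \<in> space M"
      have "cost T \<omega> = \<psi> h \<omega> + ((\<integral>\<^sup>+u. ennreal (K (jump (\<lambda>u. Y u \<omega>) u)) \<partial>count_space {0..T}) + ell K * ennreal (cont_part (\<lambda>u. Y u \<omega>) T)) + ennreal (k * Y T \<omega>)"
        unfolding cost_def total_cost_def psi_eq by (simp add: ac_simps)
      also have "\<dots> \<le> \<psi> h \<omega> + ennreal (K0 + \<kappa> * (Y T \<omega> - y0)) + ennreal (k * Y T \<omega>)"
        by (intro add_mono order_refl order_cost[OF \<omega> T])
      also have "\<dots> = \<psi> h \<omega> + ennreal (K0 + \<kappa> * (Y T \<omega> - y0) + k * Y T \<omega>)"
        unfolding ennreal_plus[OF nn[OF \<omega>]] by (rule add.assoc)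
      finally show "cost T \<omega> \<le> \<psi> h \<omega> + ennreal (K0 + \<kappa> * (Y T \<omega> - y0) + k * Y T \<omega>)" .
    qed
    also have "\<dots> = (\<integral>\<^sup>+\<omega>. \<psi> h \<omega> \<partial>M) + (\<integral>\<^sup>+\<omega>. ennreal (K0 + \<kappa> * (Y T \<omega> - y0) + k * Y T \<omega>) \<partial>M)"
      using psi_meas[OF h_meas] by (intro nn_integral_add) auto
    also have "(\<integral>\<^sup>+\<omega>. ennreal (K0 + \<kappa> * (Y T \<omega> - y0) + k * Y T \<omega>) \<partial>M) = ennreal (\<integral>\<omega>. K0 + \<kappa> * (Y T \<omega> - y0) + k * Y T \<omega> \<partial>M)"
      by (rule nn_integral_eq_integral[OF io]) (use nn in \<open>auto intro!: AE_I2 add_nonneg_nonneg\<close>)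
    also have "(\<integral>\<omega>. K0 + \<kappa> * (Y T \<omega> - y0) + k * Y T \<omega> \<partial>M) = K0 + \<kappa> * e + k * (e + y0)"
      using Y_integrable[OF T] by (simp add: prob_space e_def)
    also have "(\<integral>\<^sup>+\<omega>. \<psi> h \<omega> \<partial>M) + ennreal (K0 + \<kappa> * e + k * (e + y0)) \<le> ennreal (\<nu> * T + C1 - (\<kappa> + k) * e) + ennreal (K0 + \<kappa> * e + k * (e + y0))"
      by (rule add_right_mono[OF H])
    also have "\<dots> = ennreal (\<nu> * T + C2)"
      using pos e0 K0 kappa k_nonneg y0 by (subst ennreal_plus[symmetric]) (auto simp: C2_def algebra_simps)
    finally show ?thesis .
  qed
  have lim: "((\<lambda>T::real. ennreal (\<nu> + C2 / T)) \<longlongrightarrow> ennreal \<nu>) at_top"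
  proof (rule tendsto_ennrealI)
    have "((\<lambda>T::real. \<nu> + C2 / T) \<longlongrightarrow> \<nu> + 0) at_top"
      by (intro tendsto_intros tendsto_divide_0[OF tendsto_const] filterlim_at_top_imp_at_infinity filterlim_ident)
    then show "((\<lambda>T::real. \<nu> + C2 / T) \<longlongrightarrow> \<nu>) at_top" by simp
  qed
  have "AC M B \<mu> \<sigma> k h K x Y \<le> Limsup at_top (\<lambda>T::real. ennreal (\<nu> + C2 / T))"
    unfolding AC_eq
  proof (rule Limsup_mono)
    show "\<forall>\<^sub>F T in at_top. (\<integral>\<^sup>+\<omega>. cost T \<omega> \<partial>M) / ennreal T \<le> ennreal (\<nu> + C2 / T)"
      using eventually_gt_at_top[of 0]
    proof eventually_elim
      case (elim T)
      have "(\<integral>\<^sup>+\<omega>. cost T \<omega> \<partial>M) / ennreal T \<le> ennreal (\<nu> * T + C2) / ennreal T"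
        by (rule divide_right_mono_ennreal[OF main[OF elim]])
      also have "\<dots> \<le> ennreal (\<nu> + C2 / T)"
      proof (cases "0 \<le> \<nu> * T + C2")
        case True
        then have "ennreal (\<nu> * T + C2) / ennreal T = ennreal ((\<nu> * T + C2) / T)" using elim by (rule divide_ennreal)
        also have "(\<nu> * T + C2) / T = \<nu> + C2 / T" using elim by (simp add: field_simps)
        finally show ?thesis by simp
      next
        case False
        then show ?thesis by (simp add: ennreal_neg)
      qed
      finally show ?case .
    qed
  qed
  also have "\<dots> = ennreal \<nu>" by (rule lim_imp_Limsup[OF _ lim]) simp
  finally show ?thesis .
qed

end

section \<open>Paths of order-up-to and base stock policies\<close>

lemma mono_left_limit:
  fixes y :: "real \<Rightarrow> real"
  assumes mono: "\<And>s t. 0 \<le> s \<Longrightarrow> s \<le> t \<Longrightarrow> y s \<le> y t" and t: "0 < t"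
  shows "\<exists>l. (y \<longlongrightarrow> l) (at_left t)"
proof
  have bdd: "bdd_above (y ` {0..<t})" using mono by (intro bdd_aboveI[of _ "y t"]) auto
  show "(y \<longlongrightarrow> (SUP u\<in>{0..<t}. y u)) (at_left t)"
  proof (rule increasing_tendsto)
    show "\<forall>\<^sub>F u in at_left t. y u \<le> (SUP u\<in>{0..<t}. y u)"
      using eventually_at_left_real[OF t] by eventually_elim (auto intro!: cSUP_upper bdd)
    fix a assume "a < (SUP u\<in>{0..<t}. y u)"
    then obtain v where v: "v \<in> {0..<t}" "a < y v" using less_cSUP_iff[OF _ bdd] t by auto
    then have "v < t" by simp
    from eventually_at_left_real[OF this] show "\<forall>\<^sub>F u in at_left t. a < y u"
    proof eventually_elim
      case (elim u)
      then have "y v \<le> y u" using v by (intro mono) auto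
      with v show ?case by simp
    qed
  qed
qed

definition run_min :: "(real \<Rightarrow> real) \<Rightarrow> real \<Rightarrow> real" where
  "run_min X t = (INF u\<in>{0..t}. X u)"

locale cont_path =
  fixes X :: "real \<Rightarrow> real"
  assumes X_cont: "continuous_on {0..} X"
begin

lemma run_min_attained: assumes "0 \<le> t" shows "\<exists>v\<in>{0..t}. X v = run_min X t"
proof -
  have "\<exists>v\<in>{0..t}. \<forall>u\<in>{0..t}. X v \<le> X u"
    by (rule continuous_attains_inf) (use assms in \<open>auto intro: continuous_on_subset[OF X_cont]\<close>)
  then obtain v where v: "v \<in> {0..t}" "\<forall>u\<in>{0..t}. X v \<le> X u" by blast
  have "(INF u\<in>{0..t}. X u) = X v" using v by (intro cInf_eq_minimum) auto
  then show ?thesis using v(1) by (auto simp: run_min_def)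
qed

lemma run_min_le: assumes "u \<in> {0..t}" shows "run_min X t \<le> X u"
proof -
  have "compact (X ` {0..t})"
    by (intro compact_continuous_image continuous_on_subset[OF X_cont]) auto
  then have "bdd_below (X ` {0..t})" by (intro bounded_imp_bdd_below compact_imp_bounded)
  then show ?thesis unfolding run_min_def using assms by (intro cINF_lower)
qed

lemma run_min_0: "run_min X 0 = X 0"
  by (simp add: run_min_def)

lemma run_min_antimono: assumes "0 \<le> s" "s \<le> t" shows "run_min X t \<le> run_min X s"
proof -
  obtain v where "v \<in> {0..s}" "X v = run_min X s" using run_min_attained[OF assms(1)] by blast
  then show ?thesis using run_min_le[of v t] assms by auto
qed

lemma run_min_drop:
  assumes "0 \<le> s" "s \<le> t" and w: "\<And>v. s \<le> v \<Longrightarrow> v \<le> t \<Longrightarrow> \<bar>X s - X v\<bar> \<le> w"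
  shows "run_min X s - run_min X t \<le> w"
proof -
  obtain v where v: "v \<in> {0..t}" "X v = run_min X t" using run_min_attained[of t] assms by auto
  have "0 \<le> w" using w[of s] assms by simp
  show ?thesis
  proof (cases "v \<le> s")
    case True
    then show ?thesis using run_min_le[of v s] v \<open>0 \<le> w\<close> by auto
  next
    case False
    then show ?thesis using run_min_le[of s s] w[of v] v assms by auto
  qed
qed

lemma uniform_modulus:
  assumes "0 < e"
  obtains d where "0 < d" "\<And>u v. u \<in> {0..T} \<Longrightarrow> v \<in> {0..T} \<Longrightarrow> \<bar>u - v\<bar> < d \<Longrightarrow> \<bar>X u - X v\<bar> < e"
proof -
  have "uniformly_continuous_on {0..T} X"
    by (intro compact_uniformly_continuous continuous_on_subset[OF X_cont]) auto
  then show thesis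
    using assms that unfolding uniformly_continuous_on_def dist_real_def by metis
qed

lemma run_min_cont: "continuous_on {0..} (run_min X)"
  unfolding continuous_on_iff
proof (intro ballI allI impI)
  fix t e :: real assume t: "t \<in> {0..}" and e: "0 < e"
  obtain d where d: "0 < d" "\<And>u v. u \<in> {0..t + 1} \<Longrightarrow> v \<in> {0..t + 1} \<Longrightarrow> \<bar>u - v\<bar> < d \<Longrightarrow> \<bar>X u - X v\<bar> < e / 2"
    using uniform_modulus[of "e / 2" "t + 1"] e by auto
  have close: "\<bar>run_min X u - run_min X v\<bar> < e" if "0 \<le> u" "u \<le> v" "v \<le> t + 1" "v - u < d" for u v
  proof -
    have "run_min X u - run_min X v \<le> e / 2"
      by (rule run_min_drop) (use that d(2)[of u] in \<open>auto intro: less_imp_le\<close>)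
    then show ?thesis using run_min_antimono[OF that(1,2)] e by simp
  qed
  show "\<exists>d>0. \<forall>u\<in>{0..}. dist u t < d \<longrightarrow> dist (run_min X u) (run_min X t) < e"
  proof (intro exI[of _ "min d 1"] conjI ballI impI)
    fix u assume u: "u \<in> {0..}" "dist u t < min d 1"
    show "dist (run_min X u) (run_min X t) < e"
      using close[of u t] close[of t u] u t by (cases "u \<le> t") (auto simp: dist_real_def abs_minus_commute)
  qed (use d in auto)
qed

lemma cont_within:
  assumes "0 \<le> t" shows "(X \<longlongrightarrow> X t) (at_right t)" "0 < t \<Longrightarrow> (X \<longlongrightarrow> X t) (at_left t)"
proof -
  have l: "(X \<longlongrightarrow> X t) (at t within {0..})" using X_cont assms by (simp add: continuous_on_def)
  show "(X \<longlongrightarrow> X t) (at_right t)" by (rule tendsto_within_subset[OF l]) (use assms in auto)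
  assume "0 < t"
  have "\<forall>\<^sub>F u in at_left t. u \<in> {0..}" using eventually_at_left_real[OF \<open>0 < t\<close>] by eventually_elim auto
  then have "at t within ({..<t} \<inter> {0..}) = at_left t"
    by (intro at_within_nhd[of _ "{0<..}"]) (use \<open>0 < t\<close> in auto)
  moreover have "(X \<longlongrightarrow> X t) (at t within ({..<t} \<inter> {0..}))" by (rule tendsto_within_subset[OF l]) auto
  ultimately show "(X \<longlongrightarrow> X t) (at_left t)" by simp
qed

end

text \<open>For \<open>\<xi> > 0\<close>, the number of levels \<open>b\<close>,
  \<open>b - \<xi>\<close>, \<open>b - 2 * \<xi>\<close>, and so on that are at least
  \<open>m\<close>: the \<open>+ 1\<close> counts \<open>b\<close> itself, and for
  \<open>m > b\<close> the floor is negative and \<open>nat\<close> returns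
  \<open>0\<close>.\<close>

definition levels_hit :: "real \<Rightarrow> real \<Rightarrow> real \<Rightarrow> nat" where
  "levels_hit b \<xi> m = nat (\<lfloor>(b - m) / \<xi>\<rfloor> + 1)"

lemma less_levels_hit: "0 < \<xi> \<Longrightarrow> j < levels_hit b \<xi> m \<longleftrightarrow> m \<le> b - real j * \<xi>"
proof -
  assume x: "0 < \<xi>"
  have "j < levels_hit b \<xi> m \<longleftrightarrow> int j \<le> \<lfloor>(b - m) / \<xi>\<rfloor>" by (auto simp: levels_hit_def)
  also have "\<dots> \<longleftrightarrow> real j \<le> (b - m) / \<xi>" by (simp add: le_floor_iff)
  also have "\<dots> \<longleftrightarrow> m \<le> b - real j * \<xi>" using x by (auto simp: field_simps)
  finally show ?thesis .
qed

lemma levels_hit_mono: "0 < \<xi> \<Longrightarrow> m' \<le> m \<Longrightarrow> levels_hit b \<xi> m \<le> levels_hit b \<xi> m'"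
proof (rule ccontr)
  assume a: "0 < \<xi>" "m' \<le> m" "\<not> levels_hit b \<xi> m \<le> levels_hit b \<xi> m'"
  then have "m \<le> b - real (levels_hit b \<xi> m') * \<xi>" using less_levels_hit[OF a(1), of "levels_hit b \<xi> m'" b m] by simp
  then have "levels_hit b \<xi> m' < levels_hit b \<xi> m'" unfolding less_levels_hit[OF a(1)] using a(2) by simp
  then show False by simp
qed

section \<open>Step paths driven by a continuous nonincreasing path\<close>

locale step_path = r: cont_path r for r :: "real \<Rightarrow> real" +
  fixes b \<xi> y0 :: real
  assumes r_antimono: "\<And>s t. 0 \<le> s \<Longrightarrow> s \<le> t \<Longrightarrow> r t \<le> r s"
    and r_0: "b < r 0" and xi: "0 < \<xi>" and y0: "0 \<le> y0"
begin

definition n :: "real \<Rightarrow> nat" where "n t = levels_hit b \<xi> (r t)"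
definition y :: "real \<Rightarrow> real" where "y t = y0 + \<xi> * real (n t)"

lemma less_n: "j < n t \<longleftrightarrow> r t \<le> b - real j * \<xi>"
  unfolding n_def by (rule less_levels_hit[OF xi])

lemma n_mono: "0 \<le> s \<Longrightarrow> s \<le> t \<Longrightarrow> n s \<le> n t"
  unfolding n_def by (rule levels_hit_mono[OF xi r_antimono])

lemma n_0: "n 0 = 0"
  using less_n[of 0 0] r_0 by auto

lemma y_mono: "0 \<le> s \<Longrightarrow> s \<le> t \<Longrightarrow> y s \<le> y t"
  using n_mono[of s t] xi by (simp add: y_def)

lemma y_0: "y 0 = y0"
  by (simp add: y_def n_0)

lemma y_right_cont: assumes "0 \<le> t" shows "continuous (at_right t) y"
proof -
  have "b - real (n t) * \<xi> < r t" using less_n[of "n t" t] by auto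
  then have "\<forall>\<^sub>F u in at_right t. b - real (n t) * \<xi> < r u"
    using r.cont_within(1)[OF assms] by (rule order_tendstoD(1)[rotated])
  moreover have "\<forall>\<^sub>F u in at_right t. u \<in> {t<..<t + 1}" by (rule eventually_at_right_real) simp
  ultimately have "\<forall>\<^sub>F u in at_right t. y t = y u"
  proof eventually_elim
    case (elim u)
    have "\<not> n t < n u" using less_n[of "n t" u] elim(1) by auto
    moreover have "n t \<le> n u" using elim(2) assms by (intro n_mono) auto
    ultimately show ?case by (simp add: y_def)
  qed
  then have "(y \<longlongrightarrow> y t) (at_right t)" by (rule Lim_transform_eventually[OF tendsto_const])
  then show ?thesis by (simp add: continuous_within)
qed

sublocale increasing_path y
  using y_mono y0 y_0 mono_left_limit[of y] by unfold_locales auto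

text \<open>Continuity of \<open>r\<close> prevents it from reaching two new levels at one instant,
  so just before \<open>t\<close> the count is at most one short.\<close>

lemma left_limit_n:
  assumes t: "0 < t"
  obtains l where "Lim (at_left t) y = y0 + \<xi> * real l" "l = n t \<or> Suc l = n t"
    "\<And>v. 0 \<le> v \<Longrightarrow> v < t \<Longrightarrow> n v \<le> l"
proof (cases "\<exists>v. 0 \<le> v \<and> v < t \<and> n v = n t")
  case True
  then obtain v where v: "0 \<le> v" "v < t" "n v = n t" by blast
  have "\<forall>\<^sub>F u in at_left t. y t = y u"
    using eventually_at_left_real[OF v(2)]
  proof eventually_elim
    case (elim u)
    then have "n u = n t" using n_mono[of v u] n_mono[of u t] v by auto
    then show ?case by (simp add: y_def)
  qed
  then have "(y \<longlongrightarrow> y t) (at_left t)" by (rule Lim_transform_eventually[OF tendsto_const])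
  then have "Lim (at_left t) y = y t" by (intro tendsto_Lim) auto
  then show ?thesis using n_mono[of _ t] by (intro that[of "n t"]) (auto simp: y_def)
next
  case False
  then have less: "n v < n t" if "0 \<le> v" "v < t" for v using that n_mono[of v t] by force
  then have pos: "0 < n t" using t by (metis gr0I not_less_zero order_refl)
  define l where "l = n t - 1"
  have l: "Suc l = n t" using pos by (simp add: l_def)
  have up: "n v \<le> l" if "0 \<le> v" "v < t" for v using less[OF that] l by simp
  \<comment> \<open>The level before the last one lies strictly above \<open>r t\<close>, so
    \<open>r\<close> is already below it shortly before \<open>t\<close>.\<close>
  have ev: "\<forall>\<^sub>F u in at_left t. l \<le> n u"
  proof (cases l)
    case (Suc i)
    have "r t \<le> b - real l * \<xi>" using less_n[of l t] l by auto
    then have "r t < b - real i * \<xi>" using xi Suc by (simp add: distrib_right)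
    then have "\<forall>\<^sub>F u in at_left t. r u < b - real i * \<xi>"
      using r.cont_within(2)[of t] t by (intro order_tendstoD(2)[of r "r t"]) auto
    then show ?thesis
    proof eventually_elim
      case (elim u)
      then have "i < n u" using less_n[of i u] by simp
      then show ?case using Suc by simp
    qed
  qed simp
  have "\<forall>\<^sub>F u in at_left t. y0 + \<xi> * real l = y u"
    using ev eventually_at_left_real[OF t]
  proof eventually_elim
    case (elim u)
    then have "n u = l" using up[of u] by auto
    then show ?case by (simp add: y_def)
  qed
  then have "(y \<longlongrightarrow> y0 + \<xi> * real l) (at_left t)" by (rule Lim_transform_eventually[OF tendsto_const])
  then have "Lim (at_left t) y = y0 + \<xi> * real l" by (intro tendsto_Lim) auto
  then show ?thesis using l up by (intro that[of l]) auto
qed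

lemma jump_cases: assumes "0 < t" shows "jump y t = 0 \<or> jump y t = \<xi>"
proof (rule left_limit_n[OF assms])
  fix l assume l: "Lim (at_left t) y = y0 + \<xi> * real l" "l = n t \<or> Suc l = n t"
  from l(2) show ?thesis
  proof
    assume "l = n t" then show ?thesis using l(1) assms by (simp add: jump_def y_def)
  next
    assume "Suc l = n t"
    then have "real (n t) = real l + 1" by simp
    then show ?thesis using l(1) assms by (simp add: jump_def y_def algebra_simps)
  qed
qed

text \<open>At the first time with \<open>r\<close> at or below level \<open>j\<close>, continuity
  makes \<open>r\<close> equal to the level, and the count exceeds \<open>j\<close> for the first
  time, so a jump occurs there.\<close>

lemma hitting_time:
  assumes T: "0 < T" and j: "j < n T"
  obtains t where "t \<in> {0<..T}" "r t = b - real j * \<xi>" "jump y t = \<xi>"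
proof -
  define L where "L = b - real j * \<xi>"
  have "0 \<le> real j * \<xi>" using xi by simp
  then have L: "r T \<le> L" "L < r 0" using j less_n[of j T] r_0 unfolding L_def by (blast, linarith)
  define A where "A = {t \<in> {0..T}. r t \<le> L}"
  have cr: "continuous_on {0..T} r" by (rule continuous_on_subset[OF r.X_cont]) auto
  have "closed ({0..T} \<inter> r -` {..L})" by (rule continuous_closed_preimage[OF cr]) auto
  then have cl: "closed A" by (simp add: A_def Int_def vimage_def)
  have ne: "A \<noteq> {}" using L T by (auto simp: A_def)
  have bdd: "bdd_below A" by (intro bdd_belowI[of _ 0]) (auto simp: A_def)
  define t where "t = Inf A"
  have tA: "t \<in> A" unfolding t_def by (rule closed_contains_Inf[OF ne bdd cl])
  have low: "L < r v" if "0 \<le> v" "v < t" for v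
  proof (rule ccontr)
    assume "\<not> L < r v"
    then have "v \<in> A" using that tA by (auto simp: A_def)
    then have "t \<le> v" unfolding t_def by (rule cInf_lower[OF _ bdd])
    then show False using that by simp
  qed
  have t: "0 < t" "t \<le> T" using tA L by (auto simp: A_def less_le)
  have "L \<le> r t"
  proof (rule tendsto_lowerbound[OF r.cont_within(2)[of t]])
    show "\<forall>\<^sub>F u in at_left t. L \<le> r u"
      using eventually_at_left_real[OF t(1)] by eventually_elim (use low in \<open>auto intro: less_imp_le\<close>)
  qed (use t in auto)
  then have rt: "r t = L" using tA by (auto simp: A_def)
  then have jn: "j < n t" using less_n[of j t] by (simp add: L_def)
  have nj: "n v \<le> j" if "0 \<le> v" "v < t" for v using low[OF that] less_n[of j v] by (auto simp: L_def)
  have "jump y t \<noteq> 0"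
  proof
    assume z: "jump y t = 0"
    have "Lim (at_left t) y \<le> y0 + \<xi> * real j"
    proof (rule tendsto_upperbound)
      obtain l where l: "(y \<longlongrightarrow> l) (at_left t)" using y_left_limit[OF t(1)] by blast
      then have "Lim (at_left t) y = l" by (intro tendsto_Lim) auto
      then show "(y \<longlongrightarrow> Lim (at_left t) y) (at_left t)" using l by simp
      show "\<forall>\<^sub>F u in at_left t. y u \<le> y0 + \<xi> * real j"
        using eventually_at_left_real[OF t(1)] by eventually_elim (use nj xi in \<open>auto simp: y_def\<close>)
    qed simp
    then have "y t \<le> y0 + \<xi> * real j" using z t(1) by (simp add: jump_def)
    then have "\<xi> * real (n t) \<le> \<xi> * real j" by (simp add: y_def)
    then show False using jn xi by simp
  qed
  then show thesis using jump_cases[OF t(1)] t rt by (intro that[of t]) (auto simp: L_def)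
qed

text \<open>Each jump uses \<open>\<xi>\<close> of the increase, which bounds their number by
  \<open>n T\<close>; the hitting times of the \<open>n T\<close> levels are distinct, because
  \<open>r\<close> takes different values at them.\<close>

lemma jumps:
  assumes T: "0 < T"
  defines "H \<equiv> {u \<in> {0<..T}. jump y u \<noteq> 0}"
  shows "finite H" "card H = n T" "\<And>u. u \<in> H \<Longrightarrow> jump y u = \<xi>"
proof -
  show j: "jump y u = \<xi>" if "u \<in> H" for u using that jump_cases[of u] by (auto simp: H_def)
  have up: "card A \<le> n T" if "finite A" "A \<subseteq> H" for A
  proof -
    have "\<xi> * real (card A) = (\<Sum>u\<in>A. jump y u)" using j that(2) by (simp add: subset_iff)
    also have "\<dots> \<le> y T - y 0" using that T by (intro sum_jumps_le) (auto simp: H_def)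
    also have "\<dots> = \<xi> * real (n T)" by (simp add: y_def n_0)
    finally show ?thesis using xi by simp
  qed
  show fin: "finite H"
  proof (rule ccontr)
    assume "infinite H"
    then obtain A where "A \<subseteq> H" "finite A" "card A = Suc (n T)" using infinite_arbitrarily_large by blast
    with up[of A] show False by simp
  qed
  have "\<forall>j<n T. \<exists>t. t \<in> H \<and> r t = b - real j * \<xi>"
  proof (intro allI impI)
    fix j assume "j < n T"
    from T this show "\<exists>t. t \<in> H \<and> r t = b - real j * \<xi>"
    proof (rule hitting_time)
      fix t assume "t \<in> {0<..T}" "r t = b - real j * \<xi>" "jump y t = \<xi>"
      then show ?thesis using xi by (intro exI[of _ t]) (simp add: H_def)
    qed
  qed
  then obtain \<tau> where \<tau>: "\<And>j. j < n T \<Longrightarrow> \<tau> j \<in> H \<and> r (\<tau> j) = b - real j * \<xi>" by metis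
  have "inj_on \<tau> {..<n T}"
  proof (rule inj_onI)
    fix i j assume "i \<in> {..<n T}" "j \<in> {..<n T}" "\<tau> i = \<tau> j"
    then have "real i * \<xi> = real j * \<xi>" using \<tau>[of i] \<tau>[of j] by auto
    then show "i = j" using xi by simp
  qed
  then have "n T = card (\<tau> ` {..<n T})" by (simp add: card_image)
  also have "\<dots> \<le> card H" using \<tau> by (intro card_mono fin) auto
  finally show "card H = n T" using up[OF fin] by simp
qed

lemma cont_part_zero: assumes T: "0 < T" shows "cont_part y T = 0"
proof -
  define H where "H = {u \<in> {0<..T}. jump y u \<noteq> 0}"
  note J = jumps[OF T, folded H_def]
  have "(\<Sum>\<^sub>\<infinity>u\<in>{0..T}. jump y u) = (\<Sum>\<^sub>\<infinity>u\<in>insert 0 H. jump y u)"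
    by (rule infsum_cong_neutral) (use T in \<open>auto simp: H_def\<close>)
  also have "\<dots> = (\<Sum>u\<in>insert 0 H. jump y u)" using J(1) by simp
  also have "\<dots> = jump y 0 + (\<Sum>u\<in>H. jump y u)" by (rule sum.insert[OF J(1)]) (simp add: H_def)
  also have "(\<Sum>u\<in>H. jump y u) = (\<Sum>u\<in>H. \<xi>)" by (rule sum.cong[OF refl J(3)])
  also have "jump y 0 + (\<Sum>u\<in>H. \<xi>) = y T" using J(2) by (simp add: jump_def n_0 y_def)
  finally show ?thesis by (simp add: cont_part_def)
qed

lemma jump_cost:
  fixes K :: "real \<Rightarrow> real"
  assumes T: "0 < T" and K: "\<And>\<xi>. 0 \<le> K \<xi>" "K 0 = 0"
  shows "(\<integral>\<^sup>+u. ennreal (K (jump y u)) \<partial>count_space {0..T}) = ennreal (K y0 + K \<xi> / \<xi> * (y T - y0))"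
proof -
  define H where "H = {u \<in> {0<..T}. jump y u \<noteq> 0}"
  note J = jumps[OF T, folded H_def]
  have "(\<integral>\<^sup>+u. ennreal (K (jump y u)) \<partial>count_space {0..T}) = (\<Sum>u\<in>insert 0 H. ennreal (K (jump y u)))"
    by (rule nn_integral_count_space') (use J(1) T K in \<open>auto simp: H_def\<close>)
  also have "\<dots> = ennreal (\<Sum>u\<in>insert 0 H. K (jump y u))" by (rule sum_ennreal) (rule K)
  also have "(\<Sum>u\<in>insert 0 H. K (jump y u)) = K (jump y 0) + (\<Sum>u\<in>H. K (jump y u))"
    by (rule sum.insert[OF J(1)]) (simp add: H_def)
  also have "(\<Sum>u\<in>H. K (jump y u)) = (\<Sum>u\<in>H. K \<xi>)"
    by (rule sum.cong[OF refl arg_cong[OF J(3)]])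
  also have "K (jump y 0) + (\<Sum>u\<in>H. K \<xi>) = K y0 + K \<xi> / \<xi> * (y T - y0)" using J(2) xi by (simp add: jump_def n_0 y_def)
  finally show ?thesis .
qed

end

text \<open>Since the levels decrease and \<open>X\<close> is continuous, the
  \<open>j\<close>-th order after time \<open>0\<close> is placed when \<open>X\<close> first reaches the \<open>j\<close>-th level.\<close>

locale sS_setting = cont_path X for X :: "real \<Rightarrow> real" +
  fixes x s S :: real
  assumes X_0: "X 0 = x" and s_less_S: "s < S"
begin

text \<open>After the initial order the stock is \<open>X + y0\<close>, so the next order is due
  when \<open>X\<close> reaches \<open>s - y0\<close>, which is \<open>b\<close> in both
  cases.\<close>

definition b :: real where "b = (if x \<le> s then x - (S - s) else s)"
definition y0 :: real where "y0 = (if x \<le> s then S - x else 0)"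

sublocale st: step_path "run_min X" b "S - s" y0
  using run_min_cont run_min_antimono run_min_0 X_0 s_less_S by unfold_locales (auto simp: b_def y0_def)

lemma b_y0: "b + y0 = s"
  by (simp add: b_def y0_def)

lemma order_sum: "(\<Sum>i\<le>j. order_size x s S i) = y0 + real j * (S - s)"
  by (induction j) (auto simp: order_size_def y0_def distrib_right)

lemma below_iff: "X t + (\<Sum>i\<le>j. order_size x s S i) \<le> s \<longleftrightarrow> X t \<le> b - real j * (S - s)"
  unfolding order_sum using b_y0 by linarith

lemma order_time_iff:
  "order_time X x s S (Suc j) \<le> ereal t \<longleftrightarrow> 0 \<le> t \<and> run_min X t \<le> b - real j * (S - s)"
proof (induction j arbitrary: t)
  case IH: (Suc j)
  show ?case
  proof
    assume l: "order_time X x s S (Suc (Suc j)) \<le> ereal t"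
    then have fin: "order_time X x s S (Suc (Suc j)) \<noteq> \<infinity>" by (auto simp del: order_time.simps)
    have "order_time X x s S (Suc j) \<le> ereal t" using order_time_le_Suc l by (rule order_trans)
    then obtain a where a: "order_time X x s S (Suc j) = ereal a" "0 \<le> a"
      using order_time_nonneg[of X x s S "Suc j"] by (cases "order_time X x s S (Suc j)") (auto simp del: order_time.simps)
    obtain c where c: "order_time X x s S (Suc (Suc j)) = ereal c" "a < c"
        "X c + (\<Sum>i\<le>Suc j. order_size x s S i) \<le> s"
      using order_time_Suc_attained[OF X_cont a order_time_above[OF s_less_S X_cont X_0 a(1)] fin] by metis
    have "c \<le> t" using l c(1) by (simp del: order_time.simps)
    then show "0 \<le> t \<and> run_min X t \<le> b - real (Suc j) * (S - s)"
      using run_min_le[of c t] c(2,3) a(2) unfolding below_iff by auto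
  next
    assume r: "0 \<le> t \<and> run_min X t \<le> b - real (Suc j) * (S - s)"
    then obtain u where u: "u \<in> {0..t}" "X u \<le> b - real (Suc j) * (S - s)"
      using run_min_attained[of t] by auto
    have "run_min X u \<le> X u" using u by (intro run_min_le) auto
    moreover have "b - real (Suc j) * (S - s) \<le> b - real j * (S - s)" using s_less_S by (simp add: distrib_right)
    ultimately have le: "order_time X x s S (Suc j) \<le> ereal u" using IH[of u] u by auto
    \<comment> \<open>At an order time the stock after the order exceeds \<open>s\<close>, whereas
      at \<open>u\<close> the next level has been reached; so \<open>u\<close> lies strictly after
      the previous order.\<close>
    have "order_time X x s S (Suc j) \<noteq> ereal u"
    proof
      assume "order_time X x s S (Suc j) = ereal u"
      from order_time_above[OF s_less_S X_cont X_0 this] show False using u(2) below_iff[of u "Suc j"] by simp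
    qed
    with le have "order_time X x s S (Suc j) < ereal u" by simp
    then have "order_time X x s S (Suc (Suc j)) \<le> ereal u"
      unfolding order_time.simps(2)[of _ _ _ _ "Suc j"] using u(2) unfolding below_iff[symmetric]
      by (intro Inf_lower) auto
    also have "\<dots> \<le> ereal t" using u by simp
    finally show "order_time X x s S (Suc (Suc j)) \<le> ereal t" .
  qed
next
  case 0
  have bx: "b < X 0" using X_0 s_less_S by (auto simp: b_def)
  show ?case
  proof
    assume l: "order_time X x s S (Suc 0) \<le> ereal t"
    then have fin: "order_time X x s S (Suc 0) \<noteq> \<infinity>" by (auto simp del: order_time.simps)
    have a: "order_time X x s S 0 = ereal 0" by (simp add: zero_ereal_def)
    obtain c where c: "order_time X x s S (Suc 0) = ereal c" "0 < c"
        "X c + (\<Sum>i\<le>0. order_size x s S i) \<le> s"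
      using order_time_Suc_attained[OF X_cont a order_refl order_time_above[OF s_less_S X_cont X_0 a] fin] by metis
    have "c \<le> t" using l c(1) by (simp del: order_time.simps)
    then show "0 \<le> t \<and> run_min X t \<le> b - real 0 * (S - s)"
      using run_min_le[of c t] c(2,3) unfolding below_iff by auto
  next
    assume r: "0 \<le> t \<and> run_min X t \<le> b - real 0 * (S - s)"
    then obtain u where u: "u \<in> {0..t}" "X u \<le> b - real 0 * (S - s)"
      using run_min_attained[of t] by auto
    have "0 < u" using u bx by (cases "u = 0") auto
    then have "order_time X x s S (Suc 0) \<le> ereal u"
      unfolding order_time.simps(2)[of _ _ _ _ 0] using u(2) unfolding below_iff[symmetric]
      by (intro Inf_lower) auto
    also have "\<dots> \<le> ereal t" using u by simp
    finally show "order_time X x s S (Suc 0) \<le> ereal t" .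
  qed
qed

lemma sS_path_eq: assumes "0 \<le> t" shows "sS_path X x s S t = st.y t"
proof -
  have "order_time X x s S j \<le> ereal t \<longleftrightarrow> j \<le> st.n t" for j
  proof (cases j)
    case (Suc i)
    have "order_time X x s S (Suc i) \<le> ereal t \<longleftrightarrow> i < st.n t"
      unfolding order_time_iff st.less_n using assms by simp
    then show ?thesis using Suc by (simp add: Suc_le_eq)
  qed (use assms in simp)
  then have "{j. order_time X x s S j \<le> ereal t} = {..st.n t}" by auto
  then show ?thesis using s_less_S by (simp add: sS_path_def order_sum st.y_def mult.commute)
qed

lemma above_s: assumes "0 \<le> t" shows "s \<le> X t + st.y t"
proof -
  have "b - real (st.n t) * (S - s) < run_min X t" using st.less_n[of "st.n t" t] by auto
  also have "\<dots> \<le> X t" using assms by (intro run_min_le) auto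
  finally show ?thesis using b_y0 by (simp add: st.y_def mult.commute)
qed

text \<open>The last level reached lies above \<open>run_min X t\<close>, and the order placed there
  raises the stock to \<open>S\<close>. If no order follows the initial one, the total is
  \<open>y0\<close>, which \<open>v = 0\<close> covers.\<close>

lemma sS_growth: assumes "0 \<le> t" shows "\<exists>v\<in>{0..t}. st.y t \<le> max S (y0 + x) - X v"
proof (cases "st.n t")
  case 0
  then show ?thesis using assms X_0 by (intro bexI[of _ 0]) (auto simp: st.y_def)
next
  case (Suc j)
  obtain v where v: "v \<in> {0..t}" "X v = run_min X t" using run_min_attained[OF assms] by blast
  have "run_min X t \<le> b - real j * (S - s)" using st.less_n[of j t] Suc by simp
  moreover have "(S - s) * real (st.n t) = real j * (S - s) + (S - s)" using Suc by (simp add: algebra_simps)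
  ultimately have "st.y t \<le> S - X v" using v(2) b_y0 unfolding st.y_def by linarith
  then show ?thesis using v(1) by (intro bexI[of _ v]) auto
qed

text \<open>Each order of the cell is triggered at a time in it when \<open>X\<close> is at the
  order's level. Postponed to \<open>t'\<close>, it moves the stock from \<open>s + \<eta>\<close>
  to \<open>S + \<eta>\<close> with \<open>\<bar>\<eta>\<bar> \<le> w\<close>; the Lipschitz bound
  at both ends costs \<open>2 * P * w\<close> per order, and dividing by \<open>S - s\<close> counts
  orders in units of \<open>y\<close>.\<close>

lemma sS_control:
  assumes G: "\<And>u v. \<bar>G u - G v\<bar> \<le> P * \<bar>u - v\<bar>" and P: "0 \<le> P"
    and GS: "G S - G s = - \<kappa> * (S - s)"
    and t: "0 \<le> t" "t \<le> t'" and w: "\<And>v. t \<le> v \<Longrightarrow> v \<le> t' \<Longrightarrow> \<bar>X t' - X v\<bar> \<le> w"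
  shows "\<bar>G (X t' + st.y t') - G (X t' + st.y t) + \<kappa> * (st.y t' - st.y t)\<bar>
    \<le> (2 * P / (S - s)) * w * (st.y t' - st.y t)"
proof -
  let ?\<xi> = "S - s"
  have xi: "0 < ?\<xi>" using s_less_S by simp
  define e where "e j = X t' + y0 + ?\<xi> * real j" for j
  have nn: "st.n t \<le> st.n t'" by (rule st.n_mono[OF t])
  have step: "\<bar>G (e (Suc j)) - G (e j) + \<kappa> * ?\<xi>\<bar> \<le> 2 * P * w" if j: "st.n t \<le> j" "j < st.n t'" for j
  proof -
    define L where "L = b - real j * ?\<xi>"
    have lo: "run_min X t' \<le> L" using j(2) st.less_n[of j t'] by (simp add: L_def)
    have hi: "L < run_min X t" using j(1) st.less_n[of j t] by (auto simp: L_def)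
    obtain v where v: "v \<in> {0..t'}" "X v = run_min X t'" using run_min_attained[of t'] t by auto
    have tv: "t \<le> v" using run_min_le[of v t] v lo hi by (cases "t \<le> v") auto
    have "L \<le> X t" using run_min_le[of t t] hi t by auto
    then obtain u where u: "t \<le> u" "u \<le> v" "X u = L"
      using IVT2'[of X v L t] v lo tv continuous_on_subset[OF X_cont, of "{t..v}"] t by auto
    have eL: "\<bar>X t' - L\<bar> \<le> w" using w[of u] u v by auto
    have ej: "e j = s + (X t' - L)" "e (Suc j) = S + (X t' - L)"
      using b_y0 by (auto simp: e_def L_def algebra_simps)
    have "\<bar>G (S + (X t' - L)) - G S\<bar> \<le> P * w" "\<bar>G (s + (X t' - L)) - G s\<bar> \<le> P * w"
      using G[of "S + (X t' - L)" S] G[of "s + (X t' - L)" s] mult_left_mono[OF eL P] by auto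
    then show ?thesis using GS unfolding ej by (simp add: abs_le_iff)
  qed
  have diff: "st.y t' - st.y t = ?\<xi> * real (st.n t' - st.n t)"
    using nn by (simp add: st.y_def right_diff_distrib of_nat_diff)
  have eq: "G (X t' + st.y t') - G (X t' + st.y t) + \<kappa> * (st.y t' - st.y t)
      = (\<Sum>j=st.n t..<st.n t'. G (e (Suc j)) - G (e j) + \<kappa> * ?\<xi>)"
    using sum_Suc_diff'[OF nn, of "\<lambda>j. G (e j)"] unfolding diff
    by (simp add: sum.distrib e_def st.y_def add.assoc)
  have "\<bar>\<Sum>j=st.n t..<st.n t'. G (e (Suc j)) - G (e j) + \<kappa> * ?\<xi>\<bar> \<le> (\<Sum>j=st.n t..<st.n t'. 2 * P * w)"
    by (intro order_trans[OF sum_abs] sum_mono step) auto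
  moreover have "(\<Sum>j=st.n t..<st.n t'. 2 * P * w) = (2 * P / ?\<xi>) * w * (st.y t' - st.y t)"
    unfolding diff using xi by simp
  ultimately show ?thesis by (simp only: eq)
qed

end

context cont_path
begin

lemma base_stock_eq:
  assumes "0 \<le> t" shows "sS_path X x s s t = max 0 (s - run_min X t)"
proof -
  obtain v where v: "v \<in> {0..t}" "X v = run_min X t" using run_min_attained[OF assms] by blast
  have "(SUP u\<in>{0..t}. max 0 (s - X u)) = max 0 (s - X v)"
  proof (rule cSup_eq_maximum)
    show "max 0 (s - X v) \<in> (\<lambda>u. max 0 (s - X u)) ` {0..t}" by (rule imageI[OF v(1)])
    fix a assume "a \<in> (\<lambda>u. max 0 (s - X u)) ` {0..t}"
    then obtain u where "u \<in> {0..t}" "a = max 0 (s - X u)" by auto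
    then show "a \<le> max 0 (s - X v)" using run_min_le[of u t] v(2) by auto
  qed
  then show ?thesis using v by (simp add: sS_path_def)
qed

text \<open>Within the cell the control acts only while the stock is at \<open>s\<close>, so between
  the two arguments of \<open>G\<close> the distance to \<open>s\<close> is at most
  \<open>w\<close>; there the derivative, which vanishes at \<open>s\<close>, is at most
  \<open>R * w\<close> in absolute value.\<close>

lemma base_stock_control:
  assumes g: "\<And>u. (G has_real_derivative g u) (at u)" and gs: "g s = 0"
    and gL: "\<And>u v. \<bar>g u - g v\<bar> \<le> R * \<bar>u - v\<bar>" and R: "0 \<le> R"
    and t: "0 \<le> t" "t \<le> t'" and w: "\<And>v. t \<le> v \<Longrightarrow> v \<le> t' \<Longrightarrow> \<bar>X t' - X v\<bar> \<le> w"
  defines "y \<equiv> \<lambda>t. max 0 (s - run_min X t)"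
  shows "\<bar>G (X t' + y t') - G (X t' + y t)\<bar> \<le> R * w * (y t' - y t)"
proof (cases "y t' = y t")
  case False
  have le: "y t \<le> y t'" using run_min_antimono[OF t] by (auto simp: y_def)
  obtain v where v: "v \<in> {0..t'}" "X v = run_min X t'" using run_min_attained[of t'] t by auto
  have yt': "y t' = s - X v" using False le v(2) by (auto simp: y_def)
  have tv: "t \<le> v" using run_min_le[of v t] v False le by (cases "t \<le> v") (auto simp: y_def)
  have 1: "\<bar>X t' + y t' - s\<bar> \<le> w" using w[of v] tv v yt' by auto
  have "s - X t \<le> y t" using run_min_le[of t t] t by (auto simp: y_def)
  then have 2: "s - w \<le> X t' + y t" using w[of t] t by auto
  have gb: "\<bar>g u\<bar> \<le> R * w" if "X t' + y t \<le> u" "u \<le> X t' + y t'" for u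
  proof -
    have "\<bar>u - s\<bar> \<le> w" using 1 2 that by auto
    then have "R * \<bar>u - s\<bar> \<le> R * w" using R by (rule mult_left_mono)
    then show ?thesis using gL[of u s] gs by simp
  qed
  then have b: "- (R * w) \<le> g u" "g u \<le> R * w" if "X t' + y t \<le> u" "u \<le> X t' + y t'" for u
    using gb[OF that] by linarith+
  have "- (R * w) * (X t' + y t' - (X t' + y t)) \<le> G (X t' + y t') - G (X t' + y t)"
    by (rule deriv_lower_bound[OF g]) (use le b in auto)
  moreover have "G (X t' + y t') - G (X t' + y t) \<le> R * w * (X t' + y t' - (X t' + y t))"
    by (rule deriv_upper_bound[OF g]) (use le b in auto)
  ultimately show ?thesis by (simp add: abs_le_iff)
qed simp

end

section \<open>Optimality\<close>

text \<open>Policies agree with their explicit path descriptions only on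
  \<open>[0, \<infinity>)\<close>; left limits at positive times depend on nothing else.\<close>

lemma Lim_at_left_cong:
  fixes y z :: "real \<Rightarrow> real"
  assumes eq: "\<And>u. 0 \<le> u \<Longrightarrow> y u = z u" and t: "0 < t"
  shows "(y \<longlongrightarrow> l) (at_left t) \<longleftrightarrow> (z \<longlongrightarrow> l) (at_left t)"
proof (rule filterlim_cong[OF refl refl])
  show "\<forall>\<^sub>F u in at_left t. y u = z u"
    using eventually_at_left_real[OF t] by eventually_elim (auto intro: eq)
qed

lemma jump_cong:
  fixes y z :: "real \<Rightarrow> real"
  assumes eq: "\<And>u. 0 \<le> u \<Longrightarrow> y u = z u" and t: "0 \<le> t"
  shows "jump y t = jump z t"
proof (cases "t = 0")
  case False
  then have "Lim (at_left t) y = Lim (at_left t) z"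
    unfolding Topological_Spaces.Lim_def using Lim_at_left_cong[of y z t] eq t by simp
  then show ?thesis using False eq[OF t] by (simp add: jump_def)
qed (simp add: jump_def eq)

lemma cont_part_cong:
  fixes y z :: "real \<Rightarrow> real"
  assumes eq: "\<And>u. 0 \<le> u \<Longrightarrow> y u = z u" and t: "0 \<le> t"
  shows "cont_part y t = cont_part z t"
proof -
  have "(\<Sum>\<^sub>\<infinity>u\<in>{0..t}. jump y u) = (\<Sum>\<^sub>\<infinity>u\<in>{0..t}. jump z u)"
    by (intro infsum_cong jump_cong[of y z] eq) auto
  then show ?thesis using eq[OF t] by (simp add: cont_part_def)
qed

lemma at_right_cong:
  fixes y z :: "real \<Rightarrow> real"
  assumes eq: "\<And>u. 0 \<le> u \<Longrightarrow> y u = z u" and t: "0 \<le> t" and z: "continuous (at_right t) z"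
  shows "continuous (at_right t) y"
proof -
  have "\<forall>\<^sub>F u in at_right t. u \<in> {t<..<t + 1}" by (rule eventually_at_right_real) simp
  then have "\<forall>\<^sub>F u in at_right t. z u = y u" by eventually_elim (use eq t in auto)
  moreover have "(z \<longlongrightarrow> y t) (at_right t)" using z eq[OF t] by (simp add: continuous_within)
  ultimately show ?thesis unfolding continuous_within by (rule Lim_transform_eventually[rotated])
qed

context brownian
begin

lemma cont_path_X: "\<omega> \<in> space M \<Longrightarrow> cont_path (\<lambda>u. X x u \<omega>)"
  by unfold_locales (rule X_cont)

text \<open>By continuity the minimum is below \<open>a\<close> iff the path is below
  \<open>a\<close> at some point of some grid of \<open>[0, t]\<close>; this expresses the event
  through countably many values of \<open>X\<close> up to time \<open>t\<close>.\<close>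

lemma run_min_F:
  assumes t: "0 \<le> t" shows "(\<lambda>\<omega>. run_min (\<lambda>u. X x u \<omega>) t) \<in> borel_measurable (F t)"
proof (cases "t = 0")
  case True
  then show ?thesis using X_F[of 0 0 x] by (simp add: run_min_def)
next
  case False
  then have t: "0 < t" using assms by simp
  have m: "X x (grid t (Suc n) i) \<in> borel_measurable (F t)" if "i \<le> Suc n" for n i
    using t grid_nonneg[of t "Suc n" i] grid_le[of t "Suc n" i] that by (intro X_F) auto
  show ?thesis
    unfolding borel_measurable_iff_less
  proof
    fix a
    have "{\<omega> \<in> space (F t). run_min (\<lambda>u. X x u \<omega>) t < a}
        = (\<Union>n. \<Union>i\<in>{..Suc n}. {\<omega> \<in> space (F t). X x (grid t (Suc n) i) \<omega> < a})" (is "?L = ?R")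
    proof (intro equalityI subsetI)
      fix \<omega> assume \<omega>: "\<omega> \<in> ?L"
      then have sp: "\<omega> \<in> space M" by (simp add: space_F)
      interpret cont_path "\<lambda>u. X x u \<omega>" by (rule cont_path_X[OF sp])
      obtain v where v: "v \<in> {0..t}" "X x v \<omega> < a" using run_min_attained[of t] \<omega> t by auto
      obtain j where j: "\<And>n. j n \<le> Suc n" "(\<lambda>n. grid t (Suc n) (j n)) \<longlonglongrightarrow> v"
        using grid_dense[OF t, of v] v by auto
      have "(\<lambda>n. X x (grid t (Suc n) (j n)) \<omega>) \<longlonglongrightarrow> X x v \<omega>"
        using continuous_on_tendsto_compose[OF X_cont j(2)] v t by (simp add: grid_nonneg)
      then have "\<forall>\<^sub>F n in sequentially. X x (grid t (Suc n) (j n)) \<omega> < a" using v by (intro order_tendstoD(2)) auto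
      then obtain n where "X x (grid t (Suc n) (j n)) \<omega> < a" by (auto simp: eventually_sequentially)
      then show "\<omega> \<in> ?R" using j(1)[of n] \<omega> by auto
    next
      fix \<omega> assume "\<omega> \<in> ?R"
      then obtain n i where i: "i \<le> Suc n" "\<omega> \<in> space (F t)" "X x (grid t (Suc n) i) \<omega> < a" by auto
      interpret cont_path "\<lambda>u. X x u \<omega>" by (rule cont_path_X) (use i in \<open>simp add: space_F\<close>)
      have "run_min (\<lambda>u. X x u \<omega>) t \<le> X x (grid t (Suc n) i) \<omega>"
        using t grid_nonneg[of t "Suc n" i] grid_le[of t "Suc n" i] i(1) by (intro run_min_le) auto
      then show "\<omega> \<in> ?L" using i by auto
    qed
    also have "\<dots> \<in> sets (F t)"
    proof (rule sets.countable_UN'', simp, rule sets.finite_UN, simp)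
      fix n i assume "i \<in> {..Suc n}"
      then have [measurable]: "X x (grid t (Suc n) i) \<in> borel_measurable (F t)" using m by auto
      show "{\<omega> \<in> space (F t). X x (grid t (Suc n) i) \<omega> < a} \<in> sets (F t)" by measurable
    qed
    finally show "{\<omega> \<in> space (F t). run_min (\<lambda>u. X x u \<omega>) t < a} \<in> sets (F t)" .
  qed
qed

end

context policy
begin

text \<open>Local errors proportional to the oscillation of \<open>X\<close> times the increase of
  \<open>Y\<close> sum to at most \<open>C * w * (Y T \<omega> - Y 0 \<omega>)\<close>, and uniform
  continuity of the path makes \<open>w\<close> arbitrarily small on fine grids.\<close>

lemma control_sum_tendsto:
  assumes \<omega>: "\<omega> \<in> space M" and T: "0 < T" and C: "0 \<le> C"
    and local: "\<And>t t' w. 0 \<le> t \<Longrightarrow> t \<le> t' \<Longrightarrow> (\<And>v. t \<le> v \<Longrightarrow> v \<le> t' \<Longrightarrow> \<bar>X x t' \<omega> - X x v \<omega>\<bar> \<le> w) \<Longrightarrow>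
      \<bar>G (X x t' \<omega> + Y t' \<omega>) - G (X x t' \<omega> + Y t \<omega>) + \<kappa> * (Y t' \<omega> - Y t \<omega>)\<bar> \<le> C * w * (Y t' \<omega> - Y t \<omega>)"
  shows "(\<lambda>n. \<Sum>i<n. G (Z (grid T n (Suc i)) \<omega>) - G (Z (grid T n i) \<omega> + incr (grid T n i) (grid T n (Suc i)) \<omega>))
    \<longlonglongrightarrow> - \<kappa> * (Y T \<omega> - Y 0 \<omega>)"
proof (rule LIMSEQ_I)
  interpret p: cont_path "\<lambda>u. X x u \<omega>" by (rule cont_path_X[OF \<omega>])
  let ?D = "Y T \<omega> - Y 0 \<omega>"
  have D: "0 \<le> ?D" using Y_mono[OF \<omega>, of 0 T] T by simp
  fix e :: real assume e: "0 < e"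
  define w where "w = e / (2 * (C * ?D + 1))"
  have CD: "0 \<le> C * ?D" using C D by simp
  have w: "0 < w" using e CD by (simp add: w_def)
  obtain d where d: "0 < d" "\<And>u v. u \<in> {0..T} \<Longrightarrow> v \<in> {0..T} \<Longrightarrow> \<bar>u - v\<bar> < d \<Longrightarrow> \<bar>X x u \<omega> - X x v \<omega>\<bar> < w"
    using p.uniform_modulus[OF w, of T] by blast
  have "(\<lambda>n. T / real n) \<longlonglongrightarrow> 0" by (rule lim_const_over_n)
  then have "\<forall>\<^sub>F n in sequentially. T / real n < d" using d(1) by (rule order_tendstoD)
  then have "\<forall>\<^sub>F n in sequentially. T / real n < d \<and> 0 < n" using eventually_gt_at_top[of 0] by eventually_elim simp
  then obtain n0 where n0: "\<And>n. n0 \<le> n \<Longrightarrow> T / real n < d \<and> 0 < n" by (auto simp: eventually_sequentially)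
  show "\<exists>no. \<forall>n\<ge>no. norm ((\<Sum>i<n. G (Z (grid T n (Suc i)) \<omega>) - G (Z (grid T n i) \<omega> + incr (grid T n i) (grid T n (Suc i)) \<omega>)) - - \<kappa> * ?D) < e"
  proof (intro exI allI impI)
    fix n assume "n0 \<le> n"
    then have n: "T / real n < d" "0 < n" using n0 by auto
    let ?dY = "\<lambda>i. Y (grid T n (Suc i)) \<omega> - Y (grid T n i) \<omega>"
    let ?g = "\<lambda>i. G (Z (grid T n (Suc i)) \<omega>) - G (Z (grid T n i) \<omega> + incr (grid T n i) (grid T n (Suc i)) \<omega>)"
    have tele: "(\<Sum>i<n. ?dY i) = ?D"
      using sum_lessThan_telescope[of "\<lambda>i. Y (grid T n i) \<omega>" n] n by (simp add: grid_end)
    have step: "\<bar>?g i + \<kappa> * ?dY i\<bar> \<le> C * w * ?dY i" if i: "i < n" for i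
    proof -
      have g: "0 \<le> grid T n i" "grid T n i \<le> grid T n (Suc i)" "grid T n (Suc i) \<le> T"
        using grid_nonneg[of T n i] grid_less[OF T n(2), of i "Suc i"] grid_le[OF T n(2), of "Suc i"] T i by auto
      have I: "Z (grid T n i) \<omega> + incr (grid T n i) (grid T n (Suc i)) \<omega> = X x (grid T n (Suc i)) \<omega> + Y (grid T n i) \<omega>"
        using X_incr[of x "grid T n (Suc i)" \<omega> "grid T n i"] by (simp add: Z_def)
      have "\<bar>X x (grid T n (Suc i)) \<omega> - X x v \<omega>\<bar> \<le> w" if "grid T n i \<le> v" "v \<le> grid T n (Suc i)" for v
        using d(2)[of "grid T n (Suc i)" v] that g n(1) by (auto simp: grid_Suc intro!: less_imp_le)
      from local[OF g(1,2) this] show ?thesis by (simp only: I Z_def[of "grid T n (Suc i)"])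
    qed
    have "(\<Sum>i<n. ?g i) - - \<kappa> * ?D = (\<Sum>i<n. ?g i + \<kappa> * ?dY i)"
      unfolding sum.distrib sum_distrib_left[symmetric] tele by simp
    then have "norm ((\<Sum>i<n. ?g i) - - \<kappa> * ?D) \<le> (\<Sum>i<n. C * w * ?dY i)"
      by (simp only: real_norm_def) (intro order_trans[OF sum_abs] sum_mono step, simp)
    also have "\<dots> = C * ?D * w" unfolding sum_distrib_left[symmetric] tele by simp
    also have "\<dots> < e"
    proof -
      have "C * ?D * w = (C * ?D / (C * ?D + 1)) * (e / 2)" by (simp add: w_def)
      also have "\<dots> \<le> 1 * (e / 2)" using CD e by (intro mult_right_mono) auto
      finally show ?thesis using e by simp
    qed
    finally show "norm ((\<Sum>i<n. ?g i) - - \<kappa> * ?D) < e" .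
  qed
qed

end

section \<open>Average cost and optimality of the two kinds of policies\<close>

locale inventory_system = inventory \<mu> \<sigma> h N Q c k + brownian M F B \<mu> \<sigma>
  for \<mu> \<sigma> :: real and h :: "real \<Rightarrow> real" and N :: nat and Q :: "nat \<Rightarrow> ereal" and c :: "nat \<Rightarrow> real"
    and k :: real and M :: "'a measure" and F B
begin

lemma admissibleI:
  assumes meas: "\<And>t. 0 \<le> t \<Longrightarrow> Y t \<in> borel_measurable (F t)"
    and eq: "\<And>\<omega> t. \<omega> \<in> space M \<Longrightarrow> 0 \<le> t \<Longrightarrow> Y t \<omega> = y \<omega> t"
    and mono: "\<And>\<omega> s t. \<omega> \<in> space M \<Longrightarrow> 0 \<le> s \<Longrightarrow> s \<le> t \<Longrightarrow> y \<omega> s \<le> y \<omega> t"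
    and nonneg: "\<And>\<omega>. \<omega> \<in> space M \<Longrightarrow> 0 \<le> y \<omega> 0"
    and right: "\<And>\<omega> t. \<omega> \<in> space M \<Longrightarrow> 0 \<le> t \<Longrightarrow> continuous (at_right t) (y \<omega>)"
  shows "admissible M F Y"
  unfolding admissible_def
proof (intro conjI ballI allI impI)
  fix \<omega> assume \<omega>: "\<omega> \<in> space M"
  show "mono_on {0..} (\<lambda>t. Y t \<omega>)" using mono[OF \<omega>] eq[OF \<omega>] by (auto intro!: mono_onI)
  show "0 \<le> Y t \<omega>" if "0 \<le> t" for t
    using nonneg[OF \<omega>] mono[OF \<omega>, of 0 t] eq[OF \<omega>, of t] that by simp
  show "continuous (at_right t) (\<lambda>u. Y u \<omega>)" if "0 \<le> t" for t
    using at_right_cong[OF eq[OF \<omega>] that right[OF \<omega> that]] .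
  show "\<exists>l. ((\<lambda>u. Y u \<omega>) \<longlongrightarrow> l) (at_left t)" if "0 < t" for t
    using mono_left_limit[of "y \<omega>", OF mono[OF \<omega>] that]
      Lim_at_left_cong[of "\<lambda>u. Y u \<omega>" "y \<omega>", OF eq[OF \<omega>] that] by blast
qed (rule meas)

lemma sS_settingI: "s < S \<Longrightarrow> \<omega> \<in> space M \<Longrightarrow> sS_setting (\<lambda>u. X x u \<omega>) x s S"
  using cont_path_X[of \<omega> x] X_0[of \<omega> x]
  by (simp add: sS_setting_def sS_setting_axioms_def)

abbreviation "first_level x s S \<equiv> sS_setting.b x s S"
abbreviation "first_order x s S \<equiv> sS_setting.y0 x s S"
abbreviation "sS_y x s S \<omega> \<equiv> step_path.y (run_min (\<lambda>u. X x u \<omega>)) (first_level x s S) (S - s) (first_order x s S)"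

lemma sS_policy_eq: "s < S \<Longrightarrow> \<omega> \<in> space M \<Longrightarrow> 0 \<le> t \<Longrightarrow> sS_policy B \<mu> \<sigma> s S x t \<omega> = sS_y x s S \<omega> t"
  unfolding sS_policy_def by (rule sS_setting.sS_path_eq[OF sS_settingI])

lemma step_pathI:
  assumes "s < S" "\<omega> \<in> space M"
  shows "step_path (run_min (\<lambda>u. X x u \<omega>)) (first_level x s S) (S - s) (first_order x s S)"
proof -
  interpret sS_setting "\<lambda>u. X x u \<omega>" x s S by (rule sS_settingI[OF assms])
  show ?thesis by (rule st.step_path_axioms)
qed

lemma sS_admissible:
  assumes sS: "s < S" shows "admissible M F (sS_policy B \<mu> \<sigma> s S x)"
proof (rule admissibleI[where y = "sS_y x s S"])
  fix t :: real assume t: "0 \<le> t"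
  let ?r = "\<lambda>\<omega>. run_min (\<lambda>u. X x u \<omega>) t"
  have [measurable]: "?r \<in> borel_measurable (F t)" by (rule run_min_F[OF t])
  have "(\<lambda>\<omega>. first_order x s S + (S - s) * real (levels_hit (first_level x s S) (S - s) (?r \<omega>))) \<in> borel_measurable (F t)"
    unfolding levels_hit_def by measurable
  moreover have "sS_policy B \<mu> \<sigma> s S x t \<omega> = first_order x s S + (S - s) * real (levels_hit (first_level x s S) (S - s) (?r \<omega>))"
    if "\<omega> \<in> space (F t)" for \<omega>
  proof -
    have \<omega>: "\<omega> \<in> space M" using that by (simp add: space_F)
    interpret step_path "run_min (\<lambda>u. X x u \<omega>)" "first_level x s S" "S - s" "first_order x s S"
      by (rule step_pathI[OF sS \<omega>])
    show ?thesis using sS_policy_eq[OF sS \<omega> t, of x] by (simp add: y_def n_def)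
  qed
  ultimately show "sS_policy B \<mu> \<sigma> s S x t \<in> borel_measurable (F t)"
    by (subst measurable_cong) auto
next
  show "sS_policy B \<mu> \<sigma> s S x t \<omega> = sS_y x s S \<omega> t" if "\<omega> \<in> space M" "0 \<le> t" for \<omega> t
    by (rule sS_policy_eq[OF sS that])
  fix \<omega> assume \<omega>: "\<omega> \<in> space M"
  interpret step_path "run_min (\<lambda>u. X x u \<omega>)" "first_level x s S" "S - s" "first_order x s S"
    by (rule step_pathI[OF sS \<omega>])
  show "sS_y x s S \<omega> s' \<le> sS_y x s S \<omega> t" if "0 \<le> s'" "s' \<le> t" for s' t by (rule y_mono[OF that])
  show "0 \<le> sS_y x s S \<omega> 0" using y_0 y0 by simp
  show "continuous (at_right t) (sS_y x s S \<omega>)" if "0 \<le> t" for t by (rule y_right_cont[OF that])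
qed

lemma policyI: "admissible M F Y \<Longrightarrow> policy M F B \<mu> \<sigma> Y"
  by (simp add: policy_def policy_axioms_def brownian_axioms)

lemma controlledI: "admissible M F Y \<Longrightarrow> controlled \<mu> \<sigma> h N Q c k M F B Y"
  by (simp add: controlled_def policyI inventory_axioms)

theorem AC_sS:
  assumes sS: "s < S"
  shows "AC M B \<mu> \<sigma> k h K x (sS_policy B \<mu> \<sigma> s S x) \<le> ennreal (rate s S)"
proof -
  let ?Y = "sS_policy B \<mu> \<sigma> s S x" let ?\<xi> = "S - s"
  have xi: "0 < ?\<xi>" using sS by simp
  \<comment> \<open>Setup cost per unit ordered, since every order after the initial one has size
    \<open>S - s\<close>.\<close>
  define \<kappa> where "\<kappa> = K ?\<xi> / ?\<xi>"
  have kappa: "0 \<le> \<kappa>" using K_nonneg xi by (simp add: \<kappa>_def)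
  interpret controlled \<mu> \<sigma> h N Q c k M F B x ?Y by (rule controlledI[OF sS_admissible[OF sS]])
  have dp: "dominated_policy \<mu> \<sigma> h N Q c k M F B x ?Y s (first_order x s S) (K (first_order x s S)) \<kappa> (max S (first_order x s S + x))"
  proof unfold_locales
    show "0 \<le> first_order x s S"
    proof -
      obtain \<omega> where \<omega>: "\<omega> \<in> space M" using not_empty by auto
      interpret step_path "run_min (\<lambda>u. X x u \<omega>)" "first_level x s S" "S - s" "first_order x s S"
        by (rule step_pathI[OF sS \<omega>])
      show ?thesis by (rule y0)
    qed
    fix \<omega> and T :: real assume \<omega>: "\<omega> \<in> space M"
    interpret P: sS_setting "\<lambda>u. X x u \<omega>" x s S by (rule sS_settingI[OF sS \<omega>])
    note eq = sS_policy_eq[OF sS \<omega>, of _ x]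
    show "\<exists>v\<in>{0..T}. ?Y T \<omega> \<le> max S (first_order x s S + x) - X x v \<omega>" if "0 \<le> T"
      using P.sS_growth[OF that] eq[OF that] by simp
    show "?Y 0 \<omega> = first_order x s S" using eq[of 0] P.st.y_0 by simp
    show "s \<le> Z T \<omega>" if "0 \<le> T" using P.above_s[OF that] eq[OF that] by (simp add: Z_def)
    show "(\<integral>\<^sup>+u. ennreal (K (jump (\<lambda>u. ?Y u \<omega>) u)) \<partial>count_space {0..T}) + ell K * ennreal (cont_part (\<lambda>u. ?Y u \<omega>) T)
        \<le> ennreal (K (first_order x s S) + \<kappa> * (?Y T \<omega> - first_order x s S))" if T: "0 < T"
    proof -
      have "(\<integral>\<^sup>+u. ennreal (K (jump (\<lambda>u. ?Y u \<omega>) u)) \<partial>count_space {0..T}) = (\<integral>\<^sup>+u. ennreal (K (jump P.st.y u)) \<partial>count_space {0..T})"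
        by (intro nn_integral_cong) (simp add: jump_cong[OF eq])
      also have "\<dots> = ennreal (K (first_order x s S) + \<kappa> * (P.st.y T - first_order x s S))"
        using P.st.jump_cost[where K = K, OF T K_nonneg K_0] by (simp add: \<kappa>_def)
      finally show ?thesis
        using cont_part_cong[of "\<lambda>u. ?Y u \<omega>" P.st.y T] P.st.cont_part_zero[OF T] eq T by simp
    qed
  qed (use K_nonneg kappa in auto)
  interpret dominated_policy \<mu> \<sigma> h N Q c k M F B x ?Y s "first_order x s S" "K (first_order x s S)" \<kappa> "max S (first_order x s S + x)"
    by (rule dp)
  define J where "J A = (LBINT u:{s..S}. mc A u / \<mu>)" for A
  \<comment> \<open>The rate of the policy for the truncated cost; with it the potential plus
    \<open>k * z\<close> changes by exactly \<open>- \<kappa> * (S - s)\<close> between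
    \<open>s\<close> and \<open>S\<close>.\<close>
  define a where "a A = k * \<mu> + \<kappa> * \<mu> + \<mu> / ?\<xi> * J A" for A
  have cm: "continuous_on UNIV (\<lambda>u. mc A u / \<mu>)" if "0 \<le> A" for A
    using mu_pos by (intro continuous_intros mc_cont[OF that]) auto
  have J0: "0 \<le> J A" for A
    unfolding J_def set_lebesgue_integral_def using mu_pos by (intro integral_nonneg_AE) (simp add: mc_nonneg)
  have Jg: "J A \<le> (LBINT u:{s..S}. g u)" if A: "0 \<le> A" for A
    unfolding J_def
  proof (rule set_integral_mono[OF _ g_integrable])
    show "set_integrable lborel {s..S} (\<lambda>u. mc A u / \<mu>)"
      by (intro borel_integrable_atLeastAtMost' continuous_on_subset[OF cm[OF A]]) auto
    show "mc A u / \<mu> \<le> g u" for u using mc_le[OF A, of u] mu_pos by (simp add: g_eq divide_right_mono)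
  qed
  have rate: "rate s S = k * \<mu> + \<kappa> * \<mu> + \<mu> / ?\<xi> * (LBINT u:{s..S}. g u)" by (simp add: rate_def \<kappa>_def)
  have a0: "0 \<le> a A" for A using k_nonneg kappa mu_pos J0 xi by (simp add: a_def)
  have a_le: "a A \<le> rate s S" if "0 \<le> A" for A
    unfolding rate a_def using Jg[OF that] mu_pos xi by (intro add_left_mono mult_left_mono) auto
  show ?thesis
  proof (rule AC_upper[of "rate s S" a])
    show "0 \<le> rate s S" using a0[of 0] a_le[of 0] by simp
    fix A f and T :: real and \<omega>
    assume A: "0 \<le> A" and f: "\<And>x. (f has_real_derivative mc A x / \<mu> - a A / \<mu>) (at x)"
      and T: "0 < T" and \<omega>: "\<omega> \<in> space M"
    interpret P: sS_setting "\<lambda>u. X x u \<omega>" x s S by (rule sS_settingI[OF sS \<omega>])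
    note eq = sS_policy_eq[OF sS \<omega>, of _ x]
    from truncated_test_function[OF A f] obtain P' R L where
      tf: "test_function f (\<lambda>x. mc A x / \<mu> - a A / \<mu>) (\<lambda>x. lam \<mu> \<sigma> / \<mu> * (mc A x - hc A x)) P' R L" by blast
    interpret tf: test_function f "\<lambda>x. mc A x / \<mu> - a A / \<mu>" "\<lambda>x. lam \<mu> \<sigma> / \<mu> * (mc A x - hc A x)" P' R L by (rule tf)
    define G where "G z = f z + k * z" for z
    have GL: "\<bar>G u - G v\<bar> \<le> (P' + k) * \<bar>u - v\<bar>" for u v
    proof -
      have "\<bar>G u - G v\<bar> \<le> \<bar>f u - f v\<bar> + \<bar>k * (u - v)\<bar>"
        unfolding G_def using abs_triangle_ineq[of "f u - f v" "k * (u - v)"] by (simp add: algebra_simps)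
      also have "\<dots> \<le> P' * \<bar>u - v\<bar> + k * \<bar>u - v\<bar>"
        using tf.f_lipschitz[of u v] k_nonneg by (intro add_mono) (auto simp: abs_mult)
      finally show ?thesis by (simp add: distrib_right)
    qed
    have GS: "G S - G s = - \<kappa> * (S - s)"
    proof -
      have d: "((\<lambda>u. f u + a A / \<mu> * u) has_real_derivative mc A u / \<mu>) (at u)" for u
        using mu_pos by (auto intro!: derivative_eq_intros f)
      have "J A = f S + a A / \<mu> * S - (f s + a A / \<mu> * s)"
        unfolding J_def by (rule LBINT_FTC[OF cm[OF A] d]) (use sS in simp)
      then have "f S - f s = J A - a A / \<mu> * ?\<xi>" unfolding right_diff_distrib by linarith
      also have "a A / \<mu> * ?\<xi> = (k + \<kappa>) * ?\<xi> + J A"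
      proof -
        have "a A / \<mu> = k + \<kappa> + J A / ?\<xi>" using mu_pos by (simp add: a_def add_divide_distrib)
        then show ?thesis using xi by (simp only: distrib_right) simp
      qed
      finally show ?thesis by (simp add: G_def algebra_simps)
    qed
    have "(\<lambda>n. \<Sum>i<n. G (Z (grid T n (Suc i)) \<omega>) - G (Z (grid T n i) \<omega> + incr (grid T n i) (grid T n (Suc i)) \<omega>))
      \<longlonglongrightarrow> - \<kappa> * (?Y T \<omega> - ?Y 0 \<omega>)"
    proof (rule control_sum_tendsto[OF \<omega> T, of "2 * (P' + k) / ?\<xi>"])
      show "0 \<le> 2 * (P' + k) / ?\<xi>" using tf.bounds_nonneg k_nonneg xi by simp
      fix t t' w assume t: "0 \<le> t" "t \<le> t'" and w: "\<And>v. t \<le> v \<Longrightarrow> v \<le> t' \<Longrightarrow> \<bar>X x t' \<omega> - X x v \<omega>\<bar> \<le> w"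
      show "\<bar>G (X x t' \<omega> + ?Y t' \<omega>) - G (X x t' \<omega> + ?Y t \<omega>) + \<kappa> * (?Y t' \<omega> - ?Y t \<omega>)\<bar>
          \<le> 2 * (P' + k) / ?\<xi> * w * (?Y t' \<omega> - ?Y t \<omega>)"
        using P.sS_control[OF GL _ GS t w] tf.bounds_nonneg k_nonneg eq[of t] eq[of t'] t by simp
    qed
    then show "(\<lambda>n. \<Sum>i<n. (f (Z (grid T n (Suc i)) \<omega>) + k * Z (grid T n (Suc i)) \<omega>)
        - (f (Z (grid T n i) \<omega> + incr (grid T n i) (grid T n (Suc i)) \<omega>)
            + k * (Z (grid T n i) \<omega> + incr (grid T n i) (grid T n (Suc i)) \<omega>)))
      \<longlonglongrightarrow> - \<kappa> * (?Y T \<omega> - first_order x s S)"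
      unfolding G_def using Y_0[OF \<omega>] by simp
  qed (use a0 a_le in auto)
qed

lemma base_stock_policy_eq:
  "\<omega> \<in> space M \<Longrightarrow> 0 \<le> t \<Longrightarrow> sS_policy B \<mu> \<sigma> s s x t \<omega> = max 0 (s - run_min (\<lambda>u. X x u \<omega>) t)"
  unfolding sS_policy_def by (rule cont_path.base_stock_eq[OF cont_path_X])

lemma base_stock_cont:
  assumes "\<omega> \<in> space M" shows "continuous_on {0..} (\<lambda>t. max 0 (s - run_min (\<lambda>u. X x u \<omega>) t))"
proof -
  interpret cont_path "\<lambda>u. X x u \<omega>" by (rule cont_path_X[OF assms])
  show ?thesis by (intro continuous_intros run_min_cont)
qed

lemma base_stock_admissible: "admissible M F (sS_policy B \<mu> \<sigma> s s x)"
proof (rule admissibleI[where y = "\<lambda>\<omega> t. max 0 (s - run_min (\<lambda>u. X x u \<omega>) t)"])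
  fix t :: real assume t: "0 \<le> t"
  have [measurable]: "(\<lambda>\<omega>. run_min (\<lambda>u. X x u \<omega>) t) \<in> borel_measurable (F t)" by (rule run_min_F[OF t])
  have "(\<lambda>\<omega>. max 0 (s - run_min (\<lambda>u. X x u \<omega>) t)) \<in> borel_measurable (F t)" by measurable
  then show "sS_policy B \<mu> \<sigma> s s x t \<in> borel_measurable (F t)"
    by (subst measurable_cong) (auto simp: space_F base_stock_policy_eq t)
next
  show "sS_policy B \<mu> \<sigma> s s x t \<omega> = max 0 (s - run_min (\<lambda>u. X x u \<omega>) t)" if "\<omega> \<in> space M" "0 \<le> t" for \<omega> t
    by (rule base_stock_policy_eq[OF that])
  fix \<omega> assume \<omega>: "\<omega> \<in> space M"
  interpret cont_path "\<lambda>u. X x u \<omega>" by (rule cont_path_X[OF \<omega>])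
  show "max 0 (s - run_min (\<lambda>u. X x u \<omega>) s') \<le> max 0 (s - run_min (\<lambda>u. X x u \<omega>) t)" if "0 \<le> s'" "s' \<le> t" for s' t
    using run_min_antimono[OF that] by simp
  show "continuous (at_right t) (\<lambda>t. max 0 (s - run_min (\<lambda>u. X x u \<omega>) t))" if "0 \<le> t" for t
    unfolding continuous_within
    by (rule cont_path.cont_within(1)[OF _ that]) (unfold_locales, rule base_stock_cont[OF \<omega>])
qed simp

text \<open>With \<open>c 1 = 0\<close> the setup cost vanishes near \<open>0\<close>, so continuous
  control incurs only the proportional cost \<open>k\<close>; after a possible initial order the
  policy is continuous, hence \<open>\<kappa> = 0\<close>.\<close>

theorem AC_base_stock:
  assumes c1: "c 1 = 0"
  shows "AC M B \<mu> \<sigma> k h K x (sS_policy B \<mu> \<sigma> s s x) \<le> ennreal (k * \<mu> + m s)"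
    "ell K = 0"
proof -
  let ?Y = "sS_policy B \<mu> \<sigma> s s x"
  show ell: "ell K = 0"
  proof -
    obtain r where r: "0 < r" "\<And>\<xi>. 0 < \<xi> \<Longrightarrow> \<xi> < r \<Longrightarrow> K \<xi> = c 1" by (rule K_small) (auto intro: that)
    have "\<forall>\<^sub>F \<xi> in at_right 0. ennreal (K \<xi> / \<xi>) = 0"
      using eventually_at_right_real[OF r(1)] by eventually_elim (use r(2) c1 in auto)
    then have "Liminf (at_right 0) (\<lambda>\<xi>. ennreal (K \<xi> / \<xi>)) = Liminf (at_right (0::real)) (\<lambda>\<xi>. 0)"
      by (rule Liminf_eq)
    then show ?thesis unfolding ell_def by (simp add: Liminf_const)
  qed
  interpret controlled \<mu> \<sigma> h N Q c k M F B x ?Y by (rule controlledI[OF base_stock_admissible])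
  let ?y0 = "max 0 (s - x)"
  have dp: "dominated_policy \<mu> \<sigma> h N Q c k M F B x ?Y s ?y0 (K ?y0) 0 (max s x)"
  proof unfold_locales
    fix \<omega> and T :: real assume \<omega>: "\<omega> \<in> space M"
    interpret P: cont_path "\<lambda>u. X x u \<omega>" by (rule cont_path_X[OF \<omega>])
    note eq = base_stock_policy_eq[OF \<omega>, of _ s x]
    show "\<exists>v\<in>{0..T}. ?Y T \<omega> \<le> max s x - X x v \<omega>" if T: "0 \<le> T"
    proof (cases "s - run_min (\<lambda>u. X x u \<omega>) T \<le> 0")
      case True
      then show ?thesis using T eq[OF T] X_0[OF \<omega>, of x] by (intro bexI[of _ 0]) auto
    next
      case False
      obtain v where "v \<in> {0..T}" "X x v \<omega> = run_min (\<lambda>u. X x u \<omega>) T" using P.run_min_attained[OF T] by blast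
      then show ?thesis using False eq[OF T] by (intro bexI[of _ v]) auto
    qed
    show Y0: "?Y 0 \<omega> = ?y0" using eq[of 0] X_0[OF \<omega>, of x] by (simp add: P.run_min_0)
    show "s \<le> Z T \<omega>" if "0 \<le> T" using P.run_min_le[of T T] eq[OF that] that by (simp add: Z_def)
    show "(\<integral>\<^sup>+u. ennreal (K (jump (\<lambda>u. ?Y u \<omega>) u)) \<partial>count_space {0..T}) + ell K * ennreal (cont_part (\<lambda>u. ?Y u \<omega>) T)
        \<le> ennreal (K ?y0 + 0 * (?Y T \<omega> - ?y0))" if T: "0 < T"
    proof -
      have j: "jump (\<lambda>u. ?Y u \<omega>) u = (if u = 0 then ?y0 else 0)" if "0 \<le> u" for u
      proof (cases "u = 0")
        case False
        define y where "y t = max 0 (s - run_min (\<lambda>u. X x u \<omega>) t)" for t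
        interpret y: cont_path y
          unfolding y_def[abs_def] by unfold_locales (rule base_stock_cont[OF \<omega>])
        have "(y \<longlongrightarrow> y u) (at_left u)" using False that by (intro y.cont_within(2)) auto
        then have "Lim (at_left u) y = y u" by (intro tendsto_Lim) auto
        then have "jump y u = 0" using False by (simp add: jump_def)
        moreover have "jump (\<lambda>u. ?Y u \<omega>) u = jump y u"
          by (rule jump_cong[OF _ that]) (simp add: eq y_def)
        ultimately show ?thesis using False by simp
      qed (use Y0 in \<open>simp add: jump_def\<close>)
      have "(\<integral>\<^sup>+u. ennreal (K (jump (\<lambda>u. ?Y u \<omega>) u)) \<partial>count_space {0..T}) = (\<Sum>u\<in>{0}. ennreal (K (jump (\<lambda>u. ?Y u \<omega>) u)))"
        by (rule nn_integral_count_space') (use T j K_0 in auto)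
      then show ?thesis using j[of 0] ell by simp
    qed
  qed (use K_nonneg in auto)
  interpret dominated_policy \<mu> \<sigma> h N Q c k M F B x ?Y s ?y0 "K ?y0" 0 "max s x" by (rule dp)
  \<comment> \<open>This choice makes the derivative of \<open>f z + k * z\<close> vanish at
    \<open>s\<close>, where all control after the initial order takes place.\<close>
  define a where "a A = k * \<mu> + mc A s" for A
  show "AC M B \<mu> \<sigma> k h K x ?Y \<le> ennreal (k * \<mu> + m s)"
  proof (rule AC_upper[of "k * \<mu> + m s" a])
    show "0 \<le> k * \<mu> + m s" using k_nonneg mu_pos m_nonneg by simp
    show "0 \<le> a A" for A using k_nonneg mu_pos mc_nonneg by (simp add: a_def)
    show "0 \<le> A \<Longrightarrow> a A \<le> k * \<mu> + m s" for A using mc_le by (simp add: a_def)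
    fix A f and T :: real and \<omega>
    assume A: "0 \<le> A" and f: "\<And>x. (f has_real_derivative mc A x / \<mu> - a A / \<mu>) (at x)"
      and T: "0 < T" and \<omega>: "\<omega> \<in> space M"
    interpret P: cont_path "\<lambda>u. X x u \<omega>" by (rule cont_path_X[OF \<omega>])
    note eq = base_stock_policy_eq[OF \<omega>, of _ s x]
    from truncated_test_function[OF A f] obtain P' R L where
      tf: "test_function f (\<lambda>x. mc A x / \<mu> - a A / \<mu>) (\<lambda>x. lam \<mu> \<sigma> / \<mu> * (mc A x - hc A x)) P' R L" by blast
    interpret tf: test_function f "\<lambda>x. mc A x / \<mu> - a A / \<mu>" "\<lambda>x. lam \<mu> \<sigma> / \<mu> * (mc A x - hc A x)" P' R L by (rule tf)
    define G where "G z = f z + k * z" for z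
    have G: "(G has_real_derivative mc A u / \<mu> - a A / \<mu> + k) (at u)" for u
      unfolding G_def by (auto intro!: derivative_eq_intros f)
    have gs: "mc A s / \<mu> - a A / \<mu> + k = 0" using mu_pos by (simp add: a_def field_simps)
    have gL: "\<bar>(mc A u / \<mu> - a A / \<mu> + k) - (mc A v / \<mu> - a A / \<mu> + k)\<bar> \<le> R * \<bar>u - v\<bar>" for u v
      using tf.p_lipschitz[of u v] by simp
    have "(\<lambda>n. \<Sum>i<n. G (Z (grid T n (Suc i)) \<omega>) - G (Z (grid T n i) \<omega> + incr (grid T n i) (grid T n (Suc i)) \<omega>))
      \<longlonglongrightarrow> - 0 * (?Y T \<omega> - ?Y 0 \<omega>)"
    proof (rule control_sum_tendsto[OF \<omega> T tf.bounds_nonneg(2)])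
      fix t t' w assume t: "0 \<le> t" "t \<le> t'" and w: "\<And>v. t \<le> v \<Longrightarrow> v \<le> t' \<Longrightarrow> \<bar>X x t' \<omega> - X x v \<omega>\<bar> \<le> w"
      show "\<bar>G (X x t' \<omega> + ?Y t' \<omega>) - G (X x t' \<omega> + ?Y t \<omega>) + 0 * (?Y t' \<omega> - ?Y t \<omega>)\<bar> \<le> R * w * (?Y t' \<omega> - ?Y t \<omega>)"
        using P.base_stock_control[OF G gs gL tf.bounds_nonneg(2) t w] eq[of t] eq[of t'] t by simp
    qed
    then show "(\<lambda>n. \<Sum>i<n. (f (Z (grid T n (Suc i)) \<omega>) + k * Z (grid T n (Suc i)) \<omega>)
        - (f (Z (grid T n i) \<omega> + incr (grid T n i) (grid T n (Suc i)) \<omega>)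
            + k * (Z (grid T n i) \<omega> + incr (grid T n i) (grid T n (Suc i)) \<omega>)))
      \<longlonglongrightarrow> - 0 * (?Y T \<omega> - ?y0)"
      unfolding G_def by simp
  qed
qed

lemma optimalI:
  assumes adm: "\<And>x. admissible M F (sS_policy B \<mu> \<sigma> s S x)"
    and upper: "\<And>x. AC M B \<mu> \<sigma> k h K x (sS_policy B \<mu> \<sigma> s S x) \<le> ennreal \<nu>"
    and lower: "\<And>x Y. admissible M F Y \<Longrightarrow> ennreal \<nu> \<le> AC M B \<mu> \<sigma> k h K x Y"
  shows "nu_star M F B \<mu> \<sigma> k h K = ennreal \<nu>" "sS_optimal M F B \<mu> \<sigma> k h K s S"
proof -
  have eq: "AC M B \<mu> \<sigma> k h K x (sS_policy B \<mu> \<sigma> s S x) = ennreal \<nu>" for x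
    by (intro antisym upper lower adm)
  show nu: "nu_star M F B \<mu> \<sigma> k h K = ennreal \<nu>"
    unfolding nu_star_def
  proof (rule antisym)
    show "Inf {AC M B \<mu> \<sigma> k h K x Y |x Y. admissible M F Y} \<le> ennreal \<nu>"
      using eq[of 0] adm[of 0] by (intro Inf_lower) (metis (mono_tags, lifting) mem_Collect_eq)
    show "ennreal \<nu> \<le> Inf {AC M B \<mu> \<sigma> k h K x Y |x Y. admissible M F Y}"
      using lower by (intro Inf_greatest) auto
  qed
  show "sS_optimal M F B \<mu> \<sigma> k h K s S"
    unfolding sS_optimal_def using adm eq nu by simp
qed

text \<open>For this rate \<open>\<nu> / \<mu> - k\<close> is the minimum of \<open>g\<close>, so
  the potential inequality holds without any setup cost; this is the alternative
  \<open>Kf = (\<lambda>_. 0)\<close> of the lower bound.\<close>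

theorem base_stock_optimal:
  assumes c1: "c 1 = 0"
  shows "nu_star M F B \<mu> \<sigma> k h K = ennreal (k * \<mu> + h zs)" "sS_optimal M F B \<mu> \<sigma> k h K zs zs"
    "gamma_cost \<mu> \<sigma> k h K zs zs = ennreal (k * \<mu> + h zs)"
proof -
  let ?\<nu> = "k * \<mu> + h zs"
  have lower: "ennreal ?\<nu> \<le> AC M B \<mu> \<sigma> k h K x Y" if "admissible M F Y" for x Y
  proof -
    interpret controlled \<mu> \<sigma> h N Q c k M F B x Y by (rule controlledI[OF that])
    show ?thesis
    proof (rule AC_lower[where Kf = "\<lambda>_. 0"])
      fix z \<xi> :: real assume \<xi>: "0 < \<xi>"
      have "0 \<le> (LBINT u:{z..z + \<xi>}. g u - g zs)"
        unfolding set_lebesgue_integral_def using g_min by (intro integral_nonneg_AE) simp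
      moreover have "(LBINT u:{z..z + \<xi>}. g zs - g u) = g zs * \<xi> - (LBINT u:{z..z + \<xi>}. g u)"
        using integral_const_diff[of z "z + \<xi>" "g zs"] \<xi> by simp
      moreover have "(LBINT u:{z..z + \<xi>}. g u - g zs) = - (LBINT u:{z..z + \<xi>}. g zs - g u)"
        unfolding set_lebesgue_integral_def by (subst Bochner_Integration.integral_minus[symmetric]) (simp add: right_diff_distrib)
      moreover have "k - ?\<nu> / \<mu> = - g zs" using mu_pos by (simp add: g_zs field_simps)
      ultimately show "0 \<le> (LBINT u:{z..z + \<xi>}. g u) + (k - ?\<nu> / \<mu>) * \<xi> + 0" by simp
    qed simp
  qed
  show "nu_star M F B \<mu> \<sigma> k h K = ennreal ?\<nu>" "sS_optimal M F B \<mu> \<sigma> k h K zs zs"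
    using optimalI[of zs zs ?\<nu>] base_stock_admissible AC_base_stock(1)[OF c1, of _ zs] lower by (auto simp: m_zs)
  have "lam \<mu> \<sigma> * (LBINT u:{0..}. h (u + zs) * exp (- lam \<mu> \<sigma> * u)) = h zs"
    using expmean_eq_LBINT[OF h_meas l_pos, of zs] m_zs by simp
  then show "gamma_cost \<mu> \<sigma> k h K zs zs = ennreal ?\<nu>"
    using k_nonneg mu_pos h_nonneg AC_base_stock(2)[OF c1]
    by (simp add: gamma_cost_def ennreal_mult[symmetric] ennreal_plus[symmetric] del: ennreal_plus)
qed

text \<open>Minimality of the selected rate among all intervals, multiplied by
  \<open>\<xi> / \<mu>\<close>, is exactly the potential inequality required for the lower
  bound.\<close>

theorem selection_policy_optimal:
  assumes c1: "0 < c 1"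
  defines "s \<equiv> s_star \<mu> \<sigma> k h N Q c" and "S \<equiv> S_star \<mu> \<sigma> k h N Q c"
  shows "nu_star M F B \<mu> \<sigma> k h K = gamma_cost \<mu> \<sigma> k h K s S" "sS_optimal M F B \<mu> \<sigma> k h K s S"
proof -
  have sS: "s < S" unfolding s_def S_def by (rule s_less_S[OF c1])
  have lower: "ennreal (rate s S) \<le> AC M B \<mu> \<sigma> k h K x Y" if "admissible M F Y" for x Y
  proof -
    interpret controlled \<mu> \<sigma> h N Q c k M F B x Y by (rule controlledI[OF that])
    show ?thesis
    proof (rule AC_lower[where Kf = K])
      fix z \<xi> :: real assume \<xi>: "0 < \<xi>"
      define I where "I = (LBINT u:{z..z + \<xi>}. g u)"
      have "rate s S \<le> rate z (z + \<xi>)" unfolding s_def S_def by (rule selection_optimal[OF c1 \<xi>])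
      then have "rate s S / \<mu> * \<xi> \<le> rate z (z + \<xi>) / \<mu> * \<xi>"
        using mu_pos \<xi> by (intro mult_right_mono divide_right_mono) auto
      also have "\<dots> = k * \<xi> + K \<xi> + I" using mu_pos \<xi> by (simp add: rate_def I_def field_simps)
      finally show "0 \<le> (LBINT u:{z..z + \<xi>}. g u) + (k - rate s S / \<mu>) * \<xi> + K \<xi>"
        by (simp add: I_def algebra_simps)
    qed (use c1 in simp)
  qed
  show "nu_star M F B \<mu> \<sigma> k h K = gamma_cost \<mu> \<sigma> k h K s S" "sS_optimal M F B \<mu> \<sigma> k h K s S"
    using optimalI[of s S "rate s S"] sS_admissible[OF sS] AC_sS[OF sS] lower gamma_cost_eq[OF sS] by auto
qed

end

theorem corollary1:
  fixes M :: "'a measure" and F :: "real \<Rightarrow> 'a measure" and B :: "real \<Rightarrow> 'a \<Rightarrow> real"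
    and \<mu> \<sigma> k :: real and h :: "real \<Rightarrow> real"
    and N :: nat and Q :: "nat \<Rightarrow> ereal" and c :: "nat \<Rightarrow> real"
  assumes "\<mu> > 0" and "\<sigma> > 0" and "k \<ge> 0"
    and "filtered_prob_space M F" and "brownian_motion M F B"
    and "N \<ge> 1" and "Q 0 = 0" and "Q N = \<infinity>" and "\<forall>n<N. Q n < Q (Suc n)"
    and "\<forall>n\<in>{1..N}. c n \<ge> 0" and "\<forall>n\<in>{1..N - 1}. c n \<noteq> c (n + 1)"
    and "convex_on UNIV h" and "h 0 = 0"
    and "h differentiable_on - {0}" and "continuous_on (- {0}) (deriv h)"
    and "\<forall>z>0. deriv h z > 0" and "\<forall>z<0. deriv h z < 0"
    and "\<exists>a::nat. \<exists>b0 b1::real. a > 0 \<and> b0 > 0 \<and> b1 > 0 \<and> (\<forall>z. h z \<le> b0 + b1 * \<bar>z\<bar> ^ a)"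
  shows
    "(c 1 = 0 \<longrightarrow>
        (\<exists>!z. is_z_star \<mu> \<sigma> h z) \<and>
        sS_optimal M F B \<mu> \<sigma> k h (step_cost N Q c) (z_star \<mu> \<sigma> h) (z_star \<mu> \<sigma> h) \<and>
        nu_star M F B \<mu> \<sigma> k h (step_cost N Q c) =
          gamma_cost \<mu> \<sigma> k h (step_cost N Q c) (z_star \<mu> \<sigma> h) (z_star \<mu> \<sigma> h) \<and>
        gamma_cost \<mu> \<sigma> k h (step_cost N Q c) (z_star \<mu> \<sigma> h) (z_star \<mu> \<sigma> h) =
          ennreal (k * \<mu> + h (z_star \<mu> \<sigma> h))) \<and>
     (c 1 > 0 \<longrightarrow>
        selection_well_defined \<mu> \<sigma> k h N Q c \<and>
        sS_optimal M F B \<mu> \<sigma> k h (step_cost N Q c)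
          (s_star \<mu> \<sigma> k h N Q c) (S_star \<mu> \<sigma> k h N Q c) \<and>
        nu_star M F B \<mu> \<sigma> k h (step_cost N Q c) =
          gamma_cost \<mu> \<sigma> k h (step_cost N Q c)
            (s_star \<mu> \<sigma> k h N Q c) (S_star \<mu> \<sigma> k h N Q c))"
proof -
  \<comment> \<open>Convexity supplies continuity at \<open>0\<close>, where no derivative is
    assumed.\<close>
  have h_cont: "continuous_on A h" for A
    using convex_on_continuous[OF open_UNIV assms(12)] by (rule continuous_on_subset) simp
  have d: "(h has_real_derivative deriv h z) (at z)" if "z \<noteq> 0" for z
  proof -
    have "h differentiable at z within (- {0})" using assms(14) that by (auto simp: differentiable_on_def)
    moreover have "at z within (- {0}) = at z" by (rule at_within_open) (use that in auto)
    ultimately have "h differentiable at z" by simp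
    then show ?thesis by (simp add: DERIV_deriv_iff_real_differentiable)
  qed
  \<comment> \<open>The derivative is used only at interior points of the interval, so
    \<open>0\<close> may be an endpoint.\<close>
  have inc: "h y < h z" if "0 \<le> y" "y < z" for y z
  proof (rule DERIV_pos_imp_increasing_open[OF that(2) _ h_cont])
    fix u assume "y < u"
    then have "0 < u" using that(1) by simp
    then show "\<exists>v. (h has_real_derivative v) (at u) \<and> 0 < v"
      using d[of u] assms(16) by (intro exI[of _ "deriv h u"]) simp
  qed
  have dec: "h z < h y" if "y < z" "z \<le> 0" for y z
  proof (rule DERIV_neg_imp_decreasing_open[OF that(1) _ h_cont])
    fix u assume "u < z"
    then have "u < 0" using that(2) by simp
    then show "\<exists>v. (h has_real_derivative v) (at u) \<and> v < 0"
      using d[of u] assms(17) by (intro exI[of _ "deriv h u"]) simp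
  qed
  have h0: "0 \<le> h z" for z
    using inc[of 0 z] dec[of z 0] assms(13) by (cases z "0::real" rule: linorder_cases) auto
  have l: "0 < lam \<mu> \<sigma>" using assms(1,2) by (simp add: lam_def)
  obtain a :: nat and b0 b1 :: real where b: "0 < b0" "0 < b1" "\<And>z. h z \<le> b0 + b1 * \<bar>z\<bar> ^ a"
    using assms(18) by blast
  have "tempered (lam \<mu> \<sigma>) h"
    by (rule polynomially_bounded_tempered[OF l h_cont, of b0 b1 a]) (use b h0 in auto)
  then interpret inventory_system \<mu> \<sigma> h N Q c k M F B
    using assms l inc dec by unfold_locales auto
  show ?thesis
    using z_star_ex1 base_stock_optimal selection_policy_optimal well_defined by auto
qed

end
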